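(* Let $(\Gamma_k)_{k\ge 0}$ be a tower of strongly Birkhoff Galois structures over a Barr exact category $\mathcal{C}_0$, with base reflective subcategory $\mathcal{B}_0\subseteq\mathcal{C}_0$. For each $n\geq 2$, an $n$-fold extension $\alpha$ is a $\Gamma_{n-1}$-covering if and only if it is an ($n$-fold) symmetric covering. More precisely, $\alpha$ is a $\Gamma_{n-1}$-covering exactly when there exists a span of discrete fibrations $\beta\leftarrow\tau\rightarrow\alpha$ of order $n+1$, where $\beta$ is an $n$-cubical extension in $\mathcal{B}_0$. Hence the concept of a higher covering is symmetric: whether an $n$-cubical extension is a $\Gamma_{n-1}$-covering does not depend on the way the $n$-cube is considered as an arrow between $(n-1)$-cubes.
   Context: **Higher extensions.** $\mathcal{C}_0$ is a Barr exact category and $\mathcal{E}_1$ is the class of regular epimorphisms in $\mathcal{C}_0$. For a category $\mathcal{Y}$, a morphism $\alpha\colon f_A\to f_B$ in the arrow category $\mathsf{Arr}(\mathcal{Y})$, from $f_A\colon A_\top\to A_\perp$ to $f_B\colon B_\top\to B_\perp$, is a pair $(\alpha_\top\colon A_\top\to B_\top,\ \alpha_\perp\colon A_\perp\to B_\perp)$ with $f_B\circ\alpha_\top=\alpha_\perp\circ f_A$. For a class $\mathcal{E}$ of morphisms of $\mathcal{Y}$, this square is an $\mathcal{E}$-double extension when $\alpha_\top,\alpha_\perp,f_A,f_B$, the projections of the pullback $A_\perp\times_{B_\perp}B_\top$, and the comparison map $A_\top\to A_\perp\times_{B_\perp}B_\top$ are all in $\mathcal{E}$. Inductively, for $n\ge1$,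 $\mathcal{C}_n=\mathsf{Ext}^n(\mathcal{C}_0)$ is the full subcategory of $\mathsf{Arr}^n(\mathcal{C}_0)$ whose objects are the elements of $\mathcal{E}_n$ (the $n$-fold extensions), and $\mathcal{E}_{n+1}$ is the class of morphisms of $\mathcal{C}_n$ whose underlying square in $\mathcal{C}_{n-1}$ is an $\mathcal{E}_n$-double extension (the $(n+1)$-fold extensions). The underlying commutative $n$-cube in $\mathcal{C}_0$ of an $n$-fold extension is called an $n$-cubical extension in $\mathcal{C}_0$; it is known that being an $n$-cubical extension does not depend on the directions in which the cube is regarded as an iterated arrow. An $n$-cubical extension in $\mathcal{B}_0$ is one all of whose objects lie in $\mathcal{B}_0$. **Galois structures.** A Galois structure $\Gamma=(\mathcal{Y},\mathcal{X},L,\mathrm{I},\eta,\epsilon,\mathcal{E})$ consists of a category $\mathcal{Y}$, a class $\mathcal{E}$ of regular epimorphisms of $\mathcal{Y}$ (the extensions), and a full replete subcategory $\mathrm{I}\colon\mathcal{X}\to\mathcal{Y}$ with left adjoint $L$, unit $\eta$ with every component in $\mathcal{E}$, and counit $\epsilon$, such that: $\mathcal{E}$ contains all isomorphisms and is closed under composition; $L$ sends extensions to extensions; pullbacks along extensions exist and a pullback of an extension is an extension; every extension $e\colon Q\to B$ is of effective $\mathcal{E}$-descent, i.e. the pullback functor $e^*\colon\mathsf{Ext}(B)\to\mathsf{Ext}(Q)$ is monadic, where $\mathsf{Ext}(B)$ is the full subcategory of the slice over $B$ on the extensions. $\Gamma$ is strongly $\mathcal{E}$-Birkhoff if for every extension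 $f\colon A\to B$ the reflection square $(\eta_A,\eta_B)\colon f\to \mathrm{I}L(f)$ is an $\mathcal{E}$-double extension. A trivial $\Gamma$-covering is an extension whose reflection square is a pullback. A $\Gamma$-covering is an extension $c\colon A\to B$ for which there is an extension $e\colon Q\to B$ such that the pullback of $c$ along $e$ is a trivial $\Gamma$-covering. **Tower.** A tower of strongly Birkhoff Galois structures is a sequence of Galois structures $\Gamma_k=(\mathcal{C}_k,\mathcal{B}_k,F_k,\mathrm{I}_k,\eta^k,\epsilon^k,\mathcal{E}_{k+1})$, $k\ge0$, each strongly $\mathcal{E}_{k+1}$-Birkhoff, where for $k\ge 1$ the category $\mathcal{B}_k=\mathsf{Cov}(\mathcal{C}_{k-1})$ is the full subcategory of $\mathcal{C}_k=\mathsf{Ext}(\mathcal{C}_{k-1})$ determined by the $\Gamma_{k-1}$-coverings. **Discrete fibrations and symmetric coverings.** An $(n+1)$-cubical extension in $\mathcal{C}_0$ is a discrete fibration (of order $n+1$) when it is a limit cube: the cone out of its initial object is a limit of the diagram obtained by removing the initial object. Choosing one of the $n+1$ directions of the cube, it is regarded as a morphism between two $n$-cubical extensions, and is then called a discrete fibration from its domain to its codomain. An $n$-cubical extension $\tau$ is an ($n$-fold) symmetrically trivial covering when a discrete fibration $\tau\to\beta$ exists whose codomain $\beta$ is an $n$-fold extension in $\mathcal{B}_0$. An $n$-cubical extension $\alpha$ is an ($n$-fold) symmetric covering when a discrete fibration $\tau\to\alpha$ exists whose domain $\tau$ is a symmetrically trivial covering. *)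

theory Defs
  imports "HOL-Combinatorics.Permutations"
begin

section \<open>Categories, functors, natural transformations\<close>

record ('o, 'a) cat =
  Obj :: "'o set"
  Mor :: "'a set"
  Dom :: "'a \<Rightarrow> 'o"
  Cod :: "'a \<Rightarrow> 'o"
  Id :: "'o \<Rightarrow> 'a"
  Comp :: "'a \<Rightarrow> 'a \<Rightarrow> 'a"  (infixl \<open>\<cdot>\<index>\<close> 70)

definition in_hom :: "('o, 'a) cat \<Rightarrow> 'a \<Rightarrow> 'o \<Rightarrow> 'o \<Rightarrow> bool" where
  "in_hom C f a b \<longleftrightarrow> f \<in> Mor C \<and> Dom C f = a \<and> Cod C f = b"

locale category =
  fixes C :: "('o, 'a) cat" (structure)
  assumes Dom_in: "f \<in> Mor C \<Longrightarrow> Dom C f \<in> Obj C"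
    and Cod_in: "f \<in> Mor C \<Longrightarrow> Cod C f \<in> Obj C"
    and Id_in_hom: "a \<in> Obj C \<Longrightarrow> in_hom C (Id C a) a a"
    and Comp_in_hom: "in_hom C f a b \<Longrightarrow> in_hom C g b c \<Longrightarrow> in_hom C (g \<cdot> f) a c"
    and Comp_Id: "in_hom C f a b \<Longrightarrow> f \<cdot> Id C a = f"
    and Id_Comp: "in_hom C f a b \<Longrightarrow> Id C b \<cdot> f = f"
    and Comp_assoc: "in_hom C f a b \<Longrightarrow> in_hom C g b c \<Longrightarrow> in_hom C h c d \<Longrightarrow>
          (h \<cdot> g) \<cdot> f = h \<cdot> (g \<cdot> f)"

definition iso :: "('o, 'a) cat \<Rightarrow> 'a \<Rightarrow> bool" where
  "iso C f \<longleftrightarrow> f \<in> Mor C \<and>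
     (\<exists>g. in_hom C g (Cod C f) (Dom C f) \<and>
          g \<cdot>\<^bsub>C\<^esub> f = Id C (Dom C f) \<and> f \<cdot>\<^bsub>C\<^esub> g = Id C (Cod C f))"

definition full_sub :: "('o, 'a) cat \<Rightarrow> 'o set \<Rightarrow> ('o, 'a) cat" where
  "full_sub C S = C\<lparr>Obj := Obj C \<inter> S, Mor := {f \<in> Mor C. Dom C f \<in> S \<and> Cod C f \<in> S}\<rparr>"

definition full_replete_subcategory :: "('o, 'a) cat \<Rightarrow> ('o, 'a) cat \<Rightarrow> bool" where
  "full_replete_subcategory X Y \<longleftrightarrow> Obj X \<subseteq> Obj Y \<and> X = full_sub Y (Obj X) \<and>
     (\<forall>f. iso Y f \<and> Dom Y f \<in> Obj X \<longrightarrow> Cod Y f \<in> Obj X)"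

record ('o, 'a, 'p, 'b) fctr =
  omap :: "'o \<Rightarrow> 'p"
  amap :: "'a \<Rightarrow> 'b"

definition is_functor :: "('o, 'a) cat \<Rightarrow> ('p, 'b) cat \<Rightarrow> ('o, 'a, 'p, 'b) fctr \<Rightarrow> bool" where
  "is_functor A B F \<longleftrightarrow>
     (\<forall>a\<in>Obj A. omap F a \<in> Obj B \<and> amap F (Id A a) = Id B (omap F a)) \<and>
     (\<forall>f\<in>Mor A. in_hom B (amap F f) (omap F (Dom A f)) (omap F (Cod A f))) \<and>
     (\<forall>f\<in>Mor A. \<forall>g\<in>Mor A. Dom A g = Cod A f \<longrightarrow> amap F (g \<cdot>\<^bsub>A\<^esub> f) = amap F g \<cdot>\<^bsub>B\<^esub> amap F f)"

definition id_functor :: "('o, 'a, 'o, 'a) fctr" where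
  "id_functor = \<lparr>omap = id, amap = id\<rparr>"

definition comp_functor ::
  "('p, 'b, 'q, 'c) fctr \<Rightarrow> ('o, 'a, 'p, 'b) fctr \<Rightarrow> ('o, 'a, 'q, 'c) fctr" where
  "comp_functor G F = \<lparr>omap = omap G \<circ> omap F, amap = amap G \<circ> amap F\<rparr>"

definition natural ::
  "('o, 'a) cat \<Rightarrow> ('p, 'b) cat \<Rightarrow> ('o, 'a, 'p, 'b) fctr \<Rightarrow> ('o, 'a, 'p, 'b) fctr \<Rightarrow> ('o \<Rightarrow> 'b) \<Rightarrow> bool"
where
  "natural A B F G \<eta> \<longleftrightarrow> is_functor A B F \<and> is_functor A B G \<and>
     (\<forall>a\<in>Obj A. in_hom B (\<eta> a) (omap F a) (omap G a)) \<and>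
     (\<forall>f\<in>Mor A. amap G f \<cdot>\<^bsub>B\<^esub> \<eta> (Dom A f) = \<eta> (Cod A f) \<cdot>\<^bsub>B\<^esub> amap F f)"

definition natural_iso ::
  "('o, 'a) cat \<Rightarrow> ('p, 'b) cat \<Rightarrow> ('o, 'a, 'p, 'b) fctr \<Rightarrow> ('o, 'a, 'p, 'b) fctr \<Rightarrow> ('o \<Rightarrow> 'b) \<Rightarrow> bool"
where
  "natural_iso A B F G \<eta> \<longleftrightarrow> natural A B F G \<eta> \<and> (\<forall>a\<in>Obj A. iso B (\<eta> a))"

definition is_equivalence :: "('o, 'a) cat \<Rightarrow> ('p, 'b) cat \<Rightarrow> ('o, 'a, 'p, 'b) fctr \<Rightarrow> bool" where
  "is_equivalence A B K \<longleftrightarrow> is_functor A B K \<and>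
     (\<exists>G \<phi> \<psi>. is_functor B A G \<and> natural_iso A A id_functor (comp_functor G K) \<phi> \<and>
              natural_iso B B (comp_functor K G) id_functor \<psi>)"

text \<open>\<open>adjunction A B F U \<eta> \<epsilon>\<close>: the functor \<open>F : A \<rightarrow> B\<close> is left adjoint to \<open>U : B \<rightarrow> A\<close>.\<close>

definition adjunction ::
  "('o, 'a) cat \<Rightarrow> ('p, 'b) cat \<Rightarrow> ('o, 'a, 'p, 'b) fctr \<Rightarrow> ('p, 'b, 'o, 'a) fctr \<Rightarrow>
   ('o \<Rightarrow> 'a) \<Rightarrow> ('p \<Rightarrow> 'b) \<Rightarrow> bool" where
  "adjunction A B F U \<eta> \<epsilon> \<longleftrightarrow> is_functor A B F \<and> is_functor B A U \<and>
     natural A A id_functor (comp_functor U F) \<eta> \<and>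
     natural B B (comp_functor F U) id_functor \<epsilon> \<and>
     (\<forall>a\<in>Obj A. \<epsilon> (omap F a) \<cdot>\<^bsub>B\<^esub> amap F (\<eta> a) = Id B (omap F a)) \<and>
     (\<forall>b\<in>Obj B. amap U (\<epsilon> b) \<cdot>\<^bsub>A\<^esub> \<eta> (omap U b) = Id A (omap U b))"


section \<open>Monadic functors\<close>

text \<open>Eilenberg--Moore category of the monad \<open>(T, \<eta>, \<mu>)\<close> on \<open>A\<close>; an algebra is a pair
  \<open>(a, h)\<close> with \<open>h : T a \<rightarrow> a\<close>, and a morphism carries its domain and codomain.\<close>

definition is_algebra ::
  "('o, 'a) cat \<Rightarrow> ('o, 'a, 'o, 'a) fctr \<Rightarrow> ('o \<Rightarrow> 'a) \<Rightarrow> ('o \<Rightarrow> 'a) \<Rightarrow> 'o \<times> 'a \<Rightarrow> bool" where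
  "is_algebra A T \<eta> \<mu> = (\<lambda>(a, h). a \<in> Obj A \<and> in_hom A h (omap T a) a \<and>
     h \<cdot>\<^bsub>A\<^esub> \<eta> a = Id A a \<and> h \<cdot>\<^bsub>A\<^esub> \<mu> a = h \<cdot>\<^bsub>A\<^esub> amap T h)"

definition EM_category ::
  "('o, 'a) cat \<Rightarrow> ('o, 'a, 'o, 'a) fctr \<Rightarrow> ('o \<Rightarrow> 'a) \<Rightarrow> ('o \<Rightarrow> 'a) \<Rightarrow>
   ('o \<times> 'a, ('o \<times> 'a) \<times> ('o \<times> 'a) \<times> 'a) cat" where
  "EM_category A T \<eta> \<mu> =
    \<lparr>Obj = {x. is_algebra A T \<eta> \<mu> x},
     Mor = {(x, y, f). is_algebra A T \<eta> \<mu> x \<and> is_algebra A T \<eta> \<mu> y \<and>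
              in_hom A f (fst x) (fst y) \<and> f \<cdot>\<^bsub>A\<^esub> snd x = snd y \<cdot>\<^bsub>A\<^esub> amap T f},
     Dom = (\<lambda>(x, y, f). x),
     Cod = (\<lambda>(x, y, f). y),
     Id = (\<lambda>x. (x, x, Id A (fst x))),
     Comp = (\<lambda>(y', z, g) (x, y, f). (x, z, g \<cdot>\<^bsub>A\<^esub> f))\<rparr>"

definition comparison_functor ::
  "('p, 'b) cat \<Rightarrow> ('p, 'b, 'o, 'a) fctr \<Rightarrow> ('p \<Rightarrow> 'b) \<Rightarrow>
   ('p, 'b, 'o \<times> 'a, ('o \<times> 'a) \<times> ('o \<times> 'a) \<times> 'a) fctr" where
  "comparison_functor B U \<epsilon> =
    (let K = (\<lambda>b. (omap U b, amap U (\<epsilon> b)))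
     in \<lparr>omap = K, amap = (\<lambda>f. (K (Dom B f), K (Cod B f), amap U f))\<rparr>)"

definition monadic :: "('p, 'b) cat \<Rightarrow> ('o, 'a) cat \<Rightarrow> ('p, 'b, 'o, 'a) fctr \<Rightarrow> bool" where
  "monadic B A U \<longleftrightarrow> (\<exists>F \<eta> \<epsilon>. adjunction A B F U \<eta> \<epsilon> \<and>
     is_equivalence B
       (EM_category A (comp_functor U F) \<eta> (\<lambda>a. amap U (\<epsilon> (omap F a))))
       (comparison_functor B U \<epsilon>))"


section \<open>Limits and Barr exact categories\<close>

definition is_cone ::
  "('j, 'k) cat \<Rightarrow> ('o, 'a) cat \<Rightarrow> ('j, 'k, 'o, 'a) fctr \<Rightarrow> 'o \<Rightarrow> ('j \<Rightarrow> 'a) \<Rightarrow> bool" where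
  "is_cone J C D x \<pi> \<longleftrightarrow> x \<in> Obj C \<and> (\<forall>j\<in>Obj J. in_hom C (\<pi> j) x (omap D j)) \<and>
     (\<forall>u\<in>Mor J. amap D u \<cdot>\<^bsub>C\<^esub> \<pi> (Dom J u) = \<pi> (Cod J u))"

definition is_limit ::
  "('j, 'k) cat \<Rightarrow> ('o, 'a) cat \<Rightarrow> ('j, 'k, 'o, 'a) fctr \<Rightarrow> 'o \<Rightarrow> ('j \<Rightarrow> 'a) \<Rightarrow> bool" where
  "is_limit J C D x \<pi> \<longleftrightarrow> is_cone J C D x \<pi> \<and>
     (\<forall>y \<rho>. is_cone J C D y \<rho> \<longrightarrow>
        (\<exists>!u. in_hom C u y x \<and> (\<forall>j\<in>Obj J. \<pi> j \<cdot>\<^bsub>C\<^esub> u = \<rho> j)))"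

text \<open>Every finite category is isomorphic to one whose objects and morphisms are natural numbers.\<close>

definition has_finite_limits :: "('o, 'a) cat \<Rightarrow> bool" where
  "has_finite_limits C \<longleftrightarrow>
     (\<forall>(J :: (nat, nat) cat) D. category J \<and> finite (Obj J) \<and> finite (Mor J) \<and> is_functor J C D \<longrightarrow>
        (\<exists>x \<pi>. is_limit J C D x \<pi>))"

text \<open>\<open>p\<close> and \<open>q\<close> are the projections of a pullback of the cospan \<open>(f, g)\<close>, with \<open>f \<cdot> p = g \<cdot> q\<close>;
  so \<open>p\<close> is a pullback of \<open>g\<close> along \<open>f\<close>.\<close>

definition is_pullback :: "('o, 'a) cat \<Rightarrow> 'a \<Rightarrow> 'a \<Rightarrow> 'a \<Rightarrow> 'a \<Rightarrow> bool" where
  "is_pullback C f g p q \<longleftrightarrow>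
     f \<in> Mor C \<and> g \<in> Mor C \<and> p \<in> Mor C \<and> q \<in> Mor C \<and>
     Cod C f = Cod C g \<and> Dom C p = Dom C q \<and> Cod C p = Dom C f \<and> Cod C q = Dom C g \<and>
     f \<cdot>\<^bsub>C\<^esub> p = g \<cdot>\<^bsub>C\<^esub> q \<and>
     (\<forall>z r s. in_hom C r z (Dom C f) \<and> in_hom C s z (Dom C g) \<and> f \<cdot>\<^bsub>C\<^esub> r = g \<cdot>\<^bsub>C\<^esub> s \<longrightarrow>
        (\<exists>!u. in_hom C u z (Dom C p) \<and> p \<cdot>\<^bsub>C\<^esub> u = r \<and> q \<cdot>\<^bsub>C\<^esub> u = s))"

definition is_coequalizer :: "('o, 'a) cat \<Rightarrow> 'a \<Rightarrow> 'a \<Rightarrow> 'a \<Rightarrow> bool" where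
  "is_coequalizer C x y f \<longleftrightarrow>
     x \<in> Mor C \<and> y \<in> Mor C \<and> f \<in> Mor C \<and>
     Dom C x = Dom C y \<and> Cod C x = Dom C f \<and> Cod C y = Dom C f \<and> f \<cdot>\<^bsub>C\<^esub> x = f \<cdot>\<^bsub>C\<^esub> y \<and>
     (\<forall>z g. in_hom C g (Dom C f) z \<and> g \<cdot>\<^bsub>C\<^esub> x = g \<cdot>\<^bsub>C\<^esub> y \<longrightarrow>
        (\<exists>!u. in_hom C u (Cod C f) z \<and> u \<cdot>\<^bsub>C\<^esub> f = g))"

definition regular_epis :: "('o, 'a) cat \<Rightarrow> 'a set" where
  "regular_epis C = {f. \<exists>x y. is_coequalizer C x y f}"

definition regular_category :: "('o, 'a) cat \<Rightarrow> bool" where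
  "regular_category C \<longleftrightarrow> category C \<and> has_finite_limits C \<and>
     (\<forall>f p q. is_pullback C f f p q \<longrightarrow> (\<exists>c. is_coequalizer C p q c)) \<and>
     (\<forall>f g p q. is_pullback C f g p q \<and> g \<in> regular_epis C \<longrightarrow> p \<in> regular_epis C)"

definition equivalence_relation :: "('o, 'a) cat \<Rightarrow> 'a \<Rightarrow> 'a \<Rightarrow> bool" where
  "equivalence_relation C r s \<longleftrightarrow>
     r \<in> Mor C \<and> s \<in> Mor C \<and> Dom C r = Dom C s \<and> Cod C r = Cod C s \<and>
     (\<forall>z u v. in_hom C u z (Dom C r) \<and> in_hom C v z (Dom C r) \<and>
        r \<cdot>\<^bsub>C\<^esub> u = r \<cdot>\<^bsub>C\<^esub> v \<and> s \<cdot>\<^bsub>C\<^esub> u = s \<cdot>\<^bsub>C\<^esub> v \<longrightarrow> u = v) \<and>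
     (\<exists>d. in_hom C d (Cod C r) (Dom C r) \<and>
        r \<cdot>\<^bsub>C\<^esub> d = Id C (Cod C r) \<and> s \<cdot>\<^bsub>C\<^esub> d = Id C (Cod C r)) \<and>
     (\<exists>t. in_hom C t (Dom C r) (Dom C r) \<and> r \<cdot>\<^bsub>C\<^esub> t = s \<and> s \<cdot>\<^bsub>C\<^esub> t = r) \<and>
     (\<forall>p q. is_pullback C s r p q \<longrightarrow>
        (\<exists>t. in_hom C t (Dom C p) (Dom C r) \<and> r \<cdot>\<^bsub>C\<^esub> t = r \<cdot>\<^bsub>C\<^esub> p \<and> s \<cdot>\<^bsub>C\<^esub> t = s \<cdot>\<^bsub>C\<^esub> q))"

definition barr_exact :: "('o, 'a) cat \<Rightarrow> bool" where
  "barr_exact C \<longleftrightarrow> regular_category C \<and>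
     (\<forall>r s. equivalence_relation C r s \<longrightarrow> (\<exists>f. is_pullback C f f r s))"


section \<open>Double extensions and Galois structures\<close>

text \<open>A morphism \<open>(t, b) : f \<rightarrow> g\<close> of the arrow category, where \<open>t\<close> is the top and \<open>b\<close> the bottom
  component.\<close>

definition arrow_square :: "('o, 'a) cat \<Rightarrow> 'a \<Rightarrow> 'a \<Rightarrow> 'a \<Rightarrow> 'a \<Rightarrow> bool" where
  "arrow_square C f g t b \<longleftrightarrow> f \<in> Mor C \<and> g \<in> Mor C \<and>
     in_hom C t (Dom C f) (Dom C g) \<and> in_hom C b (Cod C f) (Cod C g) \<and> g \<cdot>\<^bsub>C\<^esub> t = b \<cdot>\<^bsub>C\<^esub> f"

definition double_extension ::
  "('o, 'a) cat \<Rightarrow> 'a set \<Rightarrow> 'a \<Rightarrow> 'a \<Rightarrow> 'a \<Rightarrow> 'a \<Rightarrow> bool" where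
  "double_extension C E f g t b \<longleftrightarrow> arrow_square C f g t b \<and>
     f \<in> E \<and> g \<in> E \<and> t \<in> E \<and> b \<in> E \<and>
     (\<exists>p q u. is_pullback C b g p q \<and> p \<in> E \<and> q \<in> E \<and>
        in_hom C u (Dom C f) (Dom C p) \<and> p \<cdot>\<^bsub>C\<^esub> u = f \<and> q \<cdot>\<^bsub>C\<^esub> u = t \<and> u \<in> E)"

definition slice :: "('o, 'a) cat \<Rightarrow> 'o \<Rightarrow> ('a, 'a \<times> 'a \<times> 'a) cat" where
  "slice C b =
    \<lparr>Obj = {p \<in> Mor C. Cod C p = b},
     Mor = {(p, q, h). p \<in> Mor C \<and> Cod C p = b \<and> q \<in> Mor C \<and> Cod C q = b \<and>
              in_hom C h (Dom C p) (Dom C q) \<and> q \<cdot>\<^bsub>C\<^esub> h = p},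
     Dom = (\<lambda>(p, q, h). p),
     Cod = (\<lambda>(p, q, h). q),
     Id = (\<lambda>p. (p, p, Id C (Dom C p))),
     Comp = (\<lambda>(q', r, k) (p, q, h). (p, r, k \<cdot>\<^bsub>C\<^esub> h))\<rparr>"

definition ext_over :: "('o, 'a) cat \<Rightarrow> 'a set \<Rightarrow> 'o \<Rightarrow> ('a, 'a \<times> 'a \<times> 'a) cat" where
  "ext_over C E b = full_sub (slice C b) E"

text \<open>The pullback functor along \<open>e\<close>, for a choice of pullbacks; another choice gives a
  naturally isomorphic functor.\<close>

definition chosen_pullback :: "('o, 'a) cat \<Rightarrow> 'a \<Rightarrow> 'a \<Rightarrow> 'a \<times> 'a" where
  "chosen_pullback C e p = (SOME (r, s). is_pullback C e p r s)"

definition pullback_functor ::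
  "('o, 'a) cat \<Rightarrow> 'a \<Rightarrow> ('a, 'a \<times> 'a \<times> 'a, 'a, 'a \<times> 'a \<times> 'a) fctr" where
  "pullback_functor C e =
    \<lparr>omap = (\<lambda>p. fst (chosen_pullback C e p)),
     amap = (\<lambda>(p, p', h).
       let (r, s) = chosen_pullback C e p; (r', s') = chosen_pullback C e p'
       in (r, r', THE u. in_hom C u (Dom C r) (Dom C r') \<and>
                         r' \<cdot>\<^bsub>C\<^esub> u = r \<and> s' \<cdot>\<^bsub>C\<^esub> u = h \<cdot>\<^bsub>C\<^esub> s))\<rparr>"

definition effective_descent :: "('o, 'a) cat \<Rightarrow> 'a set \<Rightarrow> 'a \<Rightarrow> bool" where
  "effective_descent C E e \<longleftrightarrow>
     monadic (ext_over C E (Cod C e)) (ext_over C E (Dom C e)) (pullback_functor C e)"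

text \<open>In a Galois structure the right adjoint is the inclusion of the full replete subcategory
  \<open>sub \<Gamma>\<close>, hence acts as the identity on objects and morphisms and is not recorded.\<close>

record ('o, 'a) galois =
  ambient :: "('o, 'a) cat"
  sub :: "('o, 'a) cat"
  refl :: "('o, 'a, 'o, 'a) fctr"
  unit :: "'o \<Rightarrow> 'a"
  counit :: "'o \<Rightarrow> 'a"
  exts :: "'a set"

locale galois_structure =
  fixes \<Gamma> :: "('o, 'a) galois"
  assumes category: "category (ambient \<Gamma>)"
    and sub: "full_replete_subcategory (sub \<Gamma>) (ambient \<Gamma>)"
    and adjunction: "adjunction (ambient \<Gamma>) (sub \<Gamma>) (refl \<Gamma>) id_functor (unit \<Gamma>) (counit \<Gamma>)"
    and exts_regular_epi: "exts \<Gamma> \<subseteq> regular_epis (ambient \<Gamma>)"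
    and unit_ext: "a \<in> Obj (ambient \<Gamma>) \<Longrightarrow> unit \<Gamma> a \<in> exts \<Gamma>"
    and iso_ext: "iso (ambient \<Gamma>) f \<Longrightarrow> f \<in> exts \<Gamma>"
    and comp_ext: "f \<in> exts \<Gamma> \<Longrightarrow> g \<in> exts \<Gamma> \<Longrightarrow> Dom (ambient \<Gamma>) g = Cod (ambient \<Gamma>) f \<Longrightarrow>
          g \<cdot>\<^bsub>ambient \<Gamma>\<^esub> f \<in> exts \<Gamma>"
    and refl_ext: "e \<in> exts \<Gamma> \<Longrightarrow> amap (refl \<Gamma>) e \<in> exts \<Gamma>"
    and pullback_exists: "e \<in> exts \<Gamma> \<Longrightarrow> f \<in> Mor (ambient \<Gamma>) \<Longrightarrow>
          Cod (ambient \<Gamma>) f = Cod (ambient \<Gamma>) e \<Longrightarrow> \<exists>p q. is_pullback (ambient \<Gamma>) f e p q"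
    and pullback_ext: "e \<in> exts \<Gamma> \<Longrightarrow> is_pullback (ambient \<Gamma>) f e p q \<Longrightarrow> p \<in> exts \<Gamma>"
    and descent: "e \<in> exts \<Gamma> \<Longrightarrow> effective_descent (ambient \<Gamma>) (exts \<Gamma>) e"

definition strongly_birkhoff :: "('o, 'a) galois \<Rightarrow> bool" where
  "strongly_birkhoff \<Gamma> \<longleftrightarrow> (\<forall>f\<in>exts \<Gamma>.
     double_extension (ambient \<Gamma>) (exts \<Gamma>) f (amap (refl \<Gamma>) f)
       (unit \<Gamma> (Dom (ambient \<Gamma>) f)) (unit \<Gamma> (Cod (ambient \<Gamma>) f)))"

definition trivial_covering :: "('o, 'a) galois \<Rightarrow> 'a \<Rightarrow> bool" where
  "trivial_covering \<Gamma> f \<longleftrightarrow> f \<in> exts \<Gamma> \<and>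
     is_pullback (ambient \<Gamma>) (unit \<Gamma> (Cod (ambient \<Gamma>) f)) (amap (refl \<Gamma>) f)
       f (unit \<Gamma> (Dom (ambient \<Gamma>) f))"

definition covering :: "('o, 'a) galois \<Rightarrow> 'a \<Rightarrow> bool" where
  "covering \<Gamma> c \<longleftrightarrow> c \<in> exts \<Gamma> \<and>
     (\<exists>e\<in>exts \<Gamma>. \<exists>p q. is_pullback (ambient \<Gamma>) e c p q \<and> trivial_covering \<Gamma> p)"


section \<open>Iterated arrow categories and higher extensions\<close>

text \<open>One type for the objects and morphisms of all the categories \<open>Arr\<^sup>n(C)\<close>: \<open>Ob\<close> and \<open>Ar\<close> tag the
  objects and morphisms of \<open>C\<close>, an object of \<open>Arr\<^sup>n\<^sup>+\<^sup>1(C)\<close> is a morphism of \<open>Arr\<^sup>n(C)\<close>, and \<open>Sq f g t b\<close>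
  is the morphism \<open>(t, b) : f \<rightarrow> g\<close>.\<close>

datatype ('o, 'a) iarr =
    Ob (the_Ob: 'o)
  | Ar (the_Ar: 'a)
  | Sq (sq_dom: "('o, 'a) iarr") (sq_cod: "('o, 'a) iarr")
       (sq_top: "('o, 'a) iarr") (sq_bot: "('o, 'a) iarr")

type_synonym ('o, 'a) icat = "(('o, 'a) iarr, ('o, 'a) iarr) cat"

definition tagged :: "('o, 'a) cat \<Rightarrow> ('o, 'a) icat" where
  "tagged C =
    \<lparr>Obj = Ob ` Obj C,
     Mor = Ar ` Mor C,
     Dom = (\<lambda>f. Ob (Dom C (the_Ar f))),
     Cod = (\<lambda>f. Ob (Cod C (the_Ar f))),
     Id = (\<lambda>a. Ar (Id C (the_Ob a))),
     Comp = (\<lambda>g f. Ar (the_Ar g \<cdot>\<^bsub>C\<^esub> the_Ar f))\<rparr>"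

definition arrow_cat :: "('o, 'a) icat \<Rightarrow> ('o, 'a) icat" where
  "arrow_cat Y =
    \<lparr>Obj = Mor Y,
     Mor = {Sq f g t b | f g t b. arrow_square Y f g t b},
     Dom = sq_dom,
     Cod = sq_cod,
     Id = (\<lambda>f. Sq f f (Id Y (Dom Y f)) (Id Y (Cod Y f))),
     Comp = (\<lambda>\<tau> \<sigma>. Sq (sq_dom \<sigma>) (sq_cod \<tau>) (sq_top \<tau> \<cdot>\<^bsub>Y\<^esub> sq_top \<sigma>) (sq_bot \<tau> \<cdot>\<^bsub>Y\<^esub> sq_bot \<sigma>))\<rparr>"

definition Arr_cat :: "('o, 'a) cat \<Rightarrow> nat \<Rightarrow> ('o, 'a) icat" where
  "Arr_cat C n = (arrow_cat ^^ n) (tagged C)"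

text \<open>The class of \<open>n\<close>-fold extensions. With the convention that every object of \<open>C\<close> is a \<open>0\<close>-fold
  extension, \<open>full_sub (Arr_cat C 0) (n_ext C 0)\<close> is \<open>C\<close> itself.\<close>

fun n_ext :: "('o, 'a) cat \<Rightarrow> nat \<Rightarrow> ('o, 'a) iarr set" where
  "n_ext C 0 = Obj (tagged C)"
| "n_ext C (Suc 0) = regular_epis (tagged C)"
| "n_ext C (Suc (Suc n)) =
     {Sq f g t b | f g t b.
        Sq f g t b \<in> Mor (full_sub (Arr_cat C (Suc n)) (n_ext C (Suc n))) \<and>
        double_extension (full_sub (Arr_cat C n) (n_ext C n)) (n_ext C (Suc n)) f g t b}"

definition Ext_cat :: "('o, 'a) cat \<Rightarrow> nat \<Rightarrow> ('o, 'a) icat" where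
  "Ext_cat C n = full_sub (Arr_cat C n) (n_ext C n)"

locale tower =
  fixes C :: "('o, 'a) cat" and \<Gamma> :: "nat \<Rightarrow> (('o, 'a) iarr, ('o, 'a) iarr) galois"
  assumes galois: "galois_structure (\<Gamma> k)"
    and birkhoff: "strongly_birkhoff (\<Gamma> k)"
    and ambient: "ambient (\<Gamma> k) = Ext_cat C k"
    and exts: "exts (\<Gamma> k) = n_ext C (Suc k)"
    and sub_Suc: "sub (\<Gamma> (Suc k)) = full_sub (Ext_cat C (Suc k)) {c. covering (\<Gamma> k) c}"


section \<open>Underlying cubes and symmetric coverings\<close>

text \<open>The \<open>n\<close>-cube is the poset of subsets of \<open>{..<n}\<close>, one element for each direction. Direction \<open>n\<close>
  is the outermost one of an object of \<open>Arr\<^sup>n\<^sup>+\<^sup>1(C)\<close>: sets without \<open>n\<close> lie in the domain and sets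
  with \<open>n\<close> in the codomain. Thus \<open>{}\<close> is the initial vertex.\<close>

definition cube_cat :: "nat \<Rightarrow> (nat set, nat set \<times> nat set) cat" where
  "cube_cat n =
    \<lparr>Obj = Pow {..<n},
     Mor = {(S, T). S \<subseteq> T \<and> T \<subseteq> {..<n}},
     Dom = fst,
     Cod = snd,
     Id = (\<lambda>S. (S, S)),
     Comp = (\<lambda>g f. (fst f, snd g))\<rparr>"

fun vertex :: "('o, 'a) cat \<Rightarrow> nat \<Rightarrow> ('o, 'a) iarr \<Rightarrow> nat set \<Rightarrow> ('o, 'a) iarr" where
  "vertex C 0 x S = x"
| "vertex C (Suc n) f S =
     vertex C n (if n \<in> S then Cod (Arr_cat C n) f else Dom (Arr_cat C n) f) S"

text \<open>The component at the vertex \<open>S\<close> of a morphism of \<open>Arr\<^sup>n(C)\<close>, seen as a morphism of \<open>n\<close>-cubes.\<close>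

fun component :: "nat \<Rightarrow> ('o, 'a) iarr \<Rightarrow> nat set \<Rightarrow> ('o, 'a) iarr" where
  "component 0 f S = f"
| "component (Suc n) \<sigma> S = component n (if n \<in> S then sq_bot \<sigma> else sq_top \<sigma>) S"

text \<open>The morphism from vertex \<open>S\<close> to vertex \<open>T\<close>, for \<open>S \<subseteq> T\<close>.\<close>

fun edge :: "('o, 'a) cat \<Rightarrow> nat \<Rightarrow> ('o, 'a) iarr \<Rightarrow> nat set \<Rightarrow> nat set \<Rightarrow> ('o, 'a) iarr" where
  "edge C 0 x S T = Id (tagged C) x"
| "edge C (Suc n) f S T =
     (if n \<in> S then edge C n (Cod (Arr_cat C n) f) S T
      else if n \<in> T then component n f T \<cdot>\<^bsub>tagged C\<^esub> edge C n (Dom (Arr_cat C n) f) S T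
      else edge C n (Dom (Arr_cat C n) f) S T)"

definition cube ::
  "('o, 'a) cat \<Rightarrow> nat \<Rightarrow> ('o, 'a) iarr \<Rightarrow>
   (nat set, nat set \<times> nat set, ('o, 'a) iarr, ('o, 'a) iarr) fctr" where
  "cube C n \<alpha> = \<lparr>omap = vertex C n \<alpha>, amap = (\<lambda>(S, T). edge C n \<alpha> S T)\<rparr>"

definition limit_cube :: "('o, 'a) cat \<Rightarrow> nat \<Rightarrow> ('o, 'a) iarr \<Rightarrow> bool" where
  "limit_cube C n \<alpha> \<longleftrightarrow>
     is_limit (full_sub (cube_cat n) (- {{}})) (tagged C) (cube C n \<alpha>)
       (vertex C n \<alpha> {}) (\<lambda>S. edge C n \<alpha> {} S)"

text \<open>The cube of \<open>\<tau> \<in> Arr\<^sup>n(C)\<close> is obtained from the cube of \<open>\<delta> \<in> Arr\<^sup>m(C)\<close> by precomposition with the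
  monotone map \<open>\<phi>\<close> from subsets of \<open>{..<n}\<close> to subsets of \<open>{..<m}\<close>.\<close>

definition restricts_along ::
  "('o, 'a) cat \<Rightarrow> nat \<Rightarrow> ('o, 'a) iarr \<Rightarrow> nat \<Rightarrow> ('o, 'a) iarr \<Rightarrow> (nat set \<Rightarrow> nat set) \<Rightarrow> bool" where
  "restricts_along C m \<delta> n \<tau> \<phi> \<longleftrightarrow> \<delta> \<in> Obj (Arr_cat C m) \<and> \<tau> \<in> Obj (Arr_cat C n) \<and>
     (\<forall>S. S \<subseteq> {..<n} \<longrightarrow> vertex C n \<tau> S = vertex C m \<delta> (\<phi> S)) \<and>
     (\<forall>S T. S \<subseteq> T \<and> T \<subseteq> {..<n} \<longrightarrow> edge C n \<tau> S T = edge C m \<delta> (\<phi> S) (\<phi> T))"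

text \<open>Inclusion of the \<open>n\<close>-cube as a face orthogonal to direction \<open>i\<close> of the \<open>(n+1)\<close>-cube: the domain
  face for \<open>b = False\<close>, the codomain face for \<open>b = True\<close>; the other directions keep their order.\<close>

definition face :: "nat \<Rightarrow> bool \<Rightarrow> nat set \<Rightarrow> nat set" where
  "face i b S = (\<lambda>j. if j < i then j else Suc j) ` S \<union> (if b then {i} else {})"

text \<open>\<open>\<delta>\<close> is a discrete fibration of order \<open>n + 1\<close> which, in a suitable direction \<open>i\<close>, is a morphism
  between the \<open>n\<close>-cubes \<open>\<tau>\<close> and \<open>\<alpha>\<close>.\<close>

definition discrete_fibration ::
  "('o, 'a) cat \<Rightarrow> nat \<Rightarrow> ('o, 'a) iarr \<Rightarrow> ('o, 'a) iarr \<Rightarrow> ('o, 'a) iarr \<Rightarrow> bool" where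
  "discrete_fibration C n \<delta> \<tau> \<alpha> \<longleftrightarrow>
     \<delta> \<in> n_ext C (Suc n) \<and> limit_cube C (Suc n) \<delta> \<and> \<tau> \<in> n_ext C n \<and> \<alpha> \<in> n_ext C n \<and>
     (\<exists>i\<le>n. restricts_along C (Suc n) \<delta> n \<tau> (face i False) \<and>
            restricts_along C (Suc n) \<delta> n \<alpha> (face i True))"

definition n_ext_in :: "('o, 'a) cat \<Rightarrow> ('o, 'a) iarr set \<Rightarrow> nat \<Rightarrow> ('o, 'a) iarr set" where
  "n_ext_in C B n = {\<beta> \<in> n_ext C n. \<forall>S. S \<subseteq> {..<n} \<longrightarrow> vertex C n \<beta> S \<in> B}"

definition symmetrically_trivial_covering ::
  "('o, 'a) cat \<Rightarrow> ('o, 'a) iarr set \<Rightarrow> nat \<Rightarrow> ('o, 'a) iarr \<Rightarrow> bool" where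
  "symmetrically_trivial_covering C B n \<tau> \<longleftrightarrow> \<tau> \<in> n_ext C n \<and>
     (\<exists>\<beta>\<in>n_ext_in C B n. \<exists>\<delta>. discrete_fibration C n \<delta> \<tau> \<beta>)"

definition symmetric_covering ::
  "('o, 'a) cat \<Rightarrow> ('o, 'a) iarr set \<Rightarrow> nat \<Rightarrow> ('o, 'a) iarr \<Rightarrow> bool" where
  "symmetric_covering C B n \<alpha> \<longleftrightarrow> \<alpha> \<in> n_ext C n \<and>
     (\<exists>\<tau> \<delta>. symmetrically_trivial_covering C B n \<tau> \<and> discrete_fibration C n \<delta> \<tau> \<alpha>)"

end

theory Submission
  imports Defs "HOL-Library.Nat_Bijection"
begin

text \<open>
  The idea is to describe extensions, discrete fibrations and coverings of cubes by properties that do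
  not refer to any order of the directions, and to compare the two sides of the theorem there.

  \<^emph>\<open>Extensions.\<close> In a regular category a regular epimorphism \<open>f : X \<rightarrow> Y\<close> is a morphism along which every
  generalised element \<open>z \<rightarrow> Y\<close> lifts locally, that is, after composition with some regular epimorphism
  \<open>z' \<rightarrow> z\<close>. Unfolding the recursive definition of double extensions with this description, a map of
  cubes is an extension exactly when for every vertex \<open>S\<close> the following lifting property holds: an element
  of the codomain at \<open>S\<close> together with compatible elements of the domain at all vertices strictly above
  \<open>S\<close> comes, locally, from an element of the domain at \<open>S\<close>. A cube is an extension when the map to
  the terminal cube has this property at every vertex except the last one. The key to the recursion is
  \<open>lifting_bot\<close>: when a cube is cut into two faces, lifting at a vertex of the initial face is lifting for
  the comparison map into the pullback formed with the opposite face. A discrete fibration is an extension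
  whose lifts at the initial vertex are unique and exist globally (\<open>limit_cube_iff_ulifts\<close>). The
  translation between iterated arrows and cubes is completed in \<open>cubical_all\<close> and \<open>lifting_ext_all\<close>.

  \<^emph>\<open>From spans to coverings.\<close> Let \<open>B k\<close> be the class of the \<open>k\<close>-cubes in the \<open>k\<close>-th reflective
  subcategory. It is closed under quotients along extensions (\<open>B_quotient\<close>) by the strong Birkhoff property, an
  extension between members of \<open>B k\<close> belongs to \<open>B (k + 1)\<close> (\<open>B_arrow\<close>), and the domain of a discrete
  fibration over a member of \<open>B k\<close>, with \<open>k\<close> positive, is again a member (\<open>dfib_B\<close>). Hence an
  extension of positive dimension with all vertices in \<open>B 0\<close> is a covering, and so are the apex and the
  other end of a span of discrete fibrations that starts from it.

  \<^emph>\<open>From coverings to spans.\<close> For a single covering \<open>\<alpha>\<close> of dimension \<open>k + 1\<close>, a trivialising extension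
  and the reflection produce a span of discrete fibrations from \<open>\<alpha>\<close> to an arrow between members of \<open>B k\<close>.
  To go on, the same must be done with both ends of that arrow at once, naturally, and so with a whole
  cube of members of \<open>B (k + 1)\<close>. This is \<open>reduce_dimension\<close>. There the vertexwise
  reflections of a whole cube are needed, and they need not form an extension. As a replacement
  \<open>resolvable\<close> provides, for any extension \<open>X\<close>, a span
  of extensions \<open>X \<leftarrow> Q \<rightarrow> \<beta>\<close> such that the faces of \<open>\<beta>\<close> lie in \<open>B k\<close> and morphisms from the faces of
  \<open>X\<close> into \<open>B k\<close> induce morphisms from the faces of \<open>\<beta>\<close>. The two statements support each other: the
  induction for \<open>resolvable\<close> reduces the dimension of the faces with \<open>reduce_dimension\<close>. After all
  dimensions have been reduced, \<open>base_span_of_faces\<close> composes the spans, and the far end has its vertices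
  in \<open>B 0\<close>.

  Together these give \<open>B_iff_base_span\<close>. Symmetry follows, since the existence of a
  span does not change when the directions are permuted (\<open>base_span_rx\<close>).
\<close>

section \<open>Regular categories and their generalised elements\<close>

locale regular_base =
  fixes K :: "('o, 'a) cat" and null :: 'a
  assumes regular: "regular_category K" and null: "null \<notin> Mor K"
begin

sublocale category K
  using regular by (simp add: regular_category_def)

abbreviation hom :: "'a \<Rightarrow> 'o \<Rightarrow> 'o \<Rightarrow> bool" where
  "hom \<equiv> in_hom K"

text \<open>A composition that returns a fixed non-morphism outside its natural domain is associative without any
  typing hypotheses, so that associativity can be a rewrite rule.\<close>

definition cmp :: "'a \<Rightarrow> 'a \<Rightarrow> 'a"  (infixr \<open>\<odot>\<close> 70) where
  "g \<odot> f = (if f \<in> Mor K \<and> g \<in> Mor K \<and> Dom K g = Cod K f then g \<cdot>\<^bsub>K\<^esub> f else null)"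

lemma cmp_eq_Comp: "hom f a b \<Longrightarrow> hom g b c \<Longrightarrow> g \<odot> f = g \<cdot>\<^bsub>K\<^esub> f"
  by (simp add: cmp_def in_hom_def)

lemma hom_cmp: "hom f a b \<Longrightarrow> hom g b c \<Longrightarrow> hom (g \<odot> f) a c"
  using Comp_in_hom cmp_eq_Comp by metis

lemma cmp_in_Mor_iff: "g \<odot> f \<in> Mor K \<longleftrightarrow> f \<in> Mor K \<and> g \<in> Mor K \<and> Dom K g = Cod K f"
  using null hom_cmp unfolding cmp_def in_hom_def by (metis Comp_in_hom in_hom_def)

lemma Dom_cmp: "g \<odot> f \<in> Mor K \<Longrightarrow> Dom K (g \<odot> f) = Dom K f"
  and Cod_cmp: "g \<odot> f \<in> Mor K \<Longrightarrow> Cod K (g \<odot> f) = Cod K g"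
  using hom_cmp unfolding cmp_in_Mor_iff in_hom_def by metis+

lemma cmp_assoc [simp]: "(h \<odot> g) \<odot> f = h \<odot> (g \<odot> f)"
proof (cases "f \<in> Mor K \<and> g \<in> Mor K \<and> h \<in> Mor K \<and> Dom K g = Cod K f \<and> Dom K h = Cod K g")
  case True
  then have 1: "hom f (Dom K f) (Cod K f)" "hom g (Cod K f) (Cod K g)" "hom h (Cod K g) (Cod K h)"
    by (auto simp: in_hom_def)
  show ?thesis
    using Comp_assoc[OF 1] cmp_eq_Comp[OF 1(1,2)] cmp_eq_Comp[OF 1(2,3)]
      cmp_eq_Comp[OF hom_cmp[OF 1(1,2)] 1(3)] cmp_eq_Comp[OF 1(1) hom_cmp[OF 1(2,3)]] by simp
next
  case False
  have null_if: "b \<odot> a \<notin> Mor K \<Longrightarrow> b \<odot> a = null" for a b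
    unfolding cmp_in_Mor_iff by (auto simp: cmp_def)
  have "(h \<odot> g) \<odot> f \<notin> Mor K"
    using False Dom_cmp[of h g] unfolding cmp_in_Mor_iff[of "h \<odot> g" f] cmp_in_Mor_iff[of h g]
    by auto
  moreover have "h \<odot> (g \<odot> f) \<notin> Mor K"
    using False Cod_cmp[of g f] unfolding cmp_in_Mor_iff[of h "g \<odot> f"] cmp_in_Mor_iff[of g f]
    by auto
  ultimately show ?thesis
    using null_if[of "h \<odot> g" f] null_if[of h "g \<odot> f"] by simp
qed

lemma hom_Id: "a \<in> Obj K \<Longrightarrow> hom (Id K a) a a"
  by (rule Id_in_hom)

lemma hom_Obj: "hom f a b \<Longrightarrow> a \<in> Obj K \<and> b \<in> Obj K"
  using Dom_in Cod_in by (auto simp: in_hom_def)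

lemma cmp_Id [simp]: "hom f a b \<Longrightarrow> f \<odot> Id K a = f"
  and Id_cmp [simp]: "hom f a b \<Longrightarrow> Id K b \<odot> f = f"
  using cmp_eq_Comp Comp_Id Id_Comp hom_Id hom_Obj by metis+

lemma Id_cmp_Id [simp]: "a \<in> Obj K \<Longrightarrow> Id K a \<odot> Id K a = Id K a"
  using cmp_Id hom_Id by blast

lemma Dom_Id: "a \<in> Obj K \<Longrightarrow> Dom K (Id K a) = a"
  using hom_Id by (auto simp: in_hom_def)

subsection \<open>Diagrams over finite posets of sets, and their limits\<close>

text \<open>A diagram over a poset of sets is given by its edges \<open>X S T\<close> for \<open>S \<subseteq> T\<close>; the vertices are read off
  from the identity edges.\<close>

definition V :: "(nat set \<Rightarrow> nat set \<Rightarrow> 'a) \<Rightarrow> nat set \<Rightarrow> 'o" where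
  "V X S = Dom K (X S S)"

definition diag :: "nat set set \<Rightarrow> (nat set \<Rightarrow> nat set \<Rightarrow> 'a) \<Rightarrow> bool" where
  "diag P X \<longleftrightarrow>
     (\<forall>S\<in>P. V X S \<in> Obj K \<and> X S S = Id K (V X S)) \<and>
     (\<forall>S\<in>P. \<forall>T\<in>P. S \<subseteq> T \<longrightarrow> hom (X S T) (V X S) (V X T)) \<and>
     (\<forall>S\<in>P. \<forall>T\<in>P. \<forall>U\<in>P. S \<subseteq> T \<and> T \<subseteq> U \<longrightarrow> X T U \<odot> X S T = X S U)"

text \<open>An element at stage \<open>z\<close> of the limit of the part \<open>U\<close> of the diagram, whether or not that limit
  exists.\<close>

definition fam :: "(nat set \<Rightarrow> nat set \<Rightarrow> 'a) \<Rightarrow> nat set set \<Rightarrow> 'o \<Rightarrow> (nat set \<Rightarrow> 'a) \<Rightarrow> bool" where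
  "fam X U z x \<longleftrightarrow> z \<in> Obj K \<and> (\<forall>S\<in>U. hom (x S) z (V X S)) \<and>
     (\<forall>S\<in>U. \<forall>T\<in>U. S \<subseteq> T \<longrightarrow> X S T \<odot> x S = x T)"

lemma diag_hom: "diag P X \<Longrightarrow> S \<in> P \<Longrightarrow> T \<in> P \<Longrightarrow> S \<subseteq> T \<Longrightarrow> hom (X S T) (V X S) (V X T)"
  and diag_refl: "diag P X \<Longrightarrow> S \<in> P \<Longrightarrow> X S S = Id K (V X S)"
  and diag_Obj: "diag P X \<Longrightarrow> S \<in> P \<Longrightarrow> V X S \<in> Obj K"
  and diag_comp: "diag P X \<Longrightarrow> S \<in> P \<Longrightarrow> T \<in> P \<Longrightarrow> U \<in> P \<Longrightarrow> S \<subseteq> T \<Longrightarrow> T \<subseteq> U \<Longrightarrow>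
      X T U \<odot> X S T = X S U"
  by (auto simp: diag_def)

lemma diag_mono: "diag P X \<Longrightarrow> Q \<subseteq> P \<Longrightarrow> diag Q X"
  unfolding diag_def by (simp add: subset_iff)

lemma fam_hom: "fam X U z x \<Longrightarrow> S \<in> U \<Longrightarrow> hom (x S) z (V X S)"
  and fam_comp: "fam X U z x \<Longrightarrow> S \<in> U \<Longrightarrow> T \<in> U \<Longrightarrow> S \<subseteq> T \<Longrightarrow> X S T \<odot> x S = x T"
  and fam_Obj: "fam X U z x \<Longrightarrow> z \<in> Obj K"
  by (auto simp: fam_def)

lemma fam_mono: "fam X U z x \<Longrightarrow> U' \<subseteq> U \<Longrightarrow> fam X U' z x"
  unfolding fam_def by (simp add: subset_iff)

lemma fam_restrict: "fam X U z x \<Longrightarrow> hom e z' z \<Longrightarrow> fam X U z' (\<lambda>S. x S \<odot> e)"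
  unfolding fam_def using hom_cmp hom_Obj by (simp flip: cmp_assoc)

text \<open>The poset is encoded by natural numbers because finite limits are given for index categories of that
  form.\<close>

lemma finite_limit:
  assumes fin: "finite P" and X: "diag P X"
  shows "\<exists>L \<pi>. fam X P L \<pi> \<and>
     (\<forall>z x. fam X P z x \<longrightarrow> (\<exists>!u. hom u z L \<and> (\<forall>S\<in>P. \<pi> S \<odot> u = x S)))"
proof -
  obtain \<iota> :: "nat set \<Rightarrow> nat" where inj: "inj_on \<iota> P"
    using finite_imp_inj_to_nat_seg[OF fin] by blast
  define \<kappa> where "\<kappa> = inv_into P \<iota>"
  have \<kappa>\<iota> [simp]: "S \<in> P \<Longrightarrow> \<kappa> (\<iota> S) = S" for S
    using inj by (simp add: \<kappa>_def)
  define J :: "(nat, nat) cat" where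
    "J = \<lparr>Obj = \<iota> ` P,
      Mor = {prod_encode (\<iota> S, \<iota> T) | S T. S \<in> P \<and> T \<in> P \<and> S \<subseteq> T},
      Dom = (\<lambda>u. fst (prod_decode u)), Cod = (\<lambda>u. snd (prod_decode u)),
      Id = (\<lambda>a. prod_encode (a, a)),
      Comp = (\<lambda>g f. prod_encode (fst (prod_decode f), snd (prod_decode g)))\<rparr>"
  define D :: "(nat, nat, 'o, 'a) fctr" where
    "D = \<lparr>omap = (\<lambda>j. V X (\<kappa> j)),
       amap = (\<lambda>u. X (\<kappa> (fst (prod_decode u))) (\<kappa> (snd (prod_decode u))))\<rparr>"
  have homJ: "in_hom J f a b \<longleftrightarrow> (\<exists>S\<in>P. \<exists>T\<in>P. S \<subseteq> T \<and> a = \<iota> S \<and> b = \<iota> T \<and> f = prod_encode (\<iota> S, \<iota> T))"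
    for f a b
    unfolding in_hom_def J_def by (simp, metis fst_conv snd_conv prod_encode_inverse)
  have \<iota>_eq: "S \<in> P \<Longrightarrow> T \<in> P \<Longrightarrow> \<iota> S = \<iota> T \<Longrightarrow> S = T" for S T
    using inj by (meson inj_onD)
  have MorJ: "f \<in> Mor J \<longleftrightarrow> (\<exists>S\<in>P. \<exists>T\<in>P. S \<subseteq> T \<and> f = prod_encode (\<iota> S, \<iota> T))" for f
    unfolding J_def by (simp, metis)
  have JD: "Dom J (prod_encode (a, b)) = a" "Cod J (prod_encode (a, b)) = b" "Obj J = \<iota> ` P"
    "Id J a = prod_encode (a, a)" "prod_encode (c, d) \<cdot>\<^bsub>J\<^esub> prod_encode (a, b) = prod_encode (a, d)" for a b c d
    by (simp_all add: J_def)
  have Dapp: "omap D j = V X (\<kappa> j)" "amap D (prod_encode (a, b)) = X (\<kappa> a) (\<kappa> b)" for j a b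
    by (simp_all add: D_def)
  have catJ: "category J"
  proof
    show "Dom J f \<in> Obj J" "Cod J f \<in> Obj J" if "f \<in> Mor J" for f
      using that unfolding MorJ by (auto simp: JD)
    show "in_hom J (Id J a) a a" if "a \<in> Obj J" for a
      using that unfolding homJ JD by auto
    show "f \<cdot>\<^bsub>J\<^esub> Id J a = f" "Id J b \<cdot>\<^bsub>J\<^esub> f = f" if "in_hom J f a b" for f a b
      using that unfolding homJ by (auto simp: JD)
    show "(h \<cdot>\<^bsub>J\<^esub> g) \<cdot>\<^bsub>J\<^esub> f = h \<cdot>\<^bsub>J\<^esub> (g \<cdot>\<^bsub>J\<^esub> f)" for f g h
      by (simp add: J_def)
    fix f a b g c
    assume "in_hom J f a b" "in_hom J g b c"
    then obtain S T T' U where "S\<in>P" "T\<in>P" "S \<subseteq> T" "a = \<iota> S" "b = \<iota> T" "f = prod_encode (\<iota> S, \<iota> T)"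
      "T'\<in>P" "U\<in>P" "T' \<subseteq> U" "b = \<iota> T'" "c = \<iota> U" "g = prod_encode (\<iota> T', \<iota> U)"
      unfolding homJ by blast
    moreover from this have "T' = T" using \<iota>_eq by simp
    ultimately show "in_hom J (g \<cdot>\<^bsub>J\<^esub> f) a c"
      unfolding homJ by (intro bexI[of _ S] bexI[of _ U]) (auto simp: JD)
  qed
  have "finite (Mor J)"
  proof -
    have "Mor J \<subseteq> (\<lambda>(S,T). prod_encode (\<iota> S, \<iota> T)) ` (P \<times> P)"
      unfolding subset_iff MorJ by auto
    then show ?thesis
      using fin by (meson finite_SigmaI finite_imageI finite_subset)
  qed
  moreover have "finite (Obj J)"
    using fin by (simp add: J_def)
  moreover have "is_functor J K D"
  proof -
    have "amap D (g \<cdot>\<^bsub>J\<^esub> f) = amap D g \<cdot>\<^bsub>K\<^esub> amap D f"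
      if fg: "f \<in> Mor J" "g \<in> Mor J" "Dom J g = Cod J f" for f g
    proof -
      obtain S T T' U where st: "S\<in>P" "T\<in>P" "S \<subseteq> T" "f = prod_encode (\<iota> S, \<iota> T)"
        "T'\<in>P" "U\<in>P" "T' \<subseteq> U" "g = prod_encode (\<iota> T', \<iota> U)"
        using fg(1,2) unfolding MorJ by blast
      have T: "T' = T"
        using fg(3) st \<iota>_eq by (simp add: JD)
      have "X T U \<cdot>\<^bsub>K\<^esub> X S T = X S U"
        using cmp_eq_Comp[OF diag_hom[OF X, of S T] diag_hom[OF X, of T U]] diag_comp[OF X, of S T U] st T
        by simp
      then show ?thesis
        using st T by (simp add: JD Dapp)
    qed
    moreover have "hom (amap D f) (omap D (Dom J f)) (omap D (Cod J f))" if "f \<in> Mor J" for f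
      using that diag_hom[OF X] unfolding MorJ by (auto simp: JD Dapp)
    moreover have "omap D a \<in> Obj K \<and> amap D (Id J a) = Id K (omap D a)" if "a \<in> Obj J" for a
      using that diag_refl[OF X] diag_Obj[OF X] by (auto simp: JD Dapp)
    ultimately show ?thesis
      unfolding is_functor_def by blast
  qed
  ultimately obtain L \<rho> where lim: "is_limit J K D L \<rho>"
    using regular catJ unfolding regular_category_def has_finite_limits_def by blast
  have cone: "is_cone J K D z \<rho> \<longleftrightarrow> fam X P z (\<lambda>S. \<rho> (\<iota> S))" for z \<rho>
  proof -
    have eq1: "(\<forall>u\<in>Mor J. amap D u \<cdot>\<^bsub>K\<^esub> \<rho> (Dom J u) = \<rho> (Cod J u)) \<longleftrightarrow>
      (\<forall>S\<in>P. \<forall>T\<in>P. S \<subseteq> T \<longrightarrow> X S T \<cdot>\<^bsub>K\<^esub> \<rho> (\<iota> S) = \<rho> (\<iota> T))"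
    proof (intro iffI ballI impI)
      fix S T assume "\<forall>u\<in>Mor J. amap D u \<cdot>\<^bsub>K\<^esub> \<rho> (Dom J u) = \<rho> (Cod J u)" "S \<in> P" "T \<in> P" "S \<subseteq> T"
      then have "amap D (prod_encode (\<iota> S, \<iota> T)) \<cdot>\<^bsub>K\<^esub> \<rho> (Dom J (prod_encode (\<iota> S, \<iota> T)))
          = \<rho> (Cod J (prod_encode (\<iota> S, \<iota> T)))"
        using MorJ by blast
      then show "X S T \<cdot>\<^bsub>K\<^esub> \<rho> (\<iota> S) = \<rho> (\<iota> T)"
        using \<open>S \<in> P\<close> \<open>T \<in> P\<close> by (simp add: JD Dapp)
    qed (auto simp: MorJ JD Dapp)
    have eq2: "(\<forall>j\<in>Obj J. hom (\<rho> j) z (omap D j)) \<longleftrightarrow> (\<forall>S\<in>P. hom (\<rho> (\<iota> S)) z (V X S))"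
      by (simp add: JD Dapp)
    have eq3: "X S T \<odot> \<rho> (\<iota> S) = X S T \<cdot>\<^bsub>K\<^esub> \<rho> (\<iota> S)"
      if "hom (\<rho> (\<iota> S)) z (V X S)" "S \<in> P" "T \<in> P" "S \<subseteq> T" for S T
      using cmp_eq_Comp[OF that(1) diag_hom[OF X that(2-4)]] .
    have eq4: "(\<forall>S\<in>P. hom (\<rho> (\<iota> S)) z (V X S)) \<Longrightarrow>
       (\<forall>S\<in>P. \<forall>T\<in>P. S \<subseteq> T \<longrightarrow> X S T \<cdot>\<^bsub>K\<^esub> \<rho> (\<iota> S) = \<rho> (\<iota> T)) \<longleftrightarrow>
       (\<forall>S\<in>P. \<forall>T\<in>P. S \<subseteq> T \<longrightarrow> X S T \<odot> \<rho> (\<iota> S) = \<rho> (\<iota> T))"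
      using eq3 by metis
    show ?thesis
      by (simp only: is_cone_def fam_def eq1 eq2 eq4 cong: conj_cong)
  qed
  show ?thesis
  proof (intro exI conjI allI impI)
    show "fam X P L (\<lambda>S. \<rho> (\<iota> S))"
      using lim cone by (simp add: is_limit_def)
    fix z x assume x: "fam X P z x"
    have "is_cone J K D z (\<lambda>j. x (\<kappa> j))"
      unfolding cone using x by (simp add: fam_def)
    then have ex: "\<exists>!u. hom u z L \<and> (\<forall>j\<in>Obj J. \<rho> j \<cdot>\<^bsub>K\<^esub> u = x (\<kappa> j))"
      using lim by (simp add: is_limit_def)
    have "hom (\<rho> (\<iota> S)) L (V X S)" if "S \<in> P" for S
      using lim that fam_hom unfolding is_limit_def cone by blast
    then have "\<rho> (\<iota> S) \<odot> u = \<rho> (\<iota> S) \<cdot>\<^bsub>K\<^esub> u" if "hom u z L" "S \<in> P" for u S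
      using cmp_eq_Comp[OF that(1)] that(2) by blast
    then have "(\<forall>j\<in>Obj J. \<rho> j \<cdot>\<^bsub>K\<^esub> u = x (\<kappa> j)) \<longleftrightarrow> (\<forall>S\<in>P. \<rho> (\<iota> S) \<odot> u = x S)" if "hom u z L" for u
      using that by (simp add: JD)
    then have "hom u z L \<and> (\<forall>j\<in>Obj J. \<rho> j \<cdot>\<^bsub>K\<^esub> u = x (\<kappa> j)) \<longleftrightarrow>
        hom u z L \<and> (\<forall>S\<in>P. \<rho> (\<iota> S) \<odot> u = x S)" for u
      by blast
    then show "\<exists>!u. hom u z L \<and> (\<forall>S\<in>P. \<rho> (\<iota> S) \<odot> u = x S)"
      using ex by simp
  qed
qed

lemma terminal: "\<exists>t\<in>Obj K. \<forall>z\<in>Obj K. \<exists>!u. hom u z t"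
proof -
  have "diag {} (\<lambda>_ _. null)" by (simp add: diag_def)
  from finite_limit[OF _ this] show ?thesis
    unfolding fam_def by simp metis
qed

lemma pullback:
  assumes f: "hom f a c" and g: "hom g b c"
  shows "\<exists>d p q. hom p d a \<and> hom q d b \<and> f \<odot> p = g \<odot> q \<and>
    (\<forall>z r s. hom r z a \<and> hom s z b \<and> f \<odot> r = g \<odot> s \<longrightarrow> (\<exists>!u. hom u z d \<and> p \<odot> u = r \<and> q \<odot> u = s))"
proof -
  define A B W where ABW: "A = {0::nat}" "B = {1::nat}" "W = {0, 1::nat}"
  have ne: "A \<noteq> B" "B \<noteq> A" "A \<noteq> W" "W \<noteq> A" "B \<noteq> W" "W \<noteq> B"
    "\<not> A \<subseteq> B" "\<not> B \<subseteq> A" "A \<subseteq> W" "B \<subseteq> W" "\<not> W \<subseteq> A" "\<not> W \<subseteq> B"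
    by (auto simp: ABW)
  define X where "X S T = (if S = A then if T = A then Id K a else f
     else if S = B then if T = B then Id K b else g else Id K c)" for S T
  have abc: "a \<in> Obj K" "b \<in> Obj K" "c \<in> Obj K"
    using f g hom_Obj by auto
  have Xs: "X A A = Id K a" "X B B = Id K b" "X W W = Id K c" "X A W = f" "X B W = g"
    using ne(1-6) by (simp_all add: X_def)
  have V: "V X A = a" "V X B = b" "V X W = c"
    using abc by (simp_all add: V_def Xs Dom_Id)
  have X: "diag {A, B, W} X"
    unfolding diag_def
    by (simp add: ne(7-12) Xs V abc f g hom_Id cmp_Id[OF f] Id_cmp[OF f] cmp_Id[OF g] Id_cmp[OF g])
  obtain L \<pi> where \<pi>: "fam X {A, B, W} L \<pi>"
    and un: "\<And>z x. fam X {A, B, W} z x \<Longrightarrow> \<exists>!u. hom u z L \<and> (\<forall>S\<in>{A, B, W}. \<pi> S \<odot> u = x S)"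
    using finite_limit[OF _ X] by auto
  have p: "hom (\<pi> A) L a" "hom (\<pi> B) L b" "\<pi> W = f \<odot> \<pi> A" "\<pi> W = g \<odot> \<pi> B"
    using fam_hom[OF \<pi>, of A] fam_hom[OF \<pi>, of B] fam_comp[OF \<pi>, of A W] fam_comp[OF \<pi>, of B W]
    by (simp_all add: V Xs ne(9,10))
  have "\<exists>!u. hom u z L \<and> \<pi> A \<odot> u = r \<and> \<pi> B \<odot> u = s"
    if rs: "hom r z a" "hom s z b" "f \<odot> r = g \<odot> s" for z r s
  proof -
    define x where "x S = (if S = A then r else if S = B then s else f \<odot> r)" for S
    have xs: "x A = r" "x B = s" "x W = f \<odot> r"
      using ne(1-6) by (simp_all add: x_def)
    have "fam X {A, B, W} z x"
      unfolding fam_def using hom_Obj[OF rs(1)] hom_cmp[OF rs(1) f]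
      by (simp add: ne(7-12) xs Xs V rs Id_cmp[OF rs(1)] Id_cmp[OF rs(2)] Id_cmp[OF hom_cmp[OF rs(1) f]]
          flip: rs(3))
    from un[OF this] have "\<exists>!u. hom u z L \<and> \<pi> A \<odot> u = r \<and> \<pi> B \<odot> u = s \<and> \<pi> W \<odot> u = f \<odot> r"
      by (simp add: xs)
    then show ?thesis
      using p(3) by (metis cmp_assoc)
  qed
  then show ?thesis
    using p by metis
qed

lemma is_pullback_iff:
  "is_pullback K f g p q \<longleftrightarrow> (\<exists>a b c d. hom f a c \<and> hom g b c \<and> hom p d a \<and> hom q d b \<and> f \<odot> p = g \<odot> q \<and>
    (\<forall>z r s. hom r z a \<and> hom s z b \<and> f \<odot> r = g \<odot> s \<longrightarrow> (\<exists>!u. hom u z d \<and> p \<odot> u = r \<and> q \<odot> u = s)))"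
  (is "?L \<longleftrightarrow> ?R")
proof
  assume L: ?L
  let ?a = "Dom K f" and ?b = "Dom K g" and ?c = "Cod K f" and ?d = "Dom K p"
  have h: "hom f ?a ?c" "hom g ?b ?c" "hom p ?d ?a" "hom q ?d ?b" and sq: "f \<odot> p = g \<odot> q"
    using L unfolding is_pullback_def in_hom_def by (auto simp: cmp_def)
  have "\<exists>!u. hom u z ?d \<and> p \<odot> u = r \<and> q \<odot> u = s" if "hom r z ?a" "hom s z ?b" "f \<odot> r = g \<odot> s" for z r s
  proof -
    have "f \<cdot>\<^bsub>K\<^esub> r = g \<cdot>\<^bsub>K\<^esub> s" using that h cmp_eq_Comp by metis
    then have "\<exists>!u. hom u z ?d \<and> p \<cdot>\<^bsub>K\<^esub> u = r \<and> q \<cdot>\<^bsub>K\<^esub> u = s"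
      using L that unfolding is_pullback_def by blast
    then show ?thesis using cmp_eq_Comp h(3,4) by metis
  qed
  then show ?R using h sq by (intro exI[of _ ?a] exI[of _ ?b] exI[of _ ?c] exI[of _ ?d] conjI) simp_all
next
  assume ?R
  then obtain a b c d where h: "hom f a c" "hom g b c" "hom p d a" "hom q d b" and sq: "f \<odot> p = g \<odot> q"
    and u: "\<And>z r s. hom r z a \<Longrightarrow> hom s z b \<Longrightarrow> f \<odot> r = g \<odot> s \<Longrightarrow> (\<exists>!u. hom u z d \<and> p \<odot> u = r \<and> q \<odot> u = s)"
    by blast
  have "\<exists>!u. hom u z d \<and> p \<cdot>\<^bsub>K\<^esub> u = r \<and> q \<cdot>\<^bsub>K\<^esub> u = s" if "hom r z a" "hom s z b" "f \<cdot>\<^bsub>K\<^esub> r = g \<cdot>\<^bsub>K\<^esub> s" for z r s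
  proof -
    have "f \<odot> r = g \<odot> s" using that h cmp_eq_Comp by metis
    from u[OF that(1,2) this] show ?thesis using cmp_eq_Comp h(3,4) by metis
  qed
  moreover have "f \<cdot>\<^bsub>K\<^esub> p = g \<cdot>\<^bsub>K\<^esub> q" using sq h cmp_eq_Comp by metis
  ultimately show ?L
    using h unfolding is_pullback_def by (auto simp: in_hom_def)
qed

lemma is_coequalizer_iff:
  "is_coequalizer K x y f \<longleftrightarrow> (\<exists>a b c. hom x c a \<and> hom y c a \<and> hom f a b \<and> f \<odot> x = f \<odot> y \<and>
    (\<forall>z g. hom g a z \<and> g \<odot> x = g \<odot> y \<longrightarrow> (\<exists>!u. hom u b z \<and> u \<odot> f = g)))"
proof -
  have *: "(f \<cdot>\<^bsub>K\<^esub> x = f \<cdot>\<^bsub>K\<^esub> y \<and> (\<forall>z g. hom g a z \<and> g \<cdot>\<^bsub>K\<^esub> x = g \<cdot>\<^bsub>K\<^esub> y \<longrightarrow> (\<exists>!u. hom u b z \<and> u \<cdot>\<^bsub>K\<^esub> f = g))) \<longleftrightarrow>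
     (f \<odot> x = f \<odot> y \<and> (\<forall>z g. hom g a z \<and> g \<odot> x = g \<odot> y \<longrightarrow> (\<exists>!u. hom u b z \<and> u \<odot> f = g)))"
    if h: "hom x c a" "hom y c a" "hom f a b" for a b c
  proof -
    have 1: "f \<cdot>\<^bsub>K\<^esub> x = f \<odot> x" "f \<cdot>\<^bsub>K\<^esub> y = f \<odot> y" 
      using cmp_eq_Comp h by simp_all
    have 2: "hom g a z \<and> g \<cdot>\<^bsub>K\<^esub> x = g \<cdot>\<^bsub>K\<^esub> y \<longleftrightarrow> hom g a z \<and> g \<odot> x = g \<odot> y" for g z
      using cmp_eq_Comp[OF h(1), of g z] cmp_eq_Comp[OF h(2), of g z] by auto
    have 3: "hom u b z \<and> u \<cdot>\<^bsub>K\<^esub> f = g \<longleftrightarrow> hom u b z \<and> u \<odot> f = g" for u g z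
      using cmp_eq_Comp[OF h(3), of u z] by auto
    show ?thesis
      unfolding 1 2 3 ..
  qed
  show ?thesis
  proof
    assume L: "is_coequalizer K x y f"
    have h: "hom x (Dom K x) (Dom K f)" "hom y (Dom K x) (Dom K f)" "hom f (Dom K f) (Cod K f)"
      using L by (simp_all add: is_coequalizer_def in_hom_def)
    show "\<exists>a b c. hom x c a \<and> hom y c a \<and> hom f a b \<and> f \<odot> x = f \<odot> y \<and>
      (\<forall>z g. hom g a z \<and> g \<odot> x = g \<odot> y \<longrightarrow> (\<exists>!u. hom u b z \<and> u \<odot> f = g))"
      using *[OF h] L h unfolding is_coequalizer_def
      by (intro exI[of _ "Dom K f"] exI[of _ "Cod K f"] exI[of _ "Dom K x"]) simp
  next
    assume "\<exists>a b c. hom x c a \<and> hom y c a \<and> hom f a b \<and> f \<odot> x = f \<odot> y \<and>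
      (\<forall>z g. hom g a z \<and> g \<odot> x = g \<odot> y \<longrightarrow> (\<exists>!u. hom u b z \<and> u \<odot> f = g))"
    then obtain a b c where h: "hom x c a" "hom y c a" "hom f a b"
      and r: "f \<odot> x = f \<odot> y \<and> (\<forall>z g. hom g a z \<and> g \<odot> x = g \<odot> y \<longrightarrow> (\<exists>!u. hom u b z \<and> u \<odot> f = g))"
      by metis
    have "Dom K f = a" "Cod K f = b"
      using h by (simp_all add: in_hom_def)
    then show "is_coequalizer K x y f"
      using r[folded *[OF h]] h unfolding is_coequalizer_def in_hom_def by simp
  qed
qed

subsection \<open>Covers\<close>

text \<open>Covers are the maps along which generalised elements are lifted locally.\<close>

definition cover :: "'a \<Rightarrow> 'o \<Rightarrow> 'o \<Rightarrow> bool" where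
  "cover e z' z \<longleftrightarrow> hom e z' z \<and> e \<in> regular_epis K"

lemma cover_hom: "cover e z' z \<Longrightarrow> hom e z' z"
  by (simp add: cover_def)

text \<open>A regular epimorphism is the coequalizer of some pair, so it suffices that \<open>x\<close> identifies all pairs of
  elements that \<open>e\<close> identifies.\<close>

lemma cover_factor:
  assumes e: "cover e z' z" and x: "hom x z' b"
    and eq: "\<And>w u v. hom u w z' \<Longrightarrow> hom v w z' \<Longrightarrow> e \<odot> u = e \<odot> v \<Longrightarrow> x \<odot> u = x \<odot> v"
  shows "\<exists>!y. hom y z b \<and> y \<odot> e = x"
proof -
  obtain u v where "is_coequalizer K u v e"
    using e by (auto simp: cover_def regular_epis_def)
  then obtain a1 b1 c where h: "hom u c a1" "hom v c a1" "hom e a1 b1" "e \<odot> u = e \<odot> v"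
    and un: "\<And>z g. hom g a1 z \<Longrightarrow> g \<odot> u = g \<odot> v \<Longrightarrow> (\<exists>!y. hom y b1 z \<and> y \<odot> e = g)"
    unfolding is_coequalizer_iff by metis
  have "a1 = z'" "b1 = z"
    using h(3) cover_hom[OF e] by (simp_all add: in_hom_def)
  then show ?thesis
    using un[of x b] eq[OF _ _ h(4)] h(1,2) x by simp
qed

lemma cover_epi:
  assumes e: "cover e z' z" and a: "hom a z b" and a': "hom a' z b" and eq: "a \<odot> e = a' \<odot> e"
  shows "a = a'"
proof -
  have "\<exists>!y. hom y z b \<and> y \<odot> e = a \<odot> e"
  proof (rule cover_factor[OF e])
    show "hom (a \<odot> e) z' b" using a cover_hom[OF e] by (rule hom_cmp[rotated])
  qed simp
  then show ?thesis using a a' eq by metis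
qed

lemma cover_pullback:
  assumes e: "cover e z' z" and x: "hom x y z"
  shows "\<exists>w e' x'. cover e' w y \<and> hom x' w z' \<and> e \<odot> x' = x \<odot> e'"
proof -
  obtain d p q where pq: "hom p d y" "hom q d z'" "x \<odot> p = e \<odot> q"
    "\<forall>w r s. hom r w y \<and> hom s w z' \<and> x \<odot> r = e \<odot> s \<longrightarrow> (\<exists>!u. hom u w d \<and> p \<odot> u = r \<and> q \<odot> u = s)"
    using pullback[OF x cover_hom[OF e]] by (elim exE conjE)
  have "is_pullback K x e p q"
    unfolding is_pullback_iff
    by (intro exI[of _ y] exI[of _ z'] exI[of _ z] exI[of _ d] conjI x cover_hom[OF e] pq)
  then have "p \<in> regular_epis K"
    using regular e unfolding regular_category_def cover_def by meson
  then have "cover p d y"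
    using pq(1) by (simp add: cover_def)
  then show ?thesis
    using pq(2) pq(3)[symmetric] by (intro exI conjI)
qed

text \<open>In a regular category an arrow is a regular epimorphism as soon as every arrow that respects its
  kernel pair descends along it: by regularity the kernel pair has a coequalizer.\<close>

lemma regular_epiI:
  assumes f: "hom f a b"
    and desc: "\<And>w g. hom g a w \<Longrightarrow> (\<And>y u v. hom u y a \<Longrightarrow> hom v y a \<Longrightarrow> f \<odot> u = f \<odot> v \<Longrightarrow> g \<odot> u = g \<odot> v) \<Longrightarrow>
       \<exists>!h. hom h b w \<and> h \<odot> f = g"
  shows "cover f a b"
proof -
  obtain d p q where pq: "hom p d a" "hom q d a" "f \<odot> p = f \<odot> q"
    and un: "\<forall>z r s. hom r z a \<and> hom s z a \<and> f \<odot> r = f \<odot> s \<longrightarrow> (\<exists>!u. hom u z d \<and> p \<odot> u = r \<and> q \<odot> u = s)"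
    using pullback[OF f f] by (elim exE conjE)
  have "\<exists>!h. hom h b w \<and> h \<odot> f = g" if g: "hom g a w" and eq: "g \<odot> p = g \<odot> q" for g w
  proof (rule desc[OF g])
    fix y u v assume "hom u y a" "hom v y a" "f \<odot> u = f \<odot> v"
    then obtain t where "p \<odot> t = u" "q \<odot> t = v" using un by metis
    then show "g \<odot> u = g \<odot> v" using eq by (metis cmp_assoc)
  qed
  then have "is_coequalizer K p q f"
    unfolding is_coequalizer_iff using f pq by (intro exI[of _ a] exI[of _ b] exI[of _ d]) simp
  then show ?thesis
    using f by (auto simp: cover_def regular_epis_def)
qed

lemma cover_Id: "z \<in> Obj K \<Longrightarrow> cover (Id K z) z z"
  by (rule regular_epiI[OF hom_Id]) (simp, metis cmp_Id)

text \<open>A morphism compatible with the composite descends along \<open>e'\<close>. The descended morphism is compatible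
  with \<open>e\<close> because elements lift locally along \<open>e'\<close> by stability of regular epimorphisms under pullback.\<close>

lemma cover_comp:
  assumes e: "cover e z' z" and e': "cover e' z'' z'"
  shows "cover (e \<odot> e') z'' z"
proof (rule regular_epiI)
  show h: "hom (e \<odot> e') z'' z" using e e' by (meson cover_hom hom_cmp)
  fix w g assume g: "hom g z'' w"
    and resp: "\<And>y u v. hom u y z'' \<Longrightarrow> hom v y z'' \<Longrightarrow> (e \<odot> e') \<odot> u = (e \<odot> e') \<odot> v \<Longrightarrow> g \<odot> u = g \<odot> v"
  have "\<exists>!h. hom h z' w \<and> h \<odot> e' = g"
  proof (rule cover_factor[OF e' g])
    fix y u v assume "hom u y z''" "hom v y z''" "e' \<odot> u = e' \<odot> v"
    then show "g \<odot> u = g \<odot> v" by (intro resp) simp_all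
  qed
  then obtain k where k: "hom k z' w" "k \<odot> e' = g" by auto
  have "\<exists>!h. hom h z w \<and> h \<odot> e = k"
  proof (rule cover_factor[OF e k(1)])
    fix y u v assume uv: "hom u y z'" "hom v y z'" "e \<odot> u = e \<odot> v"
    obtain y1 c1 u1 where 1: "cover c1 y1 y" "hom u1 y1 z''" "e' \<odot> u1 = u \<odot> c1"
      using cover_pullback[OF e' uv(1)] by (elim exE conjE)
    have "hom (v \<odot> c1) y1 z'" using 1 uv by (meson cover_hom hom_cmp)
    then obtain y2 c2 v2 where 2: "cover c2 y2 y1" "hom v2 y2 z''" "e' \<odot> v2 = (v \<odot> c1) \<odot> c2"
      using cover_pullback[OF e'] by meson
    have c: "hom (u1 \<odot> c2) y2 z''" using 1 2 by (meson cover_hom hom_cmp)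
    have "e \<odot> (e' \<odot> (u1 \<odot> c2)) = e \<odot> u \<odot> c1 \<odot> c2" using 1(3) by (metis cmp_assoc)
    also have "\<dots> = e \<odot> (e' \<odot> v2)" using uv(3) 2(3) by (metis cmp_assoc)
    finally have "g \<odot> (u1 \<odot> c2) = g \<odot> v2" using resp[OF c 2(2)] by simp
    then have "(k \<odot> u \<odot> c1) \<odot> c2 = (k \<odot> v \<odot> c1) \<odot> c2"
      using 1(3) 2(3) k(2) by (metis cmp_assoc)
    moreover have "hom (k \<odot> u \<odot> c1) y1 w" "hom (k \<odot> v \<odot> c1) y1 w"
      using k uv 1 by (meson cover_hom hom_cmp)+
    ultimately have "(k \<odot> u) \<odot> c1 = (k \<odot> v) \<odot> c1" using cover_epi[OF 2(1)] by simp
    then show "k \<odot> u = k \<odot> v" using cover_epi[OF 1(1)] k uv by (meson hom_cmp)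
  qed
  then obtain h where h: "hom h z w" "h \<odot> e = k" by auto
  show "\<exists>!h. hom h z w \<and> h \<odot> (e \<odot> e') = g"
  proof (intro ex1I[of _ h] conjI)
    show "h \<odot> (e \<odot> e') = g" using h k by (metis cmp_assoc)
    fix h' assume h': "hom h' z w \<and> h' \<odot> (e \<odot> e') = g"
    then have "(h' \<odot> e) \<odot> e' = k \<odot> e'" using k by simp
    then have "h' \<odot> e = k" using cover_epi[OF e'] h' k cover_hom[OF e] by (meson hom_cmp)
    then show "h' = h" using cover_epi[OF e] h h' by metis
  qed (rule h)
qed

text \<open>This is the sense in which a map that is surjective locally on elements is a regular epimorphism.\<close>

lemma coverI_local:
  assumes f: "hom f a b" and x: "hom x z a" and e: "cover (f \<odot> x) z b"
  shows "cover f a b"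
proof (rule regular_epiI[OF f])
  fix w g assume g: "hom g a w"
    and resp: "\<And>y u v. hom u y a \<Longrightarrow> hom v y a \<Longrightarrow> f \<odot> u = f \<odot> v \<Longrightarrow> g \<odot> u = g \<odot> v"
  have "\<exists>!h. hom h b w \<and> h \<odot> (f \<odot> x) = g \<odot> x"
  proof (rule cover_factor[OF e])
    show "hom (g \<odot> x) z w" using g x by (meson hom_cmp)
    fix y u v assume "hom u y z" "hom v y z" "(f \<odot> x) \<odot> u = (f \<odot> x) \<odot> v"
    then show "(g \<odot> x) \<odot> u = (g \<odot> x) \<odot> v" using resp[of "x \<odot> u" y "x \<odot> v"] x by (auto intro: hom_cmp)
  qed
  then obtain h where h: "hom h b w" "h \<odot> (f \<odot> x) = g \<odot> x" by auto
  have "h \<odot> f = g"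
  proof -
    obtain y c s where c: "cover c y a" "hom s y z" "(f \<odot> x) \<odot> s = f \<odot> c"
      using cover_pullback[OF e f] by (elim exE conjE)
    have "g \<odot> c = g \<odot> (x \<odot> s)" using resp[of c y "x \<odot> s"] c x cover_hom by (auto intro: hom_cmp)
    also have "\<dots> = (h \<odot> f) \<odot> c" using h(2) c(3) by (metis cmp_assoc)
    finally show ?thesis using cover_epi[OF c(1), of "h \<odot> f" w g] g h(1) f hom_cmp by simp
  qed
  moreover have "h' = h" if "hom h' b w" "h' \<odot> f = g" for h'
  proof -
    have "h' \<odot> (f \<odot> x) = h \<odot> (f \<odot> x)" using that h by (metis cmp_assoc)
    then show ?thesis using cover_epi[OF e that(1) h(1)] by blast
  qed
  ultimately show "\<exists>!h. hom h b w \<and> h \<odot> f = g" using h by blast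
qed

section \<open>Maps of diagrams with local lifting\<close>

definition nat_tr :: "nat set set \<Rightarrow> (nat set \<Rightarrow> nat set \<Rightarrow> 'a) \<Rightarrow> (nat set \<Rightarrow> nat set \<Rightarrow> 'a) \<Rightarrow> (nat set \<Rightarrow> 'a) \<Rightarrow> bool" where
  "nat_tr P X Y f \<longleftrightarrow> (\<forall>S\<in>P. hom (f S) (V X S) (V Y S)) \<and>
     (\<forall>S\<in>P. \<forall>T\<in>P. S \<subseteq> T \<longrightarrow> Y S T \<odot> f S = f T \<odot> X S T)"

lemma nat_hom: "nat_tr P X Y f \<Longrightarrow> S \<in> P \<Longrightarrow> hom (f S) (V X S) (V Y S)"
  and nat_sq: "nat_tr P X Y f \<Longrightarrow> S \<in> P \<Longrightarrow> T \<in> P \<Longrightarrow> S \<subseteq> T \<Longrightarrow> Y S T \<odot> f S = f T \<odot> X S T"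
  by (auto simp: nat_tr_def)

lemma nat_sq': "nat_tr P X Y f \<Longrightarrow> S \<in> P \<Longrightarrow> T \<in> P \<Longrightarrow> S \<subseteq> T \<Longrightarrow> Y S T \<odot> f S \<odot> x = f T \<odot> X S T \<odot> x"
  by (metis cmp_assoc nat_sq)

lemma nat_mono: "nat_tr P X Y f \<Longrightarrow> Q \<subseteq> P \<Longrightarrow> nat_tr Q X Y f"
  unfolding nat_tr_def by (simp add: subset_iff)

lemma nat_comp: "nat_tr P X Y f \<Longrightarrow> nat_tr P Y Z g \<Longrightarrow> nat_tr P X Z (\<lambda>S. g S \<odot> f S)"
  unfolding nat_tr_def by (meson hom_cmp cmp_assoc) (metis cmp_assoc)

lemma nat_Id: "diag P X \<Longrightarrow> nat_tr P X X (\<lambda>S. Id K (V X S))"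
  unfolding nat_tr_def by (auto simp: diag_Obj hom_Id dest: diag_hom)

definition above :: "nat set set \<Rightarrow> nat set \<Rightarrow> nat set set" where
  "above P S = {T \<in> P. S \<subset> T}"

lemma above_in: "T \<in> above P S \<Longrightarrow> T \<in> P \<and> S \<subseteq> T"
  by (auto simp: above_def)

text \<open>The data \<open>match\<close> of a lifting problem at the vertex \<open>S\<close> are an element \<open>y\<close> of the codomain and compatible
  elements of the domain at all vertices strictly above \<open>S\<close>. In \<open>sol\<close> the problem is solved after
  restriction along \<open>e\<close>. The condition \<open>lifts\<close> says that the map from \<open>X S\<close> to the limit of these
  data is a regular epimorphism, and \<open>ulifts\<close> that it is an isomorphism, both without forming the limit.\<close>

definition match where
  "match P X Y f S z x y \<longleftrightarrow> fam X (above P S) z x \<and> hom y z (V Y S) \<and>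
     (\<forall>T\<in>above P S. f T \<odot> x T = Y S T \<odot> y)"

definition sol where
  "sol P X Y f S z x y e x' \<longleftrightarrow> hom x' z (V X S) \<and> f S \<odot> x' = y \<odot> e \<and>
     (\<forall>T\<in>above P S. X S T \<odot> x' = x T \<odot> e)"

definition lifts where
  "lifts P X Y f S \<longleftrightarrow> (\<forall>z x y. match P X Y f S z x y \<longrightarrow>
     (\<exists>z' e x'. cover e z' z \<and> sol P X Y f S z' x y e x'))"

definition ulifts where
  "ulifts P X Y f S \<longleftrightarrow> (\<forall>z x y. match P X Y f S z x y \<longrightarrow> (\<exists>!x'. sol P X Y f S z x y (Id K z) x'))"

lemma matchI:
  assumes "fam X (above P S) z x" "hom y z (V Y S)" "\<And>T. T \<in> above P S \<Longrightarrow> f T \<odot> x T = Y S T \<odot> y"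
  shows "match P X Y f S z x y"
  using assms by (simp add: match_def)

lemma match_fam: "match P X Y f S z x y \<Longrightarrow> fam X (above P S) z x"
  and match_hom: "match P X Y f S z x y \<Longrightarrow> hom y z (V Y S)"
  and match_eq: "match P X Y f S z x y \<Longrightarrow> T \<in> above P S \<Longrightarrow> f T \<odot> x T = Y S T \<odot> y"
  and match_Obj: "match P X Y f S z x y \<Longrightarrow> z \<in> Obj K"
  by (auto simp: match_def fam_def)

lemma solI:
  assumes "hom x' z (V X S)" "f S \<odot> x' = y \<odot> e" "\<And>T. T \<in> above P S \<Longrightarrow> X S T \<odot> x' = x T \<odot> e"
  shows "sol P X Y f S z x y e x'"
  using assms by (simp add: sol_def)

lemma sol_hom: "sol P X Y f S z x y e x' \<Longrightarrow> hom x' z (V X S)"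
  and sol_eq: "sol P X Y f S z x y e x' \<Longrightarrow> f S \<odot> x' = y \<odot> e"
  and sol_fam: "sol P X Y f S z x y e x' \<Longrightarrow> T \<in> above P S \<Longrightarrow> X S T \<odot> x' = x T \<odot> e"
  by (auto simp: sol_def)

lemma liftsE:
  assumes "lifts P X Y f S" and "match P X Y f S z x y"
  obtains z' e x' where "cover e z' z" "sol P X Y f S z' x y e x'"
  using assms unfolding lifts_def by meson

lemma ulifts_iff:
  "ulifts P X Y f S \<longleftrightarrow> (\<forall>z x y. match P X Y f S z x y \<longrightarrow>
     (\<exists>!x'. hom x' z (V X S) \<and> f S \<odot> x' = y \<and> (\<forall>T\<in>above P S. X S T \<odot> x' = x T)))"
proof -
  have "sol P X Y f S z x y (Id K z) x' \<longleftrightarrow>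
      hom x' z (V X S) \<and> f S \<odot> x' = y \<and> (\<forall>T\<in>above P S. X S T \<odot> x' = x T)"
    if "match P X Y f S z x y" for z x y x'
    using cmp_Id[OF match_hom[OF that]] cmp_Id[OF fam_hom[OF match_fam[OF that]]]
    by (simp add: sol_def)
  then have "sol P X Y f S z x y (Id K z) =
      (\<lambda>x'. hom x' z (V X S) \<and> f S \<odot> x' = y \<and> (\<forall>T\<in>above P S. X S T \<odot> x' = x T))"
    if "match P X Y f S z x y" for z x y
    using that by (intro ext) blast
  then show ?thesis
    unfolding ulifts_def by (simp cong: imp_cong)
qed

lemma ulifts_ex:
  assumes "ulifts P X Y f S" and "match P X Y f S z x y"
  shows "\<exists>!x'. hom x' z (V X S) \<and> f S \<odot> x' = y \<and> (\<forall>T\<in>above P S. X S T \<odot> x' = x T)"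
  using assms(1)[unfolded ulifts_iff, rule_format, OF assms(2)] .

lemma ulifts_lifts: "ulifts P X Y f S \<Longrightarrow> lifts P X Y f S"
  unfolding lifts_def ulifts_def by (metis cover_Id match_Obj)

text \<open>Lifting problems are compared through their data and solutions, for instance after reindexing a diagram or
  after splitting off one direction.\<close>

lemma lifting_transfer:
  assumes corr: "\<And>z x y. match P X Y f S z x y \<Longrightarrow> \<exists>x2 y2. match P2 X2 Y2 f2 S2 z x2 y2 \<and>
     (\<forall>z' e x'. hom e z' z \<longrightarrow> (sol P2 X2 Y2 f2 S2 z' x2 y2 e x' \<longleftrightarrow> sol P X Y f S z' x y e x'))"
  shows "lifts P2 X2 Y2 f2 S2 \<Longrightarrow> lifts P X Y f S"
    and "ulifts P2 X2 Y2 f2 S2 \<Longrightarrow> ulifts P X Y f S"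
proof -
  show "lifts P X Y f S" if L: "lifts P2 X2 Y2 f2 S2"
    unfolding lifts_def
  proof (intro allI impI)
    fix z x y assume "match P X Y f S z x y"
    then obtain x2 y2 where m2: "match P2 X2 Y2 f2 S2 z x2 y2" and
      s: "\<forall>z' e x'. hom e z' z \<longrightarrow> (sol P2 X2 Y2 f2 S2 z' x2 y2 e x' \<longleftrightarrow> sol P X Y f S z' x y e x')"
      using corr by meson
    obtain z' e x' where "cover e z' z" "sol P2 X2 Y2 f2 S2 z' x2 y2 e x'"
      by (rule liftsE[OF L m2])
    then show "\<exists>z' e x'. cover e z' z \<and> sol P X Y f S z' x y e x'"
      using s cover_hom by meson
  qed
  show "ulifts P X Y f S" if L: "ulifts P2 X2 Y2 f2 S2"
    unfolding ulifts_def
  proof (intro allI impI)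
    fix z x y assume m: "match P X Y f S z x y"
    then obtain x2 y2 where m2: "match P2 X2 Y2 f2 S2 z x2 y2" and
      s: "\<forall>z' e x'. hom e z' z \<longrightarrow> (sol P2 X2 Y2 f2 S2 z' x2 y2 e x' \<longleftrightarrow> sol P X Y f S z' x y e x')"
      using corr by meson
    have "sol P2 X2 Y2 f2 S2 z x2 y2 (Id K z) = sol P X Y f S z x y (Id K z)"
      using s hom_Id[OF match_Obj[OF m]] by (intro ext) simp
    then show "\<exists>!x'. sol P X Y f S z x y (Id K z) x'"
      using L m2 unfolding ulifts_def by metis
  qed
qed

text \<open>Between cubes that are extensions, these are the maps that are extensions one dimension higher.\<close>

definition emap where
  "emap P X Y f \<longleftrightarrow> diag P X \<and> diag P Y \<and> nat_tr P X Y f \<and> (\<forall>S\<in>P. lifts P X Y f S)"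

lemma emapI: "diag P X \<Longrightarrow> diag P Y \<Longrightarrow> nat_tr P X Y f \<Longrightarrow> (\<And>S. S \<in> P \<Longrightarrow> lifts P X Y f S) \<Longrightarrow> emap P X Y f"
  by (simp add: emap_def)

lemma emap_dom: "emap P X Y f \<Longrightarrow> diag P X"
  and emap_cod: "emap P X Y f \<Longrightarrow> diag P Y"
  and emap_nat: "emap P X Y f \<Longrightarrow> nat_tr P X Y f"
  and emap_lifts: "emap P X Y f \<Longrightarrow> S \<in> P \<Longrightarrow> lifts P X Y f S"
  by (auto simp: emap_def)

text \<open>Diagrams are functions on all pairs of sets, so agreement on the indexing poset takes the place of
  equality.\<close>

definition agree :: "nat set set \<Rightarrow> (nat set \<Rightarrow> nat set \<Rightarrow> 'a) \<Rightarrow> (nat set \<Rightarrow> nat set \<Rightarrow> 'a) \<Rightarrow> bool" where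
  "agree P X X' \<longleftrightarrow> (\<forall>S\<in>P. \<forall>T\<in>P. S \<subseteq> T \<longrightarrow> X S T = X' S T)"

lemma agree_sym: "agree P X X' \<Longrightarrow> agree P X' X"
  by (simp add: agree_def)

lemma agree_refl [simp]: "agree P X X"
  by (simp add: agree_def)

lemma agree_V: "agree P X X' \<Longrightarrow> S \<in> P \<Longrightarrow> V X S = V X' S"
  by (simp add: agree_def V_def)

lemma agree_diag: "agree P X X' \<Longrightarrow> diag P X \<Longrightarrow> diag P X'"
  unfolding diag_def using agree_V[of P X X'] unfolding agree_def by (smt (verit) order_refl order_trans)

lemma agree_nat: "agree P X X' \<Longrightarrow> agree P Y Y' \<Longrightarrow> (\<And>S. S \<in> P \<Longrightarrow> f S = f' S) \<Longrightarrow> nat_tr P X Y f \<Longrightarrow> nat_tr P X' Y' f'"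
  unfolding nat_tr_def using agree_V[of P X X'] agree_V[of P Y Y'] unfolding agree_def by simp

lemma agree_fam: "agree P X X' \<Longrightarrow> U \<subseteq> P \<Longrightarrow> fam X U z x \<longleftrightarrow> fam X' U z x"
  unfolding fam_def using agree_V[of P X X'] unfolding agree_def by (simp add: subset_iff)

lemma agree_lifting:
  assumes X: "agree P X X'" and Y: "agree P Y Y'" and f: "\<And>S. S \<in> P \<Longrightarrow> f S = f' S" and S: "S \<in> P"
  shows "lifts P X Y f S \<longleftrightarrow> lifts P X' Y' f' S" "ulifts P X Y f S \<longleftrightarrow> ulifts P X' Y' f' S"
proof -
  have a: "above P S \<subseteq> P" "\<And>T. T \<in> above P S \<Longrightarrow> T \<in> P \<and> S \<subseteq> T"
    by (auto simp: above_def)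
  have "match P X Y f S = match P X' Y' f' S"
    using agree_fam[OF X a(1)] agree_V[OF Y S] f a(2) Y S
    by (intro ext) (simp add: match_def agree_def cong: ball_cong)
  moreover have "sol P X Y f S = sol P X' Y' f' S"
    using agree_V[OF X S] f a(2) X S
    by (intro ext) (simp add: sol_def agree_def cong: ball_cong)
  ultimately show "lifts P X Y f S \<longleftrightarrow> lifts P X' Y' f' S" "ulifts P X Y f S \<longleftrightarrow> ulifts P X' Y' f' S"
    by (simp_all add: lifts_def ulifts_def)
qed

lemma agree_emap:
  assumes "agree P X X'" "agree P Y Y'" "\<And>S. S \<in> P \<Longrightarrow> f S = f' S" "emap P X Y f"
  shows "emap P X' Y' f'"
proof (rule emapI)
  show "diag P X'" using agree_diag[OF assms(1) emap_dom[OF assms(4)]] .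
  show "diag P Y'" using agree_diag[OF assms(2) emap_cod[OF assms(4)]] .
  show "nat_tr P X' Y' f'" using agree_nat[OF assms(1-3) emap_nat[OF assms(4)]] .
  show "lifts P X' Y' f' S" if "S \<in> P" for S
    using agree_lifting(1)[OF assms(1-3) that] emap_lifts[OF assms(4) that] by simp
qed

text \<open>Local lifts can be constructed one vertex at a time, from the top of the diagram downwards; so a
  partial lift over an up-closed part extends locally to a larger up-closed part.\<close>

lemma extend_lift:
  assumes fin: "finite P" and X: "diag P X" and f: "nat_tr P X Y f"
    and U: "U \<subseteq> P" "\<And>S T. S \<in> U \<Longrightarrow> T \<in> P \<Longrightarrow> S \<subseteq> T \<Longrightarrow> T \<in> U"
    and W: "W \<subseteq> U" "\<And>S T. S \<in> W \<Longrightarrow> T \<in> P \<Longrightarrow> S \<subseteq> T \<Longrightarrow> T \<in> W"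
    and l: "\<And>S. S \<in> U - W \<Longrightarrow> lifts P X Y f S"
    and x: "fam X W z x" and y: "fam Y U z y" and eq: "\<And>S. S \<in> W \<Longrightarrow> f S \<odot> x S = y S"
  shows "\<exists>z' e x'. cover e z' z \<and> fam X U z' x' \<and> (\<forall>S\<in>U. f S \<odot> x' S = y S \<odot> e) \<and> (\<forall>S\<in>W. x' S = x S \<odot> e)"
  using W l x y eq
proof (induction "card (U - W)" arbitrary: W z x y)
  case 0
  have "finite U" using fin U(1) finite_subset by blast
  then have WU: "W = U" using 0 by auto
  have z: "z \<in> Obj K" using fam_Obj 0 by blast
  have "x S = x S \<odot> Id K z" if "S \<in> W" for S
    using cmp_Id fam_hom[OF 0(5) that] by simp
  moreover have "y S = y S \<odot> Id K z" if "S \<in> W" for S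
    using cmp_Id[OF fam_hom[OF 0(6)]] that WU by simp
  ultimately show ?case
    using 0 WU cover_Id[OF z] by (intro exI[of _ z] exI[of _ "Id K z"] exI[of _ x]) simp
next
  case (Suc n)
  have finU: "finite U" using fin U(1) finite_subset by blast
  then have ne: "finite (U - W)" "U - W \<noteq> {}" using Suc(2) by (simp, metis card.empty Suc_neq_Zero)
  \<comment> \<open>At a maximal missing vertex everything strictly above it is already there.\<close>
  then obtain S where S: "S \<in> U - W" and max: "\<And>T. T \<in> U - W \<Longrightarrow> S \<subseteq> T \<Longrightarrow> T = S"
    using finite_has_maximal[OF ne] by metis
  have SP: "S \<in> P" using S U(1) by auto
  have ab: "above P S \<subseteq> W"
  proof
    fix T assume T: "T \<in> above P S"
    then have "T \<in> U" using U(2)[of S T] S by (auto simp: above_def)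
    then show "T \<in> W" using max[of T] T by (auto simp: above_def)
  qed
  have "match P X Y f S z x (y S)"
  proof (rule matchI)
    show "fam X (above P S) z x" using Suc(6) ab fam_mono by metis
    show "hom (y S) z (V Y S)" using fam_hom[OF Suc(7)] S by simp
    fix T assume T: "T \<in> above P S"
    then have "T \<in> W" "S \<subseteq> T" "S \<in> U" "T \<in> U"
      using ab S Suc(3) by (auto simp: above_def)
    then show "f T \<odot> x T = Y S T \<odot> y S"
      using Suc(8)[of T] fam_comp[OF Suc(7), of S T] by simp
  qed
  then obtain z1 e1 s where e1: "cover e1 z1 z" and s: "sol P X Y f S z1 x (y S) e1 s"
    using Suc(5)[OF S] by (elim liftsE)
  note e1h = cover_hom[OF e1]
  let ?W = "insert S W"
  let ?x = "\<lambda>T. if T = S then s else x T \<odot> e1"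
  let ?y = "\<lambda>T. y T \<odot> e1"
  have SW: "S \<notin> W" using S by simp
  have x1: "fam X W z1 (\<lambda>T. x T \<odot> e1)" using fam_restrict[OF Suc(6) e1h] .
  have fam1: "fam X ?W z1 ?x"
    unfolding fam_def
  proof (intro conjI ballI impI)
    show "z1 \<in> Obj K" using fam_Obj[OF x1] .
    show "hom (?x T) z1 (V X T)" if "T \<in> ?W" for T
      using that fam_hom[OF x1] sol_hom[OF s] by auto
    fix T T' assume T: "T \<in> ?W" "T' \<in> ?W" "T \<subseteq> T'"
    show "X T T' \<odot> ?x T = ?x T'"
    proof (cases "T = S")
      case True
      show ?thesis
      proof (cases "T' = S")
        case True
        then show ?thesis using \<open>T = S\<close> diag_refl[OF X SP] Id_cmp[OF sol_hom[OF s]] by simp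
      next
        case False
        then have "T' \<in> above P S" using T True U(1) Suc(3) by (auto simp: above_def)
        then show ?thesis using sol_fam[OF s] True False by simp
      qed
    next
      case False
      then have "T \<in> W" using T by simp
      then have "T' \<in> W" using Suc(4)[of T T'] T U(1) Suc(3) SP by auto
      then show ?thesis using fam_comp[OF x1 \<open>T \<in> W\<close> _ T(3)] False SW by auto
    qed
  qed
  have "\<exists>z' e x'. cover e z' z1 \<and> fam X U z' x' \<and> (\<forall>T\<in>U. f T \<odot> x' T = ?y T \<odot> e) \<and>
      (\<forall>T\<in>?W. x' T = ?x T \<odot> e)"
  proof (rule Suc(1)[of ?W z1 ?x ?y])
    have "U - ?W = (U - W) - {S}" by auto
    then show "n = card (U - ?W)" using Suc(2) S ne by simp
    show "?W \<subseteq> U" using Suc(3) S by auto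
    show "T' \<in> ?W" if "T \<in> ?W" "T' \<in> P" "T \<subseteq> T'" for T T'
    proof (cases "T = S")
      case True
      then show ?thesis using ab that by (cases "T' = S") (auto simp: above_def)
    next
      case False
      then show ?thesis using Suc(4)[of T T'] that by simp
    qed
    show "lifts P X Y f T" if "T \<in> U - ?W" for T
      using Suc(5) that by simp
    show "fam X ?W z1 ?x" by (rule fam1)
    show "fam Y U z1 ?y" using fam_restrict[OF Suc(7) e1h] .
    show "f T \<odot> ?x T = ?y T" if "T \<in> ?W" for T
      using that sol_eq[OF s] Suc(8)[of T] SW by (auto simp flip: cmp_assoc)
  qed
  then obtain z2 e2 x2 where 2: "cover e2 z2 z1" "fam X U z2 x2"
    "\<forall>T\<in>U. f T \<odot> x2 T = ?y T \<odot> e2" "\<forall>T\<in>?W. x2 T = ?x T \<odot> e2"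
    by (elim exE conjE)
  have "x2 T = x T \<odot> e1 \<odot> e2" if "T \<in> W" for T
    using 2(4) that SW by auto
  then show ?case
    using cover_comp[OF e1 2(1)] 2 by (intro exI[of _ z2] exI[of _ "e1 \<odot> e2"] exI[of _ x2]) simp
qed

definition upset :: "nat set set \<Rightarrow> nat set set \<Rightarrow> bool" where
  "upset P U \<longleftrightarrow> U \<subseteq> P \<and> (\<forall>S\<in>U. \<forall>T\<in>P. S \<subseteq> T \<longrightarrow> T \<in> U)"

lemma upset_above: "upset P (above P S)"
  by (auto simp: upset_def above_def)

lemma lift_family:
  assumes fin: "finite P" and f: "emap P X Y f" and up: "upset P U" and y: "fam Y U z y"
  obtains z' e x where "cover e z' z" "fam X U z' x" "\<And>S. S \<in> U \<Longrightarrow> f S \<odot> x S = y S \<odot> e"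
proof -
  have U: "U \<subseteq> P" "\<And>S T. S \<in> U \<Longrightarrow> T \<in> P \<Longrightarrow> S \<subseteq> T \<Longrightarrow> T \<in> U"
    using up by (auto simp: upset_def)
  have 0: "fam X {} z (\<lambda>_. null)" using fam_Obj[OF y] by (simp add: fam_def)
  have "\<exists>z' e x'. cover e z' z \<and> fam X U z' x' \<and> (\<forall>S\<in>U. f S \<odot> x' S = y S \<odot> e) \<and> (\<forall>S\<in>{}. x' S = null \<odot> e)"
    by (rule extend_lift[OF fin emap_dom[OF f] emap_nat[OF f] U _ _ _ 0 y]) (use emap_lifts[OF f] U(1) in auto)
  then show thesis using that by auto
qed

text \<open>Pushed forward to all vertices above \<open>S\<close>, an element becomes a family on an up-closed set.\<close>

lemma lift_element:
  assumes fin: "finite P" and f: "emap P X Y f" and S: "S \<in> P" and y: "hom y z (V Y S)"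
  obtains z' e x where "cover e z' z" "hom x z' (V X S)" "f S \<odot> x = y \<odot> e"
proof -
  let ?U = "{T \<in> P. S \<subseteq> T}"
  have upU: "upset P ?U" by (auto simp: upset_def)
  have Y: "diag P Y" using emap_cod[OF f] .
  have yf: "fam Y ?U z (\<lambda>T. Y S T \<odot> y)"
    unfolding fam_def
    using hom_Obj[OF y] hom_cmp[OF y diag_hom[OF Y S]] diag_comp[OF Y S] by (auto simp flip: cmp_assoc)
  obtain z' e x where "cover e z' z" "fam X ?U z' x" "\<And>T. T \<in> ?U \<Longrightarrow> f T \<odot> x T = (Y S T \<odot> y) \<odot> e"
    using lift_family[OF fin f upU yf] by metis
  moreover have "S \<in> ?U" using S by simp
  moreover have "Y S S \<odot> y = y" using diag_refl[OF Y S] Id_cmp[OF y] by simp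
  ultimately show thesis using that[of e z' "x S"] fam_hom by metis
qed

lemma emap_cover:
  assumes fin: "finite P" and f: "emap P X Y f" and S: "S \<in> P"
  shows "cover (f S) (V X S) (V Y S)"
proof -
  have y: "hom (Id K (V Y S)) (V Y S) (V Y S)" using hom_Id diag_Obj[OF emap_cod[OF f] S] .
  obtain z e x where "cover e z (V Y S)" "hom x z (V X S)" "f S \<odot> x = Id K (V Y S) \<odot> e"
    by (rule lift_element[OF fin f S y])
  then show ?thesis
    using coverI_local[OF nat_hom[OF emap_nat[OF f] S], of x z] Id_cmp[OF cover_hom] by simp
qed

section \<open>Composition and cancellation of maps with local lifting\<close>

lemma lifts_comp:
  assumes f: "nat_tr P X Y f" and g: "nat_tr P Y Z g" and S: "S \<in> P"
    and lf: "lifts P X Y f S" and lg: "lifts P Y Z g S"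
  shows "lifts P X Z (\<lambda>T. g T \<odot> f T) S"
  unfolding lifts_def
proof (intro allI impI)
  fix z x w assume m: "match P X Z (\<lambda>T. g T \<odot> f T) S z x w"
  note mx = match_fam[OF m]
  have "fam Y (above P S) z (\<lambda>T. f T \<odot> x T)"
    unfolding fam_def
  proof (intro conjI ballI impI)
    show "z \<in> Obj K" using match_Obj[OF m] .
    show "hom (f T \<odot> x T) z (V Y T)" if "T \<in> above P S" for T
      using hom_cmp[OF fam_hom[OF mx that] nat_hom[OF f]] above_in[OF that] by simp
    show "Y T T' \<odot> f T \<odot> x T = f T' \<odot> x T'" if "T \<in> above P S" "T' \<in> above P S" "T \<subseteq> T'" for T T'
      using nat_sq'[OF f, of T T'] fam_comp[OF mx that] above_in that by simp
  qed
  then have "match P Y Z g S z (\<lambda>T. f T \<odot> x T) w"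
    using match_hom[OF m] match_eq[OF m] by (intro matchI) auto
  then obtain z1 e1 y where 1: "cover e1 z1 z" "sol P Y Z g S z1 (\<lambda>T. f T \<odot> x T) w e1 y"
    by (rule liftsE[OF lg])
  have "match P X Y f S z1 (\<lambda>T. x T \<odot> e1) y"
    using fam_restrict[OF mx cover_hom[OF 1(1)]] sol_hom[OF 1(2)] sol_fam[OF 1(2)] by (intro matchI) auto
  then obtain z2 e2 x' where 2: "cover e2 z2 z1" "sol P X Y f S z2 (\<lambda>T. x T \<odot> e1) y e2 x'"
    by (rule liftsE[OF lf])
  have "g S \<odot> f S \<odot> x' = w \<odot> e1 \<odot> e2"
    using sol_eq[OF 2(2)] sol_eq[OF 1(2)] by (metis cmp_assoc)
  then have "sol P X Z (\<lambda>T. g T \<odot> f T) S z2 x w (e1 \<odot> e2) x'"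
    using sol_hom[OF 2(2)] sol_fam[OF 2(2)] by (intro solI) auto
  then show "\<exists>z' e x'. cover e z' z \<and> sol P X Z (\<lambda>T. g T \<odot> f T) S z' x w e x'"
    using cover_comp[OF 1(1) 2(1)] by meson
qed

lemma ulifts_comp:
  assumes f: "nat_tr P X Y f" and g: "nat_tr P Y Z g" and S: "S \<in> P"
    and lf: "ulifts P X Y f S" and lg: "ulifts P Y Z g S"
  shows "ulifts P X Z (\<lambda>T. g T \<odot> f T) S"
  unfolding ulifts_iff
proof (intro allI impI)
  fix z x w assume m: "match P X Z (\<lambda>T. g T \<odot> f T) S z x w"
  note mx = match_fam[OF m]
  have "fam Y (above P S) z (\<lambda>T. f T \<odot> x T)"
    unfolding fam_def
  proof (intro conjI ballI impI)
    show "z \<in> Obj K" using match_Obj[OF m] .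
    show "hom (f T \<odot> x T) z (V Y T)" if "T \<in> above P S" for T
      using hom_cmp[OF fam_hom[OF mx that] nat_hom[OF f]] above_in[OF that] by simp
    show "Y T T' \<odot> f T \<odot> x T = f T' \<odot> x T'" if "T \<in> above P S" "T' \<in> above P S" "T \<subseteq> T'" for T T'
      using nat_sq'[OF f, of T T'] fam_comp[OF mx that] above_in that by simp
  qed
  then have "match P Y Z g S z (\<lambda>T. f T \<odot> x T) w"
    using match_hom[OF m] match_eq[OF m] by (intro matchI) auto
  from ulifts_ex[OF lg this] obtain y where y: "hom y z (V Y S)" "g S \<odot> y = w" "\<forall>T\<in>above P S. Y S T \<odot> y = f T \<odot> x T"
    and yu: "\<And>y'. hom y' z (V Y S) \<Longrightarrow> g S \<odot> y' = w \<Longrightarrow> \<forall>T\<in>above P S. Y S T \<odot> y' = f T \<odot> x T \<Longrightarrow> y' = y"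
    by metis
  have "match P X Y f S z x y"
    using mx y by (intro matchI) auto
  from ulifts_ex[OF lf this] obtain x' where x': "hom x' z (V X S)" "f S \<odot> x' = y" "\<forall>T\<in>above P S. X S T \<odot> x' = x T"
    and xu: "\<And>x''. hom x'' z (V X S) \<Longrightarrow> f S \<odot> x'' = y \<Longrightarrow> \<forall>T\<in>above P S. X S T \<odot> x'' = x T \<Longrightarrow> x'' = x'"
    by metis
  show "\<exists>!x'. hom x' z (V X S) \<and> (g S \<odot> f S) \<odot> x' = w \<and> (\<forall>T\<in>above P S. X S T \<odot> x' = x T)"
  proof (intro ex1I[of _ x'] conjI)
    show "(g S \<odot> f S) \<odot> x' = w" using x' y by simp
    fix x'' assume a: "hom x'' z (V X S) \<and> (g S \<odot> f S) \<odot> x'' = w \<and> (\<forall>T\<in>above P S. X S T \<odot> x'' = x T)"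
    have "Y S T \<odot> f S \<odot> x'' = f T \<odot> x T" if "T \<in> above P S" for T
      using nat_sq'[OF f S, of T x''] above_in[OF that] a that by simp
    then have "f S \<odot> x'' = y" using yu[of "f S \<odot> x''"] a hom_cmp[OF _ nat_hom[OF f S]] by simp
    then show "x'' = x'" using xu a by simp
  qed (use x' in auto)
qed

lemma emap_comp:
  assumes f: "emap P X Y f" and g: "emap P Y Z g"
  shows "emap P X Z (\<lambda>T. g T \<odot> f T)"
proof (rule emapI)
  show "lifts P X Z (\<lambda>T. g T \<odot> f T) S" if "S \<in> P" for S
    using lifts_comp[OF emap_nat[OF f] emap_nat[OF g] that] emap_lifts[OF f that] emap_lifts[OF g that] .
qed (use emap_dom[OF f] emap_cod[OF g] nat_comp[OF emap_nat[OF f] emap_nat[OF g]] in auto)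

text \<open>Elements of \<open>Y\<close> above \<open>S\<close> are first lifted locally to \<open>X\<close>, where the composite has the lifting
  property.\<close>

lemma lifts_cancel:
  assumes fin: "finite P" and f: "emap P X Y f" and g: "nat_tr P Y Z g" and S: "S \<in> P"
    and gf: "lifts P X Z (\<lambda>T. g T \<odot> f T) S"
  shows "lifts P Y Z g S"
  unfolding lifts_def
proof (intro allI impI)
  fix z y w assume m: "match P Y Z g S z y w"
  obtain z1 e1 x where 1: "cover e1 z1 z" "fam X (above P S) z1 x" "\<And>T. T \<in> above P S \<Longrightarrow> f T \<odot> x T = y T \<odot> e1"
    using lift_family[OF fin f upset_above match_fam[OF m]] by metis
  have "match P X Z (\<lambda>T. g T \<odot> f T) S z1 x (w \<odot> e1)"
    using 1 hom_cmp[OF cover_hom[OF 1(1)] match_hom[OF m]] match_eq[OF m]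
    by (intro matchI) (simp_all, metis cmp_assoc)
  then obtain z2 e2 x' where 2: "cover e2 z2 z1" "sol P X Z (\<lambda>T. g T \<odot> f T) S z2 x (w \<odot> e1) e2 x'"
    by (rule liftsE[OF gf])
  have "sol P Y Z g S z2 y w (e1 \<odot> e2) (f S \<odot> x')"
  proof (rule solI)
    show "hom (f S \<odot> x') z2 (V Y S)" using hom_cmp[OF sol_hom[OF 2(2)] nat_hom[OF emap_nat[OF f] S]] .
    show "g S \<odot> f S \<odot> x' = w \<odot> e1 \<odot> e2" using sol_eq[OF 2(2)] by simp
    fix T assume T: "T \<in> above P S"
    then show "Y S T \<odot> f S \<odot> x' = y T \<odot> e1 \<odot> e2"
      using nat_sq'[OF emap_nat[OF f] S, of T x'] above_in[OF T] sol_fam[OF 2(2) T] 1(3)[OF T] by (metis cmp_assoc)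
  qed
  then show "\<exists>z' e x'. cover e z' z \<and> sol P Y Z g S z' y w e x'"
    using cover_comp[OF 1(1) 2(1)] by meson
qed

lemma emap_cancel:
  assumes fin: "finite P" and f: "emap P X Y f" and g: "nat_tr P Y Z g" and gf: "emap P X Z (\<lambda>T. g T \<odot> f T)"
  shows "emap P Y Z g"
  by (rule emapI) (use emap_cod[OF f] emap_cod[OF gf] g lifts_cancel[OF fin f g] emap_lifts[OF gf] in auto)

section \<open>Pullbacks, reindexing and faces of diagrams\<close>

subsection \<open>Vertexwise pullbacks\<close>

definition pb where
  "pb P X Y Z f g R p q \<longleftrightarrow> diag P R \<and> nat_tr P R X p \<and> nat_tr P R Y q \<and>
     (\<forall>S\<in>P. f S \<odot> p S = g S \<odot> q S \<and>
       (\<forall>z x y. hom x z (V X S) \<and> hom y z (V Y S) \<and> f S \<odot> x = g S \<odot> y \<longrightarrow>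
          (\<exists>!u. hom u z (V R S) \<and> p S \<odot> u = x \<and> q S \<odot> u = y)))"

lemma pb_diag: "pb P X Y Z f g R p q \<Longrightarrow> diag P R"
  and pb_p: "pb P X Y Z f g R p q \<Longrightarrow> nat_tr P R X p"
  and pb_q: "pb P X Y Z f g R p q \<Longrightarrow> nat_tr P R Y q"
  and pb_sq: "pb P X Y Z f g R p q \<Longrightarrow> S \<in> P \<Longrightarrow> f S \<odot> p S = g S \<odot> q S"
  by (auto simp: pb_def)

lemma pb_sq': "pb P X Y Z f g R p q \<Longrightarrow> S \<in> P \<Longrightarrow> f S \<odot> p S \<odot> u = g S \<odot> q S \<odot> u"
  by (metis pb_sq cmp_assoc)

lemma pb_ex:
  assumes "pb P X Y Z f g R p q" "S \<in> P" "hom x z (V X S)" "hom y z (V Y S)" "f S \<odot> x = g S \<odot> y"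
  shows "\<exists>!u. hom u z (V R S) \<and> p S \<odot> u = x \<and> q S \<odot> u = y"
  using assms unfolding pb_def by simp

lemma pb_eqI:
  assumes R: "pb P X Y Z f g R p q" and S: "S \<in> P" and u: "hom u z (V R S)" and v: "hom v z (V R S)"
    and eq: "p S \<odot> u = p S \<odot> v" "q S \<odot> u = q S \<odot> v"
  shows "u = v"
proof -
  have "\<exists>!w. hom w z (V R S) \<and> p S \<odot> w = p S \<odot> v \<and> q S \<odot> w = q S \<odot> v"
    using pb_ex[OF R S hom_cmp[OF v nat_hom[OF pb_p[OF R] S]] hom_cmp[OF v nat_hom[OF pb_q[OF R] S]]
        pb_sq'[OF R S]] .
  then show ?thesis using u v eq by metis
qed

lemma pb_sym: "pb P X Y Z f g R p q \<Longrightarrow> pb P Y X Z g f R q p"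
  unfolding pb_def by (metis (no_types, lifting))

lemma pb_exists:
  assumes X: "diag P X" and Y: "diag P Y" and Z: "diag P Z" and f: "nat_tr P X Z f" and g: "nat_tr P Y Z g"
  shows "\<exists>R p q. pb P X Y Z f g R p q"
proof -
  have "\<forall>S\<in>P. \<exists>t. hom (fst (snd t)) (fst t) (V X S) \<and> hom (snd (snd t)) (fst t) (V Y S) \<and>
     f S \<odot> fst (snd t) = g S \<odot> snd (snd t) \<and>
     (\<forall>z r s. hom r z (V X S) \<and> hom s z (V Y S) \<and> f S \<odot> r = g S \<odot> s \<longrightarrow>
        (\<exists>!u. hom u z (fst t) \<and> fst (snd t) \<odot> u = r \<and> snd (snd t) \<odot> u = s))"
  proof
    fix S assume S: "S \<in> P"
    obtain d p q where "hom p d (V X S)" "hom q d (V Y S)" "f S \<odot> p = g S \<odot> q"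
      "\<forall>z r s. hom r z (V X S) \<and> hom s z (V Y S) \<and> f S \<odot> r = g S \<odot> s \<longrightarrow>
        (\<exists>!u. hom u z d \<and> p \<odot> u = r \<and> q \<odot> u = s)"
      using pullback[OF nat_hom[OF f S] nat_hom[OF g S]] by (elim exE conjE)
    then show "\<exists>t. hom (fst (snd t)) (fst t) (V X S) \<and> hom (snd (snd t)) (fst t) (V Y S) \<and>
     f S \<odot> fst (snd t) = g S \<odot> snd (snd t) \<and>
     (\<forall>z r s. hom r z (V X S) \<and> hom s z (V Y S) \<and> f S \<odot> r = g S \<odot> s \<longrightarrow>
        (\<exists>!u. hom u z (fst t) \<and> fst (snd t) \<odot> u = r \<and> snd (snd t) \<odot> u = s))"
      by (intro exI[of _ "(d, p, q)"]) simp
  qed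
  from bchoice[OF this] obtain t where t: "\<forall>S\<in>P. hom (fst (snd (t S))) (fst (t S)) (V X S) \<and>
     hom (snd (snd (t S))) (fst (t S)) (V Y S) \<and> f S \<odot> fst (snd (t S)) = g S \<odot> snd (snd (t S)) \<and>
     (\<forall>z r s. hom r z (V X S) \<and> hom s z (V Y S) \<and> f S \<odot> r = g S \<odot> s \<longrightarrow>
        (\<exists>!u. hom u z (fst (t S)) \<and> fst (snd (t S)) \<odot> u = r \<and> snd (snd (t S)) \<odot> u = s))"
    by (elim exE)
  define d p q where "d S = fst (t S)" and "p S = fst (snd (t S))" and "q S = snd (snd (t S))" for S
  have p: "hom (p S) (d S) (V X S)" and q: "hom (q S) (d S) (V Y S)" and sq: "f S \<odot> p S = g S \<odot> q S"
    and un: "hom r z (V X S) \<Longrightarrow> hom s z (V Y S) \<Longrightarrow> f S \<odot> r = g S \<odot> s \<Longrightarrow>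
       (\<exists>!u. hom u z (d S) \<and> p S \<odot> u = r \<and> q S \<odot> u = s)" if "S \<in> P" for S z r s
    using t that by (simp_all add: d_def p_def q_def)
  have eqI: "u = v" if "S \<in> P" "hom u z (d S)" "hom v z (d S)" "p S \<odot> u = p S \<odot> v" "q S \<odot> u = q S \<odot> v" for S u v z
  proof -
    have "f S \<odot> p S \<odot> v = g S \<odot> q S \<odot> v" using sq[OF that(1)] by (metis cmp_assoc)
    from un[OF that(1) hom_cmp[OF that(3) p[OF that(1)]] hom_cmp[OF that(3) q[OF that(1)]] this]
    show ?thesis using that by metis
  qed
  define R where "R S T = (THE u. hom u (d S) (d T) \<and> p T \<odot> u = X S T \<odot> p S \<and> q T \<odot> u = Y S T \<odot> q S)" for S T
  have R: "hom (R S T) (d S) (d T)" "p T \<odot> R S T = X S T \<odot> p S" "q T \<odot> R S T = Y S T \<odot> q S"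
    if ST: "S \<in> P" "T \<in> P" "S \<subseteq> T" for S T
  proof -
    have 1: "hom (X S T \<odot> p S) (d S) (V X T)" "hom (Y S T \<odot> q S) (d S) (V Y T)"
      using hom_cmp[OF p diag_hom[OF X]] hom_cmp[OF q diag_hom[OF Y]] ST by simp_all
    have "f T \<odot> X S T \<odot> p S = Z S T \<odot> g S \<odot> q S"
      using nat_sq'[OF f ST, of "p S"] sq[OF ST(1)] by simp
    also have "\<dots> = g T \<odot> Y S T \<odot> q S" using nat_sq'[OF g ST, of "q S"] .
    finally have "\<exists>!u. hom u (d S) (d T) \<and> p T \<odot> u = X S T \<odot> p S \<and> q T \<odot> u = Y S T \<odot> q S"
      using un[OF ST(2) 1] by simp
    from theI'[OF this] show "hom (R S T) (d S) (d T)" "p T \<odot> R S T = X S T \<odot> p S" "q T \<odot> R S T = Y S T \<odot> q S"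
      unfolding R_def by simp_all
  qed
  have dO: "d S \<in> Obj K" if "S \<in> P" for S using p[OF that] hom_Obj by blast
  have RId: "R S S = Id K (d S)" if S: "S \<in> P" for S
  proof (rule eqI[OF S R(1)[OF S S order_refl] hom_Id[OF dO[OF S]]])
    show "p S \<odot> R S S = p S \<odot> Id K (d S)"
      using R(2)[OF S S order_refl] cmp_Id[OF p[OF S]] Id_cmp[OF p[OF S]] diag_refl[OF X S] by simp
    show "q S \<odot> R S S = q S \<odot> Id K (d S)"
      using R(3)[OF S S order_refl] cmp_Id[OF q[OF S]] Id_cmp[OF q[OF S]] diag_refl[OF Y S] by simp
  qed
  have VR: "V R S = d S" if "S \<in> P" for S
    using RId[OF that] Dom_Id[OF dO[OF that]] by (simp add: V_def)
  have "diag P R"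
    unfolding diag_def
  proof (intro conjI ballI impI)
    show "V R S \<in> Obj K" "R S S = Id K (V R S)" if "S \<in> P" for S
      using VR[OF that] dO[OF that] RId[OF that] by simp_all
    show "hom (R S T) (V R S) (V R T)" if "S \<in> P" "T \<in> P" "S \<subseteq> T" for S T
      using R(1)[OF that] VR that by simp
    fix S T U assume s: "S \<in> P" "T \<in> P" "U \<in> P" and le: "S \<subseteq> T \<and> T \<subseteq> U"
    then have ST: "S \<subseteq> T" and TU: "T \<subseteq> U" and SU: "S \<subseteq> U" by auto
    show "R T U \<odot> R S T = R S U"
    proof (rule eqI[OF s(3) hom_cmp[OF R(1)[OF s(1,2) ST] R(1)[OF s(2,3) TU]] R(1)[OF s(1,3) SU]])
      show "p U \<odot> R T U \<odot> R S T = p U \<odot> R S U"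
        using R(2)[OF s(1,2) ST] R(2)[OF s(2,3) TU] R(2)[OF s(1,3) SU] diag_comp[OF X s ST TU]
        by (metis cmp_assoc)
      show "q U \<odot> R T U \<odot> R S T = q U \<odot> R S U"
        using R(3)[OF s(1,2) ST] R(3)[OF s(2,3) TU] R(3)[OF s(1,3) SU] diag_comp[OF Y s ST TU]
        by (metis cmp_assoc)
    qed
  qed
  moreover have "nat_tr P R X p" "nat_tr P R Y q"
    unfolding nat_tr_def using p q VR R by auto
  ultimately have "pb P X Y Z f g R p q"
    unfolding pb_def using sq un VR by simp
  then show ?thesis by (intro exI)
qed

lemma pb_induced:
  assumes R: "pb P X Y Z f g R p q" and W: "diag P W"
    and a: "nat_tr P W X a" and b: "nat_tr P W Y b" and eq: "\<And>S. S \<in> P \<Longrightarrow> f S \<odot> a S = g S \<odot> b S"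
  shows "\<exists>u. nat_tr P W R u \<and> (\<forall>S\<in>P. p S \<odot> u S = a S \<and> q S \<odot> u S = b S)"
proof -
  have "\<forall>S\<in>P. \<exists>u. hom u (V W S) (V R S) \<and> p S \<odot> u = a S \<and> q S \<odot> u = b S"
    using pb_ex[OF R _ nat_hom[OF a] nat_hom[OF b] eq] by (metis (no_types))
  from bchoice[OF this] obtain u where
    u: "\<forall>S\<in>P. hom (u S) (V W S) (V R S) \<and> p S \<odot> u S = a S \<and> q S \<odot> u S = b S" by (elim exE)
  have "R S T \<odot> u S = u T \<odot> W S T" if ST: "S \<in> P" "T \<in> P" "S \<subseteq> T" for S T
  proof (rule pb_eqI[OF R ST(2)])
    show "hom (R S T \<odot> u S) (V W S) (V R T)" "hom (u T \<odot> W S T) (V W S) (V R T)"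
      using u ST hom_cmp[OF _ diag_hom[OF pb_diag[OF R] ST]] hom_cmp[OF diag_hom[OF W ST]] by simp_all
    show "p T \<odot> R S T \<odot> u S = p T \<odot> u T \<odot> W S T"
      using nat_sq'[OF pb_p[OF R] ST, of "u S"] u ST nat_sq[OF a ST] by (metis cmp_assoc)
    show "q T \<odot> R S T \<odot> u S = q T \<odot> u T \<odot> W S T"
      using nat_sq'[OF pb_q[OF R] ST, of "u S"] u ST nat_sq[OF b ST] by (metis cmp_assoc)
  qed
  then have "nat_tr P W R u" using u unfolding nat_tr_def by simp
  then show ?thesis using u by (intro exI[of _ u]) simp
qed

text \<open>A lifting problem for the projection of a pullback is sent to one for the map that was pulled back, and
  solutions of the latter induce solutions of the former.\<close>

lemma pb_match:
  assumes R: "pb P X Y Z f g R p q" and g: "nat_tr P Y Z g" and S: "S \<in> P"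
    and m: "match P R Y q S z r y"
  shows "match P X Z f S z (\<lambda>T. p T \<odot> r T) (g S \<odot> y)"
proof (rule matchI)
  note r = match_fam[OF m]
  show "fam X (above P S) z (\<lambda>T. p T \<odot> r T)"
    unfolding fam_def
  proof (intro conjI ballI impI)
    show "z \<in> Obj K" using match_Obj[OF m] .
    show "hom (p T \<odot> r T) z (V X T)" if "T \<in> above P S" for T
      using hom_cmp[OF fam_hom[OF r that] nat_hom[OF pb_p[OF R]]] above_in[OF that] by simp
    show "X T T' \<odot> p T \<odot> r T = p T' \<odot> r T'" if "T \<in> above P S" "T' \<in> above P S" "T \<subseteq> T'" for T T'
      using nat_sq'[OF pb_p[OF R], of T T'] fam_comp[OF r that] above_in that by simp
  qed
  show "hom (g S \<odot> y) z (V Z S)" using hom_cmp[OF match_hom[OF m] nat_hom[OF g S]] .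
  show "f T \<odot> p T \<odot> r T = Z S T \<odot> g S \<odot> y" if "T \<in> above P S" for T
    using pb_sq'[OF R, of T "r T"] match_eq[OF m that] nat_sq'[OF g S, of T y] above_in[OF that] by simp
qed

lemma pb_sol:
  assumes R: "pb P X Y Z f g R p q" and X: "diag P X" and g: "nat_tr P Y Z g" and S: "S \<in> P"
    and m: "match P R Y q S z r y" and e: "hom e z' z"
    and x': "sol P X Z f S z' (\<lambda>T. p T \<odot> r T) (g S \<odot> y) e x'"
  shows "\<exists>r'. sol P R Y q S z' r y e r' \<and> p S \<odot> r' = x'"
proof -
  have "\<exists>!u. hom u z' (V R S) \<and> p S \<odot> u = x' \<and> q S \<odot> u = y \<odot> e"
    using sol_eq[OF x'] by (intro pb_ex[OF R S sol_hom[OF x'] hom_cmp[OF e match_hom[OF m]]]) simp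
  then obtain u where u: "hom u z' (V R S)" "p S \<odot> u = x'" "q S \<odot> u = y \<odot> e" by metis
  have "R S T \<odot> u = r T \<odot> e" if T: "T \<in> above P S" for T
  proof (rule pb_eqI[OF R])
    have TP: "T \<in> P" "S \<subseteq> T" using above_in[OF T] by auto
    show "T \<in> P" using TP by simp
    show "hom (R S T \<odot> u) z' (V R T)" using hom_cmp[OF u(1) diag_hom[OF pb_diag[OF R] S TP]] .
    show "hom (r T \<odot> e) z' (V R T)" using hom_cmp[OF e fam_hom[OF match_fam[OF m] T]] .
    show "p T \<odot> R S T \<odot> u = p T \<odot> r T \<odot> e"
      using nat_sq'[OF pb_p[OF R] S TP, of u] u(2) sol_fam[OF x' T] by simp
    show "q T \<odot> R S T \<odot> u = q T \<odot> r T \<odot> e"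
      using nat_sq'[OF pb_q[OF R] S TP, of u] u(3) match_eq[OF m T] by (metis cmp_assoc)
  qed
  then show ?thesis using u by (intro exI[of _ u] conjI solI) simp_all
qed

lemma pb_lifts:
  assumes R: "pb P X Y Z f g R p q" and X: "diag P X" and g: "nat_tr P Y Z g" and S: "S \<in> P"
    and l: "lifts P X Z f S"
  shows "lifts P R Y q S"
  unfolding lifts_def
proof (intro allI impI)
  fix z r y assume m: "match P R Y q S z r y"
  obtain z' e x' where e: "cover e z' z" and x': "sol P X Z f S z' (\<lambda>T. p T \<odot> r T) (g S \<odot> y) e x'"
    by (rule liftsE[OF l pb_match[OF R g S m]])
  then show "\<exists>z' e x'. cover e z' z \<and> sol P R Y q S z' r y e x'"
    using pb_sol[OF R X g S m cover_hom[OF e] x'] by (elim exE conjE, intro exI conjI)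
qed

lemma pb_ulifts:
  assumes R: "pb P X Y Z f g R p q" and X: "diag P X" and g: "nat_tr P Y Z g" and S: "S \<in> P"
    and l: "ulifts P X Z f S"
  shows "ulifts P R Y q S"
  unfolding ulifts_def
proof (intro allI impI)
  fix z r y assume m: "match P R Y q S z r y"
  let ?I = "Id K z"
  note I = hom_Id[OF match_Obj[OF m]]
  have ex: "\<exists>!x'. sol P X Z f S z (\<lambda>T. p T \<odot> r T) (g S \<odot> y) ?I x'"
    using l pb_match[OF R g S m] unfolding ulifts_def by simp
  then obtain x' where x': "sol P X Z f S z (\<lambda>T. p T \<odot> r T) (g S \<odot> y) ?I x'" by metis
  obtain r' where r': "sol P R Y q S z r y ?I r'" "p S \<odot> r' = x'"
    using pb_sol[OF R X g S m I x'] by (elim exE conjE)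
  have "r2 = r'" if r2: "sol P R Y q S z r y ?I r2" for r2
  proof (rule pb_eqI[OF R S sol_hom[OF r2] sol_hom[OF r'(1)]])
    have "sol P X Z f S z (\<lambda>T. p T \<odot> r T) (g S \<odot> y) ?I (p S \<odot> r2)"
    proof (rule solI)
      show "hom (p S \<odot> r2) z (V X S)" using hom_cmp[OF sol_hom[OF r2] nat_hom[OF pb_p[OF R] S]] .
      show "f S \<odot> p S \<odot> r2 = (g S \<odot> y) \<odot> ?I"
        using pb_sq'[OF R S, of r2] sol_eq[OF r2] by simp
      show "X S T \<odot> p S \<odot> r2 = (p T \<odot> r T) \<odot> ?I" if "T \<in> above P S" for T
        using nat_sq'[OF pb_p[OF R] S, of T r2] sol_fam[OF r2 that] above_in[OF that] by simp
    qed
    then show "p S \<odot> r2 = p S \<odot> r'" using ex x' r'(2) by metis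
    show "q S \<odot> r2 = q S \<odot> r'" using sol_eq[OF r2] sol_eq[OF r'(1)] by simp
  qed
  then show "\<exists>!r'. sol P R Y q S z r y ?I r'" using r'(1) by metis
qed

lemma pb_emap:
  assumes R: "pb P X Y Z f g R p q" and f: "emap P X Z f" and Y: "diag P Y" and g: "nat_tr P Y Z g"
  shows "emap P R Y q"
  by (rule emapI) (use pb_diag[OF R] Y pb_q[OF R] pb_lifts[OF R emap_dom[OF f] g] emap_lifts[OF f] in auto)

subsection \<open>Reindexing\<close>

definition rx :: "(nat set \<Rightarrow> nat set) \<Rightarrow> (nat set \<Rightarrow> nat set \<Rightarrow> 'a) \<Rightarrow> nat set \<Rightarrow> nat set \<Rightarrow> 'a" where
  "rx \<phi> X S T = X (\<phi> S) (\<phi> T)"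

lemma V_rx [simp]: "V (rx \<phi> X) S = V X (\<phi> S)"
  by (simp add: V_def rx_def)

definition mono_idx where
  "mono_idx P' P \<phi> \<longleftrightarrow> (\<forall>S\<in>P'. \<phi> S \<in> P) \<and> (\<forall>S\<in>P'. \<forall>T\<in>P'. S \<subseteq> T \<longrightarrow> \<phi> S \<subseteq> \<phi> T)"

lemma rx_diag: "mono_idx P' P \<phi> \<Longrightarrow> diag P X \<Longrightarrow> diag P' (rx \<phi> X)"
  unfolding diag_def V_rx by (simp add: rx_def mono_idx_def)

lemma rx_nat: "mono_idx P' P \<phi> \<Longrightarrow> nat_tr P X Y f \<Longrightarrow> nat_tr P' (rx \<phi> X) (rx \<phi> Y) (\<lambda>S. f (\<phi> S))"
  unfolding nat_tr_def V_rx by (simp add: rx_def mono_idx_def)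

lemma rx_pb:
  assumes \<phi>: "mono_idx P' P \<phi>" and R: "pb P X Y Z f g R p q"
  shows "pb P' (rx \<phi> X) (rx \<phi> Y) (rx \<phi> Z) (\<lambda>S. f (\<phi> S)) (\<lambda>S. g (\<phi> S)) (rx \<phi> R) (\<lambda>S. p (\<phi> S)) (\<lambda>S. q (\<phi> S))"
proof -
  have "\<phi> S \<in> P" if "S \<in> P'" for S using \<phi> that by (simp add: mono_idx_def)
  then show ?thesis
    using rx_diag[OF \<phi> pb_diag[OF R]] rx_nat[OF \<phi> pb_p[OF R]] rx_nat[OF \<phi> pb_q[OF R]] R
    unfolding pb_def V_rx by simp
qed

text \<open>An order embedding of \<open>P'\<close> into \<open>P\<close> under which the vertices strictly above correspond. Lifting at
  \<open>S\<close> involves only these vertices, so it is preserved and reflected by reindexing.\<close>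

definition iso_idx where
  "iso_idx P' P \<phi> \<longleftrightarrow> (\<forall>S\<in>P'. \<phi> S \<in> P) \<and> (\<forall>S\<in>P'. \<forall>T\<in>P'. \<phi> S \<subseteq> \<phi> T \<longleftrightarrow> S \<subseteq> T) \<and>
     (\<forall>S\<in>P'. above P (\<phi> S) = \<phi> ` above P' S)"

lemma iso_mono: "iso_idx P' P \<phi> \<Longrightarrow> mono_idx P' P \<phi>"
  by (simp add: iso_idx_def mono_idx_def)

lemma rx_lifting:
  assumes \<phi>: "iso_idx P' P \<phi>" and S: "S \<in> P'"
  shows "lifts P X Y f (\<phi> S) \<longleftrightarrow> lifts P' (rx \<phi> X) (rx \<phi> Y) (\<lambda>S. f (\<phi> S)) S"
    and "ulifts P X Y f (\<phi> S) \<longleftrightarrow> ulifts P' (rx \<phi> X) (rx \<phi> Y) (\<lambda>S. f (\<phi> S)) S"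
proof -
  have ab: "above P (\<phi> S) = \<phi> ` above P' S"
    and le: "\<And>T T'. T \<in> P' \<Longrightarrow> T' \<in> P' \<Longrightarrow> \<phi> T \<subseteq> \<phi> T' \<longleftrightarrow> T \<subseteq> T'"
    using \<phi> S by (auto simp: iso_idx_def)
  have P': "T \<in> above P' S \<Longrightarrow> T \<in> P'" for T by (simp add: above_def)
  have inj: "inj_on \<phi> P'" using le by (intro inj_onI) (metis order_antisym order_refl)
  have m: "match P X Y f (\<phi> S) z x y \<longleftrightarrow> match P' (rx \<phi> X) (rx \<phi> Y) (\<lambda>S. f (\<phi> S)) S z (\<lambda>T. x (\<phi> T)) y" for z x y
    unfolding match_def fam_def ab V_rx using le P' by (simp add: rx_def)
  have s: "sol P X Y f (\<phi> S) z x y e x' \<longleftrightarrow> sol P' (rx \<phi> X) (rx \<phi> Y) (\<lambda>S. f (\<phi> S)) S z (\<lambda>T. x (\<phi> T)) y e x'" for z x y e x'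
    unfolding sol_def ab V_rx by (simp add: rx_def)
  have 1: "\<exists>x2 y2. match P' (rx \<phi> X) (rx \<phi> Y) (\<lambda>S. f (\<phi> S)) S z x2 y2 \<and> (\<forall>z' e x'. hom e z' z \<longrightarrow>
     sol P' (rx \<phi> X) (rx \<phi> Y) (\<lambda>S. f (\<phi> S)) S z' x2 y2 e x' \<longleftrightarrow> sol P X Y f (\<phi> S) z' x y e x')"
    if "match P X Y f (\<phi> S) z x y" for z x y
    using that unfolding m by (intro exI[of _ "\<lambda>T. x (\<phi> T)"] exI[of _ y]) (simp add: s)
  have 2: "\<exists>x2 y2. match P X Y f (\<phi> S) z x2 y2 \<and> (\<forall>z' e x'. hom e z' z \<longrightarrow>
     sol P X Y f (\<phi> S) z' x2 y2 e x' \<longleftrightarrow> sol P' (rx \<phi> X) (rx \<phi> Y) (\<lambda>S. f (\<phi> S)) S z' x y e x')"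
    if mm: "match P' (rx \<phi> X) (rx \<phi> Y) (\<lambda>S. f (\<phi> S)) S z x y" for z x y
  proof -
    define x2 where "x2 T = x (inv_into P' \<phi> T)" for T
    have x2: "x2 (\<phi> T) = x T" if "T \<in> above P' S" for T
      using inj P'[OF that] by (simp add: x2_def)
    have "match P' (rx \<phi> X) (rx \<phi> Y) (\<lambda>S. f (\<phi> S)) S z (\<lambda>T. x2 (\<phi> T)) y"
      using mm x2 unfolding match_def fam_def by simp
    moreover have "sol P' (rx \<phi> X) (rx \<phi> Y) (\<lambda>S. f (\<phi> S)) S z' (\<lambda>T. x2 (\<phi> T)) y e x' \<longleftrightarrow>
        sol P' (rx \<phi> X) (rx \<phi> Y) (\<lambda>S. f (\<phi> S)) S z' x y e x'" for z' e x'
      using x2 unfolding sol_def by simp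
    ultimately show ?thesis by (intro exI[of _ x2] exI[of _ y]) (simp add: m s)
  qed
  show "lifts P X Y f (\<phi> S) \<longleftrightarrow> lifts P' (rx \<phi> X) (rx \<phi> Y) (\<lambda>S. f (\<phi> S)) S"
    using lifting_transfer(1)[OF 1] lifting_transfer(1)[OF 2] by metis
  show "ulifts P X Y f (\<phi> S) \<longleftrightarrow> ulifts P' (rx \<phi> X) (rx \<phi> Y) (\<lambda>S. f (\<phi> S)) S"
    using lifting_transfer(2)[OF 1] lifting_transfer(2)[OF 2] by metis
qed

lemma rx_emap:
  assumes \<phi>: "iso_idx P' P \<phi>" and f: "emap P X Y f"
  shows "emap P' (rx \<phi> X) (rx \<phi> Y) (\<lambda>S. f (\<phi> S))"
proof (rule emapI)
  show "lifts P' (rx \<phi> X) (rx \<phi> Y) (\<lambda>S. f (\<phi> S)) S" if "S \<in> P'" for S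
    using rx_lifting(1)[OF \<phi> that] emap_lifts[OF f, of "\<phi> S"] \<phi> that by (simp add: iso_idx_def)
qed (use rx_diag[OF iso_mono[OF \<phi>]] rx_nat[OF iso_mono[OF \<phi>]] emap_dom[OF f] emap_cod[OF f] emap_nat[OF f] in auto)

lemma iso_idx_image:
  assumes inj: "inj_on \<pi> A"
  shows "iso_idx (Pow A) (Pow (\<pi> ` A)) (image \<pi>)"
  unfolding iso_idx_def
proof (intro conjI ballI)
  fix S assume S: "S \<in> Pow A"
  show "\<pi> ` S \<in> Pow (\<pi> ` A)" using S by auto
  show le: "\<pi> ` S \<subseteq> \<pi> ` T \<longleftrightarrow> S \<subseteq> T" if "T \<in> Pow A" for T
  proof
    assume le: "\<pi> ` S \<subseteq> \<pi> ` T"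
    show "S \<subseteq> T"
    proof
      fix x assume x: "x \<in> S"
      then obtain t where t: "t \<in> T" "\<pi> x = \<pi> t" using le by auto
      then have "x = t" using inj_onD[OF inj t(2)] x S that by auto
      then show "x \<in> T" using t by simp
    qed
  qed auto
  show "above (Pow (\<pi> ` A)) (\<pi> ` S) = image \<pi> ` above (Pow A) S"
  proof
    show "image \<pi> ` above (Pow A) S \<subseteq> above (Pow (\<pi> ` A)) (\<pi> ` S)"
    proof
      fix T assume "T \<in> image \<pi> ` above (Pow A) S"
      then obtain T' where T': "T = \<pi> ` T'" "T' \<subseteq> A" "S \<subseteq> T'" "S \<noteq> T'" by (auto simp: above_def)
      then have "\<pi> ` S \<noteq> \<pi> ` T'" using inj_on_image_eq_iff[OF inj, of S T'] S by auto
      then show "T \<in> above (Pow (\<pi> ` A)) (\<pi> ` S)" using T' by (auto simp: above_def)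
    qed
    show "above (Pow (\<pi> ` A)) (\<pi> ` S) \<subseteq> image \<pi> ` above (Pow A) S"
    proof
      fix T assume T: "T \<in> above (Pow (\<pi> ` A)) (\<pi> ` S)"
      then have "T \<subseteq> \<pi> ` A" by (simp add: above_def)
      then obtain T' where T': "T' \<subseteq> A" "T = \<pi> ` T'" by (meson subset_imageE)
      then have "S \<subseteq> T'" using le T'(1) T by (auto simp: above_def)
      moreover have "S \<noteq> T'" using T T'(2) by (auto simp: above_def)
      ultimately show "T \<in> image \<pi> ` above (Pow A) S"
        using T' by (auto simp: above_def)
    qed
  qed
qed

subsection \<open>Splitting off one direction\<close>

abbreviation up :: "nat \<Rightarrow> (nat set \<Rightarrow> nat set \<Rightarrow> 'a) \<Rightarrow> nat set \<Rightarrow> nat set \<Rightarrow> 'a" where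
  "up i \<equiv> rx (insert i)"

definition dir :: "nat \<Rightarrow> (nat set \<Rightarrow> nat set \<Rightarrow> 'a) \<Rightarrow> nat set \<Rightarrow> 'a" where
  "dir i X S = X S (insert i S)"

lemma notin_lessThan: "k \<notin> {..<k :: nat}"
  by simp

lemma iso_idx_insert:
  assumes i: "i \<notin> A"
  shows "iso_idx (Pow A) (Pow (insert i A)) (insert i)"
  unfolding iso_idx_def
proof (intro conjI ballI)
  fix S assume S: "S \<in> Pow A"
  show "insert i S \<in> Pow (insert i A)" using S by auto
  show "insert i S \<subseteq> insert i T \<longleftrightarrow> S \<subseteq> T" if "T \<in> Pow A" for T
    using S that i by auto
  show "above (Pow (insert i A)) (insert i S) = insert i ` above (Pow A) S"
  proof
    show "insert i ` above (Pow A) S \<subseteq> above (Pow (insert i A)) (insert i S)"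
    proof
      fix T assume "T \<in> insert i ` above (Pow A) S"
      then obtain T' where "T = insert i T'" "T' \<subseteq> A" "S \<subset> T'" by (auto simp: above_def)
      moreover from this have "i \<notin> T'" "i \<notin> S" using i by auto
      ultimately show "T \<in> above (Pow (insert i A)) (insert i S)"
        unfolding above_def by auto
    qed
    show "above (Pow (insert i A)) (insert i S) \<subseteq> insert i ` above (Pow A) S"
    proof
      fix T assume "T \<in> above (Pow (insert i A)) (insert i S)"
      then have "T \<subseteq> insert i A" "insert i S \<subset> T" by (auto simp: above_def)
      then have "T = insert i (T - {i})" "T - {i} \<subseteq> A" "S \<subset> T - {i}"
        using S i by auto
      then show "T \<in> insert i ` above (Pow A) S" unfolding above_def by blast
    qed
  qed
qed

lemma up_mono: "i \<notin> A \<Longrightarrow> mono_idx (Pow A) (Pow (insert i A)) (insert i)"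
  by (auto simp: mono_idx_def)

lemma diag_dn: "diag (Pow (insert i A)) X \<Longrightarrow> diag (Pow A) X"
  by (rule diag_mono) auto

lemma nat_dn: "nat_tr (Pow (insert i A)) X Y f \<Longrightarrow> nat_tr (Pow A) X Y f"
  by (rule nat_mono) auto

lemma nat_dir: "i \<notin> A \<Longrightarrow> diag (Pow (insert i A)) X \<Longrightarrow> nat_tr (Pow A) X (up i X) (dir i X)"
  unfolding nat_tr_def V_rx
proof (intro conjI ballI impI)
  assume i: "i \<notin> A" and X: "diag (Pow (insert i A)) X"
  show "hom (dir i X S) (V X S) (V X (insert i S))" if "S \<in> Pow A" for S
    unfolding dir_def using that by (intro diag_hom[OF X]) auto
  show "up i X S T \<odot> dir i X S = dir i X T \<odot> X S T" if "S \<in> Pow A" "T \<in> Pow A" "S \<subseteq> T" for S T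
  proof -
    have "up i X S T \<odot> dir i X S = X S (insert i T)"
      unfolding dir_def rx_def using that by (intro diag_comp[OF X]) auto
    also have "\<dots> = dir i X T \<odot> X S T"
      unfolding dir_def using that by (intro diag_comp[OF X, symmetric]) auto
    finally show ?thesis .
  qed
qed

text \<open>The vertices above \<open>S\<close> in the cube over \<open>insert i A\<close> are those above \<open>S\<close> in the initial face, together
  with the vertices \<open>insert i T\<close> for \<open>S \<subseteq> T\<close>. Elements at the latter are determined by a single element at
  \<open>insert i S\<close>. Joined with the element of \<open>Y\<close> at \<open>S\<close>, this is an element of the pullback \<open>R\<close> at \<open>S\<close>. So the
  lifting problems for \<open>f\<close> and for the comparison map \<open>u\<close> are the same.\<close>

lemma lifting_bot:
  assumes i: "i \<notin> A" and X: "diag (Pow (insert i A)) X" and Y: "diag (Pow (insert i A)) Y"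
    and f: "nat_tr (Pow (insert i A)) X Y f"
    and R: "pb (Pow A) (up i X) Y (up i Y) (\<lambda>S. f (insert i S)) (dir i Y) R p q"
    and u: "nat_tr (Pow A) X R u" and pu: "\<And>S. S \<subseteq> A \<Longrightarrow> p S \<odot> u S = dir i X S"
    and qu: "\<And>S. S \<subseteq> A \<Longrightarrow> q S \<odot> u S = f S" and S: "S \<subseteq> A"
  shows "lifts (Pow (insert i A)) X Y f S \<longleftrightarrow> lifts (Pow A) X R u S"
    and "ulifts (Pow (insert i A)) X Y f S \<longleftrightarrow> ulifts (Pow A) X R u S"
proof -
  let ?B = "Pow (insert i A)" and ?P = "Pow A"
  have iS: "i \<notin> S" using S i by auto
  have Sin: "S \<in> ?P" "S \<in> ?B" "insert i S \<in> ?B" using S by auto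
  have ab1: "T \<in> above ?B S \<longleftrightarrow> T \<in> above ?P S" if "i \<notin> T" for T
    using that by (auto simp: above_def)
  have ab2: "T \<in> above ?B S \<longleftrightarrow> T \<subseteq> insert i A \<and> insert i S \<subseteq> T" if "i \<in> T" for T
    using that iS by (auto simp: above_def)
  have iab: "insert i S \<in> above ?B S" using ab2[of "insert i S"] S by auto
  have pu': "p T \<odot> u T \<odot> a = X T (insert i T) \<odot> a" and qu': "q T \<odot> u T \<odot> a = f T \<odot> a" if "T \<subseteq> A" for T a
    using pu[OF that] qu[OF that] by (metis cmp_assoc dir_def)+
  have Xc: "X T U \<odot> X S T \<odot> a = X S U \<odot> a" if "S \<subseteq> T" "T \<subseteq> U" "U \<subseteq> insert i A" for S T U a
    using diag_comp[OF X, of S T U] that by (metis cmp_assoc PowI order_trans)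
  note Xh = diag_hom[OF X] and ph = nat_hom[OF pb_p[OF R]] and qh = nat_hom[OF pb_q[OF R]]
  have A: "\<exists>x2 y2. match ?P X R u S z x2 y2 \<and>
     (\<forall>z' e x'. hom e z' z \<longrightarrow> (sol ?P X R u S z' x2 y2 e x' \<longleftrightarrow> sol ?B X Y f S z' x y e x'))"
    if m: "match ?B X Y f S z x y" for z x y
  proof -
    note xf = match_fam[OF m]
    have "\<exists>!r. hom r z (V R S) \<and> p S \<odot> r = x (insert i S) \<and> q S \<odot> r = y"
      using match_eq[OF m iab] fam_hom[OF xf iab] match_hom[OF m]
      by (intro pb_ex[OF R Sin(1)]) (simp_all add: dir_def)
    then obtain r where r: "hom r z (V R S)" "p S \<odot> r = x (insert i S)" "q S \<odot> r = y" by (elim ex1E conjE)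
    have "match ?P X R u S z x r"
    proof (rule matchI)
      show "fam X (above ?P S) z x" by (rule fam_mono[OF xf]) (auto simp: above_def)
      show "hom r z (V R S)" by (rule r)
      fix T assume T: "T \<in> above ?P S"
      then have TA: "T \<subseteq> A" "S \<subseteq> T" "T \<in> ?P" "i \<notin> T" using i by (auto simp: above_def)
      have Tb: "T \<in> above ?B S" "insert i T \<in> above ?B S" using T ab1[OF TA(4)] ab2[of "insert i T"] TA by auto
      show "u T \<odot> x T = R S T \<odot> r"
      proof (rule pb_eqI[OF R TA(3)])
        show "hom (u T \<odot> x T) z (V R T)" using hom_cmp[OF fam_hom[OF xf Tb(1)] nat_hom[OF u TA(3)]] .
        show "hom (R S T \<odot> r) z (V R T)" using hom_cmp[OF r(1) diag_hom[OF pb_diag[OF R] Sin(1) TA(3,2)]] .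
        have "p T \<odot> R S T \<odot> r = X (insert i S) (insert i T) \<odot> x (insert i S)"
          using nat_sq'[OF pb_p[OF R] Sin(1) TA(3,2), of r] r(2) by (simp add: rx_def)
        also have "\<dots> = x (insert i T)" using fam_comp[OF xf iab Tb(2)] TA by auto
        also have "\<dots> = p T \<odot> u T \<odot> x T"
          using fam_comp[OF xf Tb subset_insertI] pu'[OF TA(1)] by simp
        finally show "p T \<odot> u T \<odot> x T = p T \<odot> R S T \<odot> r" by simp
        show "q T \<odot> u T \<odot> x T = q T \<odot> R S T \<odot> r"
          using nat_sq'[OF pb_q[OF R] Sin(1) TA(3,2), of r] r(3) qu'[OF TA(1)] match_eq[OF m Tb(1)] by simp
      qed
    qed
    moreover have "sol ?P X R u S z' x r e x' \<longleftrightarrow> sol ?B X Y f S z' x y e x'" if e: "hom e z' z" for z' e x'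
    proof
      assume s: "sol ?P X R u S z' x r e x'"
      show "sol ?B X Y f S z' x y e x'"
      proof (rule solI)
        show "hom x' z' (V X S)" using sol_hom[OF s] .
        show "f S \<odot> x' = y \<odot> e" using qu'[OF S, of x'] sol_eq[OF s] r(3) by (metis cmp_assoc)
        have top: "X S (insert i S) \<odot> x' = x (insert i S) \<odot> e"
          using pu'[OF S, of x'] sol_eq[OF s] r(2) by (metis cmp_assoc)
        fix T assume T: "T \<in> above ?B S"
        show "X S T \<odot> x' = x T \<odot> e"
        proof (cases "i \<in> T")
          case True
          then have T': "T \<subseteq> insert i A" "insert i S \<subseteq> T" using ab2 T by auto
          have "X S T \<odot> x' = X (insert i S) T \<odot> x (insert i S) \<odot> e"
            using Xc[OF subset_insertI T'(2,1), of x'] top by simp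
          also have "\<dots> = x T \<odot> e" using fam_comp[OF xf iab T T'(2)] by (metis cmp_assoc)
          finally show ?thesis .
        next
          case False
          then show ?thesis using sol_fam[OF s] ab1 T by simp
        qed
      qed
    next
      assume s: "sol ?B X Y f S z' x y e x'"
      show "sol ?P X R u S z' x r e x'"
      proof (rule solI)
        show "hom x' z' (V X S)" using sol_hom[OF s] .
        show "X S T \<odot> x' = x T \<odot> e" if "T \<in> above ?P S" for T
          using sol_fam[OF s] that by (auto simp: above_def)
        show "u S \<odot> x' = r \<odot> e"
        proof (rule pb_eqI[OF R Sin(1)])
          show "hom (u S \<odot> x') z' (V R S)" using hom_cmp[OF sol_hom[OF s] nat_hom[OF u Sin(1)]] .
          show "hom (r \<odot> e) z' (V R S)" using hom_cmp[OF e r(1)] .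
          show "p S \<odot> u S \<odot> x' = p S \<odot> r \<odot> e"
            using pu'[OF S, of x'] sol_fam[OF s iab] r(2) by (metis cmp_assoc)
          show "q S \<odot> u S \<odot> x' = q S \<odot> r \<odot> e"
            using qu'[OF S, of x'] sol_eq[OF s] r(3) by (metis cmp_assoc)
        qed
      qed
    qed
    ultimately show ?thesis by (intro exI[of _ x] exI[of _ r]) simp
  qed
  have B: "\<exists>x2 y2. match ?B X Y f S z x2 y2 \<and>
     (\<forall>z' e x'. hom e z' z \<longrightarrow> (sol ?B X Y f S z' x2 y2 e x' \<longleftrightarrow> sol ?P X R u S z' x r e x'))"
    if m: "match ?P X R u S z x r" for z x r
  proof -
    note xf = match_fam[OF m] and rh = match_hom[OF m]
    define x2 where "x2 T = (if i \<in> T then X (insert i S) T \<odot> p S \<odot> r else x T)" for T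
    have prh: "hom (p S \<odot> r) z (V X (insert i S))" using hom_cmp[OF rh ph[OF Sin(1)]] by simp
    have x2top: "x2 (insert i S) = p S \<odot> r"
      using diag_refl[OF X Sin(3)] Id_cmp[OF prh] by (simp add: x2_def)
    have px: "p T \<odot> u T \<odot> x T = X (insert i S) (insert i T) \<odot> p S \<odot> r" if T: "T \<in> above ?P S" for T
    proof -
      have TA: "T \<in> ?P" "S \<subseteq> T" using T by (auto simp: above_def)
      show ?thesis
        using match_eq[OF m T] nat_sq'[OF pb_p[OF R] Sin(1) TA, of r] by (simp add: rx_def)
    qed
    have x2f: "fam X (above ?B S) z x2"
      unfolding fam_def
    proof (intro conjI ballI impI)
      show "z \<in> Obj K" using match_Obj[OF m] .
      show "hom (x2 T) z (V X T)" if T: "T \<in> above ?B S" for T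
      proof (cases "i \<in> T")
        case True
        then show ?thesis using hom_cmp[OF prh Xh[of "insert i S" T]] ab2 T Sin by (simp add: x2_def)
      next
        case False
        then show ?thesis using fam_hom[OF xf] ab1 T by (simp add: x2_def)
      qed
      fix T T' assume T: "T \<in> above ?B S" and T': "T' \<in> above ?B S" and le: "T \<subseteq> T'"
      show "X T T' \<odot> x2 T = x2 T'"
      proof (cases "i \<in> T")
        case True
        then have "i \<in> T'" using le by auto
        then show ?thesis using True Xc[of "insert i S" T T'] ab2[OF True] ab2[of T'] T T' le by (simp add: x2_def)
      next
        case False
        then have Ta: "T \<in> above ?P S" using ab1 T by simp
        show ?thesis
        proof (cases "i \<in> T'")
          case True
          have TA: "T \<subseteq> A" using Ta by (auto simp: above_def)
          have T'': "insert i T \<subseteq> T'" "T' \<subseteq> insert i A" "insert i S \<subseteq> insert i T"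
            using le True ab2[OF True] T' Ta by (auto simp: above_def)
          have "X T T' \<odot> x T = X (insert i T) T' \<odot> X T (insert i T) \<odot> x T"
            using Xc[OF subset_insertI T''(1,2)] by simp
          also have "\<dots> = X (insert i T) T' \<odot> X (insert i S) (insert i T) \<odot> p S \<odot> r"
            using px[OF Ta] pu'[OF TA] by simp
          also have "\<dots> = X (insert i S) T' \<odot> p S \<odot> r" using Xc T'' by simp
          finally show ?thesis using True False by (simp add: x2_def)
        next
          case F: False
          then show ?thesis using fam_comp[OF xf Ta] ab1[OF F] T' le False by (simp add: x2_def)
        qed
      qed
    qed
    have "match ?B X Y f S z x2 (q S \<odot> r)"
    proof (rule matchI[OF x2f])
      show "hom (q S \<odot> r) z (V Y S)" using hom_cmp[OF rh qh[OF Sin(1)]] .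
      have ftop: "f (insert i S) \<odot> p S \<odot> r = Y S (insert i S) \<odot> q S \<odot> r"
        using pb_sq'[OF R Sin(1), of r] by (simp add: dir_def)
      fix T assume T: "T \<in> above ?B S"
      show "f T \<odot> x2 T = Y S T \<odot> q S \<odot> r"
      proof (cases "i \<in> T")
        case True
        then have T': "T \<in> ?B" "insert i S \<subseteq> T" using ab2 T by auto
        have "f T \<odot> x2 T = Y (insert i S) T \<odot> Y S (insert i S) \<odot> q S \<odot> r"
          using nat_sq'[OF f Sin(3) T', of "p S \<odot> r"] ftop True by (simp add: x2_def)
        also have "\<dots> = Y S T \<odot> q S \<odot> r"
          using diag_comp[OF Y Sin(2,3) T'(1) _ T'(2)] by (metis cmp_assoc subset_insertI)
        finally show ?thesis .
      next
        case False
        then have Ta: "T \<in> above ?P S" using ab1 T by simp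
        then have TA: "T \<in> ?P" "S \<subseteq> T" by (auto simp: above_def)
        then show ?thesis
          using match_eq[OF m Ta] nat_sq'[OF pb_q[OF R] Sin(1) TA, of r] qu'[of T "x T"] False by (simp add: x2_def)
      qed
    qed
    moreover have "sol ?B X Y f S z' x2 (q S \<odot> r) e x' \<longleftrightarrow> sol ?P X R u S z' x r e x'" if e: "hom e z' z" for z' e x'
    proof
      assume s: "sol ?B X Y f S z' x2 (q S \<odot> r) e x'"
      show "sol ?P X R u S z' x r e x'"
      proof (rule solI)
        show "hom x' z' (V X S)" using sol_hom[OF s] .
        show "X S T \<odot> x' = x T \<odot> e" if "T \<in> above ?P S" for T
        proof -
          have "i \<notin> T" using that i by (auto simp: above_def)
          then show ?thesis using sol_fam[OF s, of T] ab1 that by (simp add: x2_def)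
        qed
        show "u S \<odot> x' = r \<odot> e"
        proof (rule pb_eqI[OF R Sin(1)])
          show "hom (u S \<odot> x') z' (V R S)" using hom_cmp[OF sol_hom[OF s] nat_hom[OF u Sin(1)]] .
          show "hom (r \<odot> e) z' (V R S)" using hom_cmp[OF e rh] .
          show "p S \<odot> u S \<odot> x' = p S \<odot> r \<odot> e"
            using pu'[OF S, of x'] sol_fam[OF s iab] x2top by simp
          show "q S \<odot> u S \<odot> x' = q S \<odot> r \<odot> e"
            using qu'[OF S, of x'] sol_eq[OF s] by simp
        qed
      qed
    next
      assume s: "sol ?P X R u S z' x r e x'"
      show "sol ?B X Y f S z' x2 (q S \<odot> r) e x'"
      proof (rule solI)
        show "hom x' z' (V X S)" using sol_hom[OF s] .
        show "f S \<odot> x' = (q S \<odot> r) \<odot> e" using qu'[OF S, of x'] sol_eq[OF s] by simp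
        have top: "X S (insert i S) \<odot> x' = p S \<odot> r \<odot> e"
          using pu'[OF S, of x'] sol_eq[OF s] by simp
        fix T assume T: "T \<in> above ?B S"
        show "X S T \<odot> x' = x2 T \<odot> e"
        proof (cases "i \<in> T")
          case True
          then have T': "T \<subseteq> insert i A" "insert i S \<subseteq> T" using ab2 T by auto
          have "X S T \<odot> x' = X (insert i S) T \<odot> X S (insert i S) \<odot> x'"
            using Xc[OF subset_insertI T'(2,1), of x'] by simp
          then show ?thesis using top True by (simp add: x2_def)
        next
          case False
          then show ?thesis using sol_fam[OF s, of T] ab1 T by (simp add: x2_def)
        qed
      qed
    qed
    ultimately show ?thesis by (intro exI[of _ x2] exI[of _ "q S \<odot> r"]) simp
  qed
  show "lifts ?B X Y f S \<longleftrightarrow> lifts ?P X R u S"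
    using lifting_transfer(1)[OF A] lifting_transfer(1)[OF B] by metis
  show "ulifts ?B X Y f S \<longleftrightarrow> ulifts ?P X R u S"
    using lifting_transfer(2)[OF A] lifting_transfer(2)[OF B] by metis
qed

section \<open>Cubical extensions\<close>

subsection \<open>The condition for a cube to be an extension\<close>

definition tt :: 'o where
  "tt = (SOME t. t \<in> Obj K \<and> (\<forall>z\<in>Obj K. \<exists>!u. hom u z t))"

lemma tt: "tt \<in> Obj K \<and> (\<forall>z\<in>Obj K. \<exists>!u. hom u z tt)"
proof -
  have "\<exists>t. t \<in> Obj K \<and> (\<forall>z\<in>Obj K. \<exists>!u. hom u z t)"
    using terminal unfolding Bex_def .
  from someI_ex[OF this] show ?thesis unfolding tt_def .
qed

lemma tt_unique: "hom u z tt \<Longrightarrow> hom v z tt \<Longrightarrow> u = v"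
proof -
  assume uv: "hom u z tt" "hom v z tt"
  then have "\<exists>!u. hom u z tt" using tt hom_Obj[of u z tt] by simp
  then obtain w where w: "\<forall>y. hom y z tt \<longrightarrow> y = w" by (elim ex1E)
  show "u = v" using mp[OF spec[OF w] uv(1)] mp[OF spec[OF w] uv(2)] by simp
qed

definition One :: "nat set \<Rightarrow> nat set \<Rightarrow> 'a" where
  "One S T = Id K tt"

definition bang :: "(nat set \<Rightarrow> nat set \<Rightarrow> 'a) \<Rightarrow> nat set \<Rightarrow> 'a" where
  "bang X S = (THE u. hom u (V X S) tt)"

lemma V_One: "V One S = tt"
  using Dom_Id tt by (simp add: V_def One_def)

lemma diag_One: "diag P One"
  unfolding diag_def V_One by (simp add: One_def tt hom_Id)

lemma rx_One: "rx \<phi> One = One"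
  by (intro ext) (simp add: rx_def One_def)

lemma bang_rx: "bang (rx \<phi> X) S = bang X (\<phi> S)"
  by (simp add: bang_def)

lemma bang_hom: "V X S \<in> Obj K \<Longrightarrow> hom (bang X S) (V X S) tt"
  unfolding bang_def by (rule theI'[OF bspec[OF conjunct2[OF tt]]])

lemma nat_bang: "diag P X \<Longrightarrow> nat_tr P X One (bang X)"
  unfolding nat_tr_def V_One
proof (intro conjI ballI impI)
  assume X: "diag P X"
  show b: "hom (bang X S) (V X S) tt" if "S \<in> P" for S
    using bang_hom diag_Obj[OF X that] .
  show "One S T \<odot> bang X S = bang X T \<odot> X S T" if "S \<in> P" "T \<in> P" "S \<subseteq> T" for S T
    using Id_cmp[OF b[OF that(1)]] b[OF that(1)] hom_cmp[OF diag_hom[OF X that] b[OF that(2)]] tt_unique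
    by (simp add: One_def)
qed

lemma bang_nat: "nat_tr P X Y f \<Longrightarrow> diag P X \<Longrightarrow> diag P Y \<Longrightarrow> S \<in> P \<Longrightarrow> bang Y S \<odot> f S = bang X S"
  by (rule tt_unique[OF hom_cmp[OF nat_hom[of P X Y f S] bang_hom] bang_hom]) (simp_all add: diag_Obj)

text \<open>Lifting along the map to the terminal cube only asks for extensions of compatible elements above \<open>S\<close>.
  At the last vertex there is nothing above, and lifting there would say that the vertex has global
  support; that vertex is left out.\<close>

definition extc :: "nat set \<Rightarrow> (nat set \<Rightarrow> nat set \<Rightarrow> 'a) \<Rightarrow> bool" where
  "extc A X \<longleftrightarrow> diag (Pow A) X \<and> (\<forall>S\<in>Pow A. S \<noteq> A \<longrightarrow> lifts (Pow A) X One (bang X) S)"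

lemma extc_diag: "extc A X \<Longrightarrow> diag (Pow A) X"
  by (simp add: extc_def)

lemma extc_agree:
  assumes X: "extc A X" and ag: "agree (Pow A) X X'"
  shows "extc A X'"
proof -
  have b: "bang X S = bang X' S" if "S \<in> Pow A" for S
    using agree_V[OF ag that] by (simp add: bang_def)
  show ?thesis
    using X agree_diag[OF ag] agree_lifting(1)[OF ag agree_refl[of _ One] b] unfolding extc_def by simp
qed

lemma extc_empty: "extc {} X \<longleftrightarrow> diag (Pow {}) X"
  by (simp add: extc_def)

lemma pbI:
  assumes "diag P R" "nat_tr P R X p" "nat_tr P R Y q" "\<And>S. S \<in> P \<Longrightarrow> f S \<odot> p S = g S \<odot> q S"
    "\<And>S z x y. S \<in> P \<Longrightarrow> hom x z (V X S) \<Longrightarrow> hom y z (V Y S) \<Longrightarrow> f S \<odot> x = g S \<odot> y \<Longrightarrow>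
       \<exists>u. hom u z (V R S) \<and> p S \<odot> u = x \<and> q S \<odot> u = y"
    "\<And>S z u v. S \<in> P \<Longrightarrow> hom u z (V R S) \<Longrightarrow> hom v z (V R S) \<Longrightarrow> p S \<odot> u = p S \<odot> v \<Longrightarrow> q S \<odot> u = q S \<odot> v \<Longrightarrow> u = v"
  shows "pb P X Y Z f g R p q"
  unfolding pb_def
proof (intro conjI ballI allI impI)
  fix S z x y assume S: "S \<in> P" and "hom x z (V X S) \<and> hom y z (V Y S) \<and> f S \<odot> x = g S \<odot> y"
  then have a: "hom x z (V X S)" "hom y z (V Y S)" "f S \<odot> x = g S \<odot> y" by simp_all
  obtain u where u: "hom u z (V R S)" "p S \<odot> u = x" "q S \<odot> u = y" using assms(5)[OF S a] by (elim exE conjE)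
  show "\<exists>!u. hom u z (V R S) \<and> p S \<odot> u = x \<and> q S \<odot> u = y"
  proof (intro ex1I[of _ u] conjI)
    show "v = u" if "hom v z (V R S) \<and> p S \<odot> v = x \<and> q S \<odot> v = y" for v
      by (rule assms(6)[OF S]) (use that u in simp_all)
  qed (use u in simp_all)
qed (use assms(1-4) in simp_all)

lemma pb_Id:
  assumes f: "nat_tr P X Z f" and X: "diag P X" and Z: "diag P Z"
  shows "pb P X Z Z f (\<lambda>S. Id K (V Z S)) X (\<lambda>S. Id K (V X S)) f"
proof (rule pbI[OF X nat_Id[OF X] f])
  show "f S \<odot> Id K (V X S) = Id K (V Z S) \<odot> f S" if "S \<in> P" for S
    using cmp_Id[OF nat_hom[OF f that]] Id_cmp[OF nat_hom[OF f that]] by simp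
  show "\<exists>u. hom u z (V X S) \<and> Id K (V X S) \<odot> u = x \<and> f S \<odot> u = y"
    if "S \<in> P" "hom x z (V X S)" "hom y z (V Z S)" "f S \<odot> x = Id K (V Z S) \<odot> y" for S z x y
    using that Id_cmp[OF that(2)] Id_cmp[OF that(3)] by (intro exI[of _ x]) simp
  show "u = v" if "hom u z (V X S)" "hom v z (V X S)" "Id K (V X S) \<odot> u = Id K (V X S) \<odot> v" for S z u v
    using that Id_cmp[OF that(1)] Id_cmp[OF that(2)] by simp
qed

text \<open>The instance of \<open>lifting_bot\<close> with terminal codomain, where the comparison map is the arrow between the two
  faces.\<close>

lemma lifting_bang:
  assumes i: "i \<notin> A" and W: "diag (Pow (insert i A)) W" and S: "S \<subseteq> A"
  shows "lifts (Pow (insert i A)) W One (bang W) S \<longleftrightarrow> lifts (Pow A) W (up i W) (dir i W) S"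
    and "ulifts (Pow (insert i A)) W One (bang W) S \<longleftrightarrow> ulifts (Pow A) W (up i W) (dir i W) S"
proof -
  let ?P = "Pow A"
  note upW = rx_diag[OF up_mono[OF i] W]
  have "pb ?P (up i W) One One (bang (up i W)) (\<lambda>S. Id K (V One S)) (up i W) (\<lambda>S. Id K (V (up i W) S)) (bang (up i W))"
    by (rule pb_Id[OF nat_bang[OF upW] upW diag_One])
  then have R: "pb ?P (up i W) One (up i One) (\<lambda>S. bang W (insert i S)) (dir i One) (up i W)
        (\<lambda>S. Id K (V (up i W) S)) (bang (up i W))"
    by (simp add: rx_One bang_rx[abs_def] dir_def[abs_def] One_def V_One)
  have p: "Id K (V (up i W) T) \<odot> dir i W T = dir i W T" if "T \<subseteq> A" for T
    using Id_cmp[OF nat_hom[OF nat_dir[OF i W], of T]] that by simp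
  have q: "bang (up i W) T \<odot> dir i W T = bang W T" if "T \<subseteq> A" for T
    using bang_nat[OF nat_dir[OF i W] diag_dn[OF W] upW] that by simp
  show "lifts (Pow (insert i A)) W One (bang W) S \<longleftrightarrow> lifts (Pow A) W (up i W) (dir i W) S"
    by (rule lifting_bot(1)[OF i W diag_One nat_bang[OF W] R nat_dir[OF i W] p q S])
  show "ulifts (Pow (insert i A)) W One (bang W) S \<longleftrightarrow> ulifts (Pow A) W (up i W) (dir i W) S"
    by (rule lifting_bot(2)[OF i W diag_One nat_bang[OF W] R nat_dir[OF i W] p q S])
qed

text \<open>Cutting a cube in the direction \<open>i\<close> recovers the recursive view of an extension as an arrow between
  extensions. The condition on the left does not single out a direction.\<close>

lemma extc_insert:
  assumes i: "i \<notin> A"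
  shows "extc (insert i A) W \<longleftrightarrow> diag (Pow (insert i A)) W \<and> extc A (up i W) \<and> emap (Pow A) W (up i W) (dir i W)"
proof (cases "diag (Pow (insert i A)) W")
  case W: True
  let ?B = "Pow (insert i A)" and ?P = "Pow A"
  note upW = rx_diag[OF up_mono[OF i] W]
  have top: "lifts ?B W One (bang W) (insert i S) \<longleftrightarrow> lifts ?P (up i W) One (bang (up i W)) S" if "S \<in> ?P" for S
    using rx_lifting(1)[OF iso_idx_insert[OF i] that, of W One "bang W"]
    by (simp add: rx_One bang_rx[abs_def])
  have bot: "lifts ?B W One (bang W) S \<longleftrightarrow> lifts ?P W (up i W) (dir i W) S" if "S \<subseteq> A" for S
    by (rule lifting_bang(1)[OF i W that])
  have split: "(\<forall>S\<in>?B. S \<noteq> insert i A \<longrightarrow> Q S) \<longleftrightarrow> (\<forall>S\<in>?P. S \<noteq> A \<longrightarrow> Q (insert i S)) \<and> (\<forall>S\<in>?P. Q S)" for Q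
  proof (intro iffI conjI ballI impI)
    assume a: "\<forall>S\<in>?B. S \<noteq> insert i A \<longrightarrow> Q S"
    show "Q (insert i S)" if "S \<in> ?P" "S \<noteq> A" for S
    proof -
      have "insert i S \<noteq> insert i A" "insert i S \<in> ?B" using that i by auto
      then show ?thesis using a by simp
    qed
    show "Q S" if "S \<in> ?P" for S
    proof -
      have "S \<noteq> insert i A" "S \<in> ?B" using that i by auto
      then show ?thesis using a by simp
    qed
  next
    fix S assume a: "(\<forall>S\<in>?P. S \<noteq> A \<longrightarrow> Q (insert i S)) \<and> (\<forall>S\<in>?P. Q S)" and S: "S \<in> ?B" "S \<noteq> insert i A"
    show "Q S"
    proof (cases "i \<in> S")
      case True
      then have "S = insert i (S - {i})" "S - {i} \<in> ?P" using S by auto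
      then show ?thesis using a S(2) by metis
    next
      case False
      then show ?thesis using a S by auto
    qed
  qed
  show ?thesis
    unfolding extc_def emap_def split using W upW diag_dn[OF W] nat_dir[OF i W] top bot by simp
qed (simp add: extc_def)

lemma extc_dom:
  assumes f: "emap (Pow A) X Y f" and Y: "extc A Y"
  shows "extc A X"
  unfolding extc_def
proof (intro conjI ballI impI)
  note X = emap_dom[OF f]
  show "diag (Pow A) X" by (rule X)
  fix S assume S: "S \<in> Pow A" "S \<noteq> A"
  have "lifts (Pow A) X One (\<lambda>T. bang Y T \<odot> f T) S"
    using lifts_comp[OF emap_nat[OF f] nat_bang[OF extc_diag[OF Y]] S(1) emap_lifts[OF f S(1)]] Y S
    by (simp add: extc_def)
  then show "lifts (Pow A) X One (bang X) S"
    using agree_lifting(1)[OF agree_refl agree_refl _ S(1), where f = "\<lambda>T. bang Y T \<odot> f T" and f' = "bang X"]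
      bang_nat[OF emap_nat[OF f] X extc_diag[OF Y]] by simp
qed

lemma extc_cod:
  assumes fin: "finite A" and f: "emap (Pow A) X Y f" and X: "extc A X"
  shows "extc A Y"
  unfolding extc_def
proof (intro conjI ballI impI)
  note Y = emap_cod[OF f]
  show "diag (Pow A) Y" by (rule Y)
  fix S assume S: "S \<in> Pow A" "S \<noteq> A"
  have "lifts (Pow A) X One (\<lambda>T. bang Y T \<odot> f T) S"
    using agree_lifting(1)[OF agree_refl agree_refl _ S(1), where f = "\<lambda>T. bang Y T \<odot> f T" and f' = "bang X"]
      bang_nat[OF emap_nat[OF f] extc_diag[OF X] Y] X S unfolding extc_def by simp
  then show "lifts (Pow A) Y One (bang Y) S"
    using lifts_cancel[OF _ f nat_bang[OF Y] S(1)] fin by simp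
qed

lemma extc_rx:
  assumes inj: "inj_on \<pi> A" and X: "extc (\<pi> ` A) X"
  shows "extc A (rx (image \<pi>) X)"
  unfolding extc_def
proof (intro conjI ballI impI)
  note iso = iso_idx_image[OF inj]
  show "diag (Pow A) (rx (image \<pi>) X)" using rx_diag[OF iso_mono[OF iso] extc_diag[OF X]] .
  fix S assume S: "S \<in> Pow A" "S \<noteq> A"
  then have "\<pi> ` S \<noteq> \<pi> ` A" using inj_on_image_eq_iff[OF inj, of S A] by simp
  moreover have "\<pi> ` S \<in> Pow (\<pi> ` A)" using S by auto
  ultimately have "lifts (Pow (\<pi> ` A)) X One (bang X) (\<pi> ` S)"
    using X by (simp add: extc_def)
  then show "lifts (Pow A) (rx (image \<pi>) X) One (bang (rx (image \<pi>) X)) S"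
    unfolding rx_lifting(1)[OF iso S(1)] by (simp add: rx_One bang_rx[abs_def])
qed

subsection \<open>Faces\<close>

text \<open>A lifting problem on the face at \<open>t\<close> becomes one on the whole cube by pushing all elements forward along
  the directions outside the face. The vertices of the whole cube over \<open>S\<close> itself are then filled in by the
  assumed lifts.\<close>

lemma lifts_at:
  assumes fin: "finite A" "finite B" and dis: "B \<inter> A = {}" and t: "t \<subseteq> A" and S: "S \<subseteq> B"
    and X: "diag (Pow (B \<union> A)) X" and Y: "diag (Pow (B \<union> A)) Y" and f: "nat_tr (Pow (B \<union> A)) X Y f"
    and l: "\<And>R. R \<subseteq> B \<union> A \<Longrightarrow> R \<inter> B = S \<Longrightarrow> lifts (Pow (B \<union> A)) X Y f R"
  shows "lifts (Pow B) (rx (\<lambda>S. S \<union> t) X) (rx (\<lambda>S. S \<union> t) Y) (\<lambda>S. f (S \<union> t)) S"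
  unfolding lifts_def
proof (intro allI impI)
  let ?P = "Pow (B \<union> A)"
  fix z x y assume m: "match (Pow B) (rx (\<lambda>S. S \<union> t) X) (rx (\<lambda>S. S \<union> t) Y) (\<lambda>S. f (S \<union> t)) S z x y"
  note xf = match_fam[OF m]
  have yh: "hom y z (V Y (S \<union> t))" using match_hom[OF m] by simp
  define W where "W = {R \<in> ?P. S \<union> t \<subseteq> R \<and> R \<inter> B \<noteq> S}"
  define U where "U = {R \<in> ?P. S \<union> t \<subseteq> R}"
  define x1 where "x1 R = X ((R \<inter> B) \<union> t) R \<odot> x (R \<inter> B)" for R
  define y1 where "y1 R = Y (S \<union> t) R \<odot> y" for R
  have St: "S \<union> t \<in> ?P" using S t by auto
  have Wb: "R \<inter> B \<in> above (Pow B) S" "(R \<inter> B) \<union> t \<in> ?P" "(R \<inter> B) \<union> t \<subseteq> R" "R \<in> ?P" if "R \<in> W" for R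
    using that S t by (auto simp: W_def above_def)
  have xh: "hom (x T) z (V X (T \<union> t))" if "T \<in> above (Pow B) S" for T
    using fam_hom[OF xf that] by simp
  have xc: "X (T \<union> t) (T' \<union> t) \<odot> x T = x T'" if "T \<in> above (Pow B) S" "T' \<in> above (Pow B) S" "T \<subseteq> T'" for T T'
    using fam_comp[OF xf that] by (simp add: rx_def)
  have f1: "fam X W z x1"
    unfolding fam_def
  proof (intro conjI ballI impI)
    show "z \<in> Obj K" using match_Obj[OF m] .
    show "hom (x1 R) z (V X R)" if "R \<in> W" for R
      unfolding x1_def using hom_cmp[OF xh[OF Wb(1)[OF that]] diag_hom[OF X Wb(2)[OF that] Wb(4)[OF that] Wb(3)[OF that]]] .
    fix R R' assume R: "R \<in> W" and R': "R' \<in> W" and le: "R \<subseteq> R'"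
    have le': "R \<inter> B \<union> t \<subseteq> R' \<inter> B \<union> t" using le by auto
    have "X R R' \<odot> x1 R = X (R \<inter> B \<union> t) R' \<odot> x (R \<inter> B)"
      unfolding x1_def using diag_comp[OF X Wb(2)[OF R] Wb(4)[OF R] Wb(4)[OF R'] Wb(3)[OF R] le] by (metis cmp_assoc)
    also have "\<dots> = X (R' \<inter> B \<union> t) R' \<odot> X (R \<inter> B \<union> t) (R' \<inter> B \<union> t) \<odot> x (R \<inter> B)"
      using diag_comp[OF X Wb(2)[OF R] Wb(2)[OF R'] Wb(4)[OF R'] le' Wb(3)[OF R']] by (metis cmp_assoc)
    also have "\<dots> = x1 R'"
      unfolding x1_def using xc[OF Wb(1)[OF R] Wb(1)[OF R'] Int_mono[OF le order_refl]] by simp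
    finally show "X R R' \<odot> x1 R = x1 R'" .
  qed
  have f2: "fam Y U z y1"
    unfolding fam_def
  proof (intro conjI ballI impI)
    show "z \<in> Obj K" using match_Obj[OF m] .
    show "hom (y1 R) z (V Y R)" if "R \<in> U" for R
      unfolding y1_def using hom_cmp[OF yh diag_hom[OF Y St]] that by (simp add: U_def)
    show "Y R R' \<odot> y1 R = y1 R'" if "R \<in> U" "R' \<in> U" "R \<subseteq> R'" for R R'
      using diag_comp[OF Y St, of R R'] that unfolding y1_def U_def by (auto simp flip: cmp_assoc)
  qed
  have "\<exists>z' e x'. cover e z' z \<and> fam X U z' x' \<and> (\<forall>R\<in>U. f R \<odot> x' R = y1 R \<odot> e) \<and> (\<forall>R\<in>W. x' R = x1 R \<odot> e)"
  proof (rule extend_lift[OF _ X f _ _ _ _ _ f1 f2])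
    show "finite ?P" using fin by simp
    show "U \<subseteq> ?P" "W \<subseteq> U" by (auto simp: U_def W_def)
    show "R' \<in> U" if "R \<in> U" "R' \<in> ?P" "R \<subseteq> R'" for R R' using that by (auto simp: U_def)
    show "R' \<in> W" if "R \<in> W" "R' \<in> ?P" "R \<subseteq> R'" for R R' using that S by (auto simp: W_def)
    show "lifts ?P X Y f R" if "R \<in> U - W" for R using that l by (auto simp: U_def W_def)
    fix R assume R: "R \<in> W"
    have "f R \<odot> x1 R = Y (R \<inter> B \<union> t) R \<odot> f (R \<inter> B \<union> t) \<odot> x (R \<inter> B)"
      unfolding x1_def using nat_sq'[OF f Wb(2)[OF R] Wb(4)[OF R] Wb(3)[OF R]] by simp
    also have "\<dots> = Y (R \<inter> B \<union> t) R \<odot> Y (S \<union> t) (R \<inter> B \<union> t) \<odot> y"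
      using match_eq[OF m Wb(1)[OF R]] by (simp add: rx_def)
    also have "\<dots> = y1 R"
    proof -
      have "S \<union> t \<subseteq> R \<inter> B \<union> t" using Wb(1)[OF R] by (auto simp: above_def)
      then show ?thesis
        unfolding y1_def using diag_comp[OF Y St Wb(2)[OF R] Wb(4)[OF R] _ Wb(3)[OF R]] by (metis cmp_assoc)
    qed
    finally show "f R \<odot> x1 R = y1 R" .
  qed
  then obtain z' e x' where e: "cover e z' z" and x': "fam X U z' x'"
    and fx: "\<forall>R\<in>U. f R \<odot> x' R = y1 R \<odot> e" and xx: "\<forall>R\<in>W. x' R = x1 R \<odot> e" by (elim exE conjE)
  have StU: "S \<union> t \<in> U" using St by (simp add: U_def)
  have "sol (Pow B) (rx (\<lambda>S. S \<union> t) X) (rx (\<lambda>S. S \<union> t) Y) (\<lambda>S. f (S \<union> t)) S z' x y e (x' (S \<union> t))"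
  proof (rule solI)
    show "hom (x' (S \<union> t)) z' (V (rx (\<lambda>S. S \<union> t) X) S)" using fam_hom[OF x' StU] by simp
    show "f (S \<union> t) \<odot> x' (S \<union> t) = y \<odot> e"
      using bspec[OF fx StU] diag_refl[OF Y St] Id_cmp[OF yh] by (simp add: y1_def)
    fix T assume T: "T \<in> above (Pow B) S"
    have TB: "(T \<union> t) \<inter> B = T" using T t dis by (auto simp: above_def)
    have "T \<noteq> S" "S \<subseteq> T" using T by (auto simp: above_def)
    then have TW: "T \<union> t \<in> W" using T t TB unfolding W_def above_def by auto
    then have TU: "T \<union> t \<in> U" by (simp add: U_def W_def)
    have "X (S \<union> t) (T \<union> t) \<odot> x' (S \<union> t) = x' (T \<union> t)"
      using fam_comp[OF x' StU TU Un_mono[OF \<open>S \<subseteq> T\<close> order_refl]] .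
    also have "\<dots> = x T \<odot> e"
      using bspec[OF xx TW] diag_refl[OF X Wb(4)[OF TW]] Id_cmp[OF xh[OF T]] by (simp add: x1_def TB flip: cmp_assoc)
    finally show "rx (\<lambda>S. S \<union> t) X S T \<odot> x' (S \<union> t) = x T \<odot> e" by (simp add: rx_def)
  qed
  then show "\<exists>z' e x'. cover e z' z \<and>
      sol (Pow B) (rx (\<lambda>S. S \<union> t) X) (rx (\<lambda>S. S \<union> t) Y) (\<lambda>S. f (S \<union> t)) S z' x y e x'"
    using e by meson
qed

abbreviation fc :: "nat set \<Rightarrow> (nat set \<Rightarrow> nat set \<Rightarrow> 'a) \<Rightarrow> nat set \<Rightarrow> nat set \<Rightarrow> 'a" where
  "fc t \<equiv> rx (\<lambda>S. S \<union> t)"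

lemma fc_mono: "t \<subseteq> A \<Longrightarrow> mono_idx (Pow B) (Pow (B \<union> A)) (\<lambda>S. S \<union> t)"
  by (auto simp: mono_idx_def)

lemma fc_emap:
  assumes "finite A" "finite B" "B \<inter> A = {}" "t \<subseteq> A" and f: "emap (Pow (B \<union> A)) X Y f"
  shows "emap (Pow B) (fc t X) (fc t Y) (\<lambda>S. f (S \<union> t))"
  using rx_diag[OF fc_mono[OF assms(4)] emap_dom[OF f]] rx_diag[OF fc_mono[OF assms(4)] emap_cod[OF f]]
    rx_nat[OF fc_mono[OF assms(4)] emap_nat[OF f]]
    lifts_at[OF assms(1-4) _ emap_dom[OF f] emap_cod[OF f] emap_nat[OF f]] emap_lifts[OF f]
  by (intro emapI) auto

lemma fc_extc:
  assumes "finite A" "finite B" "B \<inter> A = {}" "t \<subseteq> A" and X: "extc (B \<union> A) X"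
  shows "extc B (fc t X)"
  unfolding extc_def
proof (intro conjI ballI impI)
  show "diag (Pow B) (fc t X)" using rx_diag[OF fc_mono[OF assms(4)] extc_diag[OF X]] .
  fix S assume S: "S \<in> Pow B" "S \<noteq> B"
  have "lifts (Pow (B \<union> A)) X One (bang X) R" if "R \<subseteq> B \<union> A" "R \<inter> B = S" for R
  proof -
    have "R \<noteq> B \<union> A" using that S by auto
    then show ?thesis using X that by (simp add: extc_def)
  qed
  then show "lifts (Pow B) (fc t X) One (bang (fc t X)) S"
    using lifts_at[OF assms(1-4) _ extc_diag[OF X] diag_One nat_bang[OF extc_diag[OF X]], of S] S
    by (simp add: rx_One bang_rx[abs_def])
qed

subsection \<open>Isomorphisms\<close>

definition bij where
  "bij P X Y f \<longleftrightarrow> nat_tr P X Y f \<and>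
     (\<forall>S\<in>P. \<exists>h. hom h (V Y S) (V X S) \<and> h \<odot> f S = Id K (V X S) \<and> f S \<odot> h = Id K (V Y S))"

lemma bij_nat: "bij P X Y f \<Longrightarrow> nat_tr P X Y f"
  by (simp add: bij_def)

lemma bij_elem:
  assumes f: "bij P X Y f" and S: "S \<in> P" and y: "hom y z (V Y S)"
  shows "\<exists>!x. hom x z (V X S) \<and> f S \<odot> x = y"
proof -
  obtain h where h: "hom h (V Y S) (V X S)" "h \<odot> f S = Id K (V X S)" "f S \<odot> h = Id K (V Y S)"
    using f S unfolding bij_def by meson
  show ?thesis
  proof (intro ex1I[of _ "h \<odot> y"] conjI)
    show "hom (h \<odot> y) z (V X S)" using hom_cmp[OF y h(1)] .
    show "f S \<odot> h \<odot> y = y" using h(3) Id_cmp[OF y] by (metis cmp_assoc)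
    fix x assume x: "hom x z (V X S) \<and> f S \<odot> x = y"
    then have "h \<odot> y = (h \<odot> f S) \<odot> x" by simp
    then show "x = h \<odot> y" using h(2) Id_cmp[OF conjunct1[OF x]] by simp
  qed
qed

lemma bijI:
  assumes X: "diag P X" and Y: "diag P Y" and f: "nat_tr P X Y f"
    and ex: "\<And>S z y. S \<in> P \<Longrightarrow> hom y z (V Y S) \<Longrightarrow> \<exists>!x. hom x z (V X S) \<and> f S \<odot> x = y"
  shows "bij P X Y f"
  unfolding bij_def
proof (intro conjI ballI)
  show "nat_tr P X Y f" by (rule f)
  fix S assume S: "S \<in> P"
  note fS = nat_hom[OF f S]
  have "\<exists>!x. hom x (V Y S) (V X S) \<and> f S \<odot> x = Id K (V Y S)"
    using ex[OF S hom_Id[OF diag_Obj[OF Y S]]] .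
  then obtain h where h: "hom h (V Y S) (V X S)" "f S \<odot> h = Id K (V Y S)" by (elim ex1E conjE)
  have "f S \<odot> (h \<odot> f S) = f S" "f S \<odot> Id K (V X S) = f S"
    using h Id_cmp[OF fS] cmp_Id[OF fS] by (metis cmp_assoc)+
  moreover have "hom (h \<odot> f S) (V X S) (V X S)" "hom (Id K (V X S)) (V X S) (V X S)"
    using hom_cmp[OF fS h(1)] hom_Id[OF diag_Obj[OF X S]] .
  ultimately have "h \<odot> f S = Id K (V X S)" using ex[OF S fS] by metis
  then show "\<exists>h. hom h (V Y S) (V X S) \<and> h \<odot> f S = Id K (V X S) \<and> f S \<odot> h = Id K (V Y S)"
    using h by (intro exI[of _ h]) simp
qed

lemma bij_inverse:
  assumes X: "diag P X" and Y: "diag P Y" and f: "bij P X Y f"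
  shows "\<exists>g. nat_tr P Y X g \<and> (\<forall>S\<in>P. g S \<odot> f S = Id K (V X S) \<and> f S \<odot> g S = Id K (V Y S))"
proof -
  have "\<forall>S\<in>P. \<exists>h. hom h (V Y S) (V X S) \<and> h \<odot> f S = Id K (V X S) \<and> f S \<odot> h = Id K (V Y S)"
    using f by (simp add: bij_def)
  from bchoice[OF this] obtain g where
    g: "\<forall>S\<in>P. hom (g S) (V Y S) (V X S) \<and> g S \<odot> f S = Id K (V X S) \<and> f S \<odot> g S = Id K (V Y S)" by (elim exE)
  have "X S T \<odot> g S = g T \<odot> Y S T" if ST: "S \<in> P" "T \<in> P" "S \<subseteq> T" for S T
  proof -
    have gS: "hom (g S) (V Y S) (V X S)" "f S \<odot> g S = Id K (V Y S)" and gT: "g T \<odot> f T = Id K (V X T)"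
      using g ST by simp_all
    have "X S T \<odot> g S = g T \<odot> f T \<odot> X S T \<odot> g S"
      using gT Id_cmp[OF hom_cmp[OF gS(1) diag_hom[OF X ST]]] by (metis cmp_assoc)
    also have "\<dots> = g T \<odot> Y S T \<odot> f S \<odot> g S" using nat_sq'[OF bij_nat[OF f] ST, of "g S"] by simp
    also have "\<dots> = g T \<odot> Y S T" using gS(2) cmp_Id[OF diag_hom[OF Y ST]] by simp
    finally show ?thesis .
  qed
  then show ?thesis using g unfolding nat_tr_def by (intro exI[of _ g]) simp
qed

lemma bij_ulifts:
  assumes f: "bij P X Y f" and Y: "diag P Y" and X: "diag P X" and S: "S \<in> P"
  shows "ulifts P X Y f S"
  unfolding ulifts_iff
proof (intro allI impI)
  fix z x y assume m: "match P X Y f S z x y"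
  note fS = bij_nat[OF f]
  obtain x' where x': "hom x' z (V X S)" "f S \<odot> x' = y" and un: "\<And>v. hom v z (V X S) \<Longrightarrow> f S \<odot> v = y \<Longrightarrow> v = x'"
    using bij_elem[OF f S match_hom[OF m]] by metis
  have "X S T \<odot> x' = x T" if T: "T \<in> above P S" for T
  proof -
    have TP: "T \<in> P" "S \<subseteq> T" using above_in[OF T] by auto
    have "f T \<odot> X S T \<odot> x' = f T \<odot> x T"
      using nat_sq'[OF fS S TP, of x'] x'(2) match_eq[OF m T] by simp
    moreover have "hom (X S T \<odot> x') z (V X T)" "hom (x T) z (V X T)"
      using hom_cmp[OF x'(1) diag_hom[OF X S TP]] fam_hom[OF match_fam[OF m] T] .
    ultimately show ?thesis
      using bij_elem[OF f TP(1) hom_cmp[OF fam_hom[OF match_fam[OF m] T] nat_hom[OF fS TP(1)]]] by metis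
  qed
  then show "\<exists>!x'. hom x' z (V X S) \<and> f S \<odot> x' = y \<and> (\<forall>T\<in>above P S. X S T \<odot> x' = x T)"
  proof (intro ex1I[of _ x'] conjI)
    show "v = x'" if "hom v z (V X S) \<and> f S \<odot> v = y \<and> (\<forall>T\<in>above P S. X S T \<odot> v = x T)" for v
      by (rule un) (use that in simp_all)
  qed (use x' in simp_all)
qed

lemma bij_emap: "bij P X Y f \<Longrightarrow> diag P X \<Longrightarrow> diag P Y \<Longrightarrow> emap P X Y f"
  by (intro emapI bij_nat ulifts_lifts bij_ulifts)

lemma bij_Id: "diag P X \<Longrightarrow> bij P X X (\<lambda>S. Id K (V X S))"
proof (rule bijI)
  assume X: "diag P X"
  show "diag P X" "diag P X" "nat_tr P X X (\<lambda>S. Id K (V X S))" using X nat_Id by simp_all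
  show "\<exists>!x. hom x z (V X S) \<and> Id K (V X S) \<odot> x = y" if y: "hom y z (V X S)" for S z y
  proof (intro ex1I[of _ y] conjI)
    show "x = y" if "hom x z (V X S) \<and> Id K (V X S) \<odot> x = y" for x
      using Id_cmp[OF conjunct1[OF that]] that by simp
  qed (use y Id_cmp[OF y] in simp_all)
qed

text \<open>A regular epimorphism that is monic is invertible.\<close>

lemma emap_mono_bij:
  assumes fin: "finite P" and f: "emap P X Y f"
    and mono: "\<And>S z x x'. S \<in> P \<Longrightarrow> hom x z (V X S) \<Longrightarrow> hom x' z (V X S) \<Longrightarrow> f S \<odot> x = f S \<odot> x' \<Longrightarrow> x = x'"
  shows "bij P X Y f"
proof (rule bijI[OF emap_dom[OF f] emap_cod[OF f] emap_nat[OF f]])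
  fix S z y assume S: "S \<in> P" and y: "hom y z (V Y S)"
  note c = emap_cover[OF fin f S]
  have "\<exists>!h. hom h (V Y S) (V X S) \<and> h \<odot> f S = Id K (V X S)"
  proof (rule cover_factor[OF c])
    show "hom (Id K (V X S)) (V X S) (V X S)" using hom_Id[OF diag_Obj[OF emap_dom[OF f] S]] .
    show "Id K (V X S) \<odot> u = Id K (V X S) \<odot> v" if "hom u w (V X S)" "hom v w (V X S)" "f S \<odot> u = f S \<odot> v" for w u v
      using mono[OF S that] by simp
  qed
  then obtain h where h: "hom h (V Y S) (V X S)" "h \<odot> f S = Id K (V X S)" by (elim ex1E conjE)
  note fS = cover_hom[OF c]
  have "(f S \<odot> h) \<odot> f S = Id K (V Y S) \<odot> f S"
    using h cmp_Id[OF fS] Id_cmp[OF fS] by simp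
  then have fh: "f S \<odot> h = Id K (V Y S)"
    using cover_epi[OF c hom_cmp[OF h(1) fS] hom_Id[OF diag_Obj[OF emap_cod[OF f] S]]] by simp
  show "\<exists>!x. hom x z (V X S) \<and> f S \<odot> x = y"
  proof (intro ex1I[of _ "h \<odot> y"] conjI)
    show hy: "hom (h \<odot> y) z (V X S)" using hom_cmp[OF y h(1)] .
    show e: "f S \<odot> h \<odot> y = y" using fh Id_cmp[OF y] by (metis cmp_assoc)
    show "x = h \<odot> y" if "hom x z (V X S) \<and> f S \<odot> x = y" for x
      using mono[OF S _ hy] that e by simp
  qed
qed

subsection \<open>Mapping cubes\<close>

text \<open>The cube with one more direction \<open>i\<close> that represents the map \<open>f\<close>.\<close>

definition mapc :: "nat \<Rightarrow> (nat set \<Rightarrow> nat set \<Rightarrow> 'a) \<Rightarrow> (nat set \<Rightarrow> nat set \<Rightarrow> 'a) \<Rightarrow> (nat set \<Rightarrow> 'a) \<Rightarrow>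
    nat set \<Rightarrow> nat set \<Rightarrow> 'a" where
  "mapc i X Y f S T = (if i \<in> S then Y (S - {i}) (T - {i})
     else if i \<in> T then f (T - {i}) \<odot> X S (T - {i}) else X S T)"

lemma V_mapc: "V (mapc i X Y f) S = (if i \<in> S then V Y (S - {i}) else V X S)"
  by (simp add: V_def mapc_def)

lemma mapc_diag:
  assumes i: "i \<notin> A" and X: "diag (Pow A) X" and Y: "diag (Pow A) Y" and f: "nat_tr (Pow A) X Y f"
  shows "diag (Pow (insert i A)) (mapc i X Y f)"
  unfolding diag_def V_mapc
proof (intro conjI ballI impI)
  let ?B = "Pow (insert i A)" and ?P = "Pow A"
  have m: "S - {i} \<in> ?P" if "S \<in> ?B" for S using that by auto
  have m2: "S \<in> ?P" if "S \<in> ?B" "i \<notin> S" for S using that by auto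
  note Yh = diag_hom[OF Y m m] and Xh = diag_hom[OF X]
  fix S assume S: "S \<in> ?B"
  show "(if i \<in> S then V Y (S - {i}) else V X S) \<in> Obj K"
    using diag_Obj[OF Y m[OF S]] diag_Obj[OF X m2[OF S]] by simp
  show "mapc i X Y f S S = Id K (if i \<in> S then V Y (S - {i}) else V X S)"
    using diag_refl[OF Y m[OF S]] diag_refl[OF X m2[OF S]] by (simp add: mapc_def)
  fix T assume T: "T \<in> ?B"
  show "hom (mapc i X Y f S T) (if i \<in> S then V Y (S - {i}) else V X S) (if i \<in> T then V Y (T - {i}) else V X T)"
    if le: "S \<subseteq> T"
  proof (cases "i \<in> S")
    case True
    then have "i \<in> T" using le by auto
    then show ?thesis using Yh[OF S T] True le by (simp add: mapc_def Diff_mono)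
  next
    case False
    show ?thesis
    proof (cases "i \<in> T")
      case True
      have "S \<subseteq> T - {i}" using le False by auto
      then show ?thesis
        using hom_cmp[OF Xh[OF m2[OF S False] m[OF T]] nat_hom[OF f m[OF T]]] True False by (simp add: mapc_def)
    next
      case F: False
      then show ?thesis using Xh[OF m2[OF S False] m2[OF T F] le] False by (simp add: mapc_def)
    qed
  qed
  fix U assume U: "U \<in> ?B" and le: "S \<subseteq> T \<and> T \<subseteq> U"
  have ST: "S \<subseteq> T" and TU: "T \<subseteq> U" using le by auto
  have d: "S - {i} \<subseteq> T - {i}" "T - {i} \<subseteq> U - {i}" using le by auto
  show "mapc i X Y f T U \<odot> mapc i X Y f S T = mapc i X Y f S U"
  proof (cases "i \<in> S")
    case True
    then have "i \<in> T" "i \<in> U" using le by auto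
    then show ?thesis using diag_comp[OF Y m[OF S] m[OF T] m[OF U] d] True by (simp add: mapc_def)
  next
    case S': False
    then have S0: "S - {i} = S" by auto
    note SP = m2[OF S S']
    show ?thesis
    proof (cases "i \<in> T")
      case True
      then have "i \<in> U" using le by auto
      moreover have "Y (T - {i}) (U - {i}) \<odot> f (T - {i}) \<odot> X S (T - {i}) = f (U - {i}) \<odot> X S (U - {i})"
        using nat_sq'[OF f m[OF T] m[OF U] d(2)] diag_comp[OF X SP m[OF T] m[OF U]] d S0 by metis
      ultimately show ?thesis using True S' by (simp add: mapc_def)
    next
      case T': False
      then have T0: "T - {i} = T" by auto
      note TP = m2[OF T T']
      show ?thesis
      proof (cases "i \<in> U")
        case True
        have "X T (U - {i}) \<odot> X S T = X S (U - {i})"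
          using diag_comp[OF X SP TP m[OF U] ST] d T0 by simp
        then show ?thesis using True T' S' by (simp add: mapc_def)
      next
        case U': False
        then show ?thesis using diag_comp[OF X SP TP m2[OF U U'] ST TU] T' S' by (simp add: mapc_def)
      qed
    qed
  qed
qed

lemma mapc_dn: "i \<notin> A \<Longrightarrow> agree (Pow A) X (mapc i X Y f)"
  by (auto simp: agree_def mapc_def)

lemma mapc_up: "i \<notin> A \<Longrightarrow> agree (Pow A) Y (up i (mapc i X Y f))"
proof -
  assume i: "i \<notin> A"
  have "insert i S - {i} = S" if "S \<subseteq> A" for S using that i by auto
  then show ?thesis by (simp add: agree_def mapc_def rx_def)
qed

lemma mapc_dir:
  assumes i: "i \<notin> A" and X: "diag (Pow A) X" and f: "nat_tr (Pow A) X Y f" and S: "S \<in> Pow A"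
  shows "dir i (mapc i X Y f) S = f S"
proof -
  have "i \<notin> S" "insert i S - {i} = S" using S i by auto
  then show ?thesis using diag_refl[OF X S] cmp_Id[OF nat_hom[OF f S]] by (simp add: dir_def mapc_def)
qed

lemma extc_mapc:
  assumes i: "i \<notin> A" and X: "diag (Pow A) X" and Y: "diag (Pow A) Y" and f: "nat_tr (Pow A) X Y f"
  shows "extc (insert i A) (mapc i X Y f) \<longleftrightarrow> extc A Y \<and> emap (Pow A) X Y f"
proof -
  let ?W = "mapc i X Y f"
  note d = mapc_dn[OF i, of X Y f] and u = mapc_up[OF i, of Y X f]
  have "extc A (up i ?W) \<longleftrightarrow> extc A Y" using extc_agree u agree_sym by metis
  moreover have "emap (Pow A) ?W (up i ?W) (dir i ?W) \<longleftrightarrow> emap (Pow A) X Y f"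
    using agree_emap[OF d u, of f "dir i ?W"] agree_emap[OF agree_sym[OF d] agree_sym[OF u], of "dir i ?W" f]
      mapc_dir[OF i X f] by auto
  ultimately show ?thesis
    unfolding extc_insert[OF i] using mapc_diag[OF i X Y f] by simp
qed

subsection \<open>Discrete fibrations and the factorisation of a map through one\<close>

definition dfib where
  "dfib A X Y f \<longleftrightarrow> emap (Pow A) X Y f \<and> ulifts (Pow A) X Y f {}"

lemma dfib_emap: "dfib A X Y f \<Longrightarrow> emap (Pow A) X Y f"
  and dfib_u: "dfib A X Y f \<Longrightarrow> ulifts (Pow A) X Y f {}"
  by (simp_all add: dfib_def)

lemma dfib_comp:
  assumes f: "dfib A X Y f" and g: "dfib A Y Z g"
  shows "dfib A X Z (\<lambda>S. g S \<odot> f S)"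
  unfolding dfib_def
  using emap_comp[OF dfib_emap[OF f] dfib_emap[OF g]]
    ulifts_comp[OF emap_nat[OF dfib_emap[OF f]] emap_nat[OF dfib_emap[OF g]] _ dfib_u[OF f] dfib_u[OF g]] by simp

lemma dfib_pb:
  assumes R: "pb (Pow A) X Y Z f g R p q" and f: "dfib A X Z f" and Y: "diag (Pow A) Y" and g: "nat_tr (Pow A) Y Z g"
  shows "dfib A R Y q"
  unfolding dfib_def
  using pb_emap[OF R dfib_emap[OF f] Y g] pb_ulifts[OF R emap_dom[OF dfib_emap[OF f]] g _ dfib_u[OF f]] by simp

lemma dfib_bij: "bij (Pow A) X Y f \<Longrightarrow> diag (Pow A) X \<Longrightarrow> diag (Pow A) Y \<Longrightarrow> dfib A X Y f"
  unfolding dfib_def using bij_emap bij_ulifts by blast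

lemma dfib_agree:
  assumes "agree (Pow A) X X'" "agree (Pow A) Y Y'" "\<And>S. S \<in> Pow A \<Longrightarrow> f S = f' S" "dfib A X Y f"
  shows "dfib A X' Y' f'"
proof -
  have "ulifts (Pow A) X Y f {} \<longleftrightarrow> ulifts (Pow A) X' Y' f' {}"
    by (rule agree_lifting(2)[OF assms(1,2)]) (simp_all add: assms(3))
  moreover have "emap (Pow A) X' Y' f'"
    by (rule agree_emap[OF assms(1,2) _ dfib_emap[OF assms(4)]]) (simp add: assms(3))
  ultimately show ?thesis using dfib_u[OF assms(4)] unfolding dfib_def by simp
qed

lemma dfib_rx:
  assumes inj: "inj_on \<pi> A" and f: "dfib (\<pi> ` A) X Y f"
  shows "dfib A (rx (image \<pi>) X) (rx (image \<pi>) Y) (\<lambda>S. f (\<pi> ` S))"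
proof -
  have "ulifts (Pow (\<pi> ` A)) X Y f (\<pi> ` {}) \<longleftrightarrow>
      ulifts (Pow A) (rx (image \<pi>) X) (rx (image \<pi>) Y) (\<lambda>S. f (\<pi> ` S)) {}"
    by (rule rx_lifting(2)[OF iso_idx_image[OF inj]]) simp
  then show ?thesis
    unfolding dfib_def using rx_emap[OF iso_idx_image[OF inj] dfib_emap[OF f]] dfib_u[OF f] by simp
qed

lemma lifts_above:
  assumes "above P S = above P' S"
  shows "lifts P X Y f S = lifts P' X Y f S"
  using assms by (simp add: lifts_def match_def sol_def)

lemma lifts_local:
  assumes S: "S \<in> P" and X: "agree {T \<in> P. S \<subseteq> T} X X'" and Y: "agree {T \<in> P. S \<subseteq> T} Y Y'"
    and f: "\<And>T. T \<in> P \<Longrightarrow> S \<subseteq> T \<Longrightarrow> f T = f' T"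
  shows "lifts P X Y f S \<longleftrightarrow> lifts P X' Y' f' S"
proof -
  have "above P S = above {T \<in> P. S \<subseteq> T} S" by (auto simp: above_def)
  from lifts_above[OF this] show ?thesis
    using agree_lifting(1)[OF X Y, of f f' S] f S by simp
qed

text \<open>Replace the initial vertex of \<open>X\<close> by the limit of all data that a lifting problem at that vertex
  consists of, and leave the other vertices unchanged. Lifts at the initial vertex become unique, and the
  comparison from the old initial vertex to the limit is a regular epimorphism because \<open>f\<close> has local lifts.\<close>

lemma factor:
  assumes fin: "finite A" and f: "emap (Pow A) X Y f"
  shows "\<exists>X' r m. emap (Pow A) X X' r \<and> dfib A X' Y m \<and> (\<forall>S\<in>Pow A. m S \<odot> r S = f S) \<and>
     (\<forall>S\<in>Pow A. S \<noteq> {} \<longrightarrow> V X' S = V X S \<and> r S = Id K (V X S) \<and> m S = f S) \<and> agree (Pow A - {{}}) X X'"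
proof -
  let ?P = "Pow A"
  note X = emap_dom[OF f] and Y = emap_cod[OF f] and fn = emap_nat[OF f]
  \<comment> \<open>The data of a lifting problem at the initial vertex form a cone over the mapping cube without that vertex.\<close>
  obtain i where i: "i \<notin> A" using ex_new_if_finite[OF infinite_UNIV_nat fin] by blast
  define W where "W = mapc i X Y f"
  have W: "diag (Pow (insert i A)) W" unfolding W_def by (rule mapc_diag[OF i X Y fn])
  define Q where "Q = Pow (insert i A) - {{}}"
  have QW: "diag Q W" by (rule diag_mono[OF W]) (auto simp: Q_def)
  have Qf: "finite Q" using fin by (simp add: Q_def)
  obtain L \<pi> where \<pi>: "fam W Q L \<pi>"
    and un: "\<forall>z x. fam W Q z x \<longrightarrow> (\<exists>!u. hom u z L \<and> (\<forall>S\<in>Q. \<pi> S \<odot> u = x S))"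
    using finite_limit[OF Qf QW] by (elim exE conjE)
  have LO: "L \<in> Obj K" using fam_Obj[OF \<pi>] .
  have eqL: "u = v" if "hom u z L" "hom v z L" "\<And>T. T \<in> Q \<Longrightarrow> \<pi> T \<odot> u = \<pi> T \<odot> v" for u v z
  proof -
    have "fam W Q z (\<lambda>T. \<pi> T \<odot> v)"
      using fam_restrict[OF \<pi> that(2)] .
    then have "\<exists>!w. hom w z L \<and> (\<forall>S\<in>Q. \<pi> S \<odot> w = \<pi> S \<odot> v)" using un by simp
    then show ?thesis using that by metis
  qed
  have VW: "V W T = V X T" if "i \<notin> T" for T using that by (simp add: W_def V_mapc)
  have VWi: "V W (insert i T) = V Y T" if "T \<in> ?P" for T
  proof -
    have "insert i T - {i} = T" using that i by auto
    then show ?thesis by (simp add: W_def V_mapc)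
  qed
  have Wx: "W S T = X S T" if "i \<notin> T" "S \<subseteq> T" for S T using that by (auto simp: W_def mapc_def)
  have Wi: "W S (insert i T) = f T \<odot> X S T" if "S \<subseteq> T" "T \<in> ?P" for S T
  proof -
    have "insert i T - {i} = T" "i \<notin> S" using that i by auto
    then show ?thesis by (simp add: W_def mapc_def)
  qed
  have Wii: "W (insert i S) (insert i T) = Y S T" if "S \<in> ?P" "T \<in> ?P" for S T
  proof -
    have "insert i T - {i} = T" "insert i S - {i} = S" using that i by auto
    then show ?thesis by (simp add: W_def mapc_def)
  qed
  have inQ: "T \<in> ?P \<Longrightarrow> T \<noteq> {} \<Longrightarrow> T \<in> Q" "T \<in> ?P \<Longrightarrow> insert i T \<in> Q" for T by (auto simp: Q_def)
  have notin: "T \<in> ?P \<Longrightarrow> i \<notin> T" for T using i by auto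
  have Qcases: "(i \<notin> T \<and> T \<in> ?P \<and> T \<noteq> {}) \<or> (\<exists>T0\<in>?P. T = insert i T0)" if "T \<in> Q" for T
  proof (cases "i \<in> T")
    case True
    then have "T = insert i (T - {i})" "T - {i} \<in> ?P" using that by (auto simp: Q_def)
    then show ?thesis by blast
  next
    case False
    then show ?thesis using that by (auto simp: Q_def)
  qed
  define X' where "X' S T = (if S = {} then if T = {} then Id K L else \<pi> T else X S T)" for S T
  define m where "m S = (if S = {} then \<pi> {i} else f S)" for S
  have VX': "V X' S = (if S = {} then L else V X S)" for S
    using Dom_Id[OF LO] by (simp add: V_def X'_def)
  have \<pi>h: "hom (\<pi> T) L (V X T)" if "T \<in> ?P" "T \<noteq> {}" for T
    using fam_hom[OF \<pi> inQ(1)[OF that]] VW[OF notin[OF that(1)]] by simp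
  have \<pi>i: "hom (\<pi> (insert i T)) L (V Y T)" if "T \<in> ?P" for T
    using fam_hom[OF \<pi> inQ(2)[OF that]] VWi[OF that] by simp
  have \<pi>c: "X S T \<odot> \<pi> S = \<pi> T" if "S \<in> ?P" "T \<in> ?P" "S \<noteq> {}" "S \<subseteq> T" for S T
  proof -
    have "T \<noteq> {}" using that by auto
    then show ?thesis
      using fam_comp[OF \<pi> inQ(1)[OF that(1,3)] inQ(1)[OF that(2)] that(4)] Wx[OF notin[OF that(2)] that(4)] by simp
  qed
  have \<pi>f: "\<pi> (insert i T) = f T \<odot> \<pi> T" if "T \<in> ?P" "T \<noteq> {}" for T
    using fam_comp[OF \<pi> inQ(1)[OF that] inQ(2)[OF that(1)] subset_insertI] Wi[OF order_refl that(1)]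
      diag_refl[OF X that(1)] cmp_Id[OF nat_hom[OF fn that(1)]] by simp
  have \<pi>Y: "\<pi> (insert i T) = Y {} T \<odot> \<pi> {i}" if "T \<in> ?P" for T
    using fam_comp[OF \<pi> inQ(2)[of "{}"] inQ(2)[OF that]] Wii[of "{}" T] that by auto
  have X': "diag ?P X'"
    unfolding diag_def VX'
  proof (intro conjI ballI impI)
    fix S assume S: "S \<in> ?P"
    show "(if S = {} then L else V X S) \<in> Obj K" using LO diag_Obj[OF X S] by simp
    show "X' S S = Id K (if S = {} then L else V X S)" using diag_refl[OF X S] by (simp add: X'_def)
    fix T assume T: "T \<in> ?P"
    show "hom (X' S T) (if S = {} then L else V X S) (if T = {} then L else V X T)" if "S \<subseteq> T"
      using hom_Id[OF LO] \<pi>h[OF T] diag_hom[OF X S T that] that by (auto simp: X'_def)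
    fix U assume U: "U \<in> ?P" and le: "S \<subseteq> T \<and> T \<subseteq> U"
    show "X' T U \<odot> X' S T = X' S U"
    proof (cases "S = {}")
      case True
      show ?thesis
      proof (cases "T = {}")
        case True
        then show ?thesis using \<open>S = {}\<close> LO cmp_Id[OF \<pi>h[OF U]] by (simp add: X'_def)
      next
        case False
        then show ?thesis using True \<pi>c[OF T U False] le by (auto simp: X'_def)
      qed
    next
      case False
      then have "T \<noteq> {}" using le by auto
      then show ?thesis using False diag_comp[OF X S T U] le by (simp add: X'_def)
    qed
  qed
  have mn: "nat_tr ?P X' Y m"
    unfolding nat_tr_def VX'
  proof (intro conjI ballI impI)
    fix S assume S: "S \<in> ?P"
    show "hom (m S) (if S = {} then L else V X S) (V Y S)"
      using \<pi>i[of "{}"] nat_hom[OF fn S] by (simp add: m_def)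
    fix T assume T: "T \<in> ?P" and le: "S \<subseteq> T"
    show "Y S T \<odot> m S = m T \<odot> X' S T"
    proof (cases "S = {}")
      case True
      show ?thesis
      proof (cases "T = {}")
        case T0: True
        show ?thesis
          using True T0 diag_refl[OF Y T] Id_cmp[OF \<pi>i[of "{}"]] cmp_Id[OF \<pi>i[of "{}"]] by (simp add: m_def X'_def)
      next
        case False
        then show ?thesis using True \<pi>Y[OF T] \<pi>f[OF T False] by (simp add: m_def X'_def)
      qed
    next
      case False
      then have "T \<noteq> {}" using le by auto
      then show ?thesis using False nat_sq[OF fn S T le] by (simp add: m_def X'_def)
    qed
  qed
  have agX: "agree {T \<in> ?P. S \<subseteq> T} X X'" if "S \<noteq> {}" for S
    using that by (auto simp: agree_def X'_def)
  have mu: "ulifts ?P X' Y m {}"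
    unfolding ulifts_iff
  proof (intro allI impI)
    fix z x y assume mm: "match ?P X' Y m {} z x y"
    note xf = match_fam[OF mm]
    have ab: "T \<in> above ?P {} \<longleftrightarrow> T \<in> ?P \<and> T \<noteq> {}" for T by (auto simp: above_def)
    have xh: "hom (x T) z (V X T)" if "T \<in> ?P" "T \<noteq> {}" for T
      using fam_hom[OF xf, of T] that ab VX' by simp
    have yh: "hom y z (V Y {})" using match_hom[OF mm] .
    have fx: "f T \<odot> x T = Y {} T \<odot> y" if "T \<in> ?P" "T \<noteq> {}" for T
      using match_eq[OF mm, of T] that ab by (simp add: m_def)
    have xc: "X S T \<odot> x S = x T" if "S \<in> ?P" "S \<noteq> {}" "T \<in> ?P" "S \<subseteq> T" for S T
      using fam_comp[OF xf, of S T] that ab by (auto simp: X'_def)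
    define w where "w T = (if i \<in> T then Y {} (T - {i}) \<odot> y else x T)" for T
    have wx: "w T = x T" if "T \<in> ?P" for T using notin[OF that] by (simp add: w_def)
    have wi: "w (insert i T) = Y {} T \<odot> y" if "T \<in> ?P" for T
    proof -
      have "insert i T - {i} = T" using notin[OF that] by auto
      then show ?thesis by (simp add: w_def)
    qed
    have Yy: "Y S T \<odot> Y {} S \<odot> y = Y {} T \<odot> y" if "S \<in> ?P" "T \<in> ?P" "S \<subseteq> T" for S T
      using diag_comp[OF Y, of "{}" S T] that by (metis cmp_assoc empty_subsetI Pow_bottom)
    have wf: "fam W Q z w"
      unfolding fam_def
    proof (intro conjI ballI impI)
      show "z \<in> Obj K" using match_Obj[OF mm] .
      show "hom (w T) z (V W T)" if "T \<in> Q" for T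
        using Qcases[OF that]
      proof
        assume T: "i \<notin> T \<and> T \<in> ?P \<and> T \<noteq> {}"
        then show ?thesis using xh[of T] wx[of T] VW[of T] by simp
      next
        assume "\<exists>T0\<in>?P. T = insert i T0"
        then obtain T0 where T0: "T0 \<in> ?P" "T = insert i T0" by blast
        then show ?thesis using wi[OF T0(1)] VWi[OF T0(1)] hom_cmp[OF yh diag_hom[OF Y _ T0(1)]] by simp
      qed
      fix S T assume S: "S \<in> Q" and T: "T \<in> Q" and le: "S \<subseteq> T"
      show "W S T \<odot> w S = w T"
        using Qcases[OF S]
      proof
        assume "\<exists>S0\<in>?P. S = insert i S0"
        then obtain S0 where S0: "S0 \<in> ?P" "S = insert i S0" by blast
        then have "i \<in> T" using le by auto
        then obtain T0 where T0: "T0 \<in> ?P" "T = insert i T0" using Qcases[OF T] by blast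
        have "S0 \<subseteq> T0" using le S0 T0 notin[OF S0(1)] by auto
        then show ?thesis using Wii[OF S0(1) T0(1)] wi[OF S0(1)] wi[OF T0(1)] Yy[OF S0(1) T0(1)] S0 T0 by simp
      next
        assume S1: "i \<notin> S \<and> S \<in> ?P \<and> S \<noteq> {}"
        show ?thesis using Qcases[OF T]
        proof
          assume "i \<notin> T \<and> T \<in> ?P \<and> T \<noteq> {}"
          then show ?thesis using S1 xc[of S T] wx[of S] wx[of T] Wx[of T S] le by simp
        next
          assume "\<exists>T0\<in>?P. T = insert i T0"
          then obtain T0 where T0: "T0 \<in> ?P" "T = insert i T0" by blast
          have le0: "S \<subseteq> T0" using le S1 T0 by auto
          then have "T0 \<noteq> {}" using S1 by auto
          then show ?thesis
            using Wi[OF le0 T0(1)] wx[of S] S1 xc[of S T0] T0 le0 fx[of T0] wi[OF T0(1)] by simp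
        qed
      qed
    qed
    have i0: "w {i} = y" using wi[of "{}"] diag_refl[OF Y, of "{}"] Id_cmp[OF yh] by simp
    have "\<exists>!u. hom u z L \<and> (\<forall>S\<in>Q. \<pi> S \<odot> u = w S)" using un wf by simp
    then obtain u where u: "hom u z L" "\<forall>S\<in>Q. \<pi> S \<odot> u = w S" by (elim ex1E conjE)
    show "\<exists>!x'. hom x' z (V X' {}) \<and> m {} \<odot> x' = y \<and> (\<forall>T\<in>above ?P {}. X' {} T \<odot> x' = x T)"
    proof (intro ex1I[of _ u] conjI ballI)
      show "hom u z (V X' {})" using u VX' by simp
      show "m {} \<odot> u = y" using u inQ(2)[of "{}"] i0 by (simp add: m_def)
      show "X' {} T \<odot> u = x T" if "T \<in> above ?P {}" for T
        using u inQ(1)[of T] that ab wx[of T] by (simp add: X'_def)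
      fix v assume v: "hom v z (V X' {}) \<and> m {} \<odot> v = y \<and> (\<forall>T\<in>above ?P {}. X' {} T \<odot> v = x T)"
      show "v = u"
      proof (rule eqL)
        show "hom v z L" "hom u z L" using v u VX' by simp_all
        fix T assume T: "T \<in> Q"
        show "\<pi> T \<odot> v = \<pi> T \<odot> u"
          using Qcases[OF T]
        proof
          assume T1: "i \<notin> T \<and> T \<in> ?P \<and> T \<noteq> {}"
          then have "X' {} T \<odot> v = x T" using v ab by simp
          then show ?thesis using u T wx[of T] T1 by (simp add: X'_def)
        next
          assume "\<exists>T0\<in>?P. T = insert i T0"
          then obtain T0 where T0: "T0 \<in> ?P" "T = insert i T0" by blast
          have "\<pi> {i} \<odot> u = y" using u inQ(2)[of "{}"] i0 by simp
          moreover have "\<pi> {i} \<odot> v = y" using v by (simp add: m_def)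
          ultimately show ?thesis using \<pi>Y[OF T0(1)] T0(2) by simp
        qed
      qed
    qed
  qed
  have me: "emap ?P X' Y m"
  proof (rule emapI[OF X' Y mn])
    fix S assume S: "S \<in> ?P"
    show "lifts ?P X' Y m S"
    proof (cases "S = {}")
      case True
      then show ?thesis using ulifts_lifts[OF mu] by simp
    next
      case False
      have "lifts ?P X Y f S \<longleftrightarrow> lifts ?P X' Y m S"
        by (rule lifts_local[OF S agX[OF False] agree_refl]) (use False in \<open>auto simp: m_def\<close>)
      then show ?thesis using emap_lifts[OF f S] by simp
    qed
  qed
  have fW: "fam W Q (V X {}) (\<lambda>T. W {} T)"
    unfolding fam_def
  proof (intro conjI ballI impI)
    show "V X {} \<in> Obj K" using diag_Obj[OF X] by simp
    show "hom (W {} T) (V X {}) (V W T)" if "T \<in> Q" for T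
      using diag_hom[OF W, of "{}" T] that VW[of "{}"] by (simp add: Q_def)
    show "W S T \<odot> W {} S = W {} T" if "S \<in> Q" "T \<in> Q" "S \<subseteq> T" for S T
      using that by (intro diag_comp[OF W]) (auto simp: Q_def)
  qed
  then have "\<exists>!u. hom u (V X {}) L \<and> (\<forall>S\<in>Q. \<pi> S \<odot> u = W {} S)" using un by simp
  then obtain r0 where r0: "hom r0 (V X {}) L" "\<forall>S\<in>Q. \<pi> S \<odot> r0 = W {} S" by (elim ex1E conjE)
  define r where "r S = (if S = {} then r0 else Id K (V X S))" for S
  have r0x: "\<pi> T \<odot> r0 = X {} T" if "T \<in> ?P" "T \<noteq> {}" for T
    using r0(2) inQ(1)[OF that] Wx[OF notin[OF that(1)], of "{}"] by simp
  have r0i: "\<pi> {i} \<odot> r0 = f {}"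
    using r0(2) inQ(2)[of "{}"] Wi[of "{}" "{}"] diag_refl[OF X, of "{}"] cmp_Id[OF nat_hom[OF fn, of "{}"]] by simp
  have rn: "nat_tr ?P X X' r"
    unfolding nat_tr_def VX'
  proof (intro conjI ballI impI)
    fix S assume S: "S \<in> ?P"
    show "hom (r S) (V X S) (if S = {} then L else V X S)"
      using r0(1) hom_Id[OF diag_Obj[OF X S]] by (simp add: r_def)
    fix T assume T: "T \<in> ?P" and le: "S \<subseteq> T"
    show "X' S T \<odot> r S = r T \<odot> X S T"
    proof (cases "S = {}")
      case True
      show ?thesis
      proof (cases "T = {}")
        case T0: True
        then show ?thesis using True diag_refl[OF X T] Id_cmp[OF r0(1)] cmp_Id[OF r0(1)] by (simp add: r_def X'_def)
      next
        case False
        then show ?thesis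
          using True r0x[OF T False] Id_cmp[OF diag_hom[OF X, of "{}" T]] T by (simp add: r_def X'_def)
      qed
    next
      case False
      then have "T \<noteq> {}" using le by auto
      then show ?thesis
        using False Id_cmp[OF diag_hom[OF X S T le]] cmp_Id[OF diag_hom[OF X S T le]] by (simp add: r_def X'_def)
    qed
  qed
  have re: "emap ?P X X' r"
  proof (rule emapI[OF X X' rn])
    fix S assume S: "S \<in> ?P"
    show "lifts ?P X X' r S"
    proof (cases "S = {}")
      case False
      have "lifts ?P X X (\<lambda>S. Id K (V X S)) S \<longleftrightarrow> lifts ?P X X' r S"
        by (rule lifts_local[OF S agree_refl agX[OF False]]) (use False in \<open>auto simp: r_def\<close>)
      moreover have "lifts ?P X X (\<lambda>S. Id K (V X S)) S"
        using ulifts_lifts[OF bij_ulifts[OF bij_Id[OF X] X X S]] .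
      ultimately show ?thesis by simp
    next
      case True
      show ?thesis
        unfolding lifts_def
      proof (intro allI impI)
        fix z x l assume mm: "match ?P X X' r S z x l"
        note xf = match_fam[OF mm]
        have ab: "T \<in> above ?P {} \<longleftrightarrow> T \<in> ?P \<and> T \<noteq> {}" for T by (auto simp: above_def)
        have lh: "hom l z L" using match_hom[OF mm] True VX' by simp
        have xl: "\<pi> T \<odot> l = x T" if "T \<in> ?P" "T \<noteq> {}" for T
        proof -
          have "T \<in> above ?P S" using that ab True by simp
          then show ?thesis
            using match_eq[OF mm, of T] Id_cmp[OF fam_hom[OF xf, of T]] True that by (simp add: r_def X'_def)
        qed
        have "match ?P X Y f {} z x (\<pi> {i} \<odot> l)"
        proof (rule matchI)
          show "fam X (above ?P {}) z x" using xf True by simp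
          show "hom (\<pi> {i} \<odot> l) z (V Y {})" using hom_cmp[OF lh \<pi>i[of "{}"]] by simp
          show "f T \<odot> x T = Y {} T \<odot> \<pi> {i} \<odot> l" if "T \<in> above ?P {}" for T
          proof -
            have T: "T \<in> ?P" "T \<noteq> {}" using that ab by auto
            show ?thesis using xl[OF T] \<pi>f[OF T] \<pi>Y[OF T(1)] by (metis cmp_assoc)
          qed
        qed
        then obtain z' e x' where e: "cover e z' z" and s: "sol ?P X Y f {} z' x (\<pi> {i} \<odot> l) e x'"
          using emap_lifts[OF f, of "{}"] by (auto elim: liftsE)
        have "r0 \<odot> x' = l \<odot> e"
        proof (rule eqL)
          show "hom (r0 \<odot> x') z' L" using hom_cmp[OF sol_hom[OF s] r0(1)] .
          show "hom (l \<odot> e) z' L" using hom_cmp[OF cover_hom[OF e] lh] .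
          have b: "\<pi> {i} \<odot> r0 \<odot> x' = \<pi> {i} \<odot> l \<odot> e" using r0i sol_eq[OF s] by (metis cmp_assoc)
          fix T assume T: "T \<in> Q"
          show "\<pi> T \<odot> r0 \<odot> x' = \<pi> T \<odot> l \<odot> e"
            using Qcases[OF T]
          proof
            assume T1: "i \<notin> T \<and> T \<in> ?P \<and> T \<noteq> {}"
            then show ?thesis using r0x[of T] sol_fam[OF s, of T] ab xl[of T] by (metis cmp_assoc)
          next
            assume "\<exists>T0\<in>?P. T = insert i T0"
            then obtain T0 where T0: "T0 \<in> ?P" "T = insert i T0" by blast
            then show ?thesis using \<pi>Y[OF T0(1)] b by simp
          qed
        qed
        then have "sol ?P X X' r S z' x l e x'"
          using sol_hom[OF s] sol_fam[OF s] True by (intro solI) (simp_all add: r_def)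
        then show "\<exists>z' e x'. cover e z' z \<and> sol ?P X X' r S z' x l e x'" using e by meson
      qed
    qed
  qed
  have comp: "m S \<odot> r S = f S" if "S \<in> ?P" for S
    using r0i cmp_Id[OF nat_hom[OF fn that]] by (simp add: m_def r_def)
  show ?thesis
  proof (rule exI[of _ X'], rule exI[of _ r], rule exI[of _ m], intro conjI)
    show "emap ?P X X' r" by (rule re)
    show "dfib A X' Y m" using me mu by (simp add: dfib_def)
    show "\<forall>S\<in>?P. m S \<odot> r S = f S" using comp by simp
    show "\<forall>S\<in>?P. S \<noteq> {} \<longrightarrow> V X' S = V X S \<and> r S = Id K (V X S) \<and> m S = f S"
      using VX' by (simp add: r_def m_def)
    show "agree (?P - {{}}) X X'" by (auto simp: agree_def X'_def)
  qed
qed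

section \<open>Pasting of pullbacks\<close>

lemma pb_lift:
  assumes "pb P X Y Z f g R p q" "S \<in> P" "hom x z (V X S)" "hom y z (V Y S)" "f S \<odot> x = g S \<odot> y"
  obtains u where "hom u z (V R S)" "p S \<odot> u = x" "q S \<odot> u = y"
  using pb_ex[OF assms] by (elim ex1E conjE)

lemma pb_cong:
  assumes R: "pb P X Y Z f g R p q" and "\<And>S. S \<in> P \<Longrightarrow> f S = f' S" "\<And>S. S \<in> P \<Longrightarrow> g S = g' S"
    "\<And>S. S \<in> P \<Longrightarrow> p S = p' S" "\<And>S. S \<in> P \<Longrightarrow> q S = q' S"
  shows "pb P X Y Z f' g' R p' q'"
proof -
  have "nat_tr P R X p'" by (rule agree_nat[OF agree_refl agree_refl _ pb_p[OF R]]) (simp add: assms)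
  moreover have "nat_tr P R Y q'" by (rule agree_nat[OF agree_refl agree_refl _ pb_q[OF R]]) (simp add: assms)
  ultimately show ?thesis using R unfolding pb_def by (simp add: assms)
qed

lemma pb_bij:
  assumes R: "pb P X Y Z f g R' p' q'" and u: "bij P R R' u" and d: "diag P R"
    and p: "\<And>S. S \<in> P \<Longrightarrow> p' S \<odot> u S = p S" and q: "\<And>S. S \<in> P \<Longrightarrow> q' S \<odot> u S = q S"
  shows "pb P X Y Z f g R p q"
proof -
  have pu: "p' S \<odot> u S \<odot> a = p S \<odot> a" "q' S \<odot> u S \<odot> a = q S \<odot> a" if "S \<in> P" for S a
    using p[OF that] q[OF that] by (metis cmp_assoc)+
  show ?thesis
  proof (rule pbI[OF d])
    show "nat_tr P R X p"
      by (rule agree_nat[OF agree_refl agree_refl _ nat_comp[OF bij_nat[OF u] pb_p[OF R]]]) (simp add: p)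
    show "nat_tr P R Y q"
      by (rule agree_nat[OF agree_refl agree_refl _ nat_comp[OF bij_nat[OF u] pb_q[OF R]]]) (simp add: q)
    show "f S \<odot> p S = g S \<odot> q S" if "S \<in> P" for S
      using pb_sq'[OF R that, of "u S"] p q that by simp
  next
    fix S z x y assume S: "S \<in> P" and a: "hom x z (V X S)" "hom y z (V Y S)" "f S \<odot> x = g S \<odot> y"
    obtain r where r: "hom r z (V R' S)" "p' S \<odot> r = x" "q' S \<odot> r = y" by (rule pb_lift[OF R S a])
    obtain w where "hom w z (V R S)" "u S \<odot> w = r" using bij_elem[OF u S r(1)] by (elim ex1E conjE)
    then show "\<exists>w. hom w z (V R S) \<and> p S \<odot> w = x \<and> q S \<odot> w = y"
      using pu[OF S, of w] r by (intro exI[of _ w]) simp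
  next
    fix S z v w assume S: "S \<in> P" and v: "hom v z (V R S)" and w: "hom w z (V R S)"
      and e: "p S \<odot> v = p S \<odot> w" "q S \<odot> v = q S \<odot> w"
    note h = nat_hom[OF bij_nat[OF u] S]
    have "u S \<odot> v = u S \<odot> w"
      by (rule pb_eqI[OF R S hom_cmp[OF v h] hom_cmp[OF w h]]) (simp_all add: pu[OF S] e)
    then show "v = w" using bij_elem[OF u S hom_cmp[OF w h]] v w by metis
  qed
qed

lemma pb_paste:
  assumes X: "pb P Y W V' h g X f k" and b: "nat_tr P Z Y b" and R: "pb P X Z Y f b R p q"
  shows "pb P W Z V' g (\<lambda>S. h S \<odot> b S) R (\<lambda>S. k S \<odot> p S) q"
proof (rule pbI[OF pb_diag[OF R] nat_comp[OF pb_p[OF R] pb_q[OF X]] pb_q[OF R]])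
  show "g S \<odot> k S \<odot> p S = (h S \<odot> b S) \<odot> q S" if "S \<in> P" for S
    using pb_sq'[OF X that, of "p S"] pb_sq[OF R that] by simp
next
  fix S z w y assume S: "S \<in> P" and w: "hom w z (V W S)" and y: "hom y z (V Z S)" and e: "g S \<odot> w = (h S \<odot> b S) \<odot> y"
  obtain x where x: "hom x z (V X S)" "f S \<odot> x = b S \<odot> y" "k S \<odot> x = w"
    by (rule pb_lift[OF X S hom_cmp[OF y nat_hom[OF b S]] w]) (use e in auto)
  obtain r where r: "hom r z (V R S)" "p S \<odot> r = x" "q S \<odot> r = y"
    by (rule pb_lift[OF R S x(1) y x(2)])
  show "\<exists>u. hom u z (V R S) \<and> (k S \<odot> p S) \<odot> u = w \<and> q S \<odot> u = y"
    using r x by (intro exI[of _ r]) simp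
next
  fix S z u v assume S: "S \<in> P" and u: "hom u z (V R S)" and v: "hom v z (V R S)"
    and e: "(k S \<odot> p S) \<odot> u = (k S \<odot> p S) \<odot> v" "q S \<odot> u = q S \<odot> v"
  note ph = nat_hom[OF pb_p[OF R] S]
  have "p S \<odot> u = p S \<odot> v"
  proof (rule pb_eqI[OF X S hom_cmp[OF u ph] hom_cmp[OF v ph]])
    show "f S \<odot> p S \<odot> u = f S \<odot> p S \<odot> v" using pb_sq'[OF R S] e(2) by simp
    show "k S \<odot> p S \<odot> u = k S \<odot> p S \<odot> v" using e(1) by simp
  qed
  then show "u = v" using pb_eqI[OF R S u v] e(2) by simp
qed

lemma pb_paste_cancel:
  assumes X: "pb P Y W V' h g X f k" and b: "nat_tr P Z Y b" and R: "pb P W Z V' g (\<lambda>S. h S \<odot> b S) R m q"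
  shows "\<exists>p. pb P X Z Y f b R p q \<and> (\<forall>S\<in>P. k S \<odot> p S = m S)"
proof -
  have "\<exists>p. nat_tr P R X p \<and> (\<forall>S\<in>P. f S \<odot> p S = b S \<odot> q S \<and> k S \<odot> p S = m S)"
    by (rule pb_induced[OF X pb_diag[OF R] nat_comp[OF pb_q[OF R] b] pb_p[OF R]]) (simp add: pb_sq[OF R])
  then obtain p where p: "nat_tr P R X p" and fp: "\<And>S. S \<in> P \<Longrightarrow> f S \<odot> p S = b S \<odot> q S"
    and kp: "\<And>S. S \<in> P \<Longrightarrow> k S \<odot> p S = m S" by (elim exE conjE) simp
  have "pb P X Z Y f b R p q"
  proof (rule pbI[OF pb_diag[OF R] p pb_q[OF R] fp])
    fix S z x y assume S: "S \<in> P" and x: "hom x z (V X S)" and y: "hom y z (V Z S)" and e: "f S \<odot> x = b S \<odot> y"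
    note kx = hom_cmp[OF x nat_hom[OF pb_q[OF X] S]]
    have "g S \<odot> k S \<odot> x = (h S \<odot> b S) \<odot> y" using pb_sq'[OF X S, of x] e by simp
    then obtain r where r: "hom r z (V R S)" "m S \<odot> r = k S \<odot> x" "q S \<odot> r = y"
      by (rule pb_lift[OF R S kx y])
    have "p S \<odot> r = x"
    proof (rule pb_eqI[OF X S hom_cmp[OF r(1) nat_hom[OF p S]] x])
      show "f S \<odot> p S \<odot> r = f S \<odot> x" using fp[OF S] r(3) e by (metis cmp_assoc)
      show "k S \<odot> p S \<odot> r = k S \<odot> x" using kp[OF S] r(2) by (metis cmp_assoc)
    qed
    then show "\<exists>u. hom u z (V R S) \<and> p S \<odot> u = x \<and> q S \<odot> u = y" using r by (intro exI[of _ r]) simp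
  next
    fix S z u v assume S: "S \<in> P" and u: "hom u z (V R S)" and v: "hom v z (V R S)"
      and e: "p S \<odot> u = p S \<odot> v" "q S \<odot> u = q S \<odot> v"
    have "m S \<odot> u = m S \<odot> v" using kp[OF S] e(1) by (metis cmp_assoc)
    then show "u = v" using pb_eqI[OF R S u v] e(2) by simp
  qed
  then show ?thesis using kp by (intro exI[of _ p] conjI ballI) simp_all
qed

end

section \<open>Coverings of cubes\<close>

text \<open>What is used of a family of strongly Birkhoff Galois structures on cubes of all dimensions: \<open>B k\<close> is the
  reflective subcategory, \<open>F k\<close> the reflection of objects and \<open>eta k\<close> the unit. The reflection of a
  morphism is determined by naturality of the unit and is therefore not a separate parameter.\<close>

locale cube_galois = regular_base K null
  for K :: "('o, 'a) cat" and null :: 'a +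
  fixes B :: "nat \<Rightarrow> (nat set \<Rightarrow> nat set \<Rightarrow> 'a) \<Rightarrow> bool"
    and F :: "nat \<Rightarrow> (nat set \<Rightarrow> nat set \<Rightarrow> 'a) \<Rightarrow> nat set \<Rightarrow> nat set \<Rightarrow> 'a"
    and eta :: "nat \<Rightarrow> (nat set \<Rightarrow> nat set \<Rightarrow> 'a) \<Rightarrow> nat set \<Rightarrow> 'a"
  assumes B_extc: "B k X \<Longrightarrow> extc {..<k} X"
    and B_iso: "B k X \<Longrightarrow> bij (Pow {..<k}) X Y f \<Longrightarrow> diag (Pow {..<k}) Y \<Longrightarrow> B k Y"
    and F_B: "extc {..<k} X \<Longrightarrow> B k (F k X)"
    and eta_emap: "extc {..<k} X \<Longrightarrow> emap (Pow {..<k}) X (F k X) (eta k X)"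
    and F_univ: "extc {..<k} X \<Longrightarrow> B k Z \<Longrightarrow> nat_tr (Pow {..<k}) X Z h \<Longrightarrow>
       \<exists>g. nat_tr (Pow {..<k}) (F k X) Z g \<and> (\<forall>S\<in>Pow {..<k}. g S \<odot> eta k X S = h S)"
    and birkhoff: "emap (Pow {..<k}) X Y f \<Longrightarrow> extc {..<k} Y \<Longrightarrow> nat_tr (Pow {..<k}) (F k X) (F k Y) g \<Longrightarrow>
       (\<forall>S\<in>Pow {..<k}. g S \<odot> eta k X S = eta k Y S \<odot> f S) \<Longrightarrow>
       pb (Pow {..<k}) Y (F k X) (F k Y) (eta k Y) g R p q \<Longrightarrow> nat_tr (Pow {..<k}) X R u \<Longrightarrow>
       (\<forall>S\<in>Pow {..<k}. p S \<odot> u S = f S \<and> q S \<odot> u S = eta k X S) \<Longrightarrow> emap (Pow {..<k}) X R u"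
begin

definition triv where
  "triv k X Y f \<longleftrightarrow> emap (Pow {..<k}) X Y f \<and> extc {..<k} Y \<and>
     (\<exists>g. nat_tr (Pow {..<k}) (F k X) (F k Y) g \<and> (\<forall>S\<in>Pow {..<k}. g S \<odot> eta k X S = eta k Y S \<odot> f S) \<and>
        pb (Pow {..<k}) Y (F k X) (F k Y) (eta k Y) g X f (eta k X))"

definition cube_covering where
  "cube_covering k X Y f \<longleftrightarrow> (\<exists>Q e R p q. extc {..<k} Q \<and> emap (Pow {..<k}) Q Y e \<and>
     pb (Pow {..<k}) X Q Y f e R p q \<and> triv k R Q q)"

lemma fin: "finite (Pow {..<k :: nat})" "finite {..<k :: nat}"
  by simp_all

lemma B_diag: "B k X \<Longrightarrow> diag (Pow {..<k}) X"
  using B_extc extc_diag by metis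

lemma F_univE:
  assumes "extc {..<k} X" "B k Z" "nat_tr (Pow {..<k}) X Z h"
  obtains g where "nat_tr (Pow {..<k}) (F k X) Z g" "\<And>S. S \<in> Pow {..<k} \<Longrightarrow> g S \<odot> eta k X S = h S"
  using F_univ[OF assms] by (elim exE conjE) simp

lemma F_map:
  assumes X: "extc {..<k} X" and Y: "extc {..<k} Y" and f: "nat_tr (Pow {..<k}) X Y f"
  obtains g where "nat_tr (Pow {..<k}) (F k X) (F k Y) g" "\<And>S. S \<in> Pow {..<k} \<Longrightarrow> g S \<odot> eta k X S = eta k Y S \<odot> f S"
  using F_univ[OF X F_B[OF Y] nat_comp[OF f emap_nat[OF eta_emap[OF Y]]]] by (elim exE conjE) simp

lemma F_map_emap:
  assumes f: "emap (Pow {..<k}) X Y f" and Y: "extc {..<k} Y" and g: "nat_tr (Pow {..<k}) (F k X) (F k Y) g"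
    and eq: "\<And>S. S \<in> Pow {..<k} \<Longrightarrow> g S \<odot> eta k X S = eta k Y S \<odot> f S"
  shows "emap (Pow {..<k}) (F k X) (F k Y) g"
proof (rule emap_cancel[OF fin(1) eta_emap[OF extc_dom[OF f Y]] g])
  show "emap (Pow {..<k}) X (F k Y) (\<lambda>T. g T \<odot> eta k X T)"
    by (rule agree_emap[OF agree_refl agree_refl _ emap_comp[OF f eta_emap[OF Y]]]) (simp add: eq)
qed

lemma eta_bij_B:
  assumes X: "extc {..<k} X" and b: "bij (Pow {..<k}) X (F k X) (eta k X)"
  shows "B k X"
proof -
  note Xd = extc_diag[OF X] and Fd = B_diag[OF F_B[OF X]]
  obtain g where g: "nat_tr (Pow {..<k}) (F k X) X g"
    "\<forall>S\<in>Pow {..<k}. g S \<odot> eta k X S = Id K (V X S) \<and> eta k X S \<odot> g S = Id K (V (F k X) S)"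
    using bij_inverse[OF Xd Fd b] by (elim exE conjE)
  have "bij (Pow {..<k}) (F k X) X g"
    unfolding bij_def using g nat_hom[OF emap_nat[OF eta_emap[OF X]]] by (metis (no_types))
  then show ?thesis using B_iso[OF F_B[OF X]] Xd by metis
qed

lemma B_eta_bij:
  assumes B: "B k X"
  shows "bij (Pow {..<k}) X (F k X) (eta k X)"
proof (rule emap_mono_bij[OF fin(1) eta_emap[OF B_extc[OF B]]])
  obtain g where g: "nat_tr (Pow {..<k}) (F k X) X g" "\<And>S. S \<in> Pow {..<k} \<Longrightarrow> g S \<odot> eta k X S = Id K (V X S)"
    by (rule F_univE[OF B_extc[OF B] B nat_Id[OF B_diag[OF B]]], rule that, assumption, simp)
  fix S z x x' assume S: "S \<in> Pow {..<k}" and x: "hom x z (V X S)" and x': "hom x' z (V X S)"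
    and e: "eta k X S \<odot> x = eta k X S \<odot> x'"
  then have "(g S \<odot> eta k X S) \<odot> x = (g S \<odot> eta k X S) \<odot> x'" by simp
  then show "x = x'" using g(2)[OF S] Id_cmp[OF x] Id_cmp[OF x'] by simp
qed

text \<open>Admissibility: for the pullback of an extension inside the subcategory, the comparison map to the
  pullback of its reflection is an extension by the strong Birkhoff property, and a monomorphism
  because the projection into the subcategory factors through the unit.\<close>

lemma admissible:
  assumes X: "B k X" and Y: "B k Y" and \<phi>: "emap (Pow {..<k}) X Y \<phi>" and Z: "extc {..<k} Z"
    and b: "nat_tr (Pow {..<k}) Z Y b" and R: "pb (Pow {..<k}) X Z Y \<phi> b R p q"
  shows "triv k R Z q"
proof -
  let ?P = "Pow {..<k}"
  have q: "emap ?P R Z q" using pb_emap[OF R \<phi> extc_diag[OF Z] b] .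
  have Re: "extc {..<k} R" using extc_dom[OF q Z] .
  obtain g where g: "nat_tr ?P (F k R) (F k Z) g" and gq: "\<And>S. S \<in> ?P \<Longrightarrow> g S \<odot> eta k R S = eta k Z S \<odot> q S"
    by (rule F_map[OF Re Z emap_nat[OF q]], rule that, assumption, simp)
  obtain h where h: "nat_tr ?P (F k R) X h" and hp: "\<And>S. S \<in> ?P \<Longrightarrow> h S \<odot> eta k R S = p S"
    by (rule F_univE[OF Re X pb_p[OF R]], rule that, assumption, simp)
  note eZ = eta_emap[OF Z] and eR = eta_emap[OF Re]
  obtain R' p' q' where R': "pb ?P Z (F k R) (F k Z) (eta k Z) g R' p' q'"
    using pb_exists[OF extc_diag[OF Z] emap_cod[OF eR] emap_cod[OF eZ] emap_nat[OF eZ] g] by (elim exE)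
  obtain u where u: "nat_tr ?P R R' u" "\<forall>S\<in>?P. p' S \<odot> u S = q S \<and> q' S \<odot> u S = eta k R S"
    using pb_induced[OF R' pb_diag[OF R] emap_nat[OF q] emap_nat[OF eR]] gq by (metis (no_types, lifting))
  have ue: "emap ?P R R' u"
    by (rule birkhoff[OF q Z g _ R' u]) (simp add: gq)
  have "bij ?P R R' u"
  proof (rule emap_mono_bij[OF fin(1) ue])
    fix S z x x' assume S: "S \<in> ?P" and x: "hom x z (V R S)" "hom x' z (V R S)" and e: "u S \<odot> x = u S \<odot> x'"
    have "q S \<odot> x = q S \<odot> x'" "eta k R S \<odot> x = eta k R S \<odot> x'"
      using u(2) S e by (metis cmp_assoc)+
    moreover from this have "p S \<odot> x = p S \<odot> x'" using hp[OF S] by (metis cmp_assoc)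
    ultimately show "x = x'" using pb_eqI[OF R S x] by simp
  qed
  then have "pb ?P Z (F k R) (F k Z) (eta k Z) g R q (eta k R)"
    by (rule pb_bij[OF R' _ pb_diag[OF R]]) (use u(2) in simp_all)
  then show ?thesis
    unfolding triv_def using q Z g gq by (intro conjI exI[of _ g]) simp_all
qed

lemma triv_emap: "triv k X Y f \<Longrightarrow> emap (Pow {..<k}) X Y f"
  and triv_cod: "triv k X Y f \<Longrightarrow> extc {..<k} Y"
  by (simp_all add: triv_def)

lemma triv_dom: "triv k X Y f \<Longrightarrow> extc {..<k} X"
  using extc_dom triv_emap triv_cod by metis

lemma trivE:
  assumes "triv k X Y f"
  obtains g where "nat_tr (Pow {..<k}) (F k X) (F k Y) g" "\<And>S. S \<in> Pow {..<k} \<Longrightarrow> g S \<odot> eta k X S = eta k Y S \<odot> f S"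
    "pb (Pow {..<k}) Y (F k X) (F k Y) (eta k Y) g X f (eta k X)"
  using assms unfolding triv_def by (elim conjE exE) simp

text \<open>By pasting, the pullback of a trivial covering is also a pullback of its reflection, so admissibility
  applies.\<close>

lemma triv_pb:
  assumes f: "triv k X Y f" and Z: "extc {..<k} Z" and b: "nat_tr (Pow {..<k}) Z Y b"
    and R: "pb (Pow {..<k}) X Z Y f b R p q"
  shows "triv k R Z q"
proof -
  obtain g where g: "nat_tr (Pow {..<k}) (F k X) (F k Y) g" "\<And>S. S \<in> Pow {..<k} \<Longrightarrow> g S \<odot> eta k X S = eta k Y S \<odot> f S"
    "pb (Pow {..<k}) Y (F k X) (F k Y) (eta k Y) g X f (eta k X)"
    by (rule trivE[OF f], rule that, assumption, simp, assumption)
  note Y = triv_cod[OF f] and X = triv_dom[OF f]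
  show ?thesis
    by (rule admissible[OF F_B[OF X] F_B[OF Y] F_map_emap[OF triv_emap[OF f] Y g(1,2)] Z
          nat_comp[OF b emap_nat[OF eta_emap[OF Y]]] pb_paste[OF g(3) b R]])
qed

lemma triv_comp:
  assumes f: "triv k X Y f" and f': "triv k Y Z f'"
  shows "triv k X Z (\<lambda>S. f' S \<odot> f S)"
proof -
  let ?P = "Pow {..<k}"
  obtain g where g: "nat_tr ?P (F k X) (F k Y) g" "\<And>S. S \<in> ?P \<Longrightarrow> g S \<odot> eta k X S = eta k Y S \<odot> f S"
    "pb ?P Y (F k X) (F k Y) (eta k Y) g X f (eta k X)" by (rule trivE[OF f], rule that, assumption, simp, assumption)
  obtain g' where g': "nat_tr ?P (F k Y) (F k Z) g'" "\<And>S. S \<in> ?P \<Longrightarrow> g' S \<odot> eta k Y S = eta k Z S \<odot> f' S"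
    "pb ?P Z (F k Y) (F k Z) (eta k Z) g' Y f' (eta k Y)" by (rule trivE[OF f'], rule that, assumption, simp, assumption)
  have "(g' S \<odot> g S) \<odot> eta k X S = eta k Z S \<odot> f' S \<odot> f S" if "S \<in> ?P" for S
    using g(2)[OF that] g'(2)[OF that] by (metis cmp_assoc)
  then show ?thesis
    unfolding triv_def using emap_comp[OF triv_emap[OF f] triv_emap[OF f']] triv_cod[OF f']
      nat_comp[OF g(1) g'(1)] pb_paste[OF pb_sym[OF g'(3)] g(1) g(3)]
    by (intro conjI exI[of _ "\<lambda>S. g' S \<odot> g S"]) simp_all
qed

lemma bij_triv:
  assumes f: "bij (Pow {..<k}) X Y f" and X: "diag (Pow {..<k}) X" and Y: "extc {..<k} Y"
  shows "triv k X Y f"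
proof -
  let ?P = "Pow {..<k}"
  note e = eta_emap[OF Y]
  have Fd: "diag ?P (F k Y)" using emap_cod[OF e] .
  have "pb ?P (F k Y) Y (F k Y) (\<lambda>S. Id K (V (F k Y) S)) (eta k Y) X (\<lambda>S. eta k Y S \<odot> f S) f"
  proof (rule pb_bij[OF pb_sym[OF pb_Id[OF emap_nat[OF e] extc_diag[OF Y] Fd]] f X])
    show "Id K (V Y S) \<odot> f S = f S" if "S \<in> ?P" for S
      using Id_cmp[OF nat_hom[OF bij_nat[OF f] that]] .
  qed simp
  then show ?thesis
    using admissible[OF F_B[OF Y] F_B[OF Y] bij_emap[OF bij_Id[OF Fd] Fd Fd] Y emap_nat[OF e]] by metis
qed

text \<open>Both projections factor through the unit of \<open>R\<close> and are jointly monic, so the unit is monic.\<close>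

lemma B_pb:
  assumes X: "B k X" and Z: "B k Z" and \<phi>: "emap (Pow {..<k}) X Y \<phi>"
    and b: "nat_tr (Pow {..<k}) Z Y b" and R: "pb (Pow {..<k}) X Z Y \<phi> b R p q"
  shows "B k R"
proof (rule eta_bij_B)
  let ?P = "Pow {..<k}"
  show Re: "extc {..<k} R" using extc_dom[OF pb_emap[OF R \<phi> B_diag[OF Z] b] B_extc[OF Z]] .
  obtain h where h: "nat_tr ?P (F k R) X h" "\<And>S. S \<in> ?P \<Longrightarrow> h S \<odot> eta k R S = p S"
    by (rule F_univE[OF Re X pb_p[OF R]], rule that, assumption, simp)
  obtain h' where h': "nat_tr ?P (F k R) Z h'" "\<And>S. S \<in> ?P \<Longrightarrow> h' S \<odot> eta k R S = q S"
    by (rule F_univE[OF Re Z pb_q[OF R]], rule that, assumption, simp)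
  show "bij ?P R (F k R) (eta k R)"
  proof (rule emap_mono_bij[OF fin(1) eta_emap[OF Re]])
    fix S z x x' assume S: "S \<in> ?P" and x: "hom x z (V R S)" "hom x' z (V R S)" and e: "eta k R S \<odot> x = eta k R S \<odot> x'"
    have "p S \<odot> x = p S \<odot> x'" "q S \<odot> x = q S \<odot> x'" using h(2)[OF S] h'(2)[OF S] e by (metis cmp_assoc)+
    then show "x = x'" using pb_eqI[OF R S x] by simp
  qed
qed

text \<open>Closure under quotients along extensions: the unit of the quotient is shown to be a monomorphism by
  lifting two elements that it identifies through the strong Birkhoff comparison map.\<close>

lemma B_quotient:
  assumes X: "B k X" and f: "emap (Pow {..<k}) X Y f"
  shows "B k Y"
proof (rule eta_bij_B)
  let ?P = "Pow {..<k}"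
  note Xe = B_extc[OF X]
  show Y: "extc {..<k} Y" using extc_cod[OF fin(2) f Xe] .
  note eX = eta_emap[OF Xe] and eY = eta_emap[OF Y]
  obtain g where g: "nat_tr ?P (F k X) (F k Y) g" "\<And>S. S \<in> ?P \<Longrightarrow> g S \<odot> eta k X S = eta k Y S \<odot> f S"
    by (rule F_map[OF Xe Y emap_nat[OF f]], rule that, assumption, simp)
  obtain R p q where R: "pb ?P Y (F k X) (F k Y) (eta k Y) g R p q"
    using pb_exists[OF emap_cod[OF f] emap_cod[OF eX] emap_cod[OF eY] emap_nat[OF eY] g(1)] by (elim exE)
  obtain u where u: "nat_tr ?P X R u" "\<forall>S\<in>?P. p S \<odot> u S = f S \<and> q S \<odot> u S = eta k X S"
    using pb_induced[OF R emap_dom[OF f] emap_nat[OF f] emap_nat[OF eX]] g(2) by (metis (no_types, lifting))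
  have ue: "emap ?P X R u"
    by (rule birkhoff[OF f Y g(1) _ R u]) (simp add: g(2))
  show "bij ?P Y (F k Y) (eta k Y)"
  proof (rule emap_mono_bij[OF fin(1) eY])
    fix S z y y' assume S: "S \<in> ?P" and y: "hom y z (V Y S)" and y': "hom y' z (V Y S)"
      and e: "eta k Y S \<odot> y = eta k Y S \<odot> y'"
    obtain z1 e1 x where 1: "cover e1 z1 z" "hom x z1 (V X S)" "f S \<odot> x = y \<odot> e1"
      by (rule lift_element[OF fin(1) f S y])
    have ye: "hom (y' \<odot> e1) z1 (V Y S)" using hom_cmp[OF cover_hom[OF 1(1)] y'] .
    have ex: "hom (eta k X S \<odot> x) z1 (V (F k X) S)" using hom_cmp[OF 1(2) nat_hom[OF emap_nat[OF eX] S]] .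
    have "eta k Y S \<odot> y' \<odot> e1 = g S \<odot> eta k X S \<odot> x"
      using g(2)[OF S] 1(3) e by (metis cmp_assoc)
    then obtain r where r: "hom r z1 (V R S)" "p S \<odot> r = y' \<odot> e1" "q S \<odot> r = eta k X S \<odot> x"
      by (rule pb_lift[OF R S ye ex])
    obtain z2 e2 x' where 2: "cover e2 z2 z1" "hom x' z2 (V X S)" "u S \<odot> x' = r \<odot> e2"
      by (rule lift_element[OF fin(1) ue S r(1)])
    have xe: "hom (x \<odot> e2) z2 (V X S)" using hom_cmp[OF cover_hom[OF 2(1)] 1(2)] .
    have "eta k X S \<odot> x' = eta k X S \<odot> x \<odot> e2"
      using u(2) S 2(3) r(3) by (metis cmp_assoc)
    then have "x' = x \<odot> e2"
      using bij_elem[OF B_eta_bij[OF X] S hom_cmp[OF xe nat_hom[OF emap_nat[OF eX] S]]] xe 2(2) by metis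
    then have "(y \<odot> e1) \<odot> e2 = (y' \<odot> e1) \<odot> e2"
      using u(2) S 2(3) r(2) 1(3) by (metis cmp_assoc)
    then have "y \<odot> e1 = y' \<odot> e1"
      using cover_epi[OF 2(1) hom_cmp[OF cover_hom[OF 1(1)] y] ye] by simp
    then show "y = y'" using cover_epi[OF 1(1) y y'] by simp
  qed
qed

end

text \<open>An object of \<open>B (k + 1)\<close> is a covering for the \<open>k\<close>-th Galois structure, regarded as a cube with the
  additional direction \<open>k\<close>.\<close>

locale cube_tower = cube_galois K null B F eta
  for K :: "('o, 'a) cat" and null B F eta +
  assumes B_Suc: "B (Suc k) W \<longleftrightarrow> extc {..<Suc k} W \<and> cube_covering k W (up k W) (dir k W)"
begin

lemma extc_Suc: "extc {..<Suc k} W \<longleftrightarrow>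
    diag (Pow {..<Suc k}) W \<and> extc {..<k} (up k W) \<and> emap (Pow {..<k}) W (up k W) (dir k W)"
  using extc_insert[OF notin_lessThan, of k W] by (simp add: lessThan_Suc)

text \<open>By admissibility an extension between objects of the subcategory is a trivial covering.\<close>

lemma B_arrow:
  assumes W: "extc {..<Suc k} W" and B0: "B k W" and B1: "B k (up k W)"
  shows "B (Suc k) W"
proof -
  let ?P = "Pow {..<k}"
  have d: "emap ?P W (up k W) (dir k W)" and ue: "extc {..<k} (up k W)" using W by (simp_all add: extc_Suc)
  note ud = extc_diag[OF ue]
  have R: "pb ?P W (up k W) (up k W) (dir k W) (\<lambda>S. Id K (V (up k W) S)) W (\<lambda>S. Id K (V W S)) (dir k W)"
    using pb_Id[OF emap_nat[OF d] emap_dom[OF d] ud] .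
  have "triv k W (up k W) (dir k W)"
    using admissible[OF B0 B1 d ue nat_Id[OF ud] R] .
  then have "cube_covering k W (up k W) (dir k W)"
    unfolding cube_covering_def using ue bij_emap[OF bij_Id[OF ud] ud ud] R by (metis (no_types))
  then show ?thesis using W by (simp add: B_Suc)
qed

lemma B_vertices:
  "extc {..<n} X \<Longrightarrow> (\<And>S. S \<subseteq> {..<n} \<Longrightarrow> B 0 (fc S X)) \<Longrightarrow> B n X"
proof (induction n arbitrary: X)
  case 0
  have "fc {} X = X" by (intro ext) (simp add: rx_def)
  then show ?case using 0(2)[of "{}"] by simp
next
  case (Suc n)
  have up: "extc {..<n} (up n X)" and dn: "extc {..<n} X"
    using Suc(2) extc_dom unfolding extc_Suc by metis+
  have "B n X" using Suc(1)[OF dn] Suc(3) by (simp add: lessThan_Suc subset_insertI2)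
  moreover have "B 0 (fc S (up n X))" if "S \<subseteq> {..<n}" for S
  proof -
    have "fc S (up n X) = fc (insert n S) X" by (intro ext) (simp add: rx_def)
    moreover have "insert n S \<subseteq> {..<Suc n}" using that by auto
    ultimately show ?thesis using Suc(3)[of "insert n S"] by simp
  qed
  then have "B n (up n X)" using Suc(1)[OF up] by simp
  ultimately show ?case using B_arrow[OF Suc(2)] by simp
qed

text \<open>In dimension zero a discrete fibration is an isomorphism.\<close>

lemma dfib_triv_0:
  assumes f: "dfib {..<0} X Y f" and Y: "extc {..<0} Y"
  shows "triv 0 X Y f"
proof (rule bij_triv[OF _ emap_dom[OF dfib_emap[OF f]] Y])
  note fe = dfib_emap[OF f]
  show "bij (Pow {..<0}) X Y f"
  proof (rule bijI[OF emap_dom[OF fe] emap_cod[OF fe] emap_nat[OF fe]])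
    fix S z y assume S: "S \<in> Pow {..<0 :: nat}" and y: "hom y z (V Y S)"
    have S0: "S = {}" using S by simp
    have ab: "above (Pow {..<0}) {} = {}" "above {{}} {} = {}" by (auto simp: above_def)
    have "match (Pow {..<0}) X Y f {} z (\<lambda>_. null) y"
      using y S0 hom_Obj[OF y] by (intro matchI) (simp_all add: ab fam_def)
    from ulifts_ex[OF dfib_u[OF f] this] show "\<exists>!x. hom x z (V X S) \<and> f S \<odot> x = y"
      by (simp add: ab S0)
  qed
qed

text \<open>A discrete fibration over a covering is a covering: factor it as a discrete fibration one dimension
  lower, which is a trivial covering, followed by the pullback of the given covering.\<close>

lemma dfib_B_step:
  assumes IH: "\<And>X Y f. dfib {..<k} X Y f \<Longrightarrow> extc {..<k} Y \<Longrightarrow> triv k X Y f"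
    and f: "dfib {..<Suc k} X Y f" and Y: "B (Suc k) Y"
  shows "B (Suc k) X"
proof -
  let ?P = "Pow {..<k}"
  let ?B = "Pow (insert k {..<k})"
  note L = lessThan_Suc[of k]
  have fe: "emap ?B X Y f" and fu: "ulifts ?B X Y f {}" using f by (simp_all add: dfib_def L)
  note Xd = emap_dom[OF fe] and Yd = emap_cod[OF fe] and fn = emap_nat[OF fe]
  have Ye: "extc {..<Suc k} Y" using B_extc[OF Y] .
  have Xe: "extc {..<Suc k} X" using extc_dom[OF _ Ye] fe by (simp add: L)
  have dX: "emap ?P X (up k X) (dir k X)" and uX: "extc {..<k} (up k X)" using Xe by (simp_all add: extc_Suc)
  have dY: "emap ?P Y (up k Y) (dir k Y)" and uY: "extc {..<k} (up k Y)" using Ye by (simp_all add: extc_Suc)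
  let ?f1 = "\<lambda>S. f (insert k S)"
  have f1: "emap ?P (up k X) (up k Y) ?f1" using rx_emap[OF iso_idx_insert[OF notin_lessThan] fe] .
  have f1n: "nat_tr ?P (up k X) (up k Y) ?f1" using emap_nat[OF f1] .
  obtain Q e R p q where Q: "extc {..<k} Q" "emap ?P Q (up k Y) e"
    and R: "pb ?P Y Q (up k Y) (dir k Y) e R p q" and q: "triv k R Q q"
    using Y unfolding B_Suc cube_covering_def by (elim conjE exE)
  obtain R1 p1 q1 where R1: "pb ?P (up k X) Y (up k Y) ?f1 (dir k Y) R1 p1 q1"
    using pb_exists[OF extc_diag[OF uX] emap_dom[OF dY] extc_diag[OF uY] f1n emap_nat[OF dY]] by (elim exE)
  have sqf: "?f1 S \<odot> dir k X S = dir k Y S \<odot> f S" if "S \<in> ?P" for S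
  proof -
    have "S \<in> ?B" "insert k S \<in> ?B" using that by auto
    then show ?thesis using nat_sq[OF fn, of S "insert k S"] by (simp add: dir_def subset_insertI)
  qed
  obtain u where u: "nat_tr ?P X R1 u" and pu: "\<And>S. S \<in> ?P \<Longrightarrow> p1 S \<odot> u S = dir k X S"
    and qu: "\<And>S. S \<in> ?P \<Longrightarrow> q1 S \<odot> u S = f S"
    using pb_induced[OF R1 emap_dom[OF dX] emap_nat[OF dX] nat_dn[OF fn]] sqf by (metis (no_types, lifting))
  have ud: "dfib {..<k} X R1 u"
    unfolding dfib_def
  proof
    have pu': "p1 S \<odot> u S = dir k X S" and qu': "q1 S \<odot> u S = f S" if "S \<subseteq> {..<k}" for S
      using pu qu that by simp_all
    note lb = lifting_bot[OF notin_lessThan Xd Yd fn R1 u pu' qu']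
    show "emap ?P X R1 u"
      by (rule emapI[OF emap_dom[OF dX] pb_diag[OF R1] u]) (use lb(1) emap_lifts[OF fe] in auto)
    show "ulifts ?P X R1 u {}" using lb(2)[of "{}"] fu by simp
  qed
  obtain Q' a e' where Q': "pb ?P Q (up k X) (up k Y) e ?f1 Q' a e'"
    using pb_exists[OF extc_diag[OF Q(1)] extc_diag[OF uX] extc_diag[OF uY] emap_nat[OF Q(2)] f1n] by (elim exE)
  have e': "emap ?P Q' (up k X) e'" using pb_emap[OF Q' Q(2) extc_diag[OF uX] f1n] .
  have Q'e: "extc {..<k} Q'" using extc_dom[OF e' uX] .
  obtain R3 s q3 where R3: "pb ?P R Q' Q q a R3 s q3"
    using pb_exists[OF pb_diag[OF R] pb_diag[OF Q'] extc_diag[OF Q(1)] pb_q[OF R] pb_p[OF Q']] by (elim exE)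
  have t3: "triv k R3 Q' q3" using triv_pb[OF q Q'e pb_p[OF Q'] R3] .
  have "pb ?P Y Q' (up k Y) (dir k Y) (\<lambda>S. e S \<odot> a S) R3 (\<lambda>S. p S \<odot> s S) q3"
    using pb_paste[OF pb_sym[OF R] pb_p[OF Q'] R3] .
  then have pR3: "pb ?P Y Q' (up k Y) (dir k Y) (\<lambda>S. ?f1 S \<odot> e' S) R3 (\<lambda>S. p S \<odot> s S) q3"
    by (rule pb_cong) (simp_all add: pb_sq[OF Q'])
  obtain p3 where R3': "pb ?P R1 Q' (up k X) p1 e' R3 p3 q3"
    using pb_paste_cancel[OF R1 pb_q[OF Q'] pR3] by (elim exE conjE)
  obtain R2 p2 v where R2: "pb ?P X R3 R1 u p3 R2 p2 v"
    using pb_exists[OF emap_dom[OF dX] pb_diag[OF R3] pb_diag[OF R1] u pb_p[OF R3']] by (elim exE)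
  have "dfib {..<k} R2 R3 v" using dfib_pb[OF R2 ud pb_diag[OF R3] pb_p[OF R3']] .
  then have t2: "triv k R2 R3 v" using IH triv_dom[OF t3] by metis
  have "pb ?P Q' X (up k X) e' (\<lambda>S. p1 S \<odot> u S) R2 (\<lambda>S. q3 S \<odot> v S) p2"
    using pb_paste[OF R3' u pb_sym[OF R2]] .
  then have "pb ?P Q' X (up k X) e' (dir k X) R2 (\<lambda>S. q3 S \<odot> v S) p2"
    by (rule pb_cong) (simp_all add: pu)
  then have "cube_covering k X (up k X) (dir k X)"
    unfolding cube_covering_def using Q'e e' triv_comp[OF t2 t3] pb_sym by (metis (no_types))
  then show ?thesis using Xe by (simp add: B_Suc)
qed

text \<open>In positive dimension a discrete fibration is a trivial covering. The unit can be factored through a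
  discrete fibration over the reflection, whose domain is again a covering; by universality the unit is
  then a monomorphism away from the initial vertex. Hence the domain of the given discrete fibration is
  the pullback, along the unit of its codomain, of a discrete fibration between coverings.\<close>

lemma dfib_triv_step:
  assumes IH: "\<And>X Y f. dfib {..<k} X Y f \<Longrightarrow> B k Y \<Longrightarrow> B k X"
    and f: "dfib {..<k} X Y f" and Y: "extc {..<k} Y"
  shows "triv k X Y f"
proof -
  let ?P = "Pow {..<k}"
  note fe = dfib_emap[OF f] and eY = eta_emap[OF Y]
  note Xd = emap_dom[OF fe] and Yd = emap_cod[OF fe] and fn = emap_nat[OF fe] and en = emap_nat[OF eY]
  have e0: "{} \<in> ?P" by simp
  obtain Y' r m where r: "emap ?P Y Y' r" and m: "dfib {..<k} Y' (F k Y) m"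
    and mr: "\<forall>S\<in>?P. m S \<odot> r S = eta k Y S"
    and rS: "\<forall>S\<in>?P. S \<noteq> {} \<longrightarrow> V Y' S = V Y S \<and> r S = Id K (V Y S) \<and> m S = eta k Y S"
    using factor[OF fin(2) eY] by (elim exE conjE)
  have "B k Y'" using IH[OF m F_B[OF Y]] .
  then obtain h where h: "nat_tr ?P (F k Y) Y' h" "\<And>S. S \<in> ?P \<Longrightarrow> h S \<odot> eta k Y S = r S"
    using F_univE[OF Y _ emap_nat[OF r]] by metis
  have mono: "y = y'" if "S \<in> ?P" "S \<noteq> {}" "hom y z (V Y S)" "hom y' z (V Y S)" "eta k Y S \<odot> y = eta k Y S \<odot> y'" for S z y y'
  proof -
    have "r S \<odot> y = r S \<odot> y'" using h(2)[OF that(1)] that(5) by (metis cmp_assoc)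
    then show ?thesis using rS that Id_cmp[OF that(3)] Id_cmp[OF that(4)] by simp
  qed
  let ?ef = "\<lambda>S. eta k Y S \<odot> f S"
  obtain Z r2 n where r2: "emap ?P X Z r2" and n: "dfib {..<k} Z (F k Y) n"
    and nr: "\<forall>S\<in>?P. n S \<odot> r2 S = ?ef S"
    and r2S: "\<forall>S\<in>?P. S \<noteq> {} \<longrightarrow> V Z S = V X S \<and> r2 S = Id K (V X S) \<and> n S = ?ef S"
    and ag: "agree (?P - {{}}) X Z"
    using factor[OF fin(2) emap_comp[OF fe eY]] by (elim exE conjE)
  have ZB: "B k Z" using IH[OF n F_B[OF Y]] .
  note Zd = emap_cod[OF r2] and nn = emap_nat[OF dfib_emap[OF n]]
  have ab: "T \<in> above ?P {} \<longleftrightarrow> T \<in> ?P \<and> T \<noteq> {}" for T by (auto simp: above_def)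
  have nr': "n S \<odot> r2 S \<odot> x = eta k Y S \<odot> f S \<odot> x" if "S \<in> ?P" for S x
    using nr that by (metis cmp_assoc)
  have r2e: "X {} T \<odot> v = Z {} T \<odot> r2 {} \<odot> v" if "T \<in> ?P" "T \<noteq> {}" "hom v z (V X {})" for T v z
  proof -
    have "hom (X {} T \<odot> v) z (V X T)" using hom_cmp[OF that(3) diag_hom[OF Xd e0 that(1)]] by simp
    then show ?thesis
      using nat_sq'[OF emap_nat[OF r2] e0 that(1), of v] r2S that(1,2) Id_cmp by simp
  qed
  have "pb ?P Z Y (F k Y) n (eta k Y) X r2 f"
  proof (rule pbI[OF Xd emap_nat[OF r2] fn])
    show "n S \<odot> r2 S = eta k Y S \<odot> f S" if "S \<in> ?P" for S using nr that by simp
  next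
    fix S z w y assume S: "S \<in> ?P" and w: "hom w z (V Z S)" and y: "hom y z (V Y S)" and e: "n S \<odot> w = eta k Y S \<odot> y"
    show "\<exists>x. hom x z (V X S) \<and> r2 S \<odot> x = w \<and> f S \<odot> x = y"
    proof (cases "S = {}")
      case False
      then have wx: "hom w z (V X S)" "r2 S = Id K (V X S)" "n S = ?ef S" using w r2S S by auto
      have "f S \<odot> w = y"
        by (rule mono[OF S False hom_cmp[OF wx(1) nat_hom[OF fn S]] y]) (use e wx(3) in simp)
      then show ?thesis using wx Id_cmp[OF wx(1)] by (intro exI[of _ w]) simp
    next
      case True
      define x where "x T = Z {} T \<odot> w" for T
      have w0: "hom w z (V Z {})" and y0: "hom y z (V Y {})" using w y True by simp_all
      have xh: "hom (x T) z (V X T)" if "T \<in> ?P" "T \<noteq> {}" for T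
        unfolding x_def using hom_cmp[OF w0 diag_hom[OF Zd e0 that(1)]] r2S that by simp
      have xc: "X T T' \<odot> x T = x T'" if "T \<in> ?P" "T \<noteq> {}" "T' \<in> ?P" "T \<subseteq> T'" for T T'
      proof -
        have "T' \<noteq> {}" using that by auto
        then have "X T T' = Z T T'" using ag that by (simp add: agree_def)
        then show ?thesis
          unfolding x_def using diag_comp[OF Zd e0 that(1,3)] that(4) by (metis cmp_assoc empty_subsetI)
      qed
      have xf: "fam X (above ?P {}) z x"
        unfolding fam_def using hom_Obj[OF w] xh xc ab by simp
      have fx: "f T \<odot> x T = Y {} T \<odot> y" if T: "T \<in> ?P" "T \<noteq> {}" for T
      proof (rule mono[OF T])
        show "hom (f T \<odot> x T) z (V Y T)" using hom_cmp[OF xh[OF T] nat_hom[OF fn T(1)]] .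
        show "hom (Y {} T \<odot> y) z (V Y T)" using hom_cmp[OF y0 diag_hom[OF Yd e0 T(1)]] by simp
        have "n T = ?ef T" using r2S T by simp
        then have "eta k Y T \<odot> f T \<odot> x T = n T \<odot> Z {} T \<odot> w" by (simp add: x_def)
        also have "\<dots> = F k Y {} T \<odot> n {} \<odot> w" using nat_sq'[OF nn e0 T(1), of w] by simp
        also have "\<dots> = F k Y {} T \<odot> eta k Y {} \<odot> y" using e True by simp
        also have "\<dots> = eta k Y T \<odot> Y {} T \<odot> y" using nat_sq'[OF en e0 T(1), of y] by simp
        finally show "eta k Y T \<odot> f T \<odot> x T = eta k Y T \<odot> Y {} T \<odot> y" .
      qed
      have "match ?P X Y f {} z x y"
        by (rule matchI[OF xf y0]) (simp add: fx ab)
      from ulifts_ex[OF dfib_u[OF f] this]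
      obtain x' where x': "hom x' z (V X {})" "f {} \<odot> x' = y" "\<forall>T\<in>above ?P {}. X {} T \<odot> x' = x T"
        by (elim ex1E conjE)
      have "match ?P Z (F k Y) n {} z x (eta k Y {} \<odot> y)"
      proof (rule matchI)
        have "above ?P {} \<subseteq> ?P - {{}}" using ab by auto
        then show "fam Z (above ?P {}) z x" using agree_fam[OF ag] xf by simp
        show "hom (eta k Y {} \<odot> y) z (V (F k Y) {})" using hom_cmp[OF y0 nat_hom[OF en e0]] .
        show "n T \<odot> x T = F k Y {} T \<odot> eta k Y {} \<odot> y" if "T \<in> above ?P {}" for T
          using that ab fx[of T] r2S nat_sq'[OF en e0, of T y] by simp
      qed
      from ulifts_ex[OF dfib_u[OF n] this]
      obtain w' where w': "\<And>v. hom v z (V Z {}) \<Longrightarrow> n {} \<odot> v = eta k Y {} \<odot> y \<Longrightarrow> \<forall>T\<in>above ?P {}. Z {} T \<odot> v = x T \<Longrightarrow> v = w'"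
        by metis
      have "w = w'" by (rule w'[OF w0]) (use e True in \<open>simp_all add: x_def\<close>)
      moreover have "r2 {} \<odot> x' = w'"
      proof (rule w')
        show "hom (r2 {} \<odot> x') z (V Z {})" using hom_cmp[OF x'(1) nat_hom[OF emap_nat[OF r2] e0]] .
        show "n {} \<odot> r2 {} \<odot> x' = eta k Y {} \<odot> y" using nr'[OF e0, of x'] x'(2) by simp
        show "\<forall>T\<in>above ?P {}. Z {} T \<odot> r2 {} \<odot> x' = x T"
          using r2e[OF _ _ x'(1)] x'(3) ab by simp
      qed
      ultimately show ?thesis using x' True by (intro exI[of _ x']) simp
    qed
  next
    fix S z v v' assume S: "S \<in> ?P" and v: "hom v z (V X S)" "hom v' z (V X S)"
      and e: "r2 S \<odot> v = r2 S \<odot> v'" "f S \<odot> v = f S \<odot> v'"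
    show "v = v'"
    proof (cases "S = {}")
      case False
      then show ?thesis using r2S S e(1) Id_cmp[OF v(1)] Id_cmp[OF v(2)] by simp
    next
      case True
      have v0: "hom v z (V X {})" "hom v' z (V X {})" using v True by simp_all
      have "match ?P X Y f {} z (\<lambda>T. X {} T \<odot> v') (f {} \<odot> v')"
      proof (rule matchI)
        show "fam X (above ?P {}) z (\<lambda>T. X {} T \<odot> v')"
          unfolding fam_def
        proof (intro conjI ballI impI)
          show "z \<in> Obj K" using hom_Obj[OF v(1)] by simp
          show "hom (X {} T \<odot> v') z (V X T)" if "T \<in> above ?P {}" for T
            using hom_cmp[OF v0(2) diag_hom[OF Xd e0, of T]] that ab by simp
          show "X T T' \<odot> X {} T \<odot> v' = X {} T' \<odot> v'" if "T \<in> above ?P {}" "T' \<in> above ?P {}" "T \<subseteq> T'" for T T'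
            using diag_comp[OF Xd e0, of T T'] that ab by (metis cmp_assoc empty_subsetI)
        qed
        show "hom (f {} \<odot> v') z (V Y {})" using hom_cmp[OF v0(2) nat_hom[OF fn e0]] .
        show "f T \<odot> X {} T \<odot> v' = Y {} T \<odot> f {} \<odot> v'" if "T \<in> above ?P {}" for T
          using nat_sq'[OF fn e0, of T v'] that ab by simp
      qed
      from ulifts_ex[OF dfib_u[OF f] this]
      obtain x' where x': "\<And>w. hom w z (V X {}) \<Longrightarrow> f {} \<odot> w = f {} \<odot> v' \<Longrightarrow>
          \<forall>T\<in>above ?P {}. X {} T \<odot> w = X {} T \<odot> v' \<Longrightarrow> w = x'"
        by metis
      have "v = x'"
      proof (rule x'[OF v0(1)])
        show "f {} \<odot> v = f {} \<odot> v'" using e(2) True by simp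
        show "\<forall>T\<in>above ?P {}. X {} T \<odot> v = X {} T \<odot> v'"
          using r2e[OF _ _ v0(1)] r2e[OF _ _ v0(2)] e(1) True ab by simp
      qed
      moreover have "v' = x'" by (rule x'[OF v0(2)]) simp_all
      ultimately show ?thesis by simp
    qed
  qed
  then show ?thesis
    using admissible[OF ZB F_B[OF Y] dfib_emap[OF n] Y en] by metis
qed

text \<open>The two properties of discrete fibrations are proved together, since each is used for the other one
  dimension later.\<close>

lemma dfib_triv_and_B:
  "(\<forall>X Y f. dfib {..<k} X Y f \<and> extc {..<k} Y \<longrightarrow> triv k X Y f) \<and>
   (\<forall>X Y f. dfib {..<Suc k} X Y f \<and> B (Suc k) Y \<longrightarrow> B (Suc k) X)"
proof (induction k)
  case 0
  have t: "triv 0 X Y f" if "dfib {..<0} X Y f" "extc {..<0} Y" for X Y f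
    using dfib_triv_0[OF that] .
  show ?case using t dfib_B_step[of 0] by (metis (no_types))
next
  case (Suc k)
  have t: "triv (Suc k) X Y f" if "dfib {..<Suc k} X Y f" "extc {..<Suc k} Y" for X Y f
    using dfib_triv_step[OF _ that] Suc by (metis (no_types))
  show ?case using t dfib_B_step[of "Suc k"] by (metis (no_types))
qed

lemma dfib_B: "dfib {..<Suc k} X Y f \<Longrightarrow> B (Suc k) Y \<Longrightarrow> B (Suc k) X"
  using dfib_triv_and_B[of k] by meson

end

context regular_base
begin

section \<open>Gluing, descending and extending cubes\<close>

lemma agree_pb:
  assumes R: "pb P X Y Z f g R p q" and X: "agree P X X'" and Y: "agree P Y Y'" and Z: "agree P Z Z'" and RR: "agree P R R'"
  shows "pb P X' Y' Z' f g R' p q"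
  using agree_diag[OF RR pb_diag[OF R]] agree_nat[OF RR X refl pb_p[OF R]] agree_nat[OF RR Y refl pb_q[OF R]] R
    agree_V[OF X] agree_V[OF Y] agree_V[OF RR]
  unfolding pb_def by simp

lemma nat_split:
  assumes i: "i \<notin> A" and X: "diag (Pow (insert i A)) X" and Y: "diag (Pow (insert i A)) Y"
    and f0: "nat_tr (Pow A) X Y f" and f1: "nat_tr (Pow A) (up i X) (up i Y) (\<lambda>S. f (insert i S))"
    and sq: "\<And>S. S \<in> Pow A \<Longrightarrow> dir i Y S \<odot> f S = f (insert i S) \<odot> dir i X S"
  shows "nat_tr (Pow (insert i A)) X Y f"
  unfolding nat_tr_def
proof (intro conjI ballI impI)
  let ?B = "Pow (insert i A)"
  have c: "(U \<in> Pow A \<and> i \<notin> U) \<or> (\<exists>S\<in>Pow A. U = insert i S)" if "U \<in> ?B" for U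
  proof (cases "i \<in> U")
    case True
    then have "U = insert i (U - {i})" "U - {i} \<in> Pow A" using that by auto
    then show ?thesis by blast
  next
    case False
    then show ?thesis using that by auto
  qed
  fix U assume U: "U \<in> ?B"
  show "hom (f U) (V X U) (V Y U)"
    using c[OF U] nat_hom[OF f0, of U] nat_hom[OF f1] by auto
  fix T assume T: "T \<in> ?B" and le: "U \<subseteq> T"
  show "Y U T \<odot> f U = f T \<odot> X U T"
    using c[OF U]
  proof
    assume "\<exists>S\<in>Pow A. U = insert i S"
    then obtain S where S: "S \<in> Pow A" "U = insert i S" by blast
    then have "i \<in> T" using le by auto
    then obtain S' where S': "S' \<in> Pow A" "T = insert i S'" using c[OF T] by blast
    have "S \<subseteq> S'" using le S S' i by auto
    then show ?thesis using nat_sq[OF f1 S(1) S'(1)] S S' by (simp add: rx_def)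
  next
    assume U0: "U \<in> Pow A \<and> i \<notin> U"
    show ?thesis using c[OF T]
    proof
      assume "T \<in> Pow A \<and> i \<notin> T"
      then show ?thesis using nat_sq[OF f0 _ _ le] U0 by simp
    next
      assume "\<exists>S\<in>Pow A. T = insert i S"
      then obtain S where S: "S \<in> Pow A" "T = insert i S" by blast
      then have US: "U \<subseteq> S" using le U0 by auto
      have SB: "S \<in> ?B" using S by auto
      have ST: "S \<subseteq> T" using S(2) by (simp add: subset_insertI)
      have "Y U T \<odot> f U = Y S T \<odot> Y U S \<odot> f U"
        using diag_comp[OF Y U SB T US ST] by (metis cmp_assoc)
      also have "\<dots> = dir i Y S \<odot> f S \<odot> X U S"
        using nat_sq[OF f0 _ S(1) US] U0 S(2) by (simp add: dir_def)
      also have "\<dots> = f T \<odot> dir i X S \<odot> X U S"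
        using sq[OF S(1)] S(2) by (metis cmp_assoc)
      also have "\<dots> = f T \<odot> X U T"
        using diag_comp[OF X U SB T US ST] S(2) by (simp add: dir_def)
      finally show ?thesis .
    qed
  qed
qed

text \<open>At a vertex outside the codomain face of the new direction, a lift is an element of the pullback \<open>X0\<close>: one
  of its components is prescribed by the codomain, and the other by the element just above in the new
  direction. Hence lifts are unique there.\<close>

lemma mapc_pb:
  assumes i: "i \<notin> A" and Y: "diag (Pow (insert i A)) Y" and g1: "emap (Pow A) X1 (up i Y) g1"
    and R: "pb (Pow A) Y X1 (up i Y) (dir i Y) g1 X0 g0 x"
  shows "dfib (insert i A) (mapc i X0 X1 x) Y (\<lambda>U. if i \<in> U then g1 (U - {i}) else g0 U)"
proof -
  let ?P = "Pow A" and ?B = "Pow (insert i A)"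
  let ?W = "mapc i X0 X1 x" and ?\<phi> = "\<lambda>U. if i \<in> U then g1 (U - {i}) else g0 U"
  note X0d = pb_diag[OF R] and X1d = emap_dom[OF g1] and xn = pb_q[OF R] and g0n = pb_p[OF R]
  have W: "diag ?B ?W" by (rule mapc_diag[OF i X0d X1d xn])
  note dn = mapc_dn[OF i, of X0 X1 x] and upW = mapc_up[OF i, of X1 X0 x] and dW = mapc_dir[OF i X0d xn]
  have \<phi>0: "?\<phi> S = g0 S" and \<phi>1: "?\<phi> (insert i S) = g1 S" if "S \<in> ?P" for S
  proof -
    have "i \<notin> S" "insert i S - {i} = S" using that i by auto
    then show "?\<phi> S = g0 S" "?\<phi> (insert i S) = g1 S" by simp_all
  qed
  have n: "nat_tr ?B ?W Y ?\<phi>"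
  proof (rule nat_split[OF i W Y])
    show "nat_tr ?P ?W Y ?\<phi>"
      by (rule agree_nat[OF dn agree_refl _ g0n]) (use \<phi>0 in simp)
    show "nat_tr ?P (up i ?W) (up i Y) (\<lambda>S. ?\<phi> (insert i S))"
      by (rule agree_nat[OF upW agree_refl _ emap_nat[OF g1]]) (use \<phi>1 in simp)
    show "dir i Y S \<odot> ?\<phi> S = ?\<phi> (insert i S) \<odot> dir i ?W S" if "S \<in> ?P" for S
      using pb_sq[OF R that] \<phi>0[OF that] \<phi>1[OF that] dW[OF that] by simp
  qed
  let ?u = "\<lambda>S. Id K (V X0 S)"
  have u: "nat_tr ?P ?W X0 ?u"
    by (rule agree_nat[OF dn agree_refl refl nat_Id[OF X0d]])
  have R': "pb ?P (up i ?W) Y (up i Y) (\<lambda>S. ?\<phi> (insert i S)) (dir i Y) X0 x g0"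
    by (rule pb_cong[OF agree_pb[OF pb_sym[OF R] upW agree_refl agree_refl agree_refl]]) (use \<phi>1 in simp_all)
  have pu: "x S \<odot> ?u S = dir i ?W S" and qu: "g0 S \<odot> ?u S = ?\<phi> S" if "S \<subseteq> A" for S
    using cmp_Id[OF nat_hom[OF xn, of S]] cmp_Id[OF nat_hom[OF g0n, of S]] that dW[of S] \<phi>0[of S] by simp_all
  have ulb: "ulifts ?B ?W Y ?\<phi> S" if S: "S \<subseteq> A" for S
  proof -
    have "ulifts ?P X0 X0 ?u S" using bij_ulifts[OF bij_Id[OF X0d] X0d X0d] S by simp
    then have "ulifts ?P ?W X0 ?u S"
      using agree_lifting(2)[OF dn agree_refl, of ?u ?u S] S by simp
    then show ?thesis using lifting_bot(2)[OF i W Y n R' u pu qu S] by simp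
  qed
  have "lifts ?B ?W Y ?\<phi> U" if U: "U \<in> ?B" for U
  proof (cases "i \<in> U")
    case True
    define S where "S = U - {i}"
    have S: "S \<in> ?P" "U = insert i S" using U True by (auto simp: S_def)
    have "lifts ?P X1 (up i Y) g1 S" using emap_lifts[OF g1 S(1)] .
    then have "lifts ?P (up i ?W) (up i Y) (\<lambda>S. ?\<phi> (insert i S)) S"
      using agree_lifting(1)[OF upW agree_refl, of g1 "\<lambda>S. ?\<phi> (insert i S)" S] \<phi>1 S(1) by simp
    then show ?thesis using rx_lifting(1)[OF iso_idx_insert[OF i] S(1), of ?W Y ?\<phi>] S(2) by simp
  next
    case False
    then show ?thesis using ulifts_lifts[OF ulb] U by auto
  qed
  then have "emap ?B ?W Y ?\<phi>" by (intro emapI W Y n)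
  then show ?thesis using ulb[of "{}"] by (simp add: dfib_def)
qed

text \<open>Edges that exist separately after composition with covers are compatible with each other,
  because covers are epimorphisms.\<close>

lemma descend_diag:
  assumes X: "diag P X" and c: "\<And>S. S \<in> P \<Longrightarrow> cover (\<eta> S) (V X S) (w S)"
    and ex: "\<And>S T. S \<in> P \<Longrightarrow> T \<in> P \<Longrightarrow> S \<subseteq> T \<Longrightarrow> \<exists>a. hom a (w S) (w T) \<and> a \<odot> \<eta> S = \<eta> T \<odot> X S T"
  shows "\<exists>Y. diag P Y \<and> (\<forall>S\<in>P. V Y S = w S) \<and> nat_tr P X Y \<eta>"
proof -
  define Y where "Y S T = (SOME a. hom a (w S) (w T) \<and> a \<odot> \<eta> S = \<eta> T \<odot> X S T)" for S T
  have Y: "hom (Y S T) (w S) (w T)" "Y S T \<odot> \<eta> S = \<eta> T \<odot> X S T" if "S \<in> P" "T \<in> P" "S \<subseteq> T" for S T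
    using someI_ex[OF ex[OF that]] by (simp_all add: Y_def)
  have wO: "w S \<in> Obj K" if "S \<in> P" for S using hom_Obj[OF cover_hom[OF c[OF that]]] by simp
  have YI: "Y S S = Id K (w S)" if S: "S \<in> P" for S
  proof (rule cover_epi[OF c[OF S] Y(1)[OF S S order_refl] hom_Id[OF wO[OF S]]])
    note h = cover_hom[OF c[OF S]]
    show "Y S S \<odot> \<eta> S = Id K (w S) \<odot> \<eta> S"
      using Y(2)[OF S S order_refl] diag_refl[OF X S] cmp_Id[OF h] Id_cmp[OF h] by simp
  qed
  have VY: "V Y S = w S" if "S \<in> P" for S
    using YI[OF that] Dom_Id[OF wO[OF that]] by (simp add: V_def)
  have "diag P Y"
    unfolding diag_def
  proof (intro conjI ballI impI)
    show "V Y S \<in> Obj K" "Y S S = Id K (V Y S)" if "S \<in> P" for S using VY wO YI that by simp_all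
    show "hom (Y S T) (V Y S) (V Y T)" if "S \<in> P" "T \<in> P" "S \<subseteq> T" for S T using Y(1) VY that by simp
    fix S T U assume s: "S \<in> P" "T \<in> P" "U \<in> P" and "S \<subseteq> T \<and> T \<subseteq> U"
    then have le: "S \<subseteq> T" "T \<subseteq> U" "S \<subseteq> U" by auto
    show "Y T U \<odot> Y S T = Y S U"
    proof (rule cover_epi[OF c[OF s(1)] hom_cmp[OF Y(1)[OF s(1,2) le(1)] Y(1)[OF s(2,3) le(2)]] Y(1)[OF s(1,3) le(3)]])
      show "(Y T U \<odot> Y S T) \<odot> \<eta> S = Y S U \<odot> \<eta> S"
        using Y(2)[OF s(1,2) le(1)] Y(2)[OF s(2,3) le(2)] Y(2)[OF s(1,3) le(3)] diag_comp[OF X s le(1,2)]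
        by (metis cmp_assoc)
    qed
  qed
  moreover have "nat_tr P X Y \<eta>"
    unfolding nat_tr_def using Y(2) VY cover_hom[OF c] by simp
  ultimately show ?thesis using VY by (intro exI[of _ Y]) simp
qed

lemma descend_nat:
  assumes X: "diag P X" and Y: "diag P Y" and Z: "diag P Z" and \<eta>: "nat_tr P X Y \<eta>"
    and c: "\<And>S. S \<in> P \<Longrightarrow> cover (\<eta> S) (V X S) (V Y S)" and h: "nat_tr P X Z h"
    and g: "\<And>S. S \<in> P \<Longrightarrow> hom (g S) (V Y S) (V Z S)" "\<And>S. S \<in> P \<Longrightarrow> g S \<odot> \<eta> S = h S"
  shows "nat_tr P Y Z g"
  unfolding nat_tr_def
proof (intro conjI ballI impI g(1))
  fix S T assume s: "S \<in> P" "T \<in> P" "S \<subseteq> T"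
  show "Z S T \<odot> g S = g T \<odot> Y S T"
  proof (rule cover_epi[OF c[OF s(1)] hom_cmp[OF g(1)[OF s(1)] diag_hom[OF Z s]] hom_cmp[OF diag_hom[OF Y s] g(1)[OF s(2)]]])
    show "(Z S T \<odot> g S) \<odot> \<eta> S = (g T \<odot> Y S T) \<odot> \<eta> S"
      using g(2)[OF s(1)] g(2)[OF s(2)] nat_sq[OF h s] nat_sq[OF \<eta> s] by (metis cmp_assoc)
  qed
qed

subsection \<open>Changing a cube through a cover of one of its faces\<close>

text \<open>The right Kan extension of a cube over the directions \<open>D\<close> to a cube over more directions \<open>D \<union> A\<close>,
  along the inclusion as the face at \<open>t\<close>: its value is terminal at the vertices that do not lie below
  that face.\<close>

definition face_ext :: "nat set \<Rightarrow> nat set \<Rightarrow> nat set \<Rightarrow> (nat set \<Rightarrow> nat set \<Rightarrow> 'a) \<Rightarrow> nat set \<Rightarrow> nat set \<Rightarrow> 'a" where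
  "face_ext D A t Q U U' = (if U' \<inter> A \<subseteq> t then Q (U \<inter> D) (U' \<inter> D)
     else if U \<inter> A \<subseteq> t then bang Q (U \<inter> D) else Id K tt)"

lemma V_face_ext: "V (face_ext D A t Q) U = (if U \<inter> A \<subseteq> t then V Q (U \<inter> D) else tt)"
  using Dom_Id tt by (simp add: V_def face_ext_def)

lemma bang_edge: "diag P X \<Longrightarrow> S \<in> P \<Longrightarrow> T \<in> P \<Longrightarrow> S \<subseteq> T \<Longrightarrow> bang X T \<odot> X S T = bang X S"
  by (rule tt_unique[OF hom_cmp[OF diag_hom bang_hom] bang_hom]) (simp_all add: diag_Obj)

lemma face_ext_diag:
  assumes Q: "diag (Pow D) Q"
  shows "diag P (face_ext D A t Q)"
proof -
  have D: "U \<inter> D \<in> Pow D" for U by simp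
  have b: "hom (bang Q (U \<inter> D)) (V Q (U \<inter> D)) tt" for U using bang_hom diag_Obj[OF Q D] .
  have le: "U \<subseteq> T \<Longrightarrow> U \<inter> D \<subseteq> T \<inter> D" for U T by auto
  show ?thesis
    unfolding diag_def V_face_ext
  proof (intro conjI ballI impI)
    fix S show "(if S \<inter> A \<subseteq> t then V Q (S \<inter> D) else tt) \<in> Obj K" using diag_Obj[OF Q D] tt by simp
    show "face_ext D A t Q S S = Id K (if S \<inter> A \<subseteq> t then V Q (S \<inter> D) else tt)"
      using diag_refl[OF Q D] by (simp add: face_ext_def)
    fix T
    show "hom (face_ext D A t Q S T) (if S \<inter> A \<subseteq> t then V Q (S \<inter> D) else tt) (if T \<inter> A \<subseteq> t then V Q (T \<inter> D) else tt)"
      if ST: "S \<subseteq> T"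
    proof (cases "T \<inter> A \<subseteq> t")
      case True
      then have "S \<inter> A \<subseteq> t" using ST by auto
      then show ?thesis using True diag_hom[OF Q D D le[OF ST]] by (simp add: face_ext_def)
    next
      case False
      then show ?thesis using b hom_Id tt by (simp add: face_ext_def)
    qed
    fix U assume "S \<subseteq> T \<and> T \<subseteq> U"
    then have ST: "S \<subseteq> T" and TU: "T \<subseteq> U" by auto
    show "face_ext D A t Q T U \<odot> face_ext D A t Q S T = face_ext D A t Q S U"
    proof (cases "U \<inter> A \<subseteq> t")
      case True
      then have "T \<inter> A \<subseteq> t" using TU by auto
      then show ?thesis using True diag_comp[OF Q D D D le[OF ST] le[OF TU]] by (simp add: face_ext_def)
    next
      case U: False
      show ?thesis
      proof (cases "T \<inter> A \<subseteq> t")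
        case True
        then have "S \<inter> A \<subseteq> t" using ST by auto
        then show ?thesis using U True bang_edge[OF Q D D le[OF ST]] by (simp add: face_ext_def)
      next
        case False
        then show ?thesis using U Id_cmp[OF b] tt by (simp add: face_ext_def)
      qed
    qed
  qed
qed

definition face_ext_map :: "nat set \<Rightarrow> nat set \<Rightarrow> nat set \<Rightarrow> (nat set \<Rightarrow> 'a) \<Rightarrow> nat set \<Rightarrow> 'a" where
  "face_ext_map D A t f U = (if U \<inter> A \<subseteq> t then f (U \<inter> D) else Id K tt)"

lemma face_ext_nat:
  assumes X: "diag (Pow D) X" and Y: "diag (Pow D) Y" and f: "nat_tr (Pow D) X Y f"
  shows "nat_tr P (face_ext D A t X) (face_ext D A t Y) (face_ext_map D A t f)"
  unfolding nat_tr_def V_face_ext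
proof (intro conjI ballI impI)
  have D: "U \<inter> D \<in> Pow D" for U by simp
  fix S show "hom (face_ext_map D A t f S) (if S \<inter> A \<subseteq> t then V X (S \<inter> D) else tt) (if S \<inter> A \<subseteq> t then V Y (S \<inter> D) else tt)"
    using nat_hom[OF f D] hom_Id tt by (simp add: face_ext_map_def)
  fix T assume ST: "S \<subseteq> T"
  have le: "S \<inter> D \<subseteq> T \<inter> D" using ST by auto
  have bX: "hom (bang X (S \<inter> D)) (V X (S \<inter> D)) tt" using bang_hom diag_Obj[OF X D] .
  show "face_ext D A t Y S T \<odot> face_ext_map D A t f S = face_ext_map D A t f T \<odot> face_ext D A t X S T"
  proof (cases "T \<inter> A \<subseteq> t")
    case True
    then have "S \<inter> A \<subseteq> t" using ST by auto
    then show ?thesis using True nat_sq[OF f D D le] by (simp add: face_ext_def face_ext_map_def)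
  next
    case False
    then show ?thesis using bang_nat[OF f X Y D] Id_cmp[OF bX] by (simp add: face_ext_def face_ext_map_def)
  qed
qed

lemma face_ext_emap:
  assumes dis: "D \<inter> A = {}" and t: "t \<subseteq> A" and f: "emap (Pow D) X Y f"
  shows "emap (Pow (D \<union> A)) (face_ext D A t X) (face_ext D A t Y) (face_ext_map D A t f)"
proof -
  let ?P = "Pow (D \<union> A)"
  note X = emap_dom[OF f] and Y = emap_cod[OF f] and fn = emap_nat[OF f]
  note cX = face_ext_diag[OF X, of ?P A t] and cY = face_ext_diag[OF Y, of ?P A t] and cn = face_ext_nat[OF X Y fn, of ?P A t]
  show ?thesis
  proof (rule emapI[OF cX cY cn])
    fix U assume U: "U \<in> ?P"
    have Uc: "U = (U \<inter> D) \<union> (U \<inter> A)" using U by auto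
    show "lifts ?P (face_ext D A t X) (face_ext D A t Y) (face_ext_map D A t f) U"
      unfolding lifts_def
    proof (intro allI impI)
      fix z x y assume m: "match ?P (face_ext D A t X) (face_ext D A t Y) (face_ext_map D A t f) U z x y"
      note xf = match_fam[OF m] and zO = match_Obj[OF m]
      have tts: "face_ext D A t X U T \<odot> v = x T \<odot> e"
        if T: "T \<in> above ?P U" and nT: "\<not> T \<inter> A \<subseteq> t" and v: "hom v z' (V (face_ext D A t X) U)" and e: "hom e z' z" for T v e z'
      proof -
        have TP: "T \<in> ?P" "U \<subseteq> T" using T by (auto simp: above_def)
        have "hom (face_ext D A t X U T \<odot> v) z' tt" using hom_cmp[OF v diag_hom[OF cX U TP]] nT by (simp add: V_face_ext)
        moreover have "hom (x T \<odot> e) z' tt" using hom_cmp[OF e fam_hom[OF xf T]] nT by (simp add: V_face_ext)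
        ultimately show ?thesis using tt_unique by simp
      qed
      show "\<exists>z' e x'. cover e z' z \<and> sol ?P (face_ext D A t X) (face_ext D A t Y) (face_ext_map D A t f) U z' x y e x'"
      proof (cases "U \<inter> A \<subseteq> t")
        case False
        have yh: "hom y z tt" using match_hom[OF m] False by (simp add: V_face_ext)
        have "sol ?P (face_ext D A t X) (face_ext D A t Y) (face_ext_map D A t f) U z x y (Id K z) y"
        proof (rule solI)
          show yX: "hom y z (V (face_ext D A t X) U)" using yh False by (simp add: V_face_ext)
          show "face_ext_map D A t f U \<odot> y = y \<odot> Id K z" using False cmp_Id[OF yh] Id_cmp[OF yh] by (simp add: face_ext_map_def)
          show "face_ext D A t X U T \<odot> y = x T \<odot> Id K z" if "T \<in> above ?P U" for T
          proof (rule tts[OF that _ yX hom_Id[OF zO]])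
            show "\<not> T \<inter> A \<subseteq> t" using False above_in[OF that] by auto
          qed
        qed
        then show ?thesis using cover_Id[OF zO] by meson
      next
        case Ut: True
        have yh: "hom y z (V Y (U \<inter> D))" using match_hom[OF m] Ut by (simp add: V_face_ext)
        show ?thesis
        proof (cases "U \<inter> A = t")
          case False
          \<comment> \<open>Strictly below the face, the value on the face determines the solution.\<close>
          define T0 where "T0 = (U \<inter> D) \<union> t"
          have T0: "T0 \<in> above ?P U" "T0 \<inter> A = t" "T0 \<inter> D = U \<inter> D"
            using Ut False t dis Uc unfolding T0_def above_def by auto
          let ?v = "x T0"
          have vh: "hom ?v z (V X (U \<inter> D))" using fam_hom[OF xf T0(1)] T0 by (simp add: V_face_ext)
          have "sol ?P (face_ext D A t X) (face_ext D A t Y) (face_ext_map D A t f) U z x y (Id K z) ?v"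
          proof (rule solI)
            show vX: "hom ?v z (V (face_ext D A t X) U)" using vh Ut by (simp add: V_face_ext)
            have "f (U \<inter> D) \<odot> ?v = Y (U \<inter> D) (U \<inter> D) \<odot> y"
              using match_eq[OF m T0(1)] T0 Ut by (simp add: face_ext_def face_ext_map_def)
            then show "face_ext_map D A t f U \<odot> ?v = y \<odot> Id K z"
              using diag_refl[OF Y, of "U \<inter> D"] Id_cmp[OF yh] cmp_Id[OF yh] Ut by (simp add: face_ext_map_def)
            fix T assume T: "T \<in> above ?P U"
            show "face_ext D A t X U T \<odot> ?v = x T \<odot> Id K z"
            proof (cases "T \<inter> A \<subseteq> t")
              case nT: False
              then show ?thesis using tts[OF T nT vX hom_Id[OF zO]] by simp
            next
              case Tt: True
              define T1 where "T1 = (T \<inter> D) \<union> t"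
              have T1: "T1 \<in> above ?P U" "T1 \<inter> A = t" "T1 \<inter> D = T \<inter> D" "T0 \<subseteq> T1" "T \<subseteq> T1"
                using T T0 t dis Tt Uc Ut unfolding T1_def T0_def above_def by auto
              have xTh: "hom (x T) z (V X (T \<inter> D))" using fam_hom[OF xf T] Tt by (simp add: V_face_ext)
              have "X (U \<inter> D) (T \<inter> D) \<odot> ?v = x T1"
                using fam_comp[OF xf T0(1) T1(1,4)] T0 T1 by (simp add: face_ext_def)
              moreover have "X (T \<inter> D) (T \<inter> D) \<odot> x T = x T1"
                using fam_comp[OF xf T T1(1,5)] T1 by (simp add: face_ext_def)
              then have "x T = x T1" using diag_refl[OF X, of "T \<inter> D"] Id_cmp[OF xTh] by simp
              ultimately show ?thesis using Tt cmp_Id[OF xTh] by (simp add: face_ext_def)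
            qed
          qed
          then show ?thesis using cover_Id[OF zO] by meson
        next
          case eq: True
          have ab: "S \<union> t \<in> above ?P U" "(S \<union> t) \<inter> A = t" "(S \<union> t) \<inter> D = S" if "S \<in> above (Pow D) (U \<inter> D)" for S
            using that t dis Uc eq unfolding above_def by auto
          have "match (Pow D) X Y f (U \<inter> D) z (\<lambda>S. x (S \<union> t)) y"
          proof (rule matchI[OF _ yh])
            show "fam X (above (Pow D) (U \<inter> D)) z (\<lambda>S. x (S \<union> t))"
              unfolding fam_def
            proof (intro conjI ballI impI zO)
              show "hom (x (S \<union> t)) z (V X S)" if "S \<in> above (Pow D) (U \<inter> D)" for S
                using fam_hom[OF xf ab(1)[OF that]] ab(2,3)[OF that] by (simp add: V_face_ext)
              show "X S T \<odot> x (S \<union> t) = x (T \<union> t)" if "S \<in> above (Pow D) (U \<inter> D)" "T \<in> above (Pow D) (U \<inter> D)" "S \<subseteq> T" for S T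
              proof -
                have "S \<union> t \<subseteq> T \<union> t" using that by auto
                from fam_comp[OF xf ab(1)[OF that(1)] ab(1)[OF that(2)] this] show ?thesis
                  using ab(2,3)[OF that(1)] ab(2,3)[OF that(2)] by (simp add: face_ext_def)
              qed
            qed
            show "f T \<odot> x (T \<union> t) = Y (U \<inter> D) T \<odot> y" if "T \<in> above (Pow D) (U \<inter> D)" for T
              using match_eq[OF m ab(1)[OF that]] ab(2,3)[OF that] by (simp add: face_ext_def face_ext_map_def)
          qed
          then obtain z' e x' where e: "cover e z' z" and s: "sol (Pow D) X Y f (U \<inter> D) z' (\<lambda>S. x (S \<union> t)) y e x'"
            using emap_lifts[OF f, of "U \<inter> D"] by (auto elim: liftsE)
          have "sol ?P (face_ext D A t X) (face_ext D A t Y) (face_ext_map D A t f) U z' x y e x'"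
          proof (rule solI)
            show xX: "hom x' z' (V (face_ext D A t X) U)" using sol_hom[OF s] Ut by (simp add: V_face_ext)
            show "face_ext_map D A t f U \<odot> x' = y \<odot> e" using sol_eq[OF s] Ut by (simp add: face_ext_map_def)
            fix T assume T: "T \<in> above ?P U"
            show "face_ext D A t X U T \<odot> x' = x T \<odot> e"
            proof (cases "T \<inter> A \<subseteq> t")
              case nT: False
              then show ?thesis using tts[OF T nT xX cover_hom[OF e]] by simp
            next
              case Tt: True
              have "T \<inter> A = t" "T = (T \<inter> D) \<union> t" "T \<inter> D \<in> above (Pow D) (U \<inter> D)"
                using T Tt eq Uc unfolding above_def by auto
              then show ?thesis using sol_fam[OF s, of "T \<inter> D"] Tt by (simp add: face_ext_def)
            qed
          qed
          then show ?thesis using e by meson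
        qed
      qed
    qed
  qed
qed

text \<open>A cover \<open>e\<close> of the face at \<open>t\<close> is extended to the whole cube by pulling back the extended map
  \<open>face_ext\<close> along the unit of the Kan extension. At the face at \<open>t\<close> that unit is invertible, hence the
  restriction of the pullback factors through \<open>e\<close>.\<close>

lemma cover_face:
  assumes dis: "D \<inter> A = {}" and t: "t \<subseteq> A" and Z: "diag (Pow (D \<union> A)) Z" and e: "emap (Pow D) Q (fc t Z) e"
  shows "\<exists>Z' d w. emap (Pow (D \<union> A)) Z' Z d \<and> nat_tr (Pow D) (fc t Z') Q w \<and>
     (\<forall>S\<in>Pow D. e S \<odot> w S = d (S \<union> t))"
proof -
  let ?P = "Pow (D \<union> A)" and ?G = "face_ext D A t (fc t Z)" and ?H = "face_ext D A t Q"
  define n where "n U = (if U \<inter> A \<subseteq> t then Z U ((U \<inter> D) \<union> t) else bang Z U)" for U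
  have Zt: "diag (Pow D) (fc t Z)" using rx_diag[OF fc_mono[OF t] Z] .
  have UD: "(U \<inter> D) \<union> t \<in> ?P" for U using t by auto
  have n: "nat_tr ?P Z ?G n"
    unfolding nat_tr_def V_face_ext V_rx
  proof (intro conjI ballI impI)
    fix U assume U: "U \<in> ?P"
    have Ule: "U \<subseteq> (U \<inter> D) \<union> t" if "U \<inter> A \<subseteq> t" using U that by auto
    have b: "hom (bang Z U) (V Z U) tt" using bang_hom diag_Obj[OF Z U] .
    show nh: "hom (n U) (V Z U) (if U \<inter> A \<subseteq> t then V Z (U \<inter> D \<union> t) else tt)"
      using diag_hom[OF Z U UD Ule] b by (simp add: n_def)
    then have nh': "hom (n U) (V Z U) (V ?G U)" unfolding V_face_ext V_rx .
    fix T assume T: "T \<in> ?P" and le: "U \<subseteq> T"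
    show "?G U T \<odot> n U = n T \<odot> Z U T"
    proof (cases "T \<inter> A \<subseteq> t")
      case True
      then have Ut: "U \<inter> A \<subseteq> t" using le by auto
      have Tle: "T \<subseteq> (T \<inter> D) \<union> t" using T True by auto
      have l: "(U \<inter> D) \<union> t \<subseteq> (T \<inter> D) \<union> t" using le by auto
      have "Z (U \<inter> D \<union> t) (T \<inter> D \<union> t) \<odot> Z U (U \<inter> D \<union> t) = Z T (T \<inter> D \<union> t) \<odot> Z U T"
        using diag_comp[OF Z U UD UD Ule[OF Ut] l] diag_comp[OF Z U T UD le Tle] by simp
      then show ?thesis using True Ut by (simp add: face_ext_def n_def rx_def)
    next
      case False
      have "hom (?G U T \<odot> n U) (V Z U) tt"
        using hom_cmp[OF nh' diag_hom[OF face_ext_diag[OF Zt] U T le]] False by (simp add: V_face_ext)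
      moreover have "hom (n T \<odot> Z U T) (V Z U) tt"
        using hom_cmp[OF diag_hom[OF Z U T le] bang_hom[OF diag_Obj[OF Z T]]] False by (simp add: n_def)
      ultimately show ?thesis using tt_unique by simp
    qed
  qed
  have ce: "emap ?P ?H ?G (face_ext_map D A t e)" by (rule face_ext_emap[OF dis t e])
  obtain Z' d' d where Z': "pb ?P ?H Z ?G (face_ext_map D A t e) n Z' d' d"
    using pb_exists[OF emap_dom[OF ce] Z emap_cod[OF ce] emap_nat[OF ce] n] by (elim exE)
  have d: "emap ?P Z' Z d" using pb_emap[OF Z' ce Z n] .
  have St: "S \<union> t \<in> ?P" "(S \<union> t) \<inter> A \<subseteq> t" "(S \<union> t) \<inter> D = S" "S \<union> t \<in> ?P" if "S \<in> Pow D" for S using that t dis by auto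
  have ag: "agree (Pow D) (fc t ?H) Q"
    unfolding agree_def rx_def face_ext_def using St by simp
  have w: "nat_tr (Pow D) (fc t Z') Q (\<lambda>S. d' (S \<union> t))"
    by (rule agree_nat[OF agree_refl ag refl rx_nat[OF fc_mono[OF t] pb_p[OF Z']]])
  have "e S \<odot> d' (S \<union> t) = d (S \<union> t)" if S: "S \<in> Pow D" for S
  proof -
    have "hom (d (S \<union> t)) (V Z' (S \<union> t)) (V Z (S \<union> t))" using nat_hom[OF emap_nat[OF d] St(1)[OF S]] .
    then show ?thesis
      using pb_sq[OF Z' St(1)[OF S]] St[OF S] diag_refl[OF Z St(1)[OF S]] by (simp add: face_ext_map_def n_def)
  qed
  then show ?thesis using d w by (intro exI[of _ Z'] exI[of _ d] exI[of _ "\<lambda>S. d' (S \<union> t)"]) simp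
qed

end

context cube_tower
begin

section \<open>Simultaneous trivialisation of the faces of a cube\<close>

lemma fc_up: "fc t (up k X) = up k (fc t X)"
  by (intro ext) (simp add: rx_def)

lemma dir_fc: "dir k (fc t X) S = dir k X (S \<union> t)"
  by (simp add: dir_def rx_def)

text \<open>Stated for every pullback, so that no choice of one has to be carried along.\<close>

definition trivialises where
  "trivialises k X Z e \<longleftrightarrow> (\<forall>R p q. pb (Pow {..<k}) X Z (up k X) (dir k X) e R p q \<longrightarrow> triv k R Z q)"

text \<open>A refinement of a trivialising extension still trivialises, by stability of trivial coverings under
  pullback.\<close>

lemma trivialises_through:
  assumes R0: "pb (Pow {..<k}) X Q (up k X) (dir k X) e R0 p0 q0" and q0: "triv k R0 Q q0"
    and c: "nat_tr (Pow {..<k}) Z Q c" and Z: "extc {..<k} Z" and e': "\<And>S. S \<in> Pow {..<k} \<Longrightarrow> e' S = e S \<odot> c S"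
  shows "trivialises k X Z e'"
  unfolding trivialises_def
proof (intro allI impI)
  fix R p q assume R: "pb (Pow {..<k}) X Z (up k X) (dir k X) e' R p q"
  have R': "pb (Pow {..<k}) X Z (up k X) (dir k X) (\<lambda>S. e S \<odot> c S) R p q"
    by (rule pb_cong[OF R]) (simp_all add: e')
  obtain p' where "pb (Pow {..<k}) R0 Z Q q0 c R p' q"
    using pb_paste_cancel[OF pb_sym[OF R0] c R'] by (elim exE conjE)
  then show "triv k R Z q" using triv_pb[OF q0 Z c] by metis
qed

text \<open>The faces are treated one after the other. The extension that trivialises the next face is extended to
  the whole cube with \<open>cover_face\<close>, and refining the cube keeps the faces that are already trivialised.\<close>

lemma trivialise_faces:
  assumes fA: "finite A" and dis: "{..<Suc k} \<inter> A = {}" and X: "extc (insert k ({..<k} \<union> A)) X"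
    and B: "\<And>t. t \<subseteq> A \<Longrightarrow> B (Suc k) (fc t X)"
  shows "\<exists>Z e. emap (Pow ({..<k} \<union> A)) Z (up k X) e \<and>
     (\<forall>t. t \<subseteq> A \<longrightarrow> trivialises k (fc t X) (fc t Z) (\<lambda>S. e (S \<union> t)))"
proof -
  let ?D = "{..<k}" and ?P = "Pow ({..<k} \<union> A)" and ?Pk = "Pow {..<k}"
  have disk: "?D \<inter> A = {}" and kA: "k \<notin> ?D \<union> A" using dis by (auto simp: lessThan_Suc)
  have up: "extc (?D \<union> A) (up k X)" using X extc_insert[OF kA] by simp
  note upd = extc_diag[OF up]
  have upt: "extc ?D (fc t (up k X))" if "t \<subseteq> A" for t
    using fc_extc[OF fA _ disk that up] by simp
  have "finite \<T> \<Longrightarrow> \<T> \<subseteq> Pow A \<Longrightarrow> \<exists>Z e. emap ?P Z (up k X) e \<and>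
      (\<forall>t\<in>\<T>. trivialises k (fc t X) (fc t Z) (\<lambda>S. e (S \<union> t)))" for \<T>
  proof (induction \<T> rule: finite_induct)
    case empty
    have "emap ?P (up k X) (up k X) (\<lambda>S. Id K (V (up k X) S))" using bij_emap[OF bij_Id[OF upd] upd upd] .
    then show ?case by blast
  next
    case (insert t0 \<T>)
    then have t0: "t0 \<subseteq> A" and TA: "\<T> \<subseteq> Pow A" by auto
    obtain Z e where e: "emap ?P Z (up k X) e"
      and tr: "\<forall>t\<in>\<T>. trivialises k (fc t X) (fc t Z) (\<lambda>S. e (S \<union> t))"
      using insert(3)[OF TA] by (elim exE conjE)
    note Zd = emap_dom[OF e]
    have et: "emap ?Pk (fc t Z) (fc t (up k X)) (\<lambda>S. e (S \<union> t))" if "t \<subseteq> A" for t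
      using fc_emap[OF fA _ disk that e] by simp
    obtain Q e0 R0 p0 q0 where Q: "extc ?D Q" "emap ?Pk Q (up k (fc t0 X)) e0"
      and R0: "pb ?Pk (fc t0 X) Q (up k (fc t0 X)) (dir k (fc t0 X)) e0 R0 p0 q0" and q0: "triv k R0 Q q0"
      using B[OF t0] unfolding B_Suc cube_covering_def by (elim conjE exE)
    note Q2 = Q(2)[folded fc_up]
    obtain Q' a e' where Q': "pb ?Pk Q (fc t0 Z) (fc t0 (up k X)) e0 (\<lambda>S. e (S \<union> t0)) Q' a e'"
      using pb_exists[OF emap_dom[OF Q2] emap_dom[OF et[OF t0]] emap_cod[OF Q2] emap_nat[OF Q2] emap_nat[OF et[OF t0]]]
      by (elim exE)
    have e': "emap ?Pk Q' (fc t0 Z) e'" using pb_emap[OF Q' Q2 emap_dom[OF et[OF t0]] emap_nat[OF et[OF t0]]] .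
    obtain Z' d w where d: "emap ?P Z' Z d" and w: "nat_tr ?Pk (fc t0 Z') Q' w"
      and ew: "\<forall>S\<in>?Pk. e' S \<odot> w S = d (S \<union> t0)"
      using cover_face[OF disk t0 Zd e'] by (elim exE conjE)
    let ?e = "\<lambda>S. e S \<odot> d S"
    have ed: "emap ?P Z' (up k X) ?e" using emap_comp[OF d e] .
    have dt: "emap ?Pk (fc t Z') (fc t Z) (\<lambda>S. d (S \<union> t))" if "t \<subseteq> A" for t
      using fc_emap[OF fA _ disk that d] by simp
    have Z't: "extc ?D (fc t Z')" if "t \<subseteq> A" for t
      using extc_dom[OF dt[OF that] extc_dom[OF et[OF that] upt[OF that]]] .
    have "trivialises k (fc t0 X) (fc t0 Z') (\<lambda>S. ?e (S \<union> t0))"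
    proof (rule trivialises_through[OF R0 q0 nat_comp[OF w pb_p[OF Q']] Z't[OF t0]])
      fix S assume S: "S \<in> ?Pk"
      show "e (S \<union> t0) \<odot> d (S \<union> t0) = e0 S \<odot> a S \<odot> w S"
        using pb_sq'[OF Q' S, of "w S"] ew S by simp
    qed
    moreover have "trivialises k (fc t X) (fc t Z') (\<lambda>S. ?e (S \<union> t))" if t: "t \<in> \<T>" for t
    proof -
      have tA: "t \<subseteq> A" using t TA by auto
      have Xt: "emap ?Pk (fc t X) (up k (fc t X)) (dir k (fc t X))" and Xt': "diag ?Pk (fc t X)"
        using B_extc[OF B[OF tA]] emap_dom by (simp_all add: extc_Suc) metis
      obtain R p q where R: "pb ?Pk (fc t X) (fc t Z) (up k (fc t X)) (dir k (fc t X)) (\<lambda>S. e (S \<union> t)) R p q"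
        using pb_exists[OF Xt' emap_dom[OF et[OF tA]] emap_cod[OF Xt] emap_nat[OF Xt] emap_nat[OF et[OF tA], unfolded fc_up]]
        by (elim exE)
      have "triv k R (fc t Z) q" using tr t R unfolding trivialises_def by meson
      then show ?thesis
        by (rule trivialises_through[OF R _ emap_nat[OF dt[OF tA]] Z't[OF tA]]) simp
    qed
    ultimately show ?case using ed by (intro exI[of _ Z'] exI[of _ ?e]) simp
  qed
  from this[of "Pow A"] show ?thesis using fA by (simp add: Ball_def)
qed

section \<open>Covering cubes by cubes over the base subcategory\<close>

lemma B_agree:
  assumes B: "B k X" and ag: "agree (Pow {..<k}) X X'"
  shows "B k X'"
proof (rule B_iso[OF B])
  note X = B_diag[OF B]
  show X': "diag (Pow {..<k}) X'" using agree_diag[OF ag X] .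
  show "bij (Pow {..<k}) X X' (\<lambda>S. Id K (V X S))"
    using bij_Id[OF X] agree_nat[OF agree_refl ag refl] agree_V[OF ag] unfolding bij_def by simp
qed

lemma fc_insert: "fc (insert k t) X = fc t (up k X)"
  by (intro ext) (simp add: rx_def)

text \<open>A cube over \<open>{..<k} \<union> A\<close> is a family of \<open>k\<close>-cubes indexed by the subsets of \<open>A\<close>. Its members are
  reflected separately, and the edges between the reflections descend along the units, which are vertexwise
  regular epimorphisms.\<close>

lemma reflect_cube:
  assumes fA: "finite A" and dis: "{..<k} \<inter> A = {}" and X: "extc ({..<k} \<union> A) X"
  shows "\<exists>Y. diag (Pow ({..<k} \<union> A)) Y \<and>
     (\<forall>U\<in>Pow ({..<k} \<union> A). V Y U = V (F k (fc (U \<inter> A) X)) (U \<inter> {..<k})) \<and>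
     nat_tr (Pow ({..<k} \<union> A)) X Y (\<lambda>U. eta k (fc (U \<inter> A) X) (U \<inter> {..<k})) \<and>
     (\<forall>t. t \<subseteq> A \<longrightarrow> agree (Pow {..<k}) (F k (fc t X)) (fc t Y))"
proof -
  let ?D = "{..<k}" and ?P = "Pow ({..<k} \<union> A)" and ?Pk = "Pow {..<k}"
  let ?\<eta> = "\<lambda>U. eta k (fc (U \<inter> A) X) (U \<inter> ?D)" and ?w = "\<lambda>U. V (F k (fc (U \<inter> A) X)) (U \<inter> ?D)"
  note Xd = extc_diag[OF X]
  have Xt: "extc ?D (fc t X)" if "t \<subseteq> A" for t using fc_extc[OF fA _ dis that X] by simp
  have UD: "U \<inter> ?D \<in> ?Pk" "U \<inter> A \<subseteq> A" for U by auto
  have Uc: "U \<inter> ?D \<union> U \<inter> A = U" if "U \<in> ?P" for U using that by auto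
  have c: "cover (?\<eta> U) (V X U) (?w U)" if "U \<in> ?P" for U
    using emap_cover[OF fin(1) eta_emap[OF Xt[OF UD(2)]] UD(1), of U U] Uc[OF that] by simp
  have ex: "\<exists>a. hom a (?w U) (?w T) \<and> a \<odot> ?\<eta> U = ?\<eta> T \<odot> X U T" if U: "U \<in> ?P" and T: "T \<in> ?P" and le: "U \<subseteq> T" for U T
  proof -
    let ?t = "U \<inter> A" and ?t' = "T \<inter> A"
    have P1: "S \<union> ?t \<in> ?P" "S \<union> ?t' \<in> ?P" "S \<union> ?t \<subseteq> S \<union> ?t'" if "S \<in> ?Pk" for S using that le by auto
    have "nat_tr ?Pk (fc ?t X) (fc ?t' X) (\<lambda>S. X (S \<union> ?t) (S \<union> ?t'))"
      unfolding nat_tr_def V_rx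
    proof (intro conjI ballI impI)
      show "hom (X (S \<union> ?t) (S \<union> ?t')) (V X (S \<union> ?t)) (V X (S \<union> ?t'))" if "S \<in> ?Pk" for S
        by (rule diag_hom[OF Xd P1[OF that]])
      fix S S' assume S: "S \<in> ?Pk" "S' \<in> ?Pk" "S \<subseteq> S'"
      have l: "S \<union> ?t' \<subseteq> S' \<union> ?t'" "S \<union> ?t \<subseteq> S' \<union> ?t"
        using Un_mono[OF S(3) subset_refl] by simp_all
      show "fc ?t' X S S' \<odot> X (S \<union> ?t) (S \<union> ?t') = X (S' \<union> ?t) (S' \<union> ?t') \<odot> fc ?t X S S'"
        unfolding rx_def
        using trans[OF diag_comp[OF Xd P1(1)[OF S(1)] P1(2)[OF S(1)] P1(2)[OF S(2)] P1(3)[OF S(1)] l(1)]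
          diag_comp[OF Xd P1(1)[OF S(1)] P1(1)[OF S(2)] P1(2)[OF S(2)] l(2) P1(3)[OF S(2)], symmetric]] .
    qed
    note n0 = this
    obtain g where g: "nat_tr ?Pk (F k (fc ?t X)) (F k (fc ?t' X)) g"
      "\<And>S. S \<in> ?Pk \<Longrightarrow> g S \<odot> eta k (fc ?t X) S = eta k (fc ?t' X) S \<odot> X (S \<union> ?t) (S \<union> ?t')"
      by (rule F_map[OF Xt[OF UD(2)] Xt[OF UD(2)] n0], rule that, assumption, simp)
    have l: "U \<inter> ?D \<subseteq> T \<inter> ?D" using le by auto
    note e1 = eta_emap[OF Xt[OF UD(2)[of U]]]
    have "hom (g (T \<inter> ?D) \<odot> F k (fc ?t X) (U \<inter> ?D) (T \<inter> ?D)) (?w U) (?w T)"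
      using hom_cmp[OF diag_hom[OF emap_cod[OF e1] UD(1) UD(1) l] nat_hom[OF g(1) UD(1)]] .
    moreover have "(g (T \<inter> ?D) \<odot> F k (fc ?t X) (U \<inter> ?D) (T \<inter> ?D)) \<odot> ?\<eta> U = ?\<eta> T \<odot> X U T"
    proof -
      have m: "T \<inter> ?D \<union> ?t \<in> ?P" "U \<subseteq> T \<inter> ?D \<union> ?t" "T \<inter> ?D \<union> ?t \<subseteq> T" using U T le by auto
      have "F k (fc ?t X) (U \<inter> ?D) (T \<inter> ?D) \<odot> ?\<eta> U = eta k (fc ?t X) (T \<inter> ?D) \<odot> X U (T \<inter> ?D \<union> ?t)"
        using nat_sq[OF emap_nat[OF e1] UD(1) UD(1) l] Uc[OF U] by (simp add: rx_def)
      then have "(g (T \<inter> ?D) \<odot> F k (fc ?t X) (U \<inter> ?D) (T \<inter> ?D)) \<odot> ?\<eta> U =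
          g (T \<inter> ?D) \<odot> eta k (fc ?t X) (T \<inter> ?D) \<odot> X U (T \<inter> ?D \<union> ?t)" by simp
      also have "\<dots> = ?\<eta> T \<odot> X (T \<inter> ?D \<union> ?t) T \<odot> X U (T \<inter> ?D \<union> ?t)"
        using g(2)[OF UD(1)[of T]] Uc[OF T] by (metis cmp_assoc)
      also have "\<dots> = ?\<eta> T \<odot> X U T" using diag_comp[OF Xd U m(1) T m(2,3)] by simp
      finally show ?thesis .
    qed
    ultimately show ?thesis by meson
  qed
  have "\<exists>Y. diag ?P Y \<and> (\<forall>U\<in>?P. V Y U = ?w U) \<and> nat_tr ?P X Y ?\<eta>"
    by (rule descend_diag[OF Xd c ex])
  then obtain Y where Y: "diag ?P Y" and VY: "\<forall>U\<in>?P. V Y U = ?w U" and n: "nat_tr ?P X Y ?\<eta>"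
    by (elim exE conjE)
  have "agree ?Pk (F k (fc t X)) (fc t Y)" if t: "t \<subseteq> A" for t
    unfolding agree_def
  proof (intro ballI impI)
    fix S S' assume S: "S \<in> ?Pk" "S' \<in> ?Pk" "S \<subseteq> S'"
    have s: "S \<union> t \<in> ?P" "(S \<union> t) \<inter> A = t" "(S \<union> t) \<inter> ?D = S" if "S \<in> ?Pk" for S using that t dis by auto
    have l: "S \<union> t \<subseteq> S' \<union> t" using S by auto
    note e1 = eta_emap[OF Xt[OF t]]
    have V1: "V Y (S \<union> t) = V (F k (fc t X)) S" "V Y (S' \<union> t) = V (F k (fc t X)) S'"
      using VY s S by simp_all
    show "F k (fc t X) S S' = fc t Y S S'"
    proof (rule cover_epi[OF emap_cover[OF fin(1) e1 S(1)] diag_hom[OF emap_cod[OF e1] S]])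
      show "hom (fc t Y S S') (V (F k (fc t X)) S) (V (F k (fc t X)) S')"
        using diag_hom[OF Y s(1)[OF S(1)] s(1)[OF S(2)] l] V1 by (simp add: rx_def)
      show "F k (fc t X) S S' \<odot> eta k (fc t X) S = fc t Y S S' \<odot> eta k (fc t X) S"
        using nat_sq[OF emap_nat[OF e1] S] nat_sq[OF n s(1)[OF S(1)] s(1)[OF S(2)] l] s[OF S(1)] s[OF S(2)]
        by (simp add: rx_def)
    qed
  qed
  then show ?thesis using Y VY n by (intro exI[of _ Y]) simp
qed

text \<open>Up to the extension \<open>r\<close>, the faces of \<open>\<beta>\<close> are as good a target as the reflections of the faces of \<open>X\<close>:
  they receive the morphisms into objects of \<open>B k\<close>.\<close>

definition faces_factor where
  "faces_factor k A X Q \<beta> r s \<longleftrightarrow> (\<forall>t Y h. t \<subseteq> A \<and> B k Y \<and> nat_tr (Pow {..<k}) (fc t X) Y h \<longrightarrow>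
     (\<exists>g. nat_tr (Pow {..<k}) (fc t \<beta>) Y g \<and> (\<forall>S\<in>Pow {..<k}. g S \<odot> s (S \<union> t) = h S \<odot> r (S \<union> t))))"

text \<open>The vertexwise reflection of an extension need not be an extension in the directions of \<open>A\<close>, so it is
  replaced by a cube \<open>\<beta>\<close> that is joined to \<open>X\<close> by a span of extensions.\<close>

definition resolvable where
  "resolvable k A \<longleftrightarrow> (\<forall>X. extc ({..<k} \<union> A) X \<longrightarrow> (\<exists>Q \<beta> r s.
     emap (Pow ({..<k} \<union> A)) Q X r \<and> emap (Pow ({..<k} \<union> A)) Q \<beta> s \<and>
     (\<forall>t. t \<subseteq> A \<longrightarrow> B k (fc t \<beta>)) \<and> faces_factor k A X Q \<beta> r s))"

lemma faces_factorD:
  assumes "faces_factor k A X Q \<beta> r s" "t \<subseteq> A" "B k Y" "nat_tr (Pow {..<k}) (fc t X) Y h"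
  shows "\<exists>g. nat_tr (Pow {..<k}) (fc t \<beta>) Y g \<and> (\<forall>S\<in>Pow {..<k}. g S \<odot> s (S \<union> t) = h S \<odot> r (S \<union> t))"
  using assms unfolding faces_factor_def by meson

text \<open>Let \<open>X0 \<rightarrow> X1\<close> be \<open>X\<close> regarded as an arrow in the direction \<open>k\<close>. Trivialise all its faces by one extension
  \<open>Z0 \<rightarrow> X1\<close>, with pullback \<open>P0 \<rightarrow> Z0\<close> of \<open>X0 \<rightarrow> X1\<close>. The arrow \<open>P0 \<rightarrow> Z0\<close> is then the pullback of its vertexwise
  reflection \<open>F0 \<rightarrow> FZ\<close>. Resolve \<open>Z0\<close> by a span \<open>Z0 \<leftarrow> Z \<rightarrow> b\<close>. The units of the faces of \<open>Z0\<close> induce a map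
  \<open>b \<rightarrow> FZ\<close>, along which \<open>F0\<close> is pulled back to \<open>b0\<close>. Pulling back \<open>P0\<close> to \<open>Z\<close> yields \<open>\<sigma>0 \<rightarrow> Z\<close>, which is a
  pullback of both \<open>X0 \<rightarrow> X1\<close> and \<open>b0 \<rightarrow> b\<close>. These pullback squares are discrete fibrations from
  \<open>\<sigma>0 \<rightarrow> Z\<close> to \<open>X\<close> and to \<open>b0 \<rightarrow> b\<close>, and the faces of \<open>b0\<close> and \<open>b\<close> belong to \<open>B k\<close>.\<close>

lemma reduce_dimension:
  assumes fA: "finite A" and dis: "{..<Suc k} \<inter> A = {}" and X: "extc (insert k ({..<k} \<union> A)) X"
    and BX: "\<And>t. t \<subseteq> A \<Longrightarrow> B (Suc k) (fc t X)" and res: "resolvable k A"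
  shows "\<exists>\<sigma> \<rho> \<beta> s. dfib (insert k ({..<k} \<union> A)) \<sigma> X \<rho> \<and> dfib (insert k ({..<k} \<union> A)) \<sigma> \<beta> s \<and>
     (\<forall>t. t \<subseteq> insert k A \<longrightarrow> B k (fc t \<beta>)) \<and> faces_factor k (insert k A) X \<sigma> \<beta> \<rho> s"
proof -
  let ?D = "{..<k}" and ?N = "{..<k} \<union> A" and ?P = "Pow ({..<k} \<union> A)" and ?Pk = "Pow {..<k}"
  have disk: "?D \<inter> A = {}" and kN: "k \<notin> ?N" and kA: "k \<notin> A" using dis by (auto simp: lessThan_Suc)
  have finP: "finite ?P" using fA by simp
  have X': "extc ?N (up k X)" "emap ?P X (up k X) (dir k X)" using X extc_insert[OF kN] by simp_all
  note dX = X'(2) and Xd = extc_diag[OF X]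
  have St: "S \<union> t \<in> ?P" "(S \<union> t) \<inter> A = t" "(S \<union> t) \<inter> ?D = S" "k \<notin> S \<union> t" if "S \<in> ?Pk" "t \<subseteq> A" for S t
    using that disk kN by auto
  have UD: "U \<inter> ?D \<in> ?Pk" "U \<inter> A \<subseteq> A" for U by auto
  have Uc: "U \<inter> ?D \<union> U \<inter> A = U" if "U \<in> ?P" for U using that by auto
  obtain Z0 e where e: "emap ?P Z0 (up k X) e"
    and tr: "\<forall>t. t \<subseteq> A \<longrightarrow> trivialises k (fc t X) (fc t Z0) (\<lambda>S. e (S \<union> t))"
  proof -
    have "\<exists>Z e. emap ?P Z (up k X) e \<and> (\<forall>t. t \<subseteq> A \<longrightarrow> trivialises k (fc t X) (fc t Z) (\<lambda>S. e (S \<union> t)))"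
      by (rule trivialise_faces[OF fA dis X], rule BX)
    then show thesis using that by (elim exE conjE)
  qed
  note en = emap_nat[OF e] and Z0d = emap_dom[OF e]
  have Z0e: "extc ?N Z0" using extc_dom[OF e X'(1)] .
  obtain Z b r1 s1 where r1: "emap ?P Z Z0 r1" and s1: "emap ?P Z b s1" and bB: "\<forall>t. t \<subseteq> A \<longrightarrow> B k (fc t b)"
    and fc1: "faces_factor k A Z0 Z b r1 s1"
    using res Z0e unfolding resolvable_def by meson
  note r1n = emap_nat[OF r1] and s1n = emap_nat[OF s1] and Zd = emap_dom[OF s1] and bd = emap_cod[OF s1]
  obtain P0 pp qq where P0: "pb ?P X Z0 (up k X) (dir k X) e P0 pp qq"
    using pb_exists[OF emap_dom[OF dX] Z0d emap_cod[OF dX] emap_nat[OF dX] en] by (elim exE)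
  have qq: "emap ?P P0 Z0 qq" using pb_emap[OF P0 dX Z0d en] .
  note P0d = pb_diag[OF P0] and ppn = pb_p[OF P0] and qqn = pb_q[OF P0]
  have P0e: "extc ?N P0" using extc_dom[OF qq Z0e] .
  have Z0t: "extc ?D (fc t Z0)" and P0t: "extc ?D (fc t P0)" if "t \<subseteq> A" for t
    using fc_extc[OF fA _ disk that Z0e] fc_extc[OF fA _ disk that P0e] by simp_all
  have triv0: "triv k (fc t P0) (fc t Z0) (\<lambda>S. qq (S \<union> t))" if t: "t \<subseteq> A" for t
  proof -
    have "pb ?Pk (fc t X) (fc t Z0) (fc t (up k X)) (\<lambda>S. dir k X (S \<union> t)) (\<lambda>S. e (S \<union> t)) (fc t P0)
        (\<lambda>S. pp (S \<union> t)) (\<lambda>S. qq (S \<union> t))"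
      using rx_pb[OF fc_mono[OF t] P0] .
    then have "pb ?Pk (fc t X) (fc t Z0) (up k (fc t X)) (dir k (fc t X)) (\<lambda>S. e (S \<union> t)) (fc t P0)
        (\<lambda>S. pp (S \<union> t)) (\<lambda>S. qq (S \<union> t))"
      unfolding fc_up dir_fc[abs_def] .
    then show ?thesis using tr t unfolding trivialises_def by meson
  qed
  \<comment> \<open>The trivialised cube is pulled back from its vertexwise reflection.\<close>
  let ?eZ = "\<lambda>U. eta k (fc (U \<inter> A) Z0) (U \<inter> ?D)" and ?eP = "\<lambda>U. eta k (fc (U \<inter> A) P0) (U \<inter> ?D)"
  obtain FZ where FZ: "diag ?P FZ" and VFZ: "\<forall>U\<in>?P. V FZ U = V (F k (fc (U \<inter> A) Z0)) (U \<inter> ?D)"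
    and eZ: "nat_tr ?P Z0 FZ ?eZ" and agZ: "\<forall>t. t \<subseteq> A \<longrightarrow> agree ?Pk (F k (fc t Z0)) (fc t FZ)"
    using reflect_cube[OF fA disk Z0e] by (elim exE conjE)
  obtain F0 where F0: "diag ?P F0" and VF0: "\<forall>U\<in>?P. V F0 U = V (F k (fc (U \<inter> A) P0)) (U \<inter> ?D)"
    and eP: "nat_tr ?P P0 F0 ?eP" and agP: "\<forall>t. t \<subseteq> A \<longrightarrow> agree ?Pk (F k (fc t P0)) (fc t F0)"
    using reflect_cube[OF fA disk P0e] by (elim exE conjE)
  have cP: "cover (?eP U) (V P0 U) (V F0 U)" if U: "U \<in> ?P" for U
    using emap_cover[OF fin(1) eta_emap[OF P0t[OF UD(2)]] UD(1), of U U] Uc[OF U] VF0 U by simp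
  have "\<forall>t\<in>Pow A. \<exists>g. nat_tr ?Pk (F k (fc t P0)) (F k (fc t Z0)) g \<and>
      (\<forall>S\<in>?Pk. g S \<odot> eta k (fc t P0) S = eta k (fc t Z0) S \<odot> qq (S \<union> t)) \<and>
      pb ?Pk (fc t Z0) (F k (fc t P0)) (F k (fc t Z0)) (eta k (fc t Z0)) g (fc t P0) (\<lambda>S. qq (S \<union> t)) (eta k (fc t P0))"
    using triv0 unfolding triv_def by simp
  from bchoice[OF this] obtain G where "\<forall>t\<in>Pow A. nat_tr ?Pk (F k (fc t P0)) (F k (fc t Z0)) (G t) \<and>
      (\<forall>S\<in>?Pk. G t S \<odot> eta k (fc t P0) S = eta k (fc t Z0) S \<odot> qq (S \<union> t)) \<and>
      pb ?Pk (fc t Z0) (F k (fc t P0)) (F k (fc t Z0)) (eta k (fc t Z0)) (G t) (fc t P0) (\<lambda>S. qq (S \<union> t)) (eta k (fc t P0))"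
    by (elim exE)
  then have Gn: "nat_tr ?Pk (F k (fc t P0)) (F k (fc t Z0)) (G t)"
    and Ge: "\<forall>S\<in>?Pk. G t S \<odot> eta k (fc t P0) S = eta k (fc t Z0) S \<odot> qq (S \<union> t)"
    and Gpb: "pb ?Pk (fc t Z0) (F k (fc t P0)) (F k (fc t Z0)) (eta k (fc t Z0)) (G t) (fc t P0) (\<lambda>S. qq (S \<union> t)) (eta k (fc t P0))"
    if "t \<subseteq> A" for t using that by simp_all
  let ?g = "\<lambda>U. G (U \<inter> A) (U \<inter> ?D)"
  have gh: "hom (?g U) (V F0 U) (V FZ U)" and ge: "?g U \<odot> ?eP U = ?eZ U \<odot> qq U" if U: "U \<in> ?P" for U
    using nat_hom[OF Gn[OF UD(2)] UD(1), of U U] bspec[OF Ge[OF UD(2)] UD(1), of U U] VF0 VFZ U Uc[OF U] by simp_all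
  have gn: "nat_tr ?P F0 FZ ?g"
    by (rule descend_nat[OF P0d F0 FZ eP cP nat_comp[OF qqn eZ]]) (use gh ge in auto)
  have P0': "pb ?P Z0 F0 FZ ?eZ ?g P0 qq ?eP"
  proof (rule pbI[OF P0d qqn eP])
    show "?eZ U \<odot> qq U = ?g U \<odot> ?eP U" if "U \<in> ?P" for U using ge[OF that] by simp
  next
    fix U z x y assume U: "U \<in> ?P" and x: "hom x z (V Z0 U)" and y: "hom y z (V F0 U)" and eq: "?eZ U \<odot> x = ?g U \<odot> y"
    have x': "hom x z (V (fc (U \<inter> A) Z0) (U \<inter> ?D))" and y': "hom y z (V (F k (fc (U \<inter> A) P0)) (U \<inter> ?D))"
      using x y VF0 U Uc[OF U] by simp_all
    obtain u where "hom u z (V (fc (U \<inter> A) P0) (U \<inter> ?D))" "qq (U \<inter> ?D \<union> U \<inter> A) \<odot> u = x" "?eP U \<odot> u = y"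
      by (rule pb_lift[OF Gpb[OF UD(2)] UD(1) x' y' eq])
    then show "\<exists>u. hom u z (V P0 U) \<and> qq U \<odot> u = x \<and> ?eP U \<odot> u = y"
      using Uc[OF U] by (intro exI[of _ u]) simp
  next
    fix U z u v assume U: "U \<in> ?P" and u: "hom u z (V P0 U)" and v: "hom v z (V P0 U)"
      and eq: "qq U \<odot> u = qq U \<odot> v" "?eP U \<odot> u = ?eP U \<odot> v"
    show "u = v"
      by (rule pb_eqI[OF Gpb[OF UD(2)[of U]] UD(1)[of U]]) (use u v eq Uc[OF U] in simp_all)
  qed
  have "\<forall>t\<in>Pow A. \<exists>c. nat_tr ?Pk (fc t b) (F k (fc t Z0)) c \<and>
     (\<forall>S\<in>?Pk. c S \<odot> s1 (S \<union> t) = eta k (fc t Z0) S \<odot> r1 (S \<union> t))"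
    using faces_factorD[OF fc1 _ F_B[OF Z0t] emap_nat[OF eta_emap[OF Z0t]]] by simp
  from bchoice[OF this] obtain C where "\<forall>t\<in>Pow A. nat_tr ?Pk (fc t b) (F k (fc t Z0)) (C t) \<and>
     (\<forall>S\<in>?Pk. C t S \<odot> s1 (S \<union> t) = eta k (fc t Z0) S \<odot> r1 (S \<union> t))"
    by (elim exE)
  then have Cn: "nat_tr ?Pk (fc t b) (F k (fc t Z0)) (C t)"
    and Ce: "\<forall>S\<in>?Pk. C t S \<odot> s1 (S \<union> t) = eta k (fc t Z0) S \<odot> r1 (S \<union> t)" if "t \<subseteq> A" for t
    using that by simp_all
  let ?c = "\<lambda>U. C (U \<inter> A) (U \<inter> ?D)"
  have ch: "hom (?c U) (V b U) (V FZ U)" and ce: "?c U \<odot> s1 U = ?eZ U \<odot> r1 U" if U: "U \<in> ?P" for U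
    using nat_hom[OF Cn[OF UD(2)] UD(1), of U U] bspec[OF Ce[OF UD(2)] UD(1), of U U] VFZ U Uc[OF U] by simp_all
  have cn: "nat_tr ?P b FZ ?c"
    by (rule descend_nat[OF Zd bd FZ s1n emap_cover[OF finP s1] nat_comp[OF r1n eZ]]) (use ch ce in auto)
  obtain b0 pb0 qb0 where b0: "pb ?P b F0 FZ ?c ?g b0 pb0 qb0"
    using pb_exists[OF bd F0 FZ cn gn] by (elim exE)
  note b0d = pb_diag[OF b0] and pb0n = pb_p[OF b0] and qb0n = pb_q[OF b0]
  obtain \<sigma>0 n q0 where \<sigma>0: "pb ?P P0 Z Z0 qq r1 \<sigma>0 n q0"
    using pb_exists[OF P0d Zd Z0d qqn r1n] by (elim exE)
  have \<sigma>X: "pb ?P X Z (up k X) (dir k X) (\<lambda>U. e U \<odot> r1 U) \<sigma>0 (\<lambda>U. pp U \<odot> n U) q0"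
    using pb_paste[OF pb_sym[OF P0] r1n \<sigma>0] .
  have "pb ?P F0 Z FZ ?g (\<lambda>U. ?eZ U \<odot> r1 U) \<sigma>0 (\<lambda>U. ?eP U \<odot> n U) q0"
    using pb_paste[OF P0' r1n \<sigma>0] .
  then have "pb ?P F0 Z FZ ?g (\<lambda>U. ?c U \<odot> s1 U) \<sigma>0 (\<lambda>U. ?eP U \<odot> n U) q0"
    by (rule pb_cong) (simp_all add: ce)
  from pb_paste_cancel[OF b0 s1n this]
  obtain m where \<sigma>b: "pb ?P b0 Z b pb0 s1 \<sigma>0 m q0" and qm: "\<forall>U\<in>?P. qb0 U \<odot> m U = ?eP U \<odot> n U"
    by (elim exE conjE)
  have me: "emap ?P \<sigma>0 b0 m" using pb_emap[OF pb_sym[OF \<sigma>b] s1 b0d pb0n] .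
  have q0e: "emap ?P \<sigma>0 Z q0" using pb_emap[OF \<sigma>0 qq Zd r1n] .
  have pb0e: "emap ?P b0 b pb0"
  proof (rule emap_cancel[OF finP me pb0n])
    show "emap ?P \<sigma>0 b (\<lambda>T. pb0 T \<odot> m T)"
      by (rule agree_emap[OF agree_refl agree_refl _ emap_comp[OF q0e s1]]) (simp add: pb_sq[OF \<sigma>b])
  qed
  let ?\<sigma> = "mapc k \<sigma>0 Z q0" and ?\<beta> = "mapc k b0 b pb0"
  let ?\<rho> = "\<lambda>U. if k \<in> U then e (U - {k}) \<odot> r1 (U - {k}) else pp U \<odot> n U"
  let ?s = "\<lambda>U. if k \<in> U then s1 (U - {k}) else m U"
  have \<rho>: "dfib (insert k ?N) ?\<sigma> X ?\<rho>"
    using mapc_pb[OF kN Xd emap_comp[OF r1 e] \<sigma>X] .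
  note dn = mapc_dn[OF kN, of b0 b pb0] and upb = mapc_up[OF kN, of b b0 pb0]
  have \<beta>d: "diag (Pow (insert k ?N)) ?\<beta>" using mapc_diag[OF kN b0d bd pb0n] .
  have s: "dfib (insert k ?N) ?\<sigma> ?\<beta> ?s"
  proof (rule mapc_pb[OF kN \<beta>d])
    show "emap ?P Z (up k ?\<beta>) s1" by (rule agree_emap[OF agree_refl upb refl s1])
    show "pb ?P ?\<beta> Z (up k ?\<beta>) (dir k ?\<beta>) s1 \<sigma>0 m q0"
      by (rule pb_cong[OF agree_pb[OF \<sigma>b dn agree_refl upb agree_refl]]) (simp_all add: mapc_dir[OF kN b0d pb0n])
  qed
  have agb0: "agree ?Pk (fc t b0) (fc t ?\<beta>)" if "t \<subseteq> A" for t
    unfolding agree_def rx_def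
  proof (intro ballI impI)
    fix S T assume S: "S \<in> ?Pk" and T: "T \<in> ?Pk" and "S \<subseteq> T"
    then have "S \<union> t \<subseteq> T \<union> t" by (intro Un_mono subset_refl)
    then show "b0 (S \<union> t) (T \<union> t) = ?\<beta> (S \<union> t) (T \<union> t)"
      using dn[unfolded agree_def, rule_format, OF St(1)[OF S that] St(1)[OF T that]] by simp
  qed
  have agb: "agree ?Pk (fc t b) (fc (insert k t) ?\<beta>)" if "t \<subseteq> A" for t
    unfolding agree_def fc_insert rx_def[of "\<lambda>S. S \<union> t"]
  proof (intro ballI impI)
    fix S T assume S: "S \<in> ?Pk" and T: "T \<in> ?Pk" and "S \<subseteq> T"
    then have "S \<union> t \<subseteq> T \<union> t" by (intro Un_mono subset_refl)
    then show "b (S \<union> t) (T \<union> t) = up k ?\<beta> (S \<union> t) (T \<union> t)"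
      using upb[unfolded agree_def, rule_format, OF St(1)[OF S that] St(1)[OF T that]] by simp
  qed
  have agg: "emap ?Pk (fc t F0) (fc t FZ) (\<lambda>S. ?g (S \<union> t))" if t: "t \<subseteq> A" for t
  proof -
    have "emap ?Pk (F k (fc t P0)) (F k (fc t Z0)) (G t)"
      using F_map_emap[OF triv_emap[OF triv0[OF t]] Z0t[OF t] Gn[OF t]] Ge[OF t] by simp
    then show ?thesis
      by (rule agree_emap[rotated 3]) (use agP agZ t St[OF _ t] in simp_all)
  qed
  have B\<beta>: "B k (fc t ?\<beta>)" if t: "t \<subseteq> insert k A" for t
  proof (cases "k \<in> t")
    case True
    then have t': "t = insert k (t - {k})" "t - {k} \<subseteq> A" using t by auto
    have "B k (fc t' b)" if "t' \<subseteq> A" for t' using bB that by simp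
    from B_agree[OF this[OF t'(2)] agb[OF t'(2)]] show ?thesis unfolding t'(1)[symmetric] .
  next
    case False
    then have tA: "t \<subseteq> A" using t by auto
    \<comment> \<open>The faces of \<open>b0\<close> are pullbacks inside \<open>B k\<close>, since those of \<open>F0\<close> and \<open>b\<close> belong to it.\<close>
    have p: "pb ?Pk (fc t F0) (fc t b) (fc t FZ) (\<lambda>S. ?g (S \<union> t)) (\<lambda>S. ?c (S \<union> t)) (fc t b0) (\<lambda>S. qb0 (S \<union> t)) (\<lambda>S. pb0 (S \<union> t))"
      using rx_pb[OF fc_mono[OF tA] pb_sym[OF b0]] .
    have B1: "B k (fc t F0)" using B_agree[OF F_B[OF P0t[OF tA]]] agP tA by simp
    have B2: "B k (fc t b)" using bB tA by simp
    have "B k (fc t b0)"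
      by (rule B_pb[OF B1 B2 agg[OF tA] rx_nat[OF fc_mono[OF tA] cn] p])
    from B_agree[OF this agb0[OF tA]] show ?thesis .
  qed
  have "faces_factor k (insert k A) X ?\<sigma> ?\<beta> ?\<rho> ?s"
    unfolding faces_factor_def
  proof (intro allI impI)
    fix t Y h assume "t \<subseteq> insert k A \<and> B k Y \<and> nat_tr ?Pk (fc t X) Y h"
    then have t: "t \<subseteq> insert k A" and Y: "B k Y" and h: "nat_tr ?Pk (fc t X) Y h" by auto
    show "\<exists>g. nat_tr ?Pk (fc t ?\<beta>) Y g \<and> (\<forall>S\<in>?Pk. g S \<odot> ?s (S \<union> t) = h S \<odot> ?\<rho> (S \<union> t))"
    proof (cases "k \<in> t")
      case True
      define t' where "t' = t - {k}"
      have t': "t = insert k t'" "t' \<subseteq> A" "k \<notin> t'" using t True by (auto simp: t'_def)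
      have "nat_tr ?Pk (fc t' Z0) Y (\<lambda>S. h S \<odot> e (S \<union> t'))"
        by (rule nat_comp[OF rx_nat[OF fc_mono[OF t'(2)] en]]) (use h in \<open>unfold t'(1) fc_insert\<close>)
      from faces_factorD[OF fc1 t'(2) Y this]
      obtain g where g: "nat_tr ?Pk (fc t' b) Y g" "\<forall>S\<in>?Pk. g S \<odot> s1 (S \<union> t') = (h S \<odot> e (S \<union> t')) \<odot> r1 (S \<union> t')"
        by (elim exE conjE)
      have "nat_tr ?Pk (fc t ?\<beta>) Y g"
        using agree_nat[OF agb[OF t'(2)] agree_refl refl g(1)] unfolding t'(1) .
      moreover have "g S \<odot> ?s (S \<union> t) = h S \<odot> ?\<rho> (S \<union> t)" if S: "S \<in> ?Pk" for S
      proof -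
        have "k \<in> S \<union> t" "(S \<union> t) - {k} = S \<union> t'" using S t' by auto
        then show ?thesis using g(2) S by simp
      qed
      ultimately show ?thesis by (intro exI[of _ g]) simp
    next
      case False
      then have tA: "t \<subseteq> A" using t by auto
      have "nat_tr ?Pk (fc t P0) Y (\<lambda>S. h S \<odot> pp (S \<union> t))"
        using nat_comp[OF rx_nat[OF fc_mono[OF tA] ppn] h] .
      note n0 = this
      obtain h2 where h2: "nat_tr ?Pk (F k (fc t P0)) Y h2"
        "\<And>S. S \<in> ?Pk \<Longrightarrow> h2 S \<odot> eta k (fc t P0) S = h S \<odot> pp (S \<union> t)"
        by (rule F_univE[OF P0t[OF tA] Y n0], rule that, assumption, simp)
      have "nat_tr ?Pk (fc t F0) Y h2"
        using agree_nat[OF _ agree_refl refl h2(1)] agP tA by simp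
      from nat_comp[OF rx_nat[OF fc_mono[OF tA] qb0n] this]
      have "nat_tr ?Pk (fc t b0) Y (\<lambda>S. h2 S \<odot> qb0 (S \<union> t))" .
      from agree_nat[OF agb0[OF tA] agree_refl refl this]
      have "nat_tr ?Pk (fc t ?\<beta>) Y (\<lambda>S. h2 S \<odot> qb0 (S \<union> t))" .
      moreover have "(h2 S \<odot> qb0 (S \<union> t)) \<odot> ?s (S \<union> t) = h S \<odot> ?\<rho> (S \<union> t)" if S: "S \<in> ?Pk" for S
      proof -
        note s' = St[OF S tA]
        have "qb0 (S \<union> t) \<odot> m (S \<union> t) = eta k (fc t P0) S \<odot> n (S \<union> t)" using bspec[OF qm s'(1)] s' by simp
        then have "h2 S \<odot> qb0 (S \<union> t) \<odot> m (S \<union> t) = h S \<odot> pp (S \<union> t) \<odot> n (S \<union> t)"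
          using arg_cong[OF h2(2)[OF S], of "\<lambda>m. m \<odot> n (S \<union> t)"] by simp
        then show ?thesis using s'(4) by simp
      qed
      ultimately show ?thesis by (intro exI[of _ "\<lambda>S. h2 S \<odot> qb0 (S \<union> t)"]) simp
    qed
  qed
  then show ?thesis using \<rho> s B\<beta> by (intro exI conjI) simp_all
qed

text \<open>A face of \<open>X\<close> of dimension \<open>k + 1\<close> is an arrow between faces of dimension \<open>k\<close>. The reflection of that arrow
  is an extension between members of \<open>B k\<close>, hence a member of \<open>B (k + 1)\<close>; the factorisation into it yields
  the factorisations of maps defined on either end.\<close>

lemma faces_factor_lower:
  assumes fA: "finite A" and dis: "{..<Suc k} \<inter> A = {}" and X: "extc ({..<Suc k} \<union> A) X"
    and f: "faces_factor (Suc k) A X Q \<beta> r s"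
  shows "faces_factor k (insert k A) X Q \<beta> r s"
  unfolding faces_factor_def
proof (intro allI impI)
  let ?D = "{..<k}" and ?Pk = "Pow {..<k}"
  note L = lessThan_Suc[of k]
  have kA: "k \<notin> A" using dis by (auto simp: lessThan_Suc)
  fix t Y h assume "t \<subseteq> insert k A \<and> B k Y \<and> nat_tr ?Pk (fc t X) Y h"
  then have t: "t \<subseteq> insert k A" and Y: "B k Y" and h: "nat_tr ?Pk (fc t X) Y h" by auto
  define t' where "t' = t - {k}"
  have t': "t' \<subseteq> A" "k \<notin> t'" using t by (auto simp: t'_def)
  let ?W = "fc t' X"
  have W: "extc {..<Suc k} ?W" using fc_extc[OF fA _ dis t'(1) X] by simp
  then have upW: "extc ?D (up k ?W)" and dW: "emap ?Pk ?W (up k ?W) (dir k ?W)"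
    by (simp_all add: extc_Suc)
  have Wd: "diag (Pow (insert k ?D)) ?W" using extc_diag[OF W] unfolding L .
  have W0: "extc ?D ?W" using extc_dom[OF dW upW] .
  obtain g where g: "nat_tr ?Pk (F k ?W) (F k (up k ?W)) g"
    and ge: "\<And>S. S \<in> ?Pk \<Longrightarrow> g S \<odot> eta k ?W S = eta k (up k ?W) S \<odot> dir k ?W S"
    by (rule F_map[OF W0 upW emap_nat[OF dW]], rule that, assumption, simp)
  have gem: "emap ?Pk (F k ?W) (F k (up k ?W)) g" using F_map_emap[OF dW upW g ge] .
  let ?E = "mapc k (F k ?W) (F k (up k ?W)) g"
  note Fd0 = emap_dom[OF gem] and Fd1 = emap_cod[OF gem]
  note dn = mapc_dn[OF notin_lessThan, of k "F k ?W" "F k (up k ?W)" g] and upE = mapc_up[OF notin_lessThan, of k "F k (up k ?W)" "F k ?W" g]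
  have Ed: "diag (Pow (insert k ?D)) ?E" using mapc_diag[OF notin_lessThan Fd0 Fd1 g] .
  have "extc {..<Suc k} ?E"
    unfolding L extc_mapc[OF notin_lessThan Fd0 Fd1 g] using B_extc[OF F_B[OF upW]] gem by simp
  then have EB: "B (Suc k) ?E"
    by (rule B_arrow[OF _ B_agree[OF F_B[OF W0] dn] B_agree[OF F_B[OF upW] upE]])
  let ?h = "\<lambda>U. if k \<in> U then eta k (up k ?W) (U - {k}) else eta k ?W U"
  have h0: "?h S = eta k ?W S" and h1: "?h (insert k S) = eta k (up k ?W) S" if "S \<in> ?Pk" for S
  proof -
    have "k \<notin> S" "insert k S - {k} = S" using that by auto
    then show "?h S = eta k ?W S" "?h (insert k S) = eta k (up k ?W) S" by simp_all
  qed
  have "nat_tr (Pow (insert k ?D)) ?W ?E ?h"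
  proof (rule nat_split[OF notin_lessThan Wd Ed])
    show "nat_tr ?Pk ?W ?E ?h"
      by (rule agree_nat[OF agree_refl dn _ emap_nat[OF eta_emap[OF W0]]]) (use h0 in simp)
    show "nat_tr ?Pk (up k ?W) (up k ?E) (\<lambda>S. ?h (insert k S))"
      by (rule agree_nat[OF agree_refl upE _ emap_nat[OF eta_emap[OF upW]]]) (use h1 in simp)
    show "dir k ?E S \<odot> ?h S = ?h (insert k S) \<odot> dir k ?W S" if "S \<in> ?Pk" for S
      using ge[OF that] h0[OF that] h1[OF that] mapc_dir[OF notin_lessThan Fd0 g that] by simp
  qed
  from faces_factorD[OF f t'(1) EB this[folded L]]
  obtain g' where g': "nat_tr (Pow {..<Suc k}) (fc t' \<beta>) ?E g'"
    and g'e: "\<forall>S\<in>Pow {..<Suc k}. g' S \<odot> s (S \<union> t') = ?h S \<odot> r (S \<union> t')"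
    by (elim exE conjE)
  have in1: "S \<in> Pow {..<Suc k}" "insert k S \<in> Pow {..<Suc k}" if "S \<in> ?Pk" for S using that by (auto simp: L)
  note g'L = g'[unfolded L]
  show "\<exists>g. nat_tr ?Pk (fc t \<beta>) Y g \<and> (\<forall>S\<in>?Pk. g S \<odot> s (S \<union> t) = h S \<odot> r (S \<union> t))"
  proof (cases "k \<in> t")
    case False
    then have tt: "t' = t" by (simp add: t'_def)
    obtain h' where h': "nat_tr ?Pk (F k ?W) Y h'" "\<And>S. S \<in> ?Pk \<Longrightarrow> h' S \<odot> eta k ?W S = h S"
      by (rule F_univE[OF W0 Y h[unfolded tt[symmetric]]], rule that, assumption, simp)
    have "nat_tr ?Pk (fc t \<beta>) (F k ?W) g'"
      using agree_nat[OF agree_refl agree_sym[OF dn] refl nat_dn[OF g'L]] tt by simp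
    from nat_comp[OF this h'(1)] have "nat_tr ?Pk (fc t \<beta>) Y (\<lambda>S. h' S \<odot> g' S)" .
    moreover have "(h' S \<odot> g' S) \<odot> s (S \<union> t) = h S \<odot> r (S \<union> t)" if S: "S \<in> ?Pk" for S
    proof -
      have "g' S \<odot> s (S \<union> t) = eta k ?W S \<odot> r (S \<union> t)" using bspec[OF g'e in1(1)[OF S]] h0[OF S] tt by simp
      then show ?thesis using arg_cong[OF h'(2)[OF S], of "\<lambda>m. m \<odot> r (S \<union> t)"] by simp
    qed
    ultimately show ?thesis by (intro exI[of _ "\<lambda>S. h' S \<odot> g' S"]) simp
  next
    case True
    then have tt: "t = insert k t'" by (auto simp: t'_def)
    have ft: "fc t X = up k ?W" "fc t \<beta> = up k (fc t' \<beta>)" unfolding tt fc_insert fc_up by simp_all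
    obtain h' where h': "nat_tr ?Pk (F k (up k ?W)) Y h'" "\<And>S. S \<in> ?Pk \<Longrightarrow> h' S \<odot> eta k (up k ?W) S = h S"
      by (rule F_univE[OF upW Y h[unfolded ft(1)]], rule that, assumption, simp)
    have "nat_tr ?Pk (up k (fc t' \<beta>)) (up k ?E) (\<lambda>S. g' (insert k S))"
      using rx_nat[OF up_mono[OF notin_lessThan] g'L] .
    from agree_nat[OF agree_refl agree_sym[OF upE] refl this]
    have "nat_tr ?Pk (fc t \<beta>) (F k (up k ?W)) (\<lambda>S. g' (insert k S))" unfolding ft(2) .
    from nat_comp[OF this h'(1)] have "nat_tr ?Pk (fc t \<beta>) Y (\<lambda>S. h' S \<odot> g' (insert k S))" .
    moreover have "(h' S \<odot> g' (insert k S)) \<odot> s (S \<union> t) = h S \<odot> r (S \<union> t)" if S: "S \<in> ?Pk" for S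
    proof -
      have "S \<union> t = insert k S \<union> t'" using tt by auto
      then have "g' (insert k S) \<odot> s (S \<union> t) = eta k (up k ?W) S \<odot> r (S \<union> t)"
        using bspec[OF g'e in1(2)[OF S]] h1[OF S] by simp
      then show ?thesis using arg_cong[OF h'(2)[OF S], of "\<lambda>m. m \<odot> r (S \<union> t)"] by simp
    qed
    ultimately show ?thesis by (intro exI[of _ "\<lambda>S. h' S \<odot> g' (insert k S)"]) simp
  qed
qed

lemma resolvable_empty: "resolvable k {}"
  unfolding resolvable_def
proof (intro allI impI)
  fix X assume "extc ({..<k} \<union> {}) X"
  then have X: "extc {..<k} X" by simp
  have f0: "fc {} Y = Y" for Y by (intro ext) (simp add: rx_def)
  have "faces_factor k {} X X (F k X) (\<lambda>S. Id K (V X S)) (eta k X)"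
    unfolding faces_factor_def
  proof (intro allI impI)
    fix t Y h assume "t \<subseteq> {} \<and> B k Y \<and> nat_tr (Pow {..<k}) (fc t X) Y h"
    then have t: "t = {}" and Y: "B k Y" and h: "nat_tr (Pow {..<k}) X Y h" using f0 by auto
    obtain g where g: "nat_tr (Pow {..<k}) (F k X) Y g" "\<And>S. S \<in> Pow {..<k} \<Longrightarrow> g S \<odot> eta k X S = h S"
      by (rule F_univE[OF X Y h], rule that, assumption, simp)
    show "\<exists>g. nat_tr (Pow {..<k}) (fc t (F k X)) Y g \<and>
        (\<forall>S\<in>Pow {..<k}. g S \<odot> eta k X (S \<union> t) = h S \<odot> Id K (V X (S \<union> t)))"
      using g cmp_Id[OF nat_hom[OF h]] unfolding t f0 by (intro exI[of _ g]) simp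
  qed
  then show "\<exists>Q \<beta> r s. emap (Pow ({..<k} \<union> {})) Q X r \<and> emap (Pow ({..<k} \<union> {})) Q \<beta> s \<and>
     (\<forall>t. t \<subseteq> {} \<longrightarrow> B k (fc t \<beta>)) \<and> faces_factor k {} X Q \<beta> r s"
    using bij_emap[OF bij_Id[OF extc_diag[OF X]] extc_diag[OF X] extc_diag[OF X]] eta_emap[OF X] F_B[OF X] f0
    by (intro exI[of _ X] exI[of _ "F k X"] exI[of _ "\<lambda>S. Id K (V X S)"] exI[of _ "eta k X"]) simp
qed

text \<open>Resolve the faces in dimension \<open>k + 1\<close> first, then lower their dimension by a span of discrete fibrations,
  and compose the two spans.\<close>

lemma resolvable_insert:
  assumes fA: "finite A" and dis: "{..<Suc k} \<inter> A = {}"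
    and IH1: "resolvable (Suc k) A" and IH: "resolvable k A"
  shows "resolvable k (insert k A)"
  unfolding resolvable_def
proof (intro allI impI)
  let ?N = "{..<k} \<union> A"
  have e1: "{..<k} \<union> insert k A = insert k ?N" and e2: "{..<Suc k} \<union> A = insert k ?N" by (auto simp: lessThan_Suc)
  let ?Q = "Pow (insert k ?N)"
  fix X assume "extc ({..<k} \<union> insert k A) X"
  then have X: "extc (insert k ?N) X" by (simp add: e1)
  then obtain Q \<beta>0 r s0 where r: "emap ?Q Q X r" and s0: "emap ?Q Q \<beta>0 s0"
    and B0: "\<forall>t. t \<subseteq> A \<longrightarrow> B (Suc k) (fc t \<beta>0)" and f0: "faces_factor (Suc k) A X Q \<beta>0 r s0"
    using IH1 unfolding resolvable_def e2 by meson
  have fN: "finite (insert k ?N)" using fA by simp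
  have \<beta>0: "extc (insert k ?N) \<beta>0" using extc_cod[OF fN s0 extc_dom[OF r X]] .
  obtain \<sigma> \<rho> \<beta> s where \<rho>: "dfib (insert k ?N) \<sigma> \<beta>0 \<rho>" and s: "dfib (insert k ?N) \<sigma> \<beta> s"
    and BB: "\<forall>t. t \<subseteq> insert k A \<longrightarrow> B k (fc t \<beta>)" and f1: "faces_factor k (insert k A) \<beta>0 \<sigma> \<beta> \<rho> s"
  proof -
    have "\<exists>\<sigma> \<rho> \<beta> s. dfib (insert k ?N) \<sigma> \<beta>0 \<rho> \<and> dfib (insert k ?N) \<sigma> \<beta> s \<and>
        (\<forall>t. t \<subseteq> insert k A \<longrightarrow> B k (fc t \<beta>)) \<and> faces_factor k (insert k A) \<beta>0 \<sigma> \<beta> \<rho> s"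
      by (rule reduce_dimension[OF fA dis \<beta>0 _ IH]) (use B0 in simp)
    then show thesis using that by (elim exE conjE)
  qed
  note \<rho>e = dfib_emap[OF \<rho>] and se = dfib_emap[OF s]
  obtain Qf x y where Qf: "pb ?Q \<sigma> Q \<beta>0 \<rho> s0 Qf x y"
    using pb_exists[OF emap_dom[OF \<rho>e] emap_dom[OF s0] emap_cod[OF s0] emap_nat[OF \<rho>e] emap_nat[OF s0]] by (elim exE)
  have y: "emap ?Q Qf Q y" using pb_emap[OF Qf \<rho>e emap_dom[OF s0] emap_nat[OF s0]] .
  have x: "emap ?Q Qf \<sigma> x" using pb_emap[OF pb_sym[OF Qf] s0 emap_dom[OF \<rho>e] emap_nat[OF \<rho>e]] .
  have "faces_factor k (insert k A) X Qf \<beta> (\<lambda>U. r U \<odot> y U) (\<lambda>U. s U \<odot> x U)"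
    unfolding faces_factor_def
  proof (intro allI impI)
    fix t Y h assume a: "t \<subseteq> insert k A \<and> B k Y \<and> nat_tr (Pow {..<k}) (fc t X) Y h"
    obtain h1 where h1: "nat_tr (Pow {..<k}) (fc t \<beta>0) Y h1"
      and h1e: "\<forall>S\<in>Pow {..<k}. h1 S \<odot> s0 (S \<union> t) = h S \<odot> r (S \<union> t)"
    proof -
      have "\<exists>g. nat_tr (Pow {..<k}) (fc t \<beta>0) Y g \<and> (\<forall>S\<in>Pow {..<k}. g S \<odot> s0 (S \<union> t) = h S \<odot> r (S \<union> t))"
        by (rule faces_factorD[OF faces_factor_lower[OF fA dis _ f0]]) (use a X e2 in auto)
      then show thesis using that by (elim exE conjE)
    qed
    obtain h2 where h2: "nat_tr (Pow {..<k}) (fc t \<beta>) Y h2"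
      and h2e: "\<forall>S\<in>Pow {..<k}. h2 S \<odot> s (S \<union> t) = h1 S \<odot> \<rho> (S \<union> t)"
    proof -
      have tt: "t \<subseteq> insert k A" and YB: "B k Y" using a by simp_all
      show thesis using faces_factorD[OF f1 tt YB h1] that by (elim exE conjE)
    qed
    have "h2 S \<odot> s (S \<union> t) \<odot> x (S \<union> t) = h S \<odot> r (S \<union> t) \<odot> y (S \<union> t)" if S: "S \<in> Pow {..<k}" for S
    proof -
      have U: "S \<union> t \<in> ?Q" using S a by auto
      have "h2 S \<odot> s (S \<union> t) \<odot> x (S \<union> t) = h1 S \<odot> \<rho> (S \<union> t) \<odot> x (S \<union> t)"
        using arg_cong[OF bspec[OF h2e S], of "\<lambda>m. m \<odot> x (S \<union> t)"] by simp
      also have "\<dots> = h1 S \<odot> s0 (S \<union> t) \<odot> y (S \<union> t)" using pb_sq[OF Qf U] by simp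
      also have "\<dots> = h S \<odot> r (S \<union> t) \<odot> y (S \<union> t)" using arg_cong[OF bspec[OF h1e S], of "\<lambda>m. m \<odot> y (S \<union> t)"] by simp
      finally show ?thesis .
    qed
    then show "\<exists>g. nat_tr (Pow {..<k}) (fc t \<beta>) Y g \<and>
        (\<forall>S\<in>Pow {..<k}. g S \<odot> s (S \<union> t) \<odot> x (S \<union> t) = h S \<odot> r (S \<union> t) \<odot> y (S \<union> t))"
      using h2 by (intro exI[of _ h2]) simp
  qed
  then show "\<exists>Q \<beta> r s. emap (Pow ({..<k} \<union> insert k A)) Q X r \<and> emap (Pow ({..<k} \<union> insert k A)) Q \<beta> s \<and>
     (\<forall>t. t \<subseteq> insert k A \<longrightarrow> B k (fc t \<beta>)) \<and> faces_factor k (insert k A) X Q \<beta> r s"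
    unfolding e1 using emap_comp[OF y r] emap_comp[OF x se] BB by (intro exI conjI) simp_all
qed

text \<open>The direction \<open>k\<close> plays a special role only through its number, so it may be exchanged with any direction
  in \<open>A\<close>.\<close>

lemma resolvable_relabel:
  assumes i: "i \<in> A" and dis: "{..<k} \<inter> A = {}" and kA: "k \<notin> A" and res: "resolvable k (insert k (A - {i}))"
  shows "resolvable k A"
  unfolding resolvable_def
proof (intro allI impI)
  let ?D = "{..<k}" and ?A = "insert k (A - {i})" and ?Pk = "Pow {..<k}"
  define \<pi> where "\<pi> x = (if x = k then i else if x = i then k else x)" for x
  have \<pi>\<pi>: "\<pi> (\<pi> x) = x" for x by (simp add: \<pi>_def)
  have inj: "inj_on \<pi> M" for M using \<pi>\<pi> by (metis inj_onI)
  have im: "\<pi> ` (\<pi> ` M) = M" for M using \<pi>\<pi> by (simp add: image_image)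
  have ik: "i \<noteq> k" "i \<notin> ?D" using i dis kA by auto
  have fix1: "\<pi> ` S = S" if "S \<in> ?Pk" for S
  proof -
    have "\<pi> x = x" if "x \<in> S" for x using that \<open>S \<in> ?Pk\<close> ik by (auto simp: \<pi>_def)
    then show ?thesis by simp
  qed
  have iA: "\<pi> ` A = ?A"
  proof
    show "\<pi> ` A \<subseteq> ?A" using kA by (auto simp: \<pi>_def)
    show "?A \<subseteq> \<pi> ` A"
    proof
      fix x assume "x \<in> ?A"
      then have "x = \<pi> (if x = k then i else x)" "(if x = k then i else x) \<in> A" using i kA by (auto simp: \<pi>_def)
      then show "x \<in> \<pi> ` A" by (rule image_eqI)
    qed
  qed
  have iN: "\<pi> ` (?D \<union> A) = ?D \<union> ?A" using iA fix1[of ?D] by (simp add: image_Un)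
  then have iN': "\<pi> ` (?D \<union> ?A) = ?D \<union> A" using im by metis
  have rr: "rx (image \<pi>) (rx (image \<pi>) Y) = Y" for Y by (intro ext) (simp add: rx_def im)
  fix X assume X: "extc (?D \<union> A) X"
  have "extc (?D \<union> ?A) (rx (image \<pi>) X)" using extc_rx[OF inj, of "?D \<union> ?A" X] X unfolding iN' by simp
  then obtain Q \<beta> r s where r: "emap (Pow (?D \<union> ?A)) Q (rx (image \<pi>) X) r" and s: "emap (Pow (?D \<union> ?A)) Q \<beta> s"
    and BB: "\<forall>t. t \<subseteq> ?A \<longrightarrow> B k (fc t \<beta>)" and f: "faces_factor k ?A (rx (image \<pi>) X) Q \<beta> r s"
    using res unfolding resolvable_def by meson
  note iso = iso_idx_image[OF inj, of "?D \<union> A", unfolded iN]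
  have r': "emap (Pow (?D \<union> A)) (rx (image \<pi>) Q) X (\<lambda>S. r (\<pi> ` S))"
    using rx_emap[OF iso r] unfolding rr .
  have s': "emap (Pow (?D \<union> A)) (rx (image \<pi>) Q) (rx (image \<pi>) \<beta>) (\<lambda>S. s (\<pi> ` S))"
    using rx_emap[OF iso s] .
  have ag: "agree ?Pk (fc (\<pi> ` t) Y) (fc t (rx (image \<pi>) Y))" for t Y
    unfolding agree_def rx_def by (simp add: image_Un fix1)
  have tA: "\<pi> ` t \<subseteq> ?A" if "t \<subseteq> A" for t using image_mono[OF that, of \<pi>] unfolding iA .
  have BB': "B k (fc t (rx (image \<pi>) \<beta>))" if "t \<subseteq> A" for t
    using B_agree[OF _ ag[of t \<beta>]] BB tA[OF that] by simp
  have "faces_factor k A X (rx (image \<pi>) Q) (rx (image \<pi>) \<beta>) (\<lambda>S. r (\<pi> ` S)) (\<lambda>S. s (\<pi> ` S))"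
    unfolding faces_factor_def
  proof (intro allI impI)
    fix t Y h assume a: "t \<subseteq> A \<and> B k Y \<and> nat_tr ?Pk (fc t X) Y h"
    have "agree ?Pk (fc t X) (fc (\<pi> ` t) (rx (image \<pi>) X))"
      using agree_sym[OF ag[of "\<pi> ` t" "rx (image \<pi>) X"]] ag[of "\<pi> ` t" X] im[of t]
      unfolding agree_def rx_def by (simp add: image_Un fix1)
    note ag' = this
    have hX: "nat_tr ?Pk (fc t X) Y h" using a by simp
    have "nat_tr ?Pk (fc (\<pi> ` t) (rx (image \<pi>) X)) Y h" using agree_nat[OF ag' agree_refl refl hX] .
    have ta: "t \<subseteq> A" and YB: "B k Y" using a by simp_all
    from faces_factorD[OF f tA[OF ta] YB \<open>nat_tr ?Pk (fc (\<pi> ` t) (rx (image \<pi>) X)) Y h\<close>]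
    obtain g where g: "nat_tr ?Pk (fc (\<pi> ` t) \<beta>) Y g"
      "\<forall>S\<in>?Pk. g S \<odot> s (S \<union> \<pi> ` t) = h S \<odot> r (S \<union> \<pi> ` t)" by (elim exE conjE)
    have "nat_tr ?Pk (fc t (rx (image \<pi>) \<beta>)) Y g" using agree_nat[OF ag agree_refl refl g(1)] .
    then show "\<exists>g. nat_tr ?Pk (fc t (rx (image \<pi>) \<beta>)) Y g \<and>
        (\<forall>S\<in>?Pk. g S \<odot> s (\<pi> ` (S \<union> t)) = h S \<odot> r (\<pi> ` (S \<union> t)))"
      using g(2) by (intro exI[of _ g]) (simp add: image_Un fix1)
  qed
  then show "\<exists>Q \<beta> r s. emap (Pow (?D \<union> A)) Q X r \<and> emap (Pow (?D \<union> A)) Q \<beta> s \<and>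
     (\<forall>t. t \<subseteq> A \<longrightarrow> B k (fc t \<beta>)) \<and> faces_factor k A X Q \<beta> r s"
    using r' s' BB' by (intro exI conjI) simp_all
qed

lemma resolvable: "finite A \<Longrightarrow> {..<k} \<inter> A = {} \<Longrightarrow> resolvable k A"
proof (induction "card A" arbitrary: A k)
  case 0
  then show ?case using resolvable_empty by simp
next
  case (Suc n)
  have ins: "resolvable k (insert k A')" if A': "finite A'" "{..<Suc k} \<inter> A' = {}" "card A' = n" for A'
  proof (rule resolvable_insert[OF A'(1,2)])
    show "resolvable (Suc k) A'" using Suc(1)[OF A'(3)[symmetric] A'(1,2)] .
    have "{..<k} \<inter> A' = {}" using A'(2) by (auto simp: lessThan_Suc)
    then show "resolvable k A'" using Suc(1)[OF A'(3)[symmetric] A'(1)] by simp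
  qed
  show ?case
  proof (cases "k \<in> A")
    case True
    have "{..<Suc k} \<inter> (A - {k}) = {}" using Suc(4) by (auto simp: lessThan_Suc)
    moreover have "card (A - {k}) = n" using Suc(2,3) True by simp
    ultimately show ?thesis using ins[of "A - {k}"] Suc(3) True by (simp add: insert_absorb)
  next
    case False
    have "A \<noteq> {}" using Suc(2) by auto
    then obtain i where i: "i \<in> A" by blast
    have "{..<Suc k} \<inter> (A - {i}) = {}" using Suc(4) False by (auto simp: lessThan_Suc)
    moreover have "card (A - {i}) = n" using Suc(2,3) i by simp
    ultimately have "resolvable k (insert k (A - {i}))" using ins[of "A - {i}"] Suc(3) by simp
    then show ?thesis using resolvable_relabel[OF i Suc(4) False] by simp
  qed
qed

section \<open>Coverings are spans of discrete fibrations\<close>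

text \<open>A span of discrete fibrations from \<open>X\<close> to an extension with vertices in \<open>B 0\<close>. No direction is singled
  out.\<close>

definition base_span where
  "base_span A X \<longleftrightarrow> (\<exists>\<tau> f Y g. dfib A \<tau> X f \<and> dfib A \<tau> Y g \<and> extc A Y \<and> (\<forall>S. S \<subseteq> A \<longrightarrow> B 0 (fc S Y)))"

text \<open>Each application of \<open>reduce_dimension\<close> turns one dimension of the faces into a direction of \<open>A\<close>. The spans
  are composed by pullback.\<close>

lemma base_span_of_faces:
  "finite A \<Longrightarrow> {..<k} \<inter> A = {} \<Longrightarrow> extc ({..<k} \<union> A) X \<Longrightarrow> (\<And>t. t \<subseteq> A \<Longrightarrow> B k (fc t X)) \<Longrightarrow>
   base_span ({..<k} \<union> A) X"
proof (induction k arbitrary: A X)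
  case 0
  have X: "extc A X" using 0(3) by simp
  note Xd = extc_diag[OF X]
  have "dfib A X X (\<lambda>S. Id K (V X S))" using dfib_bij[OF bij_Id[OF Xd] Xd Xd] .
  moreover have "\<forall>S. S \<subseteq> A \<longrightarrow> B 0 (fc S X)" using 0(4) by simp
  ultimately show ?case unfolding base_span_def using X
    by (simp only: lessThan_0 Un_empty_left) (rule exI[of _ X], rule exI, rule exI[of _ X], rule exI, intro conjI)
next
  case (Suc k)
  let ?N = "insert k ({..<k} \<union> A)"
  have e1: "{..<k} \<union> insert k A = ?N" and e2: "{..<Suc k} \<union> A = ?N" by (auto simp: lessThan_Suc)
  have dis: "{..<k} \<inter> A = {}" "{..<k} \<inter> insert k A = {}" using Suc(3) by (auto simp: lessThan_Suc)
  have X: "extc ?N X" using Suc(4) unfolding e2 .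
  have "\<exists>\<sigma> \<rho> \<beta> s. dfib ?N \<sigma> X \<rho> \<and> dfib ?N \<sigma> \<beta> s \<and> (\<forall>t. t \<subseteq> insert k A \<longrightarrow> B k (fc t \<beta>)) \<and>
      faces_factor k (insert k A) X \<sigma> \<beta> \<rho> s"
    by (rule reduce_dimension[OF Suc(2,3) X _ resolvable[OF Suc(2) dis(1)]]) (rule Suc(5))
  then obtain \<sigma> \<rho> \<beta> s where \<rho>: "dfib ?N \<sigma> X \<rho>" and s: "dfib ?N \<sigma> \<beta> s"
    and BB: "\<forall>t. t \<subseteq> insert k A \<longrightarrow> B k (fc t \<beta>)" by (elim exE conjE)
  have fN: "finite ?N" using Suc(2) by simp
  have \<beta>: "extc ?N \<beta>" using extc_cod[OF fN dfib_emap[OF s] extc_dom[OF dfib_emap[OF \<rho>] X]] .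
  have "base_span ?N \<beta>" using Suc(1)[OF _ dis(2)] Suc(2) \<beta> BB unfolding e1 by simp
  then obtain \<tau> f Y g where f: "dfib ?N \<tau> \<beta> f" and g: "dfib ?N \<tau> Y g"
    and Y: "extc ?N Y" "\<forall>S. S \<subseteq> ?N \<longrightarrow> B 0 (fc S Y)"
    unfolding base_span_def by (elim exE conjE)
  note se = dfib_emap[OF s] and fe = dfib_emap[OF f]
  obtain R p q where R: "pb (Pow ?N) \<sigma> \<tau> \<beta> s f R p q"
    using pb_exists[OF emap_dom[OF se] emap_dom[OF fe] emap_cod[OF se] emap_nat[OF se] emap_nat[OF fe]] by (elim exE)
  have "dfib ?N R \<tau> q" using dfib_pb[OF R s emap_dom[OF fe] emap_nat[OF fe]] .
  moreover have "dfib ?N R \<sigma> p" using dfib_pb[OF pb_sym[OF R] f emap_dom[OF se] emap_nat[OF se]] .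
  ultimately show ?case
    unfolding base_span_def e2
    by - (rule exI, rule exI, rule exI, rule exI, rule conjI, erule dfib_comp[OF _ \<rho>], rule conjI, erule dfib_comp[OF _ g],
      rule conjI, rule Y(1), rule Y(2))
qed

theorem B_iff_base_span:
  assumes X: "extc {..<Suc m} X"
  shows "B (Suc m) X \<longleftrightarrow> base_span {..<Suc m} X"
proof
  assume BX: "B (Suc m) X"
  have "fc {} X = X" by (intro ext) (simp add: rx_def)
  then show "base_span {..<Suc m} X"
    using base_span_of_faces[of "{}" "Suc m" X] X BX by simp
next
  assume "base_span {..<Suc m} X"
  then obtain \<tau> f Y g where f: "dfib {..<Suc m} \<tau> X f" and g: "dfib {..<Suc m} \<tau> Y g"
    and Y: "extc {..<Suc m} Y" "\<forall>S. S \<subseteq> {..<Suc m} \<longrightarrow> B 0 (fc S Y)"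
    unfolding base_span_def by (elim exE conjE)
  have "B (Suc m) Y" using B_vertices[OF Y(1)] Y(2) by simp
  then have "B (Suc m) \<tau>" using dfib_B[OF g] by simp
  from B_quotient[OF this dfib_emap[OF f]] show "B (Suc m) X" .
qed

lemma base_span_rx:
  assumes inj: "inj_on \<pi> A" and X: "base_span (\<pi> ` A) X"
  shows "base_span A (rx (image \<pi>) X)"
proof -
  obtain \<tau> f Y g where f: "dfib (\<pi> ` A) \<tau> X f" and g: "dfib (\<pi> ` A) \<tau> Y g"
    and Y: "extc (\<pi> ` A) Y" "\<forall>S. S \<subseteq> \<pi> ` A \<longrightarrow> B 0 (fc S Y)"
    using X unfolding base_span_def by (elim exE conjE)
  have "B 0 (fc S (rx (image \<pi>) Y))" if "S \<subseteq> A" for S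
  proof (rule B_agree)
    show "B 0 (fc (\<pi> ` S) Y)" using Y(2) image_mono[OF that, of \<pi>] by simp
    show "agree (Pow {..<0}) (fc (\<pi> ` S) Y) (fc S (rx (image \<pi>) Y))" by (simp add: agree_def rx_def)
  qed
  then have BB: "\<forall>S. S \<subseteq> A \<longrightarrow> B 0 (fc S (rx (image \<pi>) Y))" by simp
  show ?thesis
    unfolding base_span_def
    by (rule exI, rule exI, rule exI, rule exI, rule conjI, rule dfib_rx[OF inj f], rule conjI, rule dfib_rx[OF inj g],
      rule conjI, rule extc_rx[OF inj Y(1)], rule BB)
qed

end

section \<open>Iterated arrows as cubes\<close>

lemma tagged_simps [simp]:
  "Obj (tagged C) = Ob ` Obj C" "Mor (tagged C) = Ar ` Mor C"
  "Dom (tagged C) (Ar f) = Ob (Dom C f)" "Cod (tagged C) (Ar f) = Ob (Cod C f)"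
  "Id (tagged C) (Ob a) = Ar (Id C a)" "Comp (tagged C) (Ar g) (Ar f) = Ar (g \<cdot>\<^bsub>C\<^esub> f)"
  by (simp_all add: tagged_def)

lemma in_hom_tagged:
  "in_hom (tagged C) m a b \<longleftrightarrow> (\<exists>m' a' b'. m = Ar m' \<and> a = Ob a' \<and> b = Ob b' \<and> in_hom C m' a' b')"
  unfolding in_hom_def by auto

lemma in_hom_tagged_Ar [simp]: "in_hom (tagged C) (Ar m) (Ob a) (Ob b) \<longleftrightarrow> in_hom C m a b"
  unfolding in_hom_def by auto

lemma ex1_tagged:
  "(\<exists>!u. in_hom (tagged C) u (Ob z) (Ob w) \<and> P u) \<longleftrightarrow> (\<exists>!u. in_hom C u z w \<and> P (Ar u))"
  unfolding Ex1_def in_hom_tagged by auto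

lemma category_tagged: "category C \<Longrightarrow> category (tagged C)"
proof -
  assume "category C"
  then interpret category C .
  show ?thesis
    by unfold_locales (auto simp: in_hom_tagged Dom_in Cod_in Id_in_hom Comp_in_hom Comp_Id Id_Comp Comp_assoc)
qed

lemma is_pullback_tagged:
  "is_pullback (tagged C) (Ar f) (Ar g) (Ar p) (Ar q) \<longleftrightarrow> is_pullback C f g p q"
proof -
  have "(\<forall>z r s. in_hom (tagged C) r z (Ob (Dom C f)) \<and> in_hom (tagged C) s z (Ob (Dom C g)) \<and>
        Ar f \<cdot>\<^bsub>tagged C\<^esub> r = Ar g \<cdot>\<^bsub>tagged C\<^esub> s \<longrightarrow>
        (\<exists>!u. in_hom (tagged C) u z (Ob (Dom C p)) \<and> Ar p \<cdot>\<^bsub>tagged C\<^esub> u = r \<and> Ar q \<cdot>\<^bsub>tagged C\<^esub> u = s)) \<longleftrightarrow>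
    (\<forall>z r s. in_hom C r z (Dom C f) \<and> in_hom C s z (Dom C g) \<and> f \<cdot>\<^bsub>C\<^esub> r = g \<cdot>\<^bsub>C\<^esub> s \<longrightarrow>
        (\<exists>!u. in_hom C u z (Dom C p) \<and> p \<cdot>\<^bsub>C\<^esub> u = r \<and> q \<cdot>\<^bsub>C\<^esub> u = s))" (is "?L \<longleftrightarrow> ?R")
  proof
    assume L: ?L
    show ?R
    proof (intro allI impI)
      fix z r s assume "in_hom C r z (Dom C f) \<and> in_hom C s z (Dom C g) \<and> f \<cdot>\<^bsub>C\<^esub> r = g \<cdot>\<^bsub>C\<^esub> s"
      then show "\<exists>!u. in_hom C u z (Dom C p) \<and> p \<cdot>\<^bsub>C\<^esub> u = r \<and> q \<cdot>\<^bsub>C\<^esub> u = s"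
        using L[rule_format, of "Ar r" "Ob z" "Ar s"] by (simp add: ex1_tagged)
    qed
  next
    assume R: ?R
    show ?L
    proof (intro allI impI)
      fix z r s assume a: "in_hom (tagged C) r z (Ob (Dom C f)) \<and> in_hom (tagged C) s z (Ob (Dom C g)) \<and>
        Ar f \<cdot>\<^bsub>tagged C\<^esub> r = Ar g \<cdot>\<^bsub>tagged C\<^esub> s"
      then obtain z' r' s' where [simp]: "z = Ob z'" "r = Ar r'" "s = Ar s'"
        unfolding in_hom_tagged by auto
      show "\<exists>!u. in_hom (tagged C) u z (Ob (Dom C p)) \<and> Ar p \<cdot>\<^bsub>tagged C\<^esub> u = r \<and> Ar q \<cdot>\<^bsub>tagged C\<^esub> u = s"
        using a R[rule_format, of r' z' s'] by (simp add: ex1_tagged)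
    qed
  qed
  then show ?thesis
    unfolding is_pullback_def by (simp add: image_iff)
qed

lemma is_coequalizer_tagged:
  "is_coequalizer (tagged C) (Ar x) (Ar y) (Ar f) \<longleftrightarrow> is_coequalizer C x y f"
proof -
  have "(\<forall>z g. in_hom (tagged C) g (Ob (Dom C f)) z \<and> g \<cdot>\<^bsub>tagged C\<^esub> Ar x = g \<cdot>\<^bsub>tagged C\<^esub> Ar y \<longrightarrow>
        (\<exists>!u. in_hom (tagged C) u (Ob (Cod C f)) z \<and> u \<cdot>\<^bsub>tagged C\<^esub> Ar f = g)) \<longleftrightarrow>
    (\<forall>z g. in_hom C g (Dom C f) z \<and> g \<cdot>\<^bsub>C\<^esub> x = g \<cdot>\<^bsub>C\<^esub> y \<longrightarrow>
        (\<exists>!u. in_hom C u (Cod C f) z \<and> u \<cdot>\<^bsub>C\<^esub> f = g))" (is "?L \<longleftrightarrow> ?R")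
  proof
    assume L: ?L
    show ?R
    proof (intro allI impI)
      fix z g assume "in_hom C g (Dom C f) z \<and> g \<cdot>\<^bsub>C\<^esub> x = g \<cdot>\<^bsub>C\<^esub> y"
      then show "\<exists>!u. in_hom C u (Cod C f) z \<and> u \<cdot>\<^bsub>C\<^esub> f = g"
        using L[rule_format, of "Ar g" "Ob z"] by (simp add: ex1_tagged)
    qed
  next
    assume R: ?R
    show ?L
    proof (intro allI impI)
      fix z g assume a: "in_hom (tagged C) g (Ob (Dom C f)) z \<and> g \<cdot>\<^bsub>tagged C\<^esub> Ar x = g \<cdot>\<^bsub>tagged C\<^esub> Ar y"
      then obtain z' g' where [simp]: "z = Ob z'" "g = Ar g'"
        unfolding in_hom_tagged by auto
      show "\<exists>!u. in_hom (tagged C) u (Ob (Cod C f)) z \<and> u \<cdot>\<^bsub>tagged C\<^esub> Ar f = g"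
        using a R[rule_format, of g' z'] by (simp add: ex1_tagged)
    qed
  qed
  then show ?thesis
    unfolding is_coequalizer_def by (simp add: image_iff)
qed

lemma has_finite_limits_tagged:
  fixes C :: "('o, 'a) cat"
  assumes "has_finite_limits C"
  shows "has_finite_limits (tagged C)"
  unfolding has_finite_limits_def
proof (intro allI impI)
  fix J :: "(nat, nat) cat" and D :: "(nat, nat, ('o, 'a) iarr, ('o, 'a) iarr) fctr"
  assume J: "category J \<and> finite (Obj J) \<and> finite (Mor J) \<and> is_functor J (tagged C) D"
  then interpret J: category J by simp
  define D' where "D' = \<lparr>omap = the_Ob \<circ> omap D, amap = the_Ar \<circ> amap D\<rparr>"
  have D: "is_functor J (tagged C) D" using J by simp
  have o: "omap D j = Ob (omap D' j)" if "j \<in> Obj J" for j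
    using D that unfolding is_functor_def D'_def by fastforce
  have a: "amap D u = Ar (amap D' u)" if "u \<in> Mor J" for u
    using D that unfolding is_functor_def D'_def in_hom_def by fastforce
  have Imor: "Id J j \<in> Mor J" if "j \<in> Obj J" for j
    using J.Id_in_hom[OF that] by (simp add: in_hom_def)
  have Cmor: "g \<cdot>\<^bsub>J\<^esub> f \<in> Mor J" if "f \<in> Mor J" "g \<in> Mor J" "Dom J g = Cod J f" for f g
    using J.Comp_in_hom[of f "Dom J f" "Cod J f" g "Cod J g"] that by (simp add: in_hom_def)
  have "is_functor J C D'"
    unfolding is_functor_def
  proof (intro conjI ballI impI)
    fix j assume j: "j \<in> Obj J"
    then have "omap D j \<in> Obj (tagged C) \<and> amap D (Id J j) = Id (tagged C) (omap D j)"
      using D unfolding is_functor_def by blast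
    then show "omap D' j \<in> Obj C" "amap D' (Id J j) = Id C (omap D' j)"
      using o[OF j] a[OF Imor[OF j]] by auto
  next
    fix u assume u: "u \<in> Mor J"
    then have "in_hom (tagged C) (amap D u) (omap D (Dom J u)) (omap D (Cod J u))"
      using D unfolding is_functor_def by blast
    then show "in_hom C (amap D' u) (omap D' (Dom J u)) (omap D' (Cod J u))"
      using o[OF J.Dom_in[OF u]] o[OF J.Cod_in[OF u]] a[OF u] by simp
  next
    fix f g assume fg: "f \<in> Mor J" "g \<in> Mor J" "Dom J g = Cod J f"
    then have "amap D (g \<cdot>\<^bsub>J\<^esub> f) = amap D g \<cdot>\<^bsub>tagged C\<^esub> amap D f"
      using D unfolding is_functor_def by blast
    then show "amap D' (g \<cdot>\<^bsub>J\<^esub> f) = amap D' g \<cdot>\<^bsub>C\<^esub> amap D' f"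
      using a[OF fg(1)] a[OF fg(2)] a[OF Cmor[OF fg]] by simp
  qed
  then obtain x \<pi> where lim: "is_limit J C D' x \<pi>"
    using assms J unfolding has_finite_limits_def by blast
  have cone: "is_cone J (tagged C) D (Ob y) (\<lambda>j. Ar (\<rho> j)) \<longleftrightarrow> is_cone J C D' y \<rho>" for y \<rho>
    unfolding is_cone_def using o a by (simp add: image_iff)
  have "is_limit J (tagged C) D (Ob x) (\<lambda>j. Ar (\<pi> j))"
    unfolding is_limit_def
  proof (intro conjI allI impI)
    show "is_cone J (tagged C) D (Ob x) (\<lambda>j. Ar (\<pi> j))"
      using lim unfolding cone is_limit_def by simp
    fix y \<rho> assume c: "is_cone J (tagged C) D y \<rho>"
    then obtain y' where [simp]: "y = Ob y'" unfolding is_cone_def by auto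
    have \<rho>: "\<rho> j = Ar (the_Ar (\<rho> j))" if "j \<in> Obj J" for j
      using c that unfolding is_cone_def in_hom_tagged by fastforce
    have "is_cone J (tagged C) D y \<rho> \<longleftrightarrow> is_cone J (tagged C) D y (\<lambda>j. Ar (the_Ar (\<rho> j)))"
      unfolding is_cone_def using \<rho>[symmetric] J.Dom_in J.Cod_in by simp
    then have "is_cone J C D' y' (\<lambda>j. the_Ar (\<rho> j))"
      using c by (simp add: cone)
    then have "\<exists>!u. in_hom C u y' x \<and> (\<forall>j\<in>Obj J. \<pi> j \<cdot>\<^bsub>C\<^esub> u = the_Ar (\<rho> j))"
      using lim unfolding is_limit_def by blast
    moreover have "(Ar m = \<rho> j) \<longleftrightarrow> (m = the_Ar (\<rho> j))" if "j \<in> Obj J" for m j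
      using \<rho>[OF that] by (metis iarr.sel(2))
    ultimately show "\<exists>!u. in_hom (tagged C) u y (Ob x) \<and> (\<forall>j\<in>Obj J. Ar (\<pi> j) \<cdot>\<^bsub>tagged C\<^esub> u = \<rho> j)"
      by (simp add: ex1_tagged)
  qed
  then show "\<exists>x \<pi>. is_limit J (tagged C) D x \<pi>" by blast
qed

lemma regular_category_tagged:
  assumes "regular_category C"
  shows "regular_category (tagged C)"
proof -
  have Ar: "f \<in> Mor (tagged C) \<Longrightarrow> \<exists>f'. f = Ar f'" for f by auto
  have pb: "\<exists>f' g' p' q'. f = Ar f' \<and> g = Ar g' \<and> p = Ar p' \<and> q = Ar q' \<and> is_pullback C f' g' p' q'"
    if "is_pullback (tagged C) f g p q" for f g p q
  proof -
    have "f \<in> Mor (tagged C)" "g \<in> Mor (tagged C)" "p \<in> Mor (tagged C)" "q \<in> Mor (tagged C)"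
      using that unfolding is_pullback_def by simp_all
    then obtain f' g' p' q' where "f = Ar f'" "g = Ar g'" "p = Ar p'" "q = Ar q'" using Ar by metis
    then show ?thesis using that is_pullback_tagged by metis
  qed
  have re: "Ar f \<in> regular_epis (tagged C) \<longleftrightarrow> f \<in> regular_epis C" for f
  proof
    assume "Ar f \<in> regular_epis (tagged C)"
    then obtain x y where c: "is_coequalizer (tagged C) x y (Ar f)" unfolding regular_epis_def by blast
    then have "x \<in> Mor (tagged C)" "y \<in> Mor (tagged C)" unfolding is_coequalizer_def by simp_all
    then obtain x' y' where "x = Ar x'" "y = Ar y'" using Ar by metis
    then have "is_coequalizer C x' y' f" using c is_coequalizer_tagged[of C x' y' f] by simp
    then show "f \<in> regular_epis C" unfolding regular_epis_def by blast
  next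
    assume "f \<in> regular_epis C"
    then obtain x y where "is_coequalizer C x y f" unfolding regular_epis_def by blast
    then have "is_coequalizer (tagged C) (Ar x) (Ar y) (Ar f)" by (simp add: is_coequalizer_tagged)
    then show "Ar f \<in> regular_epis (tagged C)" unfolding regular_epis_def by blast
  qed
  show ?thesis
    unfolding regular_category_def
  proof (intro conjI allI impI)
    show "category (tagged C)" using assms category_tagged unfolding regular_category_def by blast
    show "has_finite_limits (tagged C)" using assms has_finite_limits_tagged unfolding regular_category_def by blast
  next
    fix f p q assume "is_pullback (tagged C) f f p q"
    from pb[OF this] obtain f' p' q' where e: "p = Ar p'" "q = Ar q'" "is_pullback C f' f' p' q'" by auto
    then obtain c where "is_coequalizer C p' q' c" using assms unfolding regular_category_def by blast
    then show "\<exists>c. is_coequalizer (tagged C) p q c" using e is_coequalizer_tagged by metis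
  next
    fix f g p q assume a: "is_pullback (tagged C) f g p q \<and> g \<in> regular_epis (tagged C)"
    from pb[OF conjunct1[OF a]] obtain f' g' p' q' where e: "g = Ar g'" "p = Ar p'" "is_pullback C f' g' p' q'"
      by auto
    then have "p' \<in> regular_epis C" using assms a re unfolding regular_category_def by blast
    then show "p \<in> regular_epis (tagged C)" using e re by simp
  qed
qed

locale regular_cat =
  fixes C :: "('o, 'a) cat"
  assumes regular_C: "regular_category C"

sublocale regular_cat \<subseteq> regular_base "tagged C" "Ob undefined"
  using regular_C regular_category_tagged by unfold_locales auto

context regular_cat
begin

notation cmp (infixr \<open>\<odot>\<close> 70)

text \<open>The iterated arrow and the morphism of iterated arrows that belong to a cube and to a map of cubes; the last
  direction is the outermost one.\<close>

fun tomor where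
  "tomor 0 X Y f = f {}"
| "tomor (Suc k) X Y f = Sq (tomor k X (up k X) (dir k X)) (tomor k Y (up k Y) (dir k Y))
     (tomor k X Y f) (tomor k (up k X) (up k Y) (\<lambda>S. f (insert k S)))"

fun toarr where
  "toarr 0 X = V X {}"
| "toarr (Suc k) X = tomor k X (up k X) (dir k X)"

abbreviation Arr where "Arr \<equiv> Arr_cat C"

lemma Arr_0: "Arr 0 = tagged C"
  by (simp add: Arr_cat_def)

lemma Arr_Suc: "Arr (Suc k) = arrow_cat (Arr k)"
  by (simp add: Arr_cat_def)

lemma Arr_Suc_simps:
  "Obj (Arr (Suc k)) = Mor (Arr k)" "Dom (Arr (Suc k)) = sq_dom" "Cod (Arr (Suc k)) = sq_cod"
  "Id (Arr (Suc k)) m = Sq m m (Id (Arr k) (Dom (Arr k) m)) (Id (Arr k) (Cod (Arr k) m))"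
  "Sq f' g' t' b' \<cdot>\<^bsub>Arr (Suc k)\<^esub> Sq f g t b = Sq f g' (t' \<cdot>\<^bsub>Arr k\<^esub> t) (b' \<cdot>\<^bsub>Arr k\<^esub> b)"
  "Sq f g t b \<in> Mor (Arr (Suc k)) \<longleftrightarrow> arrow_square (Arr k) f g t b"
  by (simp_all add: Arr_Suc arrow_cat_def)

lemma Pow_Suc_iff: "Pow {..<Suc k} = Pow (insert k {..<k})"
  by (simp add: lessThan_Suc)

lemma in_Pow_Suc: "S \<in> Pow {..<k} \<Longrightarrow> S \<in> Pow {..<Suc k}" "S \<in> Pow {..<k} \<Longrightarrow> insert k S \<in> Pow {..<Suc k}"
  unfolding Pow_Suc_iff by auto

lemma agree_up: "agree (Pow {..<Suc k}) X X' \<Longrightarrow> agree (Pow {..<k}) (up k X) (up k X')"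
  unfolding agree_def rx_def using in_Pow_Suc(2) insert_mono by metis

lemma agree_Suc_dn: "agree (Pow {..<Suc k}) X X' \<Longrightarrow> agree (Pow {..<k}) X X'"
  unfolding agree_def using in_Pow_Suc(1) by metis

lemma agree_dir: "agree (Pow {..<Suc k}) X X' \<Longrightarrow> S \<in> Pow {..<k} \<Longrightarrow> dir k X S = dir k X' S"
  unfolding agree_def dir_def using in_Pow_Suc subset_insertI by metis

lemma tomor_cong:
  "agree (Pow {..<k}) X X' \<Longrightarrow> agree (Pow {..<k}) Y Y' \<Longrightarrow> (\<And>S. S \<in> Pow {..<k} \<Longrightarrow> f S = f' S) \<Longrightarrow>
   tomor k X Y f = tomor k X' Y' f'"
proof (induction k arbitrary: X X' Y Y' f f')
  case 0
  then show ?case by simp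
next
  case (Suc k)
  note X = Suc(2) and Y = Suc(3) and f = Suc(4)
  have "tomor k X (up k X) (dir k X) = tomor k X' (up k X') (dir k X')"
    by (rule Suc(1)[OF agree_Suc_dn[OF X] agree_up[OF X] agree_dir[OF X]])
  moreover have "tomor k Y (up k Y) (dir k Y) = tomor k Y' (up k Y') (dir k Y')"
    by (rule Suc(1)[OF agree_Suc_dn[OF Y] agree_up[OF Y] agree_dir[OF Y]])
  moreover have "tomor k X Y f = tomor k X' Y' f'"
    by (rule Suc(1)[OF agree_Suc_dn[OF X] agree_Suc_dn[OF Y] f[OF in_Pow_Suc(1)]])
  moreover have "tomor k (up k X) (up k Y) (\<lambda>S. f (insert k S)) = tomor k (up k X') (up k Y') (\<lambda>S. f' (insert k S))"
    by (rule Suc(1)[OF agree_up[OF X] agree_up[OF Y] f[OF in_Pow_Suc(2)]])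
  ultimately show ?case by simp
qed

lemma toarr_cong: "agree (Pow {..<k}) X X' \<Longrightarrow> toarr k X = toarr k X'"
proof (cases k)
  case 0
  then show "agree (Pow {..<k}) X X' \<Longrightarrow> toarr k X = toarr k X'" using agree_V[of "Pow {..<k}" X X' "{}"] by simp
next
  case (Suc m)
  assume a: "agree (Pow {..<k}) X X'"
  show "toarr k X = toarr k X'"
    using tomor_cong[OF agree_Suc_dn[OF a[unfolded Suc]] agree_up[OF a[unfolded Suc]] agree_dir[OF a[unfolded Suc]]]
    unfolding Suc by simp
qed

lemma tomor_inj: "tomor k X Y f = tomor k X' Y' f' \<Longrightarrow> S \<in> Pow {..<k} \<Longrightarrow> f S = f' S"
proof (induction k arbitrary: X X' Y Y' f f' S)
  case 0
  then show ?case by simp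
next
  case (Suc k)
  have e: "tomor k X Y f = tomor k X' Y' f'"
    "tomor k (up k X) (up k Y) (\<lambda>S. f (insert k S)) = tomor k (up k X') (up k Y') (\<lambda>S. f' (insert k S))"
    using Suc(2) by simp_all
  show ?case
  proof (cases "k \<in> S")
    case True
    then have S: "S - {k} \<in> Pow {..<k}" "insert k (S - {k}) = S" using Suc(3) by (auto simp: lessThan_Suc)
    then show ?thesis using Suc(1)[OF e(2) S(1)] by simp
  next
    case False
    then have "S \<in> Pow {..<k}" using Suc(3) by (auto simp: lessThan_Suc)
    then show ?thesis using Suc(1)[OF e(1)] by simp
  qed
qed

lemma diag_Suc:
  assumes "diag (Pow {..<Suc k}) X"
  shows "diag (Pow {..<k}) X" "diag (Pow {..<k}) (up k X)" "nat_tr (Pow {..<k}) X (up k X) (dir k X)"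
  using assms diag_dn[of k "{..<k}" X] rx_diag[OF up_mono[OF notin_lessThan]] nat_dir[OF notin_lessThan]
  unfolding Pow_Suc_iff by simp_all

lemma nat_Suc:
  assumes "nat_tr (Pow {..<Suc k}) X Y f"
  shows "nat_tr (Pow {..<k}) X Y f" "nat_tr (Pow {..<k}) (up k X) (up k Y) (\<lambda>S. f (insert k S))"
    "S \<in> Pow {..<k} \<Longrightarrow> dir k Y S \<odot> f S = f (insert k S) \<odot> dir k X S"
  using nat_dn[of k "{..<k}" X Y f] rx_nat[OF up_mono[OF notin_lessThan] assms[unfolded Pow_Suc_iff]]
    nat_sq[OF assms in_Pow_Suc subset_insertI] assms
  unfolding Pow_Suc_iff dir_def by simp_all

lemma diag_SucI:
  assumes "diag (Pow {..<k}) X" "diag (Pow {..<k}) Y" "nat_tr (Pow {..<k}) X Y f"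
  shows "diag (Pow {..<Suc k}) (mapc k X Y f)"
  using mapc_diag[OF notin_lessThan assms] unfolding Pow_Suc_iff .

text \<open>Typing, identities and composition are proved together, since the squares of the next dimension commute
  by the composition law of the previous one.\<close>

lemma tomor_functorial:
  "(\<forall>X. diag (Pow {..<k}) X \<longrightarrow> toarr k X \<in> Obj (Arr k) \<and>
       Id (Arr k) (toarr k X) = tomor k X X (\<lambda>S. Id (tagged C) (V X S))) \<and>
   (\<forall>X Y f. diag (Pow {..<k}) X \<and> diag (Pow {..<k}) Y \<and> nat_tr (Pow {..<k}) X Y f \<longrightarrow>
       in_hom (Arr k) (tomor k X Y f) (toarr k X) (toarr k Y)) \<and>
   (\<forall>X Y Z f g. nat_tr (Pow {..<k}) X Y f \<and> nat_tr (Pow {..<k}) Y Z g \<longrightarrow>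
       tomor k Y Z g \<cdot>\<^bsub>Arr k\<^esub> tomor k X Y f = tomor k X Z (\<lambda>S. g S \<odot> f S))"
proof (induction k)
  case 0
  have e: "{} \<in> Pow {..<0 :: nat}" by simp
  show ?case
    unfolding Arr_0 toarr.simps tomor.simps
  proof (intro conjI allI impI)
    show "V X {} \<in> Obj (tagged C)" if "diag (Pow {..<0}) X" for X using diag_Obj[OF that e] .
    show "hom (f {}) (V X {}) (V Y {})" if "diag (Pow {..<0}) X \<and> diag (Pow {..<0}) Y \<and> nat_tr (Pow {..<0}) X Y f" for X Y f
      using nat_hom[of "Pow {..<0}" X Y f "{}"] that by simp
    show "g {} \<cdot>\<^bsub>tagged C\<^esub> f {} = g {} \<odot> f {}" if "nat_tr (Pow {..<0}) X Y f \<and> nat_tr (Pow {..<0}) Y Z g" for X Y Z f g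
      using cmp_eq_Comp[OF nat_hom[OF conjunct1[OF that] e] nat_hom[OF conjunct2[OF that] e]] by simp
  qed simp
next
  case (Suc k)
  note obj = conjunct1[OF Suc, THEN spec, THEN mp, THEN conjunct1]
  note idn = conjunct1[OF Suc, THEN spec, THEN mp, THEN conjunct2]
  have hm: "in_hom (Arr k) (tomor k X Y f) (toarr k X) (toarr k Y)"
    if "diag (Pow {..<k}) X" "diag (Pow {..<k}) Y" "nat_tr (Pow {..<k}) X Y f" for X Y f
    using Suc that by simp
  have cm: "tomor k Y Z g \<cdot>\<^bsub>Arr k\<^esub> tomor k X Y f = tomor k X Z (\<lambda>S. g S \<odot> f S)"
    if "nat_tr (Pow {..<k}) X Y f" "nat_tr (Pow {..<k}) Y Z g" for X Y Z f g
    using Suc that by simp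
  have arr: "in_hom (Arr k) (tomor k X (up k X) (dir k X)) (toarr k X) (toarr k (up k X))"
    if "diag (Pow {..<Suc k}) X" for X using hm[OF diag_Suc[OF that]] .
  show ?case
  proof (intro conjI allI impI)
    fix X assume X: "diag (Pow {..<Suc k}) X"
    show "toarr (Suc k) X \<in> Obj (Arr (Suc k))"
      using arr[OF X] by (simp add: Arr_Suc_simps in_hom_def)
    have "Dom (Arr k) (toarr (Suc k) X) = toarr k X" "Cod (Arr k) (toarr (Suc k) X) = toarr k (up k X)"
      using arr[OF X] by (simp_all add: in_hom_def)
    then show "Id (Arr (Suc k)) (toarr (Suc k) X) = tomor (Suc k) X X (\<lambda>S. Id (tagged C) (V X S))"
      using idn[OF diag_Suc(1)[OF X]] idn[OF diag_Suc(2)[OF X]] by (simp add: Arr_Suc_simps)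
  next
    fix X Y f assume a: "diag (Pow {..<Suc k}) X \<and> diag (Pow {..<Suc k}) Y \<and> nat_tr (Pow {..<Suc k}) X Y f"
    then have X: "diag (Pow {..<Suc k}) X" and Y: "diag (Pow {..<Suc k}) Y" and f: "nat_tr (Pow {..<Suc k}) X Y f"
      by simp_all
    note f' = nat_Suc[OF f]
    have "tomor k Y (up k Y) (dir k Y) \<cdot>\<^bsub>Arr k\<^esub> tomor k X Y f =
        tomor k (up k X) (up k Y) (\<lambda>S. f (insert k S)) \<cdot>\<^bsub>Arr k\<^esub> tomor k X (up k X) (dir k X)"
      unfolding cm[OF f'(1) diag_Suc(3)[OF Y]] cm[OF diag_Suc(3)[OF X] f'(2)]
      by (rule tomor_cong[OF agree_refl agree_refl f'(3)])
    then have "arrow_square (Arr k) (tomor k X (up k X) (dir k X)) (tomor k Y (up k Y) (dir k Y))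
       (tomor k X Y f) (tomor k (up k X) (up k Y) (\<lambda>S. f (insert k S)))"
      using arr[OF X] arr[OF Y] hm[OF diag_Suc(1)[OF X] diag_Suc(1)[OF Y] f'(1)]
        hm[OF diag_Suc(2)[OF X] diag_Suc(2)[OF Y] f'(2)]
      unfolding arrow_square_def by (simp add: in_hom_def)
    then show "in_hom (Arr (Suc k)) (tomor (Suc k) X Y f) (toarr (Suc k) X) (toarr (Suc k) Y)"
      by (simp add: in_hom_def Arr_Suc_simps)
  next
    fix X Y Z f g assume a: "nat_tr (Pow {..<Suc k}) X Y f \<and> nat_tr (Pow {..<Suc k}) Y Z g"
    note f = nat_Suc[OF conjunct1[OF a]] and g = nat_Suc[OF conjunct2[OF a]]
    show "tomor (Suc k) Y Z g \<cdot>\<^bsub>Arr (Suc k)\<^esub> tomor (Suc k) X Y f = tomor (Suc k) X Z (\<lambda>S. g S \<odot> f S)"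
      using cm[OF f(1) g(1)] cm[OF f(2) g(2)] by (simp add: Arr_Suc_simps)
  qed
qed

lemma toarr_Obj: "diag (Pow {..<k}) X \<Longrightarrow> toarr k X \<in> Obj (Arr k)"
  and Id_toarr: "diag (Pow {..<k}) X \<Longrightarrow> Id (Arr k) (toarr k X) = tomor k X X (\<lambda>S. Id (tagged C) (V X S))"
  and tomor_hom: "diag (Pow {..<k}) X \<Longrightarrow> diag (Pow {..<k}) Y \<Longrightarrow> nat_tr (Pow {..<k}) X Y f \<Longrightarrow>
    in_hom (Arr k) (tomor k X Y f) (toarr k X) (toarr k Y)"
  and tomor_comp: "nat_tr (Pow {..<k}) X Y f \<Longrightarrow> nat_tr (Pow {..<k}) Y Z g \<Longrightarrow>
    tomor k Y Z g \<cdot>\<^bsub>Arr k\<^esub> tomor k X Y f = tomor k X Z (\<lambda>S. g S \<odot> f S)"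
  using tomor_functorial[of k] by simp_all

text \<open>A commutative square between arrows is the same as two maps of faces that form a map of cubes; with
  injectivity of \<open>tomor\<close>, equality of the composites of the square is naturality in the new direction.\<close>

lemma tomor_surj:
  "(\<forall>a\<in>Obj (Arr k). \<exists>X. diag (Pow {..<k}) X \<and> a = toarr k X) \<and>
   (\<forall>m\<in>Mor (Arr k). Dom (Arr k) m \<in> Obj (Arr k) \<and> Cod (Arr k) m \<in> Obj (Arr k)) \<and>
   (\<forall>m X Y. in_hom (Arr k) m (toarr k X) (toarr k Y) \<and> diag (Pow {..<k}) X \<and> diag (Pow {..<k}) Y \<longrightarrow>
      (\<exists>f. nat_tr (Pow {..<k}) X Y f \<and> m = tomor k X Y f))"
proof (induction k)
  case 0
  have P: "Pow {..<0 :: nat} = {{}}" by simp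
  show ?case
    unfolding Arr_0 P
  proof (intro conjI ballI allI impI)
    fix a assume a: "a \<in> Obj (tagged C)"
    have "V (\<lambda>_ _. Id (tagged C) a) {} = a" using Dom_Id[OF a] by (simp add: V_def)
    then show "\<exists>X. diag {{}} X \<and> a = toarr 0 X"
      using a hom_Id[OF a] Id_cmp_Id[OF a] unfolding diag_def by (intro exI[of _ "\<lambda>_ _. Id (tagged C) a"]) simp
  next
    fix m assume "m \<in> Mor (tagged C)"
    then show "Dom (tagged C) m \<in> Obj (tagged C)" "Cod (tagged C) m \<in> Obj (tagged C)" using Dom_in Cod_in by auto
  next
    fix m X Y assume a: "in_hom (tagged C) m (toarr 0 X) (toarr 0 Y) \<and> diag {{}} X \<and> diag {{}} Y"
    then have h: "hom m (V X {}) (V Y {})" and X: "X {} {} = Id (tagged C) (V X {})" and Y: "Y {} {} = Id (tagged C) (V Y {})"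
      unfolding diag_def by simp_all
    show "\<exists>f. nat_tr {{}} X Y f \<and> m = tomor 0 X Y f"
      unfolding nat_tr_def using h X Y cmp_Id[OF h] Id_cmp[OF h] by (intro exI[of _ "\<lambda>_. m"]) simp
  qed
next
  case (Suc k)
  have obj: "\<exists>X. diag (Pow {..<k}) X \<and> a = toarr k X" if "a \<in> Obj (Arr k)" for a using Suc that by simp
  have dc: "Dom (Arr k) m \<in> Obj (Arr k)" "Cod (Arr k) m \<in> Obj (Arr k)" if "m \<in> Mor (Arr k)" for m using Suc that by simp_all
  have mor: "\<exists>f. nat_tr (Pow {..<k}) X Y f \<and> m = tomor k X Y f"
    if "in_hom (Arr k) m (toarr k X) (toarr k Y)" "diag (Pow {..<k}) X" "diag (Pow {..<k}) Y" for m X Y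
    using Suc that by simp
  show ?case
  proof (intro conjI ballI allI impI)
    fix a assume "a \<in> Obj (Arr (Suc k))"
    then have a: "a \<in> Mor (Arr k)" by (simp add: Arr_Suc_simps)
    obtain X Y where X: "diag (Pow {..<k}) X" "Dom (Arr k) a = toarr k X" and Y: "diag (Pow {..<k}) Y" "Cod (Arr k) a = toarr k Y"
      using obj[OF dc(1)[OF a]] obj[OF dc(2)[OF a]] by (elim exE conjE)
    have "in_hom (Arr k) a (toarr k X) (toarr k Y)" using a X(2) Y(2) by (simp add: in_hom_def)
    from mor[OF this X(1) Y(1)]
    obtain f where f: "nat_tr (Pow {..<k}) X Y f" and e: "a = tomor k X Y f" by (elim exE conjE)
    have "toarr (Suc k) (mapc k X Y f) = tomor k X Y f"
      unfolding toarr.simps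
      by (rule tomor_cong[OF agree_sym[OF mapc_dn[OF notin_lessThan]] agree_sym[OF mapc_up[OF notin_lessThan]] mapc_dir[OF notin_lessThan X(1) f]])
    then show "\<exists>X. diag (Pow {..<Suc k}) X \<and> a = toarr (Suc k) X"
      using diag_SucI[OF X(1) Y(1) f] e by (intro exI[of _ "mapc k X Y f"]) simp
  next
    fix m assume m: "m \<in> Mor (Arr (Suc k))"
    then obtain f g t b where "m = Sq f g t b" unfolding Arr_Suc arrow_cat_def by auto
    then show "Dom (Arr (Suc k)) m \<in> Obj (Arr (Suc k))" "Cod (Arr (Suc k)) m \<in> Obj (Arr (Suc k))"
      using m by (simp_all add: Arr_Suc_simps arrow_square_def)
  next
    fix m X Y assume a: "in_hom (Arr (Suc k)) m (toarr (Suc k) X) (toarr (Suc k) Y) \<and>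
       diag (Pow {..<Suc k}) X \<and> diag (Pow {..<Suc k}) Y"
    then have X: "diag (Pow {..<Suc k}) X" and Y: "diag (Pow {..<Suc k}) Y"
      and h: "in_hom (Arr (Suc k)) m (toarr (Suc k) X) (toarr (Suc k) Y)" by simp_all
    have "m \<in> Mor (Arr (Suc k))" using h by (simp add: in_hom_def)
    then obtain f g t b where "m = Sq f g t b" unfolding Arr_Suc arrow_cat_def by auto
    with h have m: "m = Sq (toarr (Suc k) X) (toarr (Suc k) Y) t b" by (simp add: in_hom_def Arr_Suc_simps)
    note X' = diag_Suc[OF X] and Y' = diag_Suc[OF Y]
    have sq: "arrow_square (Arr k) (toarr (Suc k) X) (toarr (Suc k) Y) t b"
      using h unfolding m in_hom_def by (simp add: Arr_Suc_simps)
    have hX: "in_hom (Arr k) (toarr (Suc k) X) (toarr k X) (toarr k (up k X))" using tomor_hom[OF X'] by simp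
    have hY: "in_hom (Arr k) (toarr (Suc k) Y) (toarr k Y) (toarr k (up k Y))" using tomor_hom[OF Y'] by simp
    have t: "in_hom (Arr k) t (toarr k X) (toarr k Y)" and b: "in_hom (Arr k) b (toarr k (up k X)) (toarr k (up k Y))"
      using sq hX hY unfolding arrow_square_def in_hom_def by simp_all
    obtain t' b' where t': "nat_tr (Pow {..<k}) X Y t'" "t = tomor k X Y t'"
      and b': "nat_tr (Pow {..<k}) (up k X) (up k Y) b'" "b = tomor k (up k X) (up k Y) b'"
      using mor[OF t X'(1) Y'(1)] mor[OF b X'(2) Y'(2)] by (elim exE conjE)
    let ?h = "\<lambda>U. if k \<in> U then b' (U - {k}) else t' U"
    have h0: "?h S = t' S" and h1: "?h (insert k S) = b' S" if "S \<in> Pow {..<k}" for S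
    proof -
      have "k \<notin> S" "insert k S - {k} = S" using that by auto
      then show "?h S = t' S" "?h (insert k S) = b' S" by simp_all
    qed
    have e: "tomor k X (up k Y) (\<lambda>S. dir k Y S \<odot> t' S) = tomor k X (up k Y) (\<lambda>S. b' S \<odot> dir k X S)"
      using sq tomor_comp[OF t'(1) Y'(3)] tomor_comp[OF X'(3) b'(1)] unfolding arrow_square_def t'(2) b'(2) by simp
    have "nat_tr (Pow (insert k {..<k})) X Y ?h"
    proof (rule nat_split[OF notin_lessThan X[unfolded Pow_Suc_iff] Y[unfolded Pow_Suc_iff]])
      show "nat_tr (Pow {..<k}) X Y ?h" by (rule agree_nat[OF agree_refl agree_refl _ t'(1)]) (use h0 in simp)
      show "nat_tr (Pow {..<k}) (up k X) (up k Y) (\<lambda>S. ?h (insert k S))"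
        by (rule agree_nat[OF agree_refl agree_refl _ b'(1)]) (use h1 in simp)
      show "dir k Y S \<odot> ?h S = ?h (insert k S) \<odot> dir k X S" if "S \<in> Pow {..<k}" for S
        using tomor_inj[OF e that] h0[OF that] h1[OF that] by simp
    qed
    moreover have "m = tomor (Suc k) X Y ?h"
    proof -
      have "tomor k X Y ?h = t" unfolding t'(2) by (rule tomor_cong[OF agree_refl agree_refl h0])
      moreover have "tomor k (up k X) (up k Y) (\<lambda>S. ?h (insert k S)) = b"
        unfolding b'(2) by (rule tomor_cong[OF agree_refl agree_refl h1])
      ultimately show ?thesis unfolding m by simp
    qed
    ultimately show "\<exists>f. nat_tr (Pow {..<Suc k}) X Y f \<and> m = tomor (Suc k) X Y f"
      unfolding Pow_Suc_iff by (intro exI[of _ ?h]) simp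
  qed
qed

lemma toarr_ex: "a \<in> Obj (Arr k) \<Longrightarrow> \<exists>X. diag (Pow {..<k}) X \<and> a = toarr k X"
  and tomor_ex: "in_hom (Arr k) m (toarr k X) (toarr k Y) \<Longrightarrow> diag (Pow {..<k}) X \<Longrightarrow> diag (Pow {..<k}) Y \<Longrightarrow>
      \<exists>f. nat_tr (Pow {..<k}) X Y f \<and> m = tomor k X Y f"
  using tomor_surj[of k] by simp_all

lemma component_tomor: "component k (tomor k X Y f) S = f (S \<inter> {..<k})"
proof (induction k arbitrary: X Y f)
  case 0
  then show ?case by simp
next
  case (Suc k)
  have "S \<inter> {..<Suc k} = (if k \<in> S then insert k (S \<inter> {..<k}) else S \<inter> {..<k})"
    by (auto simp: lessThan_Suc)
  then show ?case by (simp add: Suc)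
qed

lemma vertex_toarr: "diag (Pow {..<k}) X \<Longrightarrow> vertex C k (toarr k X) S = V X (S \<inter> {..<k})"
proof (induction k arbitrary: X)
  case 0
  then show ?case by simp
next
  case (Suc k)
  note X = diag_Suc[OF Suc(2)]
  have e: "S \<inter> {..<Suc k} = (if k \<in> S then insert k (S \<inter> {..<k}) else S \<inter> {..<k})"
    by (auto simp: lessThan_Suc)
  have "in_hom (Arr k) (toarr (Suc k) X) (toarr k X) (toarr k (up k X))" using tomor_hom[OF X] by simp
  then show ?case using Suc(1)[OF X(1)] Suc(1)[OF X(2)] unfolding e by (simp add: in_hom_def del: toarr.simps)
qed

lemma edge_toarr:
  "diag (Pow {..<k}) X \<Longrightarrow> S \<subseteq> T \<Longrightarrow> edge C k (toarr k X) S T = X (S \<inter> {..<k}) (T \<inter> {..<k})"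
proof (induction k arbitrary: X)
  case 0
  then show ?case using diag_refl[of "Pow {..<0}" X "{}"] by simp
next
  case (Suc k)
  note X = diag_Suc[OF Suc(2)]
  have e: "S \<inter> {..<Suc k} = (if k \<in> S then insert k (S \<inter> {..<k}) else S \<inter> {..<k})" for S
    by (auto simp: lessThan_Suc)
  have h: "Dom (Arr k) (toarr (Suc k) X) = toarr k X" "Cod (Arr k) (toarr (Suc k) X) = toarr k (up k X)"
    using tomor_hom[OF X] by (simp_all add: in_hom_def)
  have IH: "edge C k (toarr k X) S T = X (S \<inter> {..<k}) (T \<inter> {..<k})"
    "edge C k (toarr k (up k X)) S T = up k X (S \<inter> {..<k}) (T \<inter> {..<k})"
    using Suc(1)[OF X(1) Suc(3)] Suc(1)[OF X(2) Suc(3)] by simp_all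
  show ?case
  proof (cases "k \<in> S")
    case True
    then have "k \<in> T" using Suc(3) by auto
    then show ?thesis using True IH(2) unfolding edge.simps h e by (simp add: rx_def)
  next
    case kS: False
    show ?thesis
    proof (cases "k \<in> T")
      case False
      then show ?thesis using kS IH(1) unfolding edge.simps h e by simp
    next
      case True
      let ?S = "S \<inter> {..<k}" and ?T = "T \<inter> {..<k}"
      have P: "?S \<in> Pow {..<k}" "?T \<in> Pow {..<k}" "?S \<subseteq> ?T" using Suc(3) by auto
      have "component k (toarr (Suc k) X) T = dir k X ?T" using component_tomor by simp
      moreover have "dir k X ?T \<cdot>\<^bsub>tagged C\<^esub> X ?S ?T = dir k X ?T \<odot> X ?S ?T"
        using cmp_eq_Comp[OF diag_hom[OF X(1) P] nat_hom[OF X(3) P(2)]] by simp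
      moreover have "dir k X ?T \<odot> X ?S ?T = X ?S (insert k ?T)"
        unfolding dir_def
        using diag_comp[OF Suc(2) in_Pow_Suc(1)[OF P(1)] in_Pow_Suc(1)[OF P(2)] in_Pow_Suc(2)[OF P(2)] P(3) subset_insertI] .
      ultimately show ?thesis using kS True IH(1) unfolding edge.simps h e by (simp del: toarr.simps)
    qed
  qed
qed

section \<open>Higher extensions as cubes with local lifting\<close>

abbreviation Ext where "Ext \<equiv> Ext_cat C"

lemma Ext_simps:
  "Obj (Ext k) = Obj (Arr k) \<inter> n_ext C k" "Dom (Ext k) = Dom (Arr k)" "Cod (Ext k) = Cod (Arr k)"
  "Id (Ext k) = Id (Arr k)" "Comp (Ext k) = Comp (Arr k)"
  by (simp_all add: Ext_cat_def full_sub_def)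

lemma in_hom_Ext: "in_hom (Ext k) m a b \<longleftrightarrow> in_hom (Arr k) m a b \<and> a \<in> n_ext C k \<and> b \<in> n_ext C k"
  unfolding in_hom_def Ext_cat_def full_sub_def by auto

lemma n_ext_Obj: "n_ext C k \<subseteq> Obj (Arr k)"
proof (cases k)
  case 0
  then show ?thesis by (simp add: Arr_0)
next
  case k: (Suc m)
  show ?thesis
  proof (cases m)
    case 0
    have "regular_epis (tagged C) \<subseteq> Mor (tagged C)" unfolding regular_epis_def is_coequalizer_def by blast
    then show ?thesis unfolding k 0 by (simp only: n_ext.simps Arr_Suc_simps Arr_0)
  next
    case (Suc n)
    show ?thesis unfolding k Suc by (auto simp: Arr_Suc_simps(1) full_sub_def)
  qed
qed

lemma Obj_Ext: "Obj (Ext k) = n_ext C k"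
  using n_ext_Obj[of k] Ext_simps(1)[of k] by blast

text \<open>This is the first half of the comparison of extensions with cubes. It is a predicate on \<open>k\<close> because it is
  proved together with the second half, \<open>lifting_ext\<close>, by induction.\<close>

definition cubical :: "nat \<Rightarrow> bool" where
  "cubical k \<longleftrightarrow> (\<forall>X. diag (Pow {..<k}) X \<longrightarrow> (toarr k X \<in> n_ext C k \<longleftrightarrow> extc {..<k} X))"

lemma cubicalD: "cubical k \<Longrightarrow> extc {..<k} X \<Longrightarrow> toarr k X \<in> n_ext C k"
  unfolding cubical_def using extc_diag by metis

lemma cubical_ex:
  assumes c: "cubical k" and a: "a \<in> n_ext C k"
  shows "\<exists>X. extc {..<k} X \<and> a = toarr k X"
proof -
  obtain X where "diag (Pow {..<k}) X" "a = toarr k X" using toarr_ex[of a k] a n_ext_Obj[of k] by (auto simp: subset_iff)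
  then show ?thesis using c a unfolding cubical_def by (intro exI[of _ X]) simp
qed

lemma Ext_hom:
  assumes c: "cubical k" and X: "extc {..<k} X" and Y: "extc {..<k} Y"
  shows "nat_tr (Pow {..<k}) X Y f \<Longrightarrow> in_hom (Ext k) (tomor k X Y f) (toarr k X) (toarr k Y)"
    and "in_hom (Ext k) m (toarr k X) (toarr k Y) \<Longrightarrow> \<exists>f. nat_tr (Pow {..<k}) X Y f \<and> m = tomor k X Y f"
  using tomor_hom[OF extc_diag[OF X] extc_diag[OF Y]] tomor_ex[OF _ extc_diag[OF X] extc_diag[OF Y]]
    cubicalD[OF c X] cubicalD[OF c Y] unfolding in_hom_Ext by simp_all

lemma tomor_eq_iff: "tomor k X Y f = tomor k X Y g \<longleftrightarrow> (\<forall>S\<in>Pow {..<k}. f S = g S)"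
proof
  assume e: "tomor k X Y f = tomor k X Y g"
  show "\<forall>S\<in>Pow {..<k}. f S = g S" using tomor_inj[OF e] by simp
next
  assume "\<forall>S\<in>Pow {..<k}. f S = g S"
  then show "tomor k X Y f = tomor k X Y g" by (intro tomor_cong[OF agree_refl agree_refl]) simp
qed

text \<open>The universal property of the limit at each vertex assembles into that of the cubes.\<close>

lemma Ext_pullbackI:
  assumes c: "cubical k" and X: "extc {..<k} X" and Y: "extc {..<k} Y" and Z: "extc {..<k} Z" and R: "extc {..<k} R"
    and f: "nat_tr (Pow {..<k}) X Z f" and g: "nat_tr (Pow {..<k}) Y Z g" and pb: "pb (Pow {..<k}) X Y Z f g R p q"
  shows "is_pullback (Ext k) (tomor k X Z f) (tomor k Y Z g) (tomor k R X p) (tomor k R Y q)"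
proof -
  let ?P = "Pow {..<k}"
  note hf = Ext_hom(1)[OF c X Z f] and hg = Ext_hom(1)[OF c Y Z g]
  note hp = Ext_hom(1)[OF c R X pb_p[OF pb]] and hq = Ext_hom(1)[OF c R Y pb_q[OF pb]]
  have dc: "Dom (Ext k) (tomor k X Z f) = toarr k X" "Dom (Ext k) (tomor k Y Z g) = toarr k Y"
    "Dom (Ext k) (tomor k R X p) = toarr k R"
    using hf hg hp by (simp_all add: in_hom_def)
  have sq: "tomor k X Z f \<cdot>\<^bsub>Ext k\<^esub> tomor k R X p = tomor k Y Z g \<cdot>\<^bsub>Ext k\<^esub> tomor k R Y q"
    unfolding Ext_simps tomor_comp[OF pb_p[OF pb] f] tomor_comp[OF pb_q[OF pb] g] tomor_eq_iff
    using pb_sq[OF pb] by simp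
  have "\<exists>!u. in_hom (Ext k) u z (toarr k R) \<and> tomor k R X p \<cdot>\<^bsub>Ext k\<^esub> u = r \<and> tomor k R Y q \<cdot>\<^bsub>Ext k\<^esub> u = s"
    if r: "in_hom (Ext k) r z (toarr k X)" and s: "in_hom (Ext k) s z (toarr k Y)"
      and e: "tomor k X Z f \<cdot>\<^bsub>Ext k\<^esub> r = tomor k Y Z g \<cdot>\<^bsub>Ext k\<^esub> s" for z r s
  proof -
    have "z \<in> n_ext C k" using r unfolding in_hom_Ext by simp
    from cubical_ex[OF c this] obtain W where W: "extc {..<k} W" and z: "z = toarr k W" by (elim exE conjE)
    obtain r' s' where r': "nat_tr ?P W X r'" "r = tomor k W X r'" and s': "nat_tr ?P W Y s'" "s = tomor k W Y s'"
      using Ext_hom(2)[OF c W X r[unfolded z]] Ext_hom(2)[OF c W Y s[unfolded z]] by (elim exE conjE)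
    have e': "f S \<odot> r' S = g S \<odot> s' S" if "S \<in> ?P" for S
      using e that unfolding r'(2) s'(2) Ext_simps tomor_comp[OF r'(1) f] tomor_comp[OF s'(1) g] tomor_eq_iff by simp
    have "\<exists>u. nat_tr ?P W R u \<and> (\<forall>S\<in>?P. p S \<odot> u S = r' S \<and> q S \<odot> u S = s' S)"
      by (rule pb_induced[OF pb extc_diag[OF W] r'(1) s'(1) e'])
    then obtain u where u: "nat_tr ?P W R u" "\<forall>S\<in>?P. p S \<odot> u S = r' S \<and> q S \<odot> u S = s' S" by (elim exE conjE)
    show ?thesis
    proof (rule ex1I[of _ "tomor k W R u"], intro conjI)
      show "in_hom (Ext k) (tomor k W R u) z (toarr k R)" unfolding z using Ext_hom(1)[OF c W R u(1)] .
      show "tomor k R X p \<cdot>\<^bsub>Ext k\<^esub> tomor k W R u = r" "tomor k R Y q \<cdot>\<^bsub>Ext k\<^esub> tomor k W R u = s"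
        unfolding Ext_simps tomor_comp[OF u(1) pb_p[OF pb]] tomor_comp[OF u(1) pb_q[OF pb]] r'(2) s'(2) tomor_eq_iff
        using u(2) by simp_all
    next
      fix v assume v: "in_hom (Ext k) v z (toarr k R) \<and> tomor k R X p \<cdot>\<^bsub>Ext k\<^esub> v = r \<and> tomor k R Y q \<cdot>\<^bsub>Ext k\<^esub> v = s"
      obtain v' where v': "nat_tr ?P W R v'" "v = tomor k W R v'"
        using Ext_hom(2)[OF c W R conjunct1[OF v[unfolded z]]] by (elim exE conjE)
      have ve: "p S \<odot> v' S = r' S" "q S \<odot> v' S = s' S" if "S \<in> ?P" for S
        using v that unfolding v'(2) r'(2) s'(2) Ext_simps tomor_comp[OF v'(1) pb_p[OF pb]] tomor_comp[OF v'(1) pb_q[OF pb]] tomor_eq_iff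
        by simp_all
      have "v' S = u S" if S: "S \<in> ?P" for S
        by (rule pb_eqI[OF pb S nat_hom[OF v'(1) S] nat_hom[OF u(1) S]]) (use ve[OF S] u(2) S in simp_all)
      then show "v = tomor k W R u" unfolding v'(2) tomor_eq_iff by simp
    qed
  qed
  then show ?thesis
    unfolding is_pullback_def using hf hg hp hq sq by (simp add: in_hom_def)
qed

lemma ex1_unique: "\<exists>!x. Q x \<Longrightarrow> Q a \<Longrightarrow> Q b \<Longrightarrow> a = b"
  by auto

text \<open>Conversely a pullback along an extension is pointwise, because the pointwise pullback is itself a
  cubical extension and pullbacks are unique up to isomorphism.\<close>

lemma Ext_pullbackD:
  assumes c: "cubical k" and X: "extc {..<k} X" and Y: "extc {..<k} Y" and Z: "extc {..<k} Z" and R: "extc {..<k} R"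
    and f: "nat_tr (Pow {..<k}) X Z f" and g: "emap (Pow {..<k}) Y Z g"
    and p: "nat_tr (Pow {..<k}) R X p" and q: "nat_tr (Pow {..<k}) R Y q"
    and P: "is_pullback (Ext k) (tomor k X Z f) (tomor k Y Z g) (tomor k R X p) (tomor k R Y q)"
  shows "pb (Pow {..<k}) X Y Z f g R p q"
proof -
  let ?P = "Pow {..<k}"
  note gn = emap_nat[OF g]
  note hf = Ext_hom(1)[OF c X Z f] and hg = Ext_hom(1)[OF c Y Z gn] and hp = Ext_hom(1)[OF c R X p] and hq = Ext_hom(1)[OF c R Y q]
  obtain R0 p0 q0 where pb0: "pb ?P X Y Z f g R0 p0 q0"
    using pb_exists[OF extc_diag[OF X] extc_diag[OF Y] extc_diag[OF Z] f gn] by (elim exE)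
  have "emap ?P R0 X p0" using pb_emap[OF pb_sym[OF pb0] g extc_diag[OF X] f] .
  then have R0: "extc {..<k} R0" using extc_dom X by simp
  have sq: "f S \<odot> p S = g S \<odot> q S" if "S \<in> ?P" for S
    using P that unfolding is_pullback_def Ext_simps tomor_comp[OF p f] tomor_comp[OF q gn] tomor_eq_iff by simp
  have univ: "\<exists>u. nat_tr ?P W R u \<and> (\<forall>S\<in>?P. p S \<odot> u S = r S \<and> q S \<odot> u S = s S) \<and>
      (\<forall>v. nat_tr ?P W R v \<and> (\<forall>S\<in>?P. p S \<odot> v S = r S \<and> q S \<odot> v S = s S) \<longrightarrow> (\<forall>S\<in>?P. v S = u S))"
    if W: "extc {..<k} W" and r: "nat_tr ?P W X r" and s: "nat_tr ?P W Y s" and e: "\<And>S. S \<in> ?P \<Longrightarrow> f S \<odot> r S = g S \<odot> s S" for W r s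
  proof -
    have "in_hom (Ext k) (tomor k W X r) (toarr k W) (Dom (Ext k) (tomor k X Z f))"
      "in_hom (Ext k) (tomor k W Y s) (toarr k W) (Dom (Ext k) (tomor k Y Z g))"
      using Ext_hom(1)[OF c W X r] Ext_hom(1)[OF c W Y s] hf hg by (simp_all add: in_hom_def)
    moreover have "tomor k X Z f \<cdot>\<^bsub>Ext k\<^esub> tomor k W X r = tomor k Y Z g \<cdot>\<^bsub>Ext k\<^esub> tomor k W Y s"
      unfolding Ext_simps tomor_comp[OF r f] tomor_comp[OF s gn] tomor_eq_iff by (intro ballI e)
    moreover have "Dom (Ext k) (tomor k R X p) = toarr k R" using hp by (simp add: in_hom_def)
    ultimately have ex1: "\<exists>!u. in_hom (Ext k) u (toarr k W) (toarr k R) \<and> tomor k R X p \<cdot>\<^bsub>Ext k\<^esub> u = tomor k W X r \<and>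
        tomor k R Y q \<cdot>\<^bsub>Ext k\<^esub> u = tomor k W Y s"
      using P[unfolded is_pullback_def, THEN conjunct2, THEN conjunct2, THEN conjunct2, THEN conjunct2, THEN conjunct2,
          THEN conjunct2, THEN conjunct2, THEN conjunct2, THEN conjunct2, rule_format, of "tomor k W X r" "toarr k W" "tomor k W Y s"]
      by simp
    have tr: "in_hom (Ext k) (tomor k W R v) (toarr k W) (toarr k R) \<and>
       tomor k R X p \<cdot>\<^bsub>Ext k\<^esub> tomor k W R v = tomor k W X r \<and> tomor k R Y q \<cdot>\<^bsub>Ext k\<^esub> tomor k W R v = tomor k W Y s \<longleftrightarrow>
       (\<forall>S\<in>?P. p S \<odot> v S = r S \<and> q S \<odot> v S = s S)" if v: "nat_tr ?P W R v" for v
      using Ext_hom(1)[OF c W R v] unfolding Ext_simps tomor_comp[OF v p] tomor_comp[OF v q] tomor_eq_iff by auto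
    from ex1 obtain m where m: "in_hom (Ext k) m (toarr k W) (toarr k R)" "tomor k R X p \<cdot>\<^bsub>Ext k\<^esub> m = tomor k W X r"
      "tomor k R Y q \<cdot>\<^bsub>Ext k\<^esub> m = tomor k W Y s" by (elim ex1E conjE)
    obtain u where u: "nat_tr ?P W R u" "m = tomor k W R u" using Ext_hom(2)[OF c W R m(1)] by (elim exE conjE)
    have ue: "\<forall>S\<in>?P. p S \<odot> u S = r S \<and> q S \<odot> u S = s S" using tr[OF u(1)] m unfolding u(2) by simp
    have un: "\<forall>S\<in>?P. v S = u S" if v: "nat_tr ?P W R v" "\<forall>S\<in>?P. p S \<odot> v S = r S \<and> q S \<odot> v S = s S" for v
    proof -
      have "tomor k W R v = tomor k W R u"
        by (rule ex1_unique[OF ex1, OF tr[OF v(1), THEN iffD2, OF v(2)] tr[OF u(1), THEN iffD2, OF ue]])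
      then show ?thesis unfolding tomor_eq_iff .
    qed
    show ?thesis
      by (rule exI[of _ u], intro conjI allI impI, rule u(1), rule ue, elim conjE, rule un)
  qed
  have "\<exists>u. nat_tr ?P R0 R u \<and> (\<forall>S\<in>?P. p S \<odot> u S = p0 S \<and> q S \<odot> u S = q0 S) \<and>
      (\<forall>v. nat_tr ?P R0 R v \<and> (\<forall>S\<in>?P. p S \<odot> v S = p0 S \<and> q S \<odot> v S = q0 S) \<longrightarrow> (\<forall>S\<in>?P. v S = u S))"
    by (rule univ[OF R0 pb_p[OF pb0] pb_q[OF pb0] pb_sq[OF pb0]])
  then obtain u where u: "nat_tr ?P R0 R u" and ue: "\<forall>S\<in>?P. p S \<odot> u S = p0 S \<and> q S \<odot> u S = q0 S" by (elim exE conjE)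
  have "\<exists>u. nat_tr ?P R R0 u \<and> (\<forall>S\<in>?P. p0 S \<odot> u S = p S \<and> q0 S \<odot> u S = q S)"
    by (rule pb_induced[OF pb0 extc_diag[OF R] p q sq])
  then obtain v where v: "nat_tr ?P R R0 v" and ve: "\<forall>S\<in>?P. p0 S \<odot> v S = p S \<and> q0 S \<odot> v S = q S" by (elim exE conjE)
  have "\<exists>u. nat_tr ?P R R u \<and> (\<forall>S\<in>?P. p S \<odot> u S = p S \<and> q S \<odot> u S = q S) \<and>
      (\<forall>v. nat_tr ?P R R v \<and> (\<forall>S\<in>?P. p S \<odot> v S = p S \<and> q S \<odot> v S = q S) \<longrightarrow> (\<forall>S\<in>?P. v S = u S))"
    by (rule univ[OF R p q sq])
  then obtain w where w': "\<forall>v. nat_tr ?P R R v \<and> (\<forall>S\<in>?P. p S \<odot> v S = p S \<and> q S \<odot> v S = q S) \<longrightarrow> (\<forall>S\<in>?P. v S = w S)"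
    by (elim exE conjE)
  note w = bspec[OF mp[OF spec[OF w'] conjI]]
  have eq: "p S \<odot> u S \<odot> a = p0 S \<odot> a" "q S \<odot> u S \<odot> a = q0 S \<odot> a" "p0 S \<odot> v S \<odot> a = p S \<odot> a" "q0 S \<odot> v S \<odot> a = q S \<odot> a" if "S \<in> ?P" for S a
    using arg_cong[OF conjunct1[OF bspec[OF ue that]], of "\<lambda>m. m \<odot> a"] arg_cong[OF conjunct2[OF bspec[OF ue that]], of "\<lambda>m. m \<odot> a"]
      arg_cong[OF conjunct1[OF bspec[OF ve that]], of "\<lambda>m. m \<odot> a"] arg_cong[OF conjunct2[OF bspec[OF ve that]], of "\<lambda>m. m \<odot> a"] by simp_all
  have uv: "u S \<odot> v S = Id (tagged C) (V R S)" if S: "S \<in> ?P" for S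
  proof -
    have "u S \<odot> v S = w S"
      by (rule w[OF nat_comp[OF v u] _ S]) (use ue ve eq in simp)
    moreover have "Id (tagged C) (V R S) = w S"
      by (rule w[OF nat_Id[OF extc_diag[OF R]] _ S]) (use cmp_Id[OF nat_hom[OF p]] cmp_Id[OF nat_hom[OF q]] in simp)
    ultimately show ?thesis by simp
  qed
  have "bij ?P R R0 v"
    unfolding bij_def
  proof (intro conjI ballI)
    show "nat_tr ?P R R0 v" using v .
    fix S assume S: "S \<in> ?P"
    have "v S \<odot> u S = Id (tagged C) (V R0 S)"
    proof (rule pb_eqI[OF pb0 S hom_cmp[OF nat_hom[OF u S] nat_hom[OF v S]] hom_Id[OF diag_Obj[OF extc_diag[OF R0] S]]])
      show "p0 S \<odot> v S \<odot> u S = p0 S \<odot> Id (tagged C) (V R0 S)" "q0 S \<odot> v S \<odot> u S = q0 S \<odot> Id (tagged C) (V R0 S)"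
        using eq[OF S] bspec[OF ue S] cmp_Id[OF nat_hom[OF pb_p[OF pb0] S]] cmp_Id[OF nat_hom[OF pb_q[OF pb0] S]] by simp_all
    qed
    then show "\<exists>h. hom h (V R0 S) (V R S) \<and> h \<odot> v S = Id (tagged C) (V R S) \<and> v S \<odot> h = Id (tagged C) (V R0 S)"
      using nat_hom[OF u S] uv[OF S] by (intro exI[of _ "u S"]) simp
  qed
  then show ?thesis
    by (rule pb_bij[OF pb0 _ extc_diag[OF R]]) (use ve in simp_all)
qed

text \<open>In a cube without directions nothing lies above the only vertex, and lifting reduces to local lifting of
  elements.\<close>

lemma regular_epi_iff_emap:
  assumes X: "diag (Pow {}) X" and Y: "diag (Pow {}) Y" and f: "nat_tr (Pow {}) X Y f"
  shows "f {} \<in> regular_epis (tagged C) \<longleftrightarrow> emap (Pow {}) X Y f"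
proof
  have P: "{} \<in> Pow {}" by simp
  note fh = nat_hom[OF f P]
  { assume "f {} \<in> regular_epis (tagged C)"
    then have c: "cover (f {}) (V X {}) (V Y {})" using fh by (simp add: cover_def)
    show "emap (Pow {}) X Y f"
    proof (rule emapI[OF X Y f])
      fix S :: "nat set" assume "S \<in> Pow {}"
      then have S: "S = {}" by simp
      have ab: "above (Pow {}) {} = {}" by (auto simp: above_def)
      show "lifts (Pow {}) X Y f S"
        unfolding lifts_def S
      proof (intro allI impI)
        fix z x y assume m: "match (Pow {}) X Y f {} z x y"
        obtain w e' x' where "cover e' w z" "hom x' w (V X {})" "f {} \<odot> x' = y \<odot> e'"
          using cover_pullback[OF c match_hom[OF m]] by (elim exE conjE)
        then show "\<exists>z' e x'. cover e z' z \<and> sol (Pow {}) X Y f {} z' x y e x'"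
          unfolding sol_def ab by (intro exI conjI ballI) simp_all
      qed
    qed }
  { assume e: "emap (Pow {}) X Y f"
    have "cover (f {}) (V X {}) (V Y {})" by (rule emap_cover[OF _ e P]) simp
    then show "f {} \<in> regular_epis (tagged C)" by (simp add: cover_def) }
qed

lemma pb_unique:
  assumes R: "pb P X Y Z f g R p q" and R': "pb P X Y Z f g R' p' q'"
  shows "\<exists>v. bij P R' R v \<and> (\<forall>S\<in>P. p S \<odot> v S = p' S \<and> q S \<odot> v S = q' S)"
proof -
  have "\<exists>v. nat_tr P R' R v \<and> (\<forall>S\<in>P. p S \<odot> v S = p' S \<and> q S \<odot> v S = q' S)"
    by (rule pb_induced[OF R pb_diag[OF R'] pb_p[OF R'] pb_q[OF R'] pb_sq[OF R']])
  then obtain v where v: "nat_tr P R' R v" and ve: "\<forall>S\<in>P. p S \<odot> v S = p' S \<and> q S \<odot> v S = q' S" by (elim exE conjE)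
  have eq: "p S \<odot> v S \<odot> a = p' S \<odot> a" "q S \<odot> v S \<odot> a = q' S \<odot> a" if "S \<in> P" for S a
    using arg_cong[OF conjunct1[OF bspec[OF ve that]], of "\<lambda>m. m \<odot> a"]
      arg_cong[OF conjunct2[OF bspec[OF ve that]], of "\<lambda>m. m \<odot> a"] by simp_all
  have "bij P R' R v"
  proof (rule bijI[OF pb_diag[OF R'] pb_diag[OF R] v])
    fix S z y assume S: "S \<in> P" and y: "hom y z (V R S)"
    have "f S \<odot> p S \<odot> y = g S \<odot> q S \<odot> y" by (rule pb_sq'[OF R S])
    from pb_ex[OF R' S hom_cmp[OF y nat_hom[OF pb_p[OF R] S]] hom_cmp[OF y nat_hom[OF pb_q[OF R] S]] this]
    obtain u where u: "hom u z (V R' S)" "p' S \<odot> u = p S \<odot> y" "q' S \<odot> u = q S \<odot> y" by (elim ex1E conjE)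
    show "\<exists>!x. hom x z (V R' S) \<and> v S \<odot> x = y"
    proof (rule ex1I[of _ u], intro conjI)
      show "hom u z (V R' S)" by (rule u(1))
      show "v S \<odot> u = y"
        by (rule pb_eqI[OF R S hom_cmp[OF u(1) nat_hom[OF v S]] y]) (simp_all add: eq[OF S] u)
      fix x assume x: "hom x z (V R' S) \<and> v S \<odot> x = y"
      have "p S \<odot> v S \<odot> x = p S \<odot> y" "q S \<odot> v S \<odot> x = q S \<odot> y" using x by simp_all
      then show "x = u"
        by (intro pb_eqI[OF R' S conjunct1[OF x] u(1)]) (simp_all add: eq[OF S] u)
    qed
  qed
  then show ?thesis using ve by (intro exI[of _ v]) simp
qed

definition lifting_ext :: "nat \<Rightarrow> bool" where
  "lifting_ext k \<longleftrightarrow> (\<forall>X Y f. diag (Pow {..<k}) X \<and> diag (Pow {..<k}) Y \<and> nat_tr (Pow {..<k}) X Y f \<longrightarrow>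
     (tomor k X Y f \<in> n_ext C (Suc k) \<longleftrightarrow> extc {..<k} Y \<and> emap (Pow {..<k}) X Y f))"

lemma lifting_extI:
  "lifting_ext k \<Longrightarrow> extc {..<k} Y \<Longrightarrow> emap (Pow {..<k}) X Y f \<Longrightarrow> tomor k X Y f \<in> n_ext C (Suc k)"
  unfolding lifting_ext_def using emap_dom emap_cod emap_nat by metis

lemma lifting_extD:
  assumes "lifting_ext k" "tomor k X Y f \<in> n_ext C (Suc k)"
    "diag (Pow {..<k}) X" "diag (Pow {..<k}) Y" "nat_tr (Pow {..<k}) X Y f"
  shows "extc {..<k} Y" "emap (Pow {..<k}) X Y f"
  using assms unfolding lifting_ext_def by simp_all

text \<open>A double extension asserts a property of the comparison map for some pullback in the category of
  extensions. Pullbacks there are vertexwise, so the comparison with any other vertexwise pullback differs from it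
  by an isomorphism.\<close>

lemma double_extensionD:
  assumes c: "cubical k" and le: "lifting_ext k"
    and X: "diag (Pow {..<k}) X" and X1: "diag (Pow {..<k}) X1" and Y: "diag (Pow {..<k}) Y" and Y1: "diag (Pow {..<k}) Y1"
    and d: "nat_tr (Pow {..<k}) X X1 d" and e: "nat_tr (Pow {..<k}) Y Y1 e"
    and t: "nat_tr (Pow {..<k}) X Y t" and b: "nat_tr (Pow {..<k}) X1 Y1 b"
    and D: "double_extension (Ext k) (n_ext C (Suc k)) (tomor k X X1 d) (tomor k Y Y1 e) (tomor k X Y t) (tomor k X1 Y1 b)"
    and R: "pb (Pow {..<k}) X1 Y Y1 b e R p q" and u: "nat_tr (Pow {..<k}) X R u"
    and eq: "\<forall>S\<in>Pow {..<k}. p S \<odot> u S = d S \<and> q S \<odot> u S = t S"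
  shows "emap (Pow {..<k}) X R u" "emap (Pow {..<k}) X1 Y1 b"
proof -
  let ?P = "Pow {..<k}" and ?E = "n_ext C (Suc k)"
  obtain P Q U where E: "tomor k X X1 d \<in> ?E" "tomor k Y Y1 e \<in> ?E" "tomor k X Y t \<in> ?E" "tomor k X1 Y1 b \<in> ?E"
    and pbE: "is_pullback (Ext k) (tomor k X1 Y1 b) (tomor k Y Y1 e) P Q"
    and U: "in_hom (Ext k) U (Dom (Ext k) (tomor k X X1 d)) (Dom (Ext k) P)"
      "P \<cdot>\<^bsub>Ext k\<^esub> U = tomor k X X1 d" "Q \<cdot>\<^bsub>Ext k\<^esub> U = tomor k X Y t" "U \<in> ?E"
    using D unfolding double_extension_def by (elim conjE exE)
  note dE = lifting_extD[OF le E(1) X X1 d] and eE = lifting_extD[OF le E(2) Y Y1 e]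
  note tE = lifting_extD[OF le E(3) X Y t] and bE = lifting_extD[OF le E(4) X1 Y1 b]
  show "emap ?P X1 Y1 b" by (rule bE(2))
  have Xe: "extc {..<k} X" using extc_dom[OF tE(2) tE(1)] .
  have dm: "Dom (Ext k) (tomor k X X1 d) = toarr k X" "Dom (Ext k) (tomor k X1 Y1 b) = toarr k X1" "Dom (Ext k) (tomor k Y Y1 e) = toarr k Y"
    using tomor_hom[OF X X1 d] tomor_hom[OF X1 Y1 b] tomor_hom[OF Y Y1 e] by (simp_all add: in_hom_def Ext_simps)
  have "Dom (Ext k) P \<in> n_ext C k" using U(1) unfolding in_hom_Ext by simp
  from cubical_ex[OF c this] obtain R' where R': "extc {..<k} R'" "Dom (Ext k) P = toarr k R'" by (elim exE conjE)
  have "in_hom (Ext k) P (toarr k R') (toarr k X1)" "in_hom (Ext k) Q (toarr k R') (toarr k Y)"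
    using pbE dm R'(2) unfolding is_pullback_def in_hom_def by simp_all
  from Ext_hom(2)[OF c R'(1) dE(1) this(1)] Ext_hom(2)[OF c R'(1) tE(1) this(2)]
  obtain p' q' where p': "nat_tr ?P R' X1 p'" "P = tomor k R' X1 p'" and q': "nat_tr ?P R' Y q'" "Q = tomor k R' Y q'"
    by (elim exE conjE)
  have "in_hom (Ext k) U (toarr k X) (toarr k R')" using U(1) dm R'(2) by simp
  from Ext_hom(2)[OF c Xe R'(1) this] obtain u' where u': "nat_tr ?P X R' u'" "U = tomor k X R' u'" by (elim exE conjE)
  have uE: "emap ?P X R' u'" using lifting_extD(2)[OF le U(4)[unfolded u'(2)] X extc_diag[OF R'(1)] u'(1)] .
  have ue: "p' S \<odot> u' S = d S" "q' S \<odot> u' S = t S" if "S \<in> ?P" for S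
    using U(2,3) that unfolding p'(2) q'(2) u'(2) Ext_simps tomor_comp[OF u'(1) p'(1)] tomor_comp[OF u'(1) q'(1)] tomor_eq_iff
    by simp_all
  have pb': "pb ?P X1 Y Y1 b e R' p' q'"
    by (rule Ext_pullbackD[OF c dE(1) tE(1) eE(1) R'(1) b eE(2) p'(1) q'(1) pbE[unfolded p'(2) q'(2)]])
  obtain v where v: "bij ?P R' R v" and ve: "\<forall>S\<in>?P. p S \<odot> v S = p' S \<and> q S \<odot> v S = q' S"
    using pb_unique[OF R pb'] by (elim exE conjE)
  have vu: "v S \<odot> u' S = u S" if S: "S \<in> ?P" for S
  proof (rule pb_eqI[OF R S hom_cmp[OF nat_hom[OF u'(1) S] nat_hom[OF bij_nat[OF v] S]] nat_hom[OF u S]])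
    show "p S \<odot> v S \<odot> u' S = p S \<odot> u S" "q S \<odot> v S \<odot> u' S = q S \<odot> u S"
      using arg_cong[OF conjunct1[OF bspec[OF ve S]], of "\<lambda>m. m \<odot> u' S"]
        arg_cong[OF conjunct2[OF bspec[OF ve S]], of "\<lambda>m. m \<odot> u' S"] ue[OF S] bspec[OF eq S] by simp_all
  qed
  show "emap ?P X R u"
    by (rule agree_emap[OF agree_refl agree_refl vu emap_comp[OF uE bij_emap[OF v extc_diag[OF R'(1)] pb_diag[OF R]]]])
qed

lemma double_extensionI:
  assumes c: "cubical k" and le: "lifting_ext k" and Y1: "extc {..<k} Y1"
    and d: "emap (Pow {..<k}) X X1 d" and e: "emap (Pow {..<k}) Y Y1 e"
    and t: "emap (Pow {..<k}) X Y t" and b: "emap (Pow {..<k}) X1 Y1 b"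
    and R: "pb (Pow {..<k}) X1 Y Y1 b e R p q" and u: "emap (Pow {..<k}) X R u"
    and eq: "\<forall>S\<in>Pow {..<k}. p S \<odot> u S = d S \<and> q S \<odot> u S = t S"
  shows "double_extension (Ext k) (n_ext C (Suc k)) (tomor k X X1 d) (tomor k Y Y1 e) (tomor k X Y t) (tomor k X1 Y1 b)"
proof -
  let ?P = "Pow {..<k}" and ?E = "n_ext C (Suc k)"
  have Y: "extc {..<k} Y" and X1: "extc {..<k} X1" using extc_dom[OF e Y1] extc_dom[OF b Y1] .
  have X: "extc {..<k} X" using extc_dom[OF t Y] .
  have q: "emap ?P R Y q" using pb_emap[OF R b extc_diag[OF Y] emap_nat[OF e]] .
  have p: "emap ?P R X1 p" using pb_emap[OF pb_sym[OF R] e extc_diag[OF X1] emap_nat[OF b]] .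
  have Re: "extc {..<k} R" using extc_dom[OF q Y] .
  note hd = Ext_hom(1)[OF c X X1 emap_nat[OF d]] and he = Ext_hom(1)[OF c Y Y1 emap_nat[OF e]]
  note ht = Ext_hom(1)[OF c X Y emap_nat[OF t]] and hb = Ext_hom(1)[OF c X1 Y1 emap_nat[OF b]]
  note hu = Ext_hom(1)[OF c X Re emap_nat[OF u]] and hp = Ext_hom(1)[OF c Re X1 emap_nat[OF p]]
  have sq: "tomor k Y Y1 e \<cdot>\<^bsub>Ext k\<^esub> tomor k X Y t = tomor k X1 Y1 b \<cdot>\<^bsub>Ext k\<^esub> tomor k X X1 d"
    unfolding Ext_simps tomor_comp[OF emap_nat[OF t] emap_nat[OF e]] tomor_comp[OF emap_nat[OF d] emap_nat[OF b]] tomor_eq_iff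
  proof
    fix S assume S: "S \<in> ?P"
    show "e S \<odot> t S = b S \<odot> d S" using pb_sq'[OF R S, of "u S"] bspec[OF eq S] by simp
  qed
  have cu: "tomor k R X1 p \<cdot>\<^bsub>Ext k\<^esub> tomor k X R u = tomor k X X1 d" "tomor k R Y q \<cdot>\<^bsub>Ext k\<^esub> tomor k X R u = tomor k X Y t"
    unfolding Ext_simps tomor_comp[OF emap_nat[OF u] emap_nat[OF p]] tomor_comp[OF emap_nat[OF u] emap_nat[OF q]] tomor_eq_iff
    using eq by simp_all
  show ?thesis
    unfolding double_extension_def
  proof (intro conjI exI)
    show "arrow_square (Ext k) (tomor k X X1 d) (tomor k Y Y1 e) (tomor k X Y t) (tomor k X1 Y1 b)"
      unfolding arrow_square_def using hd he ht hb sq by (simp add: in_hom_def)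
    show "tomor k X X1 d \<in> ?E" "tomor k Y Y1 e \<in> ?E" "tomor k X Y t \<in> ?E" "tomor k X1 Y1 b \<in> ?E"
      "tomor k R X1 p \<in> ?E" "tomor k R Y q \<in> ?E" "tomor k X R u \<in> ?E"
      by (rule lifting_extI[OF le X1 d] lifting_extI[OF le Y1 e] lifting_extI[OF le Y t] lifting_extI[OF le Y1 b]
        lifting_extI[OF le X1 p] lifting_extI[OF le Y q] lifting_extI[OF le Re u])+
    show "is_pullback (Ext k) (tomor k X1 Y1 b) (tomor k Y Y1 e) (tomor k R X1 p) (tomor k R Y q)"
      by (rule Ext_pullbackI[OF c X1 Y Y1 Re emap_nat[OF b] emap_nat[OF e] R])
    show "in_hom (Ext k) (tomor k X R u) (Dom (Ext k) (tomor k X X1 d)) (Dom (Ext k) (tomor k R X1 p))"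
      using hu hd hp by (simp add: in_hom_def)
    show "tomor k R X1 p \<cdot>\<^bsub>Ext k\<^esub> tomor k X R u = tomor k X X1 d" "tomor k R Y q \<cdot>\<^bsub>Ext k\<^esub> tomor k X R u = tomor k X Y t"
      by (rule cu)+
  qed
qed

lemma cubical_0: "cubical 0"
  unfolding cubical_def using diag_Obj[of "Pow {..<0}" _ "{}"] extc_empty by simp

lemma lifting_ext_0: "lifting_ext 0"
  unfolding lifting_ext_def using regular_epi_iff_emap extc_empty by simp

lemma cubical_Suc:
  assumes le: "lifting_ext k"
  shows "cubical (Suc k)"
  unfolding cubical_def
proof (intro allI impI)
  fix X assume X: "diag (Pow {..<Suc k}) X"
  have "extc {..<Suc k} X \<longleftrightarrow> extc {..<k} (up k X) \<and> emap (Pow {..<k}) X (up k X) (dir k X)"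
    unfolding lessThan_Suc extc_insert[OF notin_lessThan] using X unfolding Pow_Suc_iff by simp
  then show "toarr (Suc k) X \<in> n_ext C (Suc k) \<longleftrightarrow> extc {..<Suc k} X"
    using le diag_Suc[OF X] unfolding lifting_ext_def by simp
qed

lemma Sq_n_ext:
  "Sq f g t b \<in> n_ext C (Suc (Suc k)) \<longleftrightarrow> arrow_square (Arr k) f g t b \<and> f \<in> n_ext C (Suc k) \<and> g \<in> n_ext C (Suc k) \<and>
     double_extension (Ext k) (n_ext C (Suc k)) f g t b"
  by (auto simp: Ext_cat_def full_sub_def Arr_Suc_simps)

text \<open>The comparison map to the pullback of the square has the local lifting property at \<open>S\<close> exactly when
  the map of cubes has it at \<open>S\<close>; this is why double extensions are the maps with local lifts everywhere.\<close>

lemma lifting_ext_Suc: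
  assumes c: "cubical k" and le: "lifting_ext k"
  shows "lifting_ext (Suc k)"
  unfolding lifting_ext_def
proof (intro allI impI)
  let ?P = "Pow {..<k}" and ?Q = "Pow (insert k {..<k})"
  fix X Y f assume a: "diag (Pow {..<Suc k}) X \<and> diag (Pow {..<Suc k}) Y \<and> nat_tr (Pow {..<Suc k}) X Y f"
  then have X: "diag (Pow {..<Suc k}) X" and Y: "diag (Pow {..<Suc k}) Y" and f: "nat_tr (Pow {..<Suc k}) X Y f" by simp_all
  note X' = diag_Suc[OF X] and Y' = diag_Suc[OF Y] and f' = nat_Suc[OF f]
  note XQ = X[unfolded Pow_Suc_iff] and YQ = Y[unfolded Pow_Suc_iff] and fQ = f[unfolded Pow_Suc_iff]
  let ?f1 = "\<lambda>S. f (insert k S)"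
  note cS = cubical_Suc[OF le]
  obtain R p q where R: "pb ?P (up k X) Y (up k Y) ?f1 (dir k Y) R p q"
    using pb_exists[OF X'(2) Y'(1) Y'(2) f'(2) Y'(3)] by (elim exE)
  have "\<exists>u. nat_tr ?P X R u \<and> (\<forall>S\<in>?P. p S \<odot> u S = dir k X S \<and> q S \<odot> u S = f S)"
    by (rule pb_induced[OF R X'(1) X'(3) f'(1)]) (simp add: f'(3))
  then obtain u where u: "nat_tr ?P X R u" and ue: "\<forall>S\<in>?P. p S \<odot> u S = dir k X S \<and> q S \<odot> u S = f S" by (elim exE conjE)
  have bot: "lifts ?Q X Y f S \<longleftrightarrow> lifts ?P X R u S" if "S \<in> ?P" for S
    by (rule lifting_bot(1)[OF notin_lessThan XQ YQ fQ R u]) (use ue that in simp_all)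
  note top = rx_lifting(1)[OF iso_idx_insert[OF notin_lessThan], of _ k X Y f]
  have Yx: "extc {..<Suc k} Y \<longleftrightarrow> extc {..<k} (up k Y) \<and> emap ?P Y (up k Y) (dir k Y)"
    unfolding lessThan_Suc extc_insert[OF notin_lessThan] using YQ by simp
  have tom: "tomor (Suc k) X Y f = Sq (toarr (Suc k) X) (toarr (Suc k) Y) (tomor k X Y f) (tomor k (up k X) (up k Y) ?f1)"
    by simp
  have asq: "arrow_square (Arr k) (toarr (Suc k) X) (toarr (Suc k) Y) (tomor k X Y f) (tomor k (up k X) (up k Y) ?f1)"
    using tomor_hom[OF X Y f] unfolding tom in_hom_def by (simp add: Arr_Suc_simps del: toarr.simps)
  show "tomor (Suc k) X Y f \<in> n_ext C (Suc (Suc k)) \<longleftrightarrow> extc {..<Suc k} Y \<and> emap (Pow {..<Suc k}) X Y f"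
  proof
    assume "tomor (Suc k) X Y f \<in> n_ext C (Suc (Suc k))"
    then have Yn: "toarr (Suc k) Y \<in> n_ext C (Suc k)"
      and D: "double_extension (Ext k) (n_ext C (Suc k)) (tomor k X (up k X) (dir k X)) (tomor k Y (up k Y) (dir k Y))
        (tomor k X Y f) (tomor k (up k X) (up k Y) ?f1)"
      unfolding tom Sq_n_ext by simp_all
    have Ye: "extc {..<Suc k} Y" using cS Y Yn unfolding cubical_def by blast
    note DD = double_extensionD[OF c le X'(1,2) Y'(1,2) X'(3) Y'(3) f'(1,2) D R u ue]
    have "lifts ?Q X Y f S" if S: "S \<in> ?Q" for S
    proof (cases "k \<in> S")
      case False
      then have "S \<in> ?P" using S by auto
      then show ?thesis using bot emap_lifts[OF DD(1)] by simp
    next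
      case True
      then have S': "S - {k} \<in> ?P" "insert k (S - {k}) = S" using S by auto
      show ?thesis using top[OF S'(1)] emap_lifts[OF DD(2) S'(1)] unfolding S'(2) by simp
    qed
    then have "emap ?Q X Y f" by (rule emapI[OF XQ YQ fQ])
    then show "extc {..<Suc k} Y \<and> emap (Pow {..<Suc k}) X Y f" using Ye unfolding Pow_Suc_iff by simp
  next
    assume a: "extc {..<Suc k} Y \<and> emap (Pow {..<Suc k}) X Y f"
    then have Ye: "extc {..<Suc k} Y" and fe: "emap ?Q X Y f" unfolding Pow_Suc_iff by simp_all
    have Xe: "extc {..<Suc k} X" using extc_dom[of "{..<Suc k}" X Y f] a by simp
    have uY: "extc {..<k} (up k Y)" and dY: "emap ?P Y (up k Y) (dir k Y)" using Ye Yx by simp_all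
    have dX: "emap ?P X (up k X) (dir k X)"
      using Xe unfolding lessThan_Suc extc_insert[OF notin_lessThan] by simp
    have f1: "emap ?P (up k X) (up k Y) ?f1"
      using rx_emap[OF iso_idx_insert[OF notin_lessThan] fe] .
    have uE: "emap ?P X R u"
      by (rule emapI[OF X'(1) pb_diag[OF R] u]) (use bot emap_lifts[OF fe] in auto)
    have qE: "emap ?P R Y q" using pb_emap[OF R f1 Y'(1) Y'(3)] .
    have fE: "emap ?P X Y f"
      by (rule agree_emap[OF agree_refl agree_refl _ emap_comp[OF uE qE]]) (use ue in simp)
    have D: "double_extension (Ext k) (n_ext C (Suc k)) (tomor k X (up k X) (dir k X)) (tomor k Y (up k Y) (dir k Y))
        (tomor k X Y f) (tomor k (up k X) (up k Y) ?f1)"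
      by (rule double_extensionI[OF c le uY dX dY fE f1 R uE ue])
    show "tomor (Suc k) X Y f \<in> n_ext C (Suc (Suc k))"
      unfolding tom Sq_n_ext using asq D cubicalD[OF cS Xe] cubicalD[OF cS Ye] by simp
  qed
qed

theorem cubical_all: "cubical k" and lifting_ext_all: "lifting_ext k"
proof -
  have "cubical k \<and> lifting_ext k"
  proof (induction k)
    case 0
    show ?case using cubical_0 lifting_ext_0 by simp
  next
    case (Suc k)
    then show ?case using cubical_Suc lifting_ext_Suc by simp
  qed
  then show "cubical k" "lifting_ext k" by simp_all
qed

end

section \<open>A tower of Galois structures as coverings of cubes\<close>

context galois_structure
begin

lemma sub_simps:
  "Dom (galois.sub \<Gamma>) = Dom (ambient \<Gamma>)" "Cod (galois.sub \<Gamma>) = Cod (ambient \<Gamma>)"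
  "Comp (galois.sub \<Gamma>) = Comp (ambient \<Gamma>)" "Obj (galois.sub \<Gamma>) \<subseteq> Obj (ambient \<Gamma>)"
  and in_hom_sub: "in_hom (galois.sub \<Gamma>) m a b \<Longrightarrow> in_hom (ambient \<Gamma>) m a b"
proof -
  let ?S = "galois.sub \<Gamma>"
  have e: "?S = full_sub (ambient \<Gamma>) (Obj ?S)" and o: "Obj ?S \<subseteq> Obj (ambient \<Gamma>)"
    using sub unfolding full_replete_subcategory_def by simp_all
  show "Dom ?S = Dom (ambient \<Gamma>)" "Cod ?S = Cod (ambient \<Gamma>)" "Comp ?S = Comp (ambient \<Gamma>)" "Obj ?S \<subseteq> Obj (ambient \<Gamma>)"
    by (subst e, simp add: full_sub_def | rule o)+
  have m: "m \<in> Mor ?S \<longleftrightarrow> m \<in> Mor (ambient \<Gamma>) \<and> Dom (ambient \<Gamma>) m \<in> Obj ?S \<and> Cod (ambient \<Gamma>) m \<in> Obj ?S" for m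
    by (subst e, simp add: full_sub_def)
  have d: "Dom ?S = Dom (ambient \<Gamma>)" "Cod ?S = Cod (ambient \<Gamma>)" by (subst e, simp add: full_sub_def)+
  show "in_hom ?S m a b \<Longrightarrow> in_hom (ambient \<Gamma>) m a b" unfolding in_hom_def m d by simp
qed

lemma refl_Obj: "a \<in> Obj (ambient \<Gamma>) \<Longrightarrow> omap (refl \<Gamma>) a \<in> Obj (galois.sub \<Gamma>)"
  and refl_hom: "in_hom (ambient \<Gamma>) m a b \<Longrightarrow> in_hom (galois.sub \<Gamma>) (amap (refl \<Gamma>) m) (omap (refl \<Gamma>) a) (omap (refl \<Gamma>) b)"
  and unit_hom: "a \<in> Obj (ambient \<Gamma>) \<Longrightarrow> in_hom (ambient \<Gamma>) (unit \<Gamma> a) a (omap (refl \<Gamma>) a)"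
  and unit_natural: "in_hom (ambient \<Gamma>) m a b \<Longrightarrow> amap (refl \<Gamma>) m \<cdot>\<^bsub>ambient \<Gamma>\<^esub> unit \<Gamma> a = unit \<Gamma> b \<cdot>\<^bsub>ambient \<Gamma>\<^esub> m"
  and counit_hom: "b \<in> Obj (galois.sub \<Gamma>) \<Longrightarrow> in_hom (galois.sub \<Gamma>) (counit \<Gamma> b) (omap (refl \<Gamma>) b) b"
  and counit_unit: "b \<in> Obj (galois.sub \<Gamma>) \<Longrightarrow> counit \<Gamma> b \<cdot>\<^bsub>ambient \<Gamma>\<^esub> unit \<Gamma> b = Id (ambient \<Gamma>) b"
  using adjunction unfolding adjunction_def is_functor_def natural_def id_functor_def comp_functor_def in_hom_def
  by auto

text \<open>The factorisation is the reflection of \<open>m\<close> followed by the counit.\<close>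

lemma unit_universal:
  assumes m: "in_hom (ambient \<Gamma>) m a z" and z: "z \<in> Obj (galois.sub \<Gamma>)"
  shows "\<exists>g. in_hom (ambient \<Gamma>) g (omap (refl \<Gamma>) a) z \<and> g \<cdot>\<^bsub>ambient \<Gamma>\<^esub> unit \<Gamma> a = m"
proof -
  let ?A = "ambient \<Gamma>"
  interpret A: category ?A by (rule category)
  have a: "a \<in> Obj ?A" and zA: "z \<in> Obj ?A" using m A.Dom_in z sub_simps(4) by (auto simp: in_hom_def)
  have L: "in_hom ?A (amap (refl \<Gamma>) m) (omap (refl \<Gamma>) a) (omap (refl \<Gamma>) z)" using in_hom_sub[OF refl_hom[OF m]] .
  have E: "in_hom ?A (counit \<Gamma> z) (omap (refl \<Gamma>) z) z" using in_hom_sub[OF counit_hom[OF z]] .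
  have "(counit \<Gamma> z \<cdot>\<^bsub>?A\<^esub> amap (refl \<Gamma>) m) \<cdot>\<^bsub>?A\<^esub> unit \<Gamma> a = counit \<Gamma> z \<cdot>\<^bsub>?A\<^esub> (amap (refl \<Gamma>) m \<cdot>\<^bsub>?A\<^esub> unit \<Gamma> a)"
    by (rule A.Comp_assoc[OF unit_hom[OF a] L E])
  also have "\<dots> = (counit \<Gamma> z \<cdot>\<^bsub>?A\<^esub> unit \<Gamma> z) \<cdot>\<^bsub>?A\<^esub> m"
    unfolding unit_natural[OF m] using A.Comp_assoc[OF m unit_hom[OF zA] E] by simp
  also have "\<dots> = m" using counit_unit[OF z] A.Id_Comp[OF m] by simp
  finally show ?thesis using A.Comp_in_hom[OF L E] by (intro exI conjI)
qed

end

locale regular_tower = regular_cat C + tower C \<Gamma>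
  for C :: "('o, 'a) cat" and \<Gamma> :: "nat \<Rightarrow> (('o, 'a) iarr, ('o, 'a) iarr) galois"
begin

definition base_cube where
  "base_cube k X \<longleftrightarrow> extc {..<k} X \<and> toarr k X \<in> Obj (galois.sub (\<Gamma> k))"

definition refl_cube where
  "refl_cube k X = edge C k (omap (refl (\<Gamma> k)) (toarr k X))"

definition unit_cube where
  "unit_cube k X = component k (unit (\<Gamma> k) (toarr k X))"

lemma toarr_edge_agree:
  assumes X: "diag (Pow {..<k}) X"
  shows "agree (Pow {..<k}) X (edge C k (toarr k X))"
  unfolding agree_def
proof (intro ballI impI)
  fix S T assume "S \<in> Pow {..<k}" "T \<in> Pow {..<k}" "S \<subseteq> T"
  moreover from this have "S \<inter> {..<k} = S" "T \<inter> {..<k} = T" by auto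
  ultimately show "X S T = edge C k (toarr k X) S T" using edge_toarr[OF X, of S T] by simp
qed

lemma edge_diag: "a \<in> Obj (Arr k) \<Longrightarrow> diag (Pow {..<k}) (edge C k a)"
  and toarr_edge: "a \<in> Obj (Arr k) \<Longrightarrow> toarr k (edge C k a) = a"
proof -
  assume "a \<in> Obj (Arr k)"
  from toarr_ex[OF this] obtain X where X: "diag (Pow {..<k}) X" "a = toarr k X" by (elim exE conjE)
  show "diag (Pow {..<k}) (edge C k a)" unfolding X(2) using agree_diag[OF toarr_edge_agree[OF X(1)] X(1)] .
  show "toarr k (edge C k a) = a" unfolding X(2) using toarr_cong[OF toarr_edge_agree[OF X(1)]] by simp
qed

text \<open>The components of a morphism recover the map of cubes from which it comes.\<close>

lemma tomor_component:
  assumes "in_hom (Ext k) m (toarr k X) (toarr k Y)" "extc {..<k} X" "extc {..<k} Y"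
  shows "nat_tr (Pow {..<k}) X Y (component k m)" "m = tomor k X Y (component k m)"
proof -
  obtain f where f: "nat_tr (Pow {..<k}) X Y f" "m = tomor k X Y f"
    using Ext_hom(2)[OF cubical_all assms(2,3,1)] by (elim exE conjE)
  have e: "f S = component k m S" if "S \<in> Pow {..<k}" for S
  proof -
    have "S \<inter> {..<k} = S" using that by auto
    then show ?thesis unfolding f(2) component_tomor by simp
  qed
  show "nat_tr (Pow {..<k}) X Y (component k m)" by (rule agree_nat[OF agree_refl agree_refl e f(1)])
  have "tomor k X Y f = tomor k X Y (component k m)" by (rule tomor_cong[OF agree_refl agree_refl e])
  then show "m = tomor k X Y (component k m)" unfolding f(2) .
qed

lemma galois_level: "galois_structure (\<Gamma> k)"
  by (rule galois)

lemma sub_Ext: "Obj (galois.sub (\<Gamma> k)) \<subseteq> n_ext C k"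
  using galois_structure.sub_simps(4)[OF galois_level[of k]] unfolding ambient Obj_Ext .

lemma toarr_Obj_Ext: "extc {..<k} X \<Longrightarrow> toarr k X \<in> Obj (ambient (\<Gamma> k))"
  unfolding ambient Obj_Ext using cubicalD[OF cubical_all] .

lemma toarr_refl_cube:
  assumes X: "extc {..<k} X"
  shows "toarr k (refl_cube k X) = omap (refl (\<Gamma> k)) (toarr k X)" "extc {..<k} (refl_cube k X)" "base_cube k (refl_cube k X)"
proof -
  have o: "omap (refl (\<Gamma> k)) (toarr k X) \<in> Obj (galois.sub (\<Gamma> k))"
    using galois_structure.refl_Obj[OF galois_level toarr_Obj_Ext[OF X]] .
  then have oe: "omap (refl (\<Gamma> k)) (toarr k X) \<in> n_ext C k" using sub_Ext by (simp add: subset_iff)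
  then have oa: "omap (refl (\<Gamma> k)) (toarr k X) \<in> Obj (Arr k)" using n_ext_Obj by (simp add: subset_iff)
  show e: "toarr k (refl_cube k X) = omap (refl (\<Gamma> k)) (toarr k X)" unfolding refl_cube_def using toarr_edge[OF oa] .
  have "diag (Pow {..<k}) (refl_cube k X)" unfolding refl_cube_def using edge_diag[OF oa] .
  then show x: "extc {..<k} (refl_cube k X)" using cubical_all[of k] oe unfolding cubical_def e[symmetric] by simp
  then show "base_cube k (refl_cube k X)" unfolding base_cube_def e using o by simp
qed

lemma unit_cube:
  assumes X: "extc {..<k} X"
  shows "emap (Pow {..<k}) X (refl_cube k X) (unit_cube k X)" "unit (\<Gamma> k) (toarr k X) = tomor k X (refl_cube k X) (unit_cube k X)"
proof -
  note F = toarr_refl_cube[OF X]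
  have "in_hom (Ext k) (unit (\<Gamma> k) (toarr k X)) (toarr k X) (toarr k (refl_cube k X))"
    using galois_structure.unit_hom[OF galois_level toarr_Obj_Ext[OF X]] unfolding F(1) ambient .
  note t = tomor_component[OF this X F(2)]
  show e: "unit (\<Gamma> k) (toarr k X) = tomor k X (refl_cube k X) (unit_cube k X)" unfolding unit_cube_def using t(2) .
  have n: "nat_tr (Pow {..<k}) X (refl_cube k X) (unit_cube k X)" unfolding unit_cube_def using t(1) .
  have "tomor k X (refl_cube k X) (unit_cube k X) \<in> n_ext C (Suc k)"
    using galois_structure.unit_ext[OF galois_level toarr_Obj_Ext[OF X]] unfolding exts e .
  then show "emap (Pow {..<k}) X (refl_cube k X) (unit_cube k X)"
    by (rule lifting_extD(2)[OF lifting_ext_all _ extc_diag[OF X] extc_diag[OF F(2)] n])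
qed

text \<open>A map between the reflections is determined by its composite with the unit, which is vertexwise epic.\<close>

lemma refl_tomor:
  assumes X: "extc {..<k} X" and Y: "extc {..<k} Y" and f: "nat_tr (Pow {..<k}) X Y f"
    and g: "nat_tr (Pow {..<k}) (refl_cube k X) (refl_cube k Y) g" and sq: "\<forall>S\<in>Pow {..<k}. g S \<odot> unit_cube k X S = unit_cube k Y S \<odot> f S"
  shows "amap (refl (\<Gamma> k)) (tomor k X Y f) = tomor k (refl_cube k X) (refl_cube k Y) g"
proof -
  let ?P = "Pow {..<k}"
  note FX = toarr_refl_cube[OF X] and FY = toarr_refl_cube[OF Y]
  have hm: "in_hom (ambient (\<Gamma> k)) (tomor k X Y f) (toarr k X) (toarr k Y)"
    unfolding ambient using Ext_hom(1)[OF cubical_all X Y f] .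
  have "in_hom (Ext k) (amap (refl (\<Gamma> k)) (tomor k X Y f)) (toarr k (refl_cube k X)) (toarr k (refl_cube k Y))"
    using galois_structure.in_hom_sub[OF galois_level galois_structure.refl_hom[OF galois_level hm]] unfolding ambient FX(1) FY(1) .
  note t = tomor_component[OF this FX(2) FY(2)]
  let ?h = "component k (amap (refl (\<Gamma> k)) (tomor k X Y f))"
  have "amap (refl (\<Gamma> k)) (tomor k X Y f) \<cdot>\<^bsub>Ext k\<^esub> unit (\<Gamma> k) (toarr k X) = unit (\<Gamma> k) (toarr k Y) \<cdot>\<^bsub>Ext k\<^esub> tomor k X Y f"
    using galois_structure.unit_natural[OF galois_level hm] unfolding ambient .
  then have "tomor k (refl_cube k X) (refl_cube k Y) ?h \<cdot>\<^bsub>Arr k\<^esub> tomor k X (refl_cube k X) (unit_cube k X) = tomor k Y (refl_cube k Y) (unit_cube k Y) \<cdot>\<^bsub>Arr k\<^esub> tomor k X Y f"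
    unfolding t(2)[symmetric] unit_cube(2)[OF X] unit_cube(2)[OF Y] Ext_simps .
  then have e: "\<forall>S\<in>?P. ?h S \<odot> unit_cube k X S = unit_cube k Y S \<odot> f S"
    unfolding tomor_comp[OF emap_nat[OF unit_cube(1)[OF X]] t(1)] tomor_comp[OF f emap_nat[OF unit_cube(1)[OF Y]]] tomor_eq_iff .
  have "?h S = g S" if S: "S \<in> ?P" for S
  proof (rule cover_epi[OF emap_cover[OF _ unit_cube(1)[OF X] S] nat_hom[OF t(1) S] nat_hom[OF g S]])
    show "?h S \<odot> unit_cube k X S = g S \<odot> unit_cube k X S" using bspec[OF e S] bspec[OF sq S] by simp
  qed simp
  then have "tomor k (refl_cube k X) (refl_cube k Y) ?h = tomor k (refl_cube k X) (refl_cube k Y) g" unfolding tomor_eq_iff by simp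
  then show ?thesis unfolding t(2)[symmetric] .
qed

lemma refl_cube_univ:
  assumes X: "extc {..<k} X" and Z: "base_cube k Z" and h: "nat_tr (Pow {..<k}) X Z h"
  shows "\<exists>g. nat_tr (Pow {..<k}) (refl_cube k X) Z g \<and> (\<forall>S\<in>Pow {..<k}. g S \<odot> unit_cube k X S = h S)"
proof -
  have Ze: "extc {..<k} Z" and Zs: "toarr k Z \<in> Obj (galois.sub (\<Gamma> k))" using Z unfolding base_cube_def by simp_all
  note FX = toarr_refl_cube[OF X]
  have "in_hom (ambient (\<Gamma> k)) (tomor k X Z h) (toarr k X) (toarr k Z)"
    unfolding ambient using Ext_hom(1)[OF cubical_all X Ze h] .
  from galois_structure.unit_universal[OF galois_level this Zs] obtain m where
    m: "in_hom (Ext k) m (toarr k (refl_cube k X)) (toarr k Z)" "m \<cdot>\<^bsub>Ext k\<^esub> unit (\<Gamma> k) (toarr k X) = tomor k X Z h"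
    unfolding ambient FX(1) by (elim exE conjE)
  obtain g where g: "nat_tr (Pow {..<k}) (refl_cube k X) Z g" "m = tomor k (refl_cube k X) Z g"
    using Ext_hom(2)[OF cubical_all FX(2) Ze m(1)] by (elim exE conjE)
  have "\<forall>S\<in>Pow {..<k}. g S \<odot> unit_cube k X S = h S"
    using m(2) unfolding g(2) unit_cube(2)[OF X] Ext_simps tomor_comp[OF emap_nat[OF unit_cube(1)[OF X]] g(1)] tomor_eq_iff .
  then show ?thesis using g(1) by (intro exI[of _ g]) simp
qed

lemma base_cube_iso:
  assumes X: "base_cube k X" and f: "bij (Pow {..<k}) X Y f" and Y: "diag (Pow {..<k}) Y"
  shows "base_cube k Y"
proof -
  have Xe: "extc {..<k} X" and Xs: "toarr k X \<in> Obj (galois.sub (\<Gamma> k))" using X unfolding base_cube_def by simp_all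
  have Ye: "extc {..<k} Y" by (rule extc_cod[OF _ bij_emap[OF f extc_diag[OF Xe] Y] Xe]) simp
  obtain g where g: "nat_tr (Pow {..<k}) Y X g"
    and ge: "\<forall>S\<in>Pow {..<k}. g S \<odot> f S = Id (tagged C) (V X S) \<and> f S \<odot> g S = Id (tagged C) (V Y S)"
    using bij_inverse[OF extc_diag[OF Xe] Y f] by (elim exE conjE)
  note hf = Ext_hom(1)[OF cubical_all Xe Ye bij_nat[OF f]] and hg = Ext_hom(1)[OF cubical_all Ye Xe g]
  have "iso (Ext k) (tomor k X Y f)"
    unfolding iso_def
  proof (intro conjI exI)
    show "tomor k X Y f \<in> Mor (Ext k)" using hf by (simp add: in_hom_def)
    show "in_hom (Ext k) (tomor k Y X g) (Cod (Ext k) (tomor k X Y f)) (Dom (Ext k) (tomor k X Y f))"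
      using hf hg by (simp add: in_hom_def)
    have "Dom (Arr k) (tomor k X Y f) = toarr k X" "Cod (Arr k) (tomor k X Y f) = toarr k Y"
      using hf by (simp_all add: in_hom_def Ext_simps)
    then show "tomor k Y X g \<cdot>\<^bsub>Ext k\<^esub> tomor k X Y f = Id (Ext k) (Dom (Ext k) (tomor k X Y f))"
      "tomor k X Y f \<cdot>\<^bsub>Ext k\<^esub> tomor k Y X g = Id (Ext k) (Cod (Ext k) (tomor k X Y f))"
      unfolding Ext_simps tomor_comp[OF bij_nat[OF f] g] tomor_comp[OF g bij_nat[OF f]]
      using Id_toarr[OF extc_diag[OF Xe]] Id_toarr[OF Y] ge by (simp_all add: tomor_eq_iff)
  qed
  moreover have "Dom (Ext k) (tomor k X Y f) = toarr k X" "Cod (Ext k) (tomor k X Y f) = toarr k Y"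
    using hf by (simp_all add: in_hom_def)
  ultimately have "toarr k Y \<in> Obj (galois.sub (\<Gamma> k))"
    using galois_structure.sub[OF galois_level[of k], unfolded full_replete_subcategory_def ambient, THEN conjunct2, THEN conjunct2,
        rule_format, of "tomor k X Y f"] Xs by simp
  then show ?thesis unfolding base_cube_def using Ye by simp
qed

text \<open>The strong Birkhoff property states this for one pullback of the reflection square; \<open>double_extensionD\<close>
  extends it to all vertexwise pullbacks.\<close>

lemma birkhoff_cubes:
  assumes f: "emap (Pow {..<k}) X Y f" and Y: "extc {..<k} Y" and g: "nat_tr (Pow {..<k}) (refl_cube k X) (refl_cube k Y) g"
    and sq: "\<forall>S\<in>Pow {..<k}. g S \<odot> unit_cube k X S = unit_cube k Y S \<odot> f S"
    and R: "pb (Pow {..<k}) Y (refl_cube k X) (refl_cube k Y) (unit_cube k Y) g R p q" and u: "nat_tr (Pow {..<k}) X R u"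
    and eq: "\<forall>S\<in>Pow {..<k}. p S \<odot> u S = f S \<and> q S \<odot> u S = unit_cube k X S"
  shows "emap (Pow {..<k}) X R u"
proof -
  have X: "extc {..<k} X" using extc_dom[OF f Y] .
  note FX = toarr_refl_cube[OF X] and FY = toarr_refl_cube[OF Y]
  have m: "tomor k X Y f \<in> galois.exts (\<Gamma> k)" unfolding exts using lifting_extI[OF lifting_ext_all Y f] .
  have d: "Dom (Ext k) (tomor k X Y f) = toarr k X" "Cod (Ext k) (tomor k X Y f) = toarr k Y"
    using Ext_hom(1)[OF cubical_all X Y emap_nat[OF f]] by (simp_all add: in_hom_def)
  have "double_extension (Ext k) (n_ext C (Suc k)) (tomor k X Y f) (amap (refl (\<Gamma> k)) (tomor k X Y f))
       (unit (\<Gamma> k) (toarr k X)) (unit (\<Gamma> k) (toarr k Y))"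
    using birkhoff[of k] m unfolding strongly_birkhoff_def ambient exts d[symmetric] by blast
  then have "double_extension (Ext k) (n_ext C (Suc k)) (tomor k X Y f) (tomor k (refl_cube k X) (refl_cube k Y) g)
       (tomor k X (refl_cube k X) (unit_cube k X)) (tomor k Y (refl_cube k Y) (unit_cube k Y))"
    unfolding refl_tomor[OF X Y emap_nat[OF f] g sq] unit_cube(2)[OF X] unit_cube(2)[OF Y] .
  from double_extensionD(1)[OF cubical_all lifting_ext_all extc_diag[OF X] extc_diag[OF Y] extc_diag[OF FX(2)] extc_diag[OF FY(2)]
      emap_nat[OF f] g emap_nat[OF unit_cube(1)[OF X]] emap_nat[OF unit_cube(1)[OF Y]] this R u eq]
  show ?thesis .
qed

end

sublocale regular_tower \<subseteq> cubes: cube_galois "tagged C" "Ob undefined" base_cube refl_cube unit_cube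
proof unfold_locales
  fix k :: nat and X Y Z R f g h p q u
  show "base_cube k X \<Longrightarrow> extc {..<k} X" by (simp add: base_cube_def)
  show "base_cube k X \<Longrightarrow> bij (Pow {..<k}) X Y f \<Longrightarrow> diag (Pow {..<k}) Y \<Longrightarrow> base_cube k Y" by (rule base_cube_iso)
  show "extc {..<k} X \<Longrightarrow> base_cube k (refl_cube k X)" by (rule toarr_refl_cube)
  show "extc {..<k} X \<Longrightarrow> emap (Pow {..<k}) X (refl_cube k X) (unit_cube k X)" by (rule unit_cube)
  show "extc {..<k} X \<Longrightarrow> base_cube k Z \<Longrightarrow> nat_tr (Pow {..<k}) X Z h \<Longrightarrow>
       \<exists>g. nat_tr (Pow {..<k}) (refl_cube k X) Z g \<and> (\<forall>S\<in>Pow {..<k}. g S \<odot> unit_cube k X S = h S)" by (rule refl_cube_univ)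
  show "emap (Pow {..<k}) X Y f \<Longrightarrow> extc {..<k} Y \<Longrightarrow> nat_tr (Pow {..<k}) (refl_cube k X) (refl_cube k Y) g \<Longrightarrow>
       (\<forall>S\<in>Pow {..<k}. g S \<odot> unit_cube k X S = unit_cube k Y S \<odot> f S) \<Longrightarrow>
       pb (Pow {..<k}) Y (refl_cube k X) (refl_cube k Y) (unit_cube k Y) g R p q \<Longrightarrow> nat_tr (Pow {..<k}) X R u \<Longrightarrow>
       (\<forall>S\<in>Pow {..<k}. p S \<odot> u S = f S \<and> q S \<odot> u S = unit_cube k X S) \<Longrightarrow> emap (Pow {..<k}) X R u"
    by (rule birkhoff_cubes)
qed

context regular_tower
begin

lemma trivial_covering_iff:
  assumes X: "extc {..<k} X" and Y: "extc {..<k} Y" and f: "nat_tr (Pow {..<k}) X Y f"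
  shows "trivial_covering (\<Gamma> k) (tomor k X Y f) \<longleftrightarrow> cubes.triv k X Y f"
proof -
  let ?P = "Pow {..<k}"
  note FX = toarr_refl_cube[OF X] and FY = toarr_refl_cube[OF Y]
  have d: "Dom (Ext k) (tomor k X Y f) = toarr k X" "Cod (Ext k) (tomor k X Y f) = toarr k Y"
    using Ext_hom(1)[OF cubical_all X Y f] by (simp_all add: in_hom_def)
  note nX = emap_nat[OF unit_cube(1)[OF X]] and nY = emap_nat[OF unit_cube(1)[OF Y]]
  have mem: "tomor k X Y f \<in> n_ext C (Suc k) \<longleftrightarrow> emap ?P X Y f"
    using lifting_extI[OF lifting_ext_all Y] lifting_extD(2)[OF lifting_ext_all _ extc_diag[OF X] extc_diag[OF Y] f] by blast
  show ?thesis
  proof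
    assume "trivial_covering (\<Gamma> k) (tomor k X Y f)"
    then have "tomor k X Y f \<in> n_ext C (Suc k)"
      and P: "is_pullback (Ext k) (unit (\<Gamma> k) (toarr k Y)) (amap (refl (\<Gamma> k)) (tomor k X Y f)) (tomor k X Y f) (unit (\<Gamma> k) (toarr k X))"
      unfolding trivial_covering_def exts ambient d by simp_all
    then have fe: "emap ?P X Y f" using mem by simp
    obtain g where g: "nat_tr ?P (refl_cube k X) (refl_cube k Y) g" "\<And>S. S \<in> ?P \<Longrightarrow> g S \<odot> unit_cube k X S = unit_cube k Y S \<odot> f S"
      by (rule cubes.F_map[OF X Y f], rule that, assumption, simp)
    have sq: "\<forall>S\<in>?P. g S \<odot> unit_cube k X S = unit_cube k Y S \<odot> f S" using g(2) by simp
    have ge: "emap ?P (refl_cube k X) (refl_cube k Y) g" by (rule cubes.F_map_emap[OF fe Y g])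
    have "pb ?P Y (refl_cube k X) (refl_cube k Y) (unit_cube k Y) g X f (unit_cube k X)"
      by (rule Ext_pullbackD[OF cubical_all Y FX(2) FY(2) X nY ge f nX
        P[unfolded refl_tomor[OF X Y f g(1) sq] unit_cube(2)[OF X] unit_cube(2)[OF Y]]])
    then show "cubes.triv k X Y f"
      unfolding cubes.triv_def using fe Y g(1) sq by (intro conjI exI[of _ g]) simp_all
  next
    assume "cubes.triv k X Y f"
    then obtain g where fe: "emap ?P X Y f" and g: "nat_tr ?P (refl_cube k X) (refl_cube k Y) g"
      and sq: "\<forall>S\<in>?P. g S \<odot> unit_cube k X S = unit_cube k Y S \<odot> f S"
      and P: "pb ?P Y (refl_cube k X) (refl_cube k Y) (unit_cube k Y) g X f (unit_cube k X)"
      unfolding cubes.triv_def by (elim conjE exE)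
    have "is_pullback (Ext k) (tomor k Y (refl_cube k Y) (unit_cube k Y)) (tomor k (refl_cube k X) (refl_cube k Y) g) (tomor k X Y f) (tomor k X (refl_cube k X) (unit_cube k X))"
      by (rule Ext_pullbackI[OF cubical_all Y FX(2) FY(2) X nY g P])
    then show "trivial_covering (\<Gamma> k) (tomor k X Y f)"
      unfolding trivial_covering_def exts ambient d refl_tomor[OF X Y f g sq] unit_cube(2)[OF X] unit_cube(2)[OF Y]
      using mem fe by simp
  qed
qed

text \<open>The objects and morphisms that witness a covering are replaced by the cubes that they come from, and
  pullbacks by vertexwise ones.\<close>

lemma covering_iff:
  assumes Y: "extc {..<k} Y" and f: "emap (Pow {..<k}) X Y f"
  shows "covering (\<Gamma> k) (tomor k X Y f) \<longleftrightarrow> cubes.cube_covering k X Y f"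
proof -
  let ?P = "Pow {..<k}"
  have X: "extc {..<k} X" using extc_dom[OF f Y] .
  note fn = emap_nat[OF f]
  note hf = Ext_hom(1)[OF cubical_all X Y fn]
  show ?thesis
  proof
    assume "covering (\<Gamma> k) (tomor k X Y f)"
    then obtain e p q where e: "e \<in> n_ext C (Suc k)" and P: "is_pullback (Ext k) e (tomor k X Y f) p q"
      and t: "trivial_covering (\<Gamma> k) p"
      unfolding covering_def exts ambient by (elim conjE exE bexE)
    let ?Q = "Dom (Ext k) e" and ?R = "Dom (Ext k) p"
    have he: "in_hom (Ext k) e ?Q (toarr k Y)" and hp: "in_hom (Ext k) p ?R ?Q" and hq: "in_hom (Ext k) q ?R (toarr k X)"
      using P hf unfolding is_pullback_def in_hom_def by simp_all
    have "?Q \<in> n_ext C k" "?R \<in> n_ext C k" using he hp unfolding in_hom_Ext by simp_all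
    from cubical_ex[OF cubical_all this(1)] cubical_ex[OF cubical_all this(2)]
    obtain Q R where Q: "extc {..<k} Q" "?Q = toarr k Q" and R: "extc {..<k} R" "?R = toarr k R" by (elim exE conjE)
    from Ext_hom(2)[OF cubical_all Q(1) Y he[unfolded Q(2)]] Ext_hom(2)[OF cubical_all R(1) Q(1) hp[unfolded Q(2) R(2)]]
      Ext_hom(2)[OF cubical_all R(1) X hq[unfolded R(2)]]
    obtain e' p' q' where e': "nat_tr ?P Q Y e'" "e = tomor k Q Y e'" and p': "nat_tr ?P R Q p'" "p = tomor k R Q p'"
      and q': "nat_tr ?P R X q'" "q = tomor k R X q'" by (elim exE conjE)
    have eE: "emap ?P Q Y e'"
      using lifting_extD(2)[OF lifting_ext_all e[unfolded e'(2)] extc_diag[OF Q(1)] extc_diag[OF Y] e'(1)] .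
    have pbE: "pb ?P Q X Y e' f R p' q'"
      by (rule Ext_pullbackD[OF cubical_all Q(1) X Y R(1) e'(1) f p'(1) q'(1) P[unfolded e'(2) p'(2) q'(2)]])
    have tE: "cubes.triv k R Q p'" using t unfolding p'(2) trivial_covering_iff[OF R(1) Q(1) p'(1)] .
    show "cubes.cube_covering k X Y f"
      unfolding cubes.cube_covering_def
      by (rule exI, rule exI, rule exI, rule exI, rule exI, rule conjI, rule Q(1), rule conjI, rule eE,
        rule conjI, rule pb_sym[OF pbE], rule tE)
  next
    assume "cubes.cube_covering k X Y f"
    then obtain Q e R p q where Q: "extc {..<k} Q" and e: "emap ?P Q Y e" and P: "pb ?P X Q Y f e R p q" and t: "cubes.triv k R Q q"
      unfolding cubes.cube_covering_def by (elim exE conjE)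
    have q: "emap ?P R Q q" using pb_emap[OF P f extc_diag[OF Q] emap_nat[OF e]] .
    have R: "extc {..<k} R" using extc_dom[OF q Q] .
    have "is_pullback (Ext k) (tomor k Q Y e) (tomor k X Y f) (tomor k R Q q) (tomor k R X p)"
      by (rule Ext_pullbackI[OF cubical_all Q X Y R emap_nat[OF e] fn pb_sym[OF P]])
    moreover have "trivial_covering (\<Gamma> k) (tomor k R Q q)" using t unfolding trivial_covering_iff[OF R Q emap_nat[OF q]] .
    moreover have "tomor k X Y f \<in> n_ext C (Suc k)" "tomor k Q Y e \<in> n_ext C (Suc k)"
      using lifting_extI[OF lifting_ext_all Y f] lifting_extI[OF lifting_ext_all Y e] .
    ultimately show "covering (\<Gamma> k) (tomor k X Y f)"
      unfolding covering_def exts ambient by blast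
  qed
qed

lemma covering_toarr:
  assumes X: "extc {..<Suc k} X"
  shows "covering (\<Gamma> k) (toarr (Suc k) X) \<longleftrightarrow> cubes.cube_covering k X (up k X) (dir k X)"
  using covering_iff[of k "up k X" X "dir k X"] X unfolding lessThan_Suc extc_insert[OF notin_lessThan] by simp

lemma base_cube_Suc: "base_cube (Suc k) X \<longleftrightarrow> extc {..<Suc k} X \<and> covering (\<Gamma> k) (toarr (Suc k) X)"
  unfolding base_cube_def sub_Suc full_sub_def using cubicalD[OF cubical_all, of "Suc k" X] Obj_Ext[of "Suc k"] by auto

end

sublocale regular_tower \<subseteq> cubes: cube_tower "tagged C" "Ob undefined" base_cube refl_cube unit_cube
proof unfold_locales
  show "base_cube (Suc k) X \<longleftrightarrow> extc {..<Suc k} X \<and> cubes.cube_covering k X (up k X) (dir k X)" for k X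
    using base_cube_Suc covering_toarr by blast
qed

context regular_cat
begin

section \<open>Discrete fibrations\<close>

text \<open>A cone over the cube without its initial vertex is a family of compatible elements above that vertex, which
  is a lifting problem for the map to the terminal cube.\<close>

lemma limit_cube_iff_ulifts:
  assumes D: "diag (Pow {..<m}) D"
  shows "limit_cube C m (toarr m D) \<longleftrightarrow> ulifts (Pow {..<m}) D One (bang D) {}"
proof -
  let ?U = "Pow {..<m} - {{}}" and ?J = "full_sub (cube_cat m) (- {{}})"
  have ab: "above (Pow {..<m}) {} = ?U" by (auto simp: above_def)
  have v: "vertex C m (toarr m D) S = V D S" if "S \<subseteq> {..<m}" for S
    using vertex_toarr[OF D, of S] Int_absorb2[OF that] by simp
  have e: "edge C m (toarr m D) S T = D S T" if "S \<subseteq> T" "T \<subseteq> {..<m}" for S T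
    using edge_toarr[OF D that(1)] Int_absorb2[OF that(2)] Int_absorb2[OF subset_trans[OF that]] by simp
  have oJ: "Obj ?J = ?U" by (auto simp: full_sub_def cube_cat_def)
  have mJ: "Mor ?J = {(S, T). S \<in> ?U \<and> T \<in> ?U \<and> S \<subseteq> T}" by (auto simp: full_sub_def cube_cat_def)
  have dJ: "Dom ?J = fst" "Cod ?J = snd" by (simp_all add: full_sub_def cube_cat_def)
  have cone: "is_cone ?J (tagged C) (cube C m (toarr m D)) z x \<longleftrightarrow> fam D ?U z x" for z x
  proof -
    have h: "(\<forall>j\<in>Obj ?J. hom (x j) z (omap (cube C m (toarr m D)) j)) \<longleftrightarrow> (\<forall>S\<in>?U. hom (x S) z (V D S))"
      unfolding oJ cube_def using v by simp
    have c: "(\<forall>u\<in>Mor ?J. amap (cube C m (toarr m D)) u \<cdot>\<^bsub>tagged C\<^esub> x (Dom ?J u) = x (Cod ?J u)) \<longleftrightarrow>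
        (\<forall>S\<in>?U. \<forall>T\<in>?U. S \<subseteq> T \<longrightarrow> D S T \<cdot>\<^bsub>tagged C\<^esub> x S = x T)"
      unfolding mJ dJ cube_def using e by auto
    have d: "D S T \<cdot>\<^bsub>tagged C\<^esub> x S = D S T \<odot> x S" if "\<forall>S\<in>?U. hom (x S) z (V D S)" "S \<in> ?U" "T \<in> ?U" "S \<subseteq> T" for S T
    proof -
      have "S \<in> Pow {..<m}" "T \<in> Pow {..<m}" using that by simp_all
      then show ?thesis using cmp_eq_Comp[OF bspec[OF that(1,2)] diag_hom[OF D _ _ that(4)]] by simp
    qed
    have "(\<forall>S\<in>?U. hom (x S) z (V D S)) \<Longrightarrow> (\<forall>S\<in>?U. \<forall>T\<in>?U. S \<subseteq> T \<longrightarrow> D S T \<cdot>\<^bsub>tagged C\<^esub> x S = x T) \<longleftrightarrow>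
        (\<forall>S\<in>?U. \<forall>T\<in>?U. S \<subseteq> T \<longrightarrow> D S T \<odot> x S = x T)"
      by (intro ball_cong imp_cong refl) (simp add: d)
    then show ?thesis unfolding is_cone_def fam_def h c by (intro conj_cong refl)
  qed
  have apex: "fam D ?U (V D {}) (D {})"
    unfolding fam_def
  proof (intro conjI ballI impI)
    show "V D {} \<in> Obj (tagged C)" using diag_Obj[OF D, of "{}"] by simp
    show "hom (D {} S) (V D {}) (V D S)" if "S \<in> ?U" for S using diag_hom[OF D, of "{}" S] that by simp
    show "D S T \<odot> D {} S = D {} T" if "S \<in> ?U" "T \<in> ?U" "S \<subseteq> T" for S T
      using diag_comp[OF D, of "{}" S T] that by simp
  qed
  have univ: "(\<exists>!u. hom u z (vertex C m (toarr m D) {}) \<and> (\<forall>j\<in>Obj ?J. edge C m (toarr m D) {} j \<cdot>\<^bsub>tagged C\<^esub> u = x j)) \<longleftrightarrow>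
      (\<exists>!u. hom u z (V D {}) \<and> (\<forall>S\<in>?U. D {} S \<odot> u = x S))" for z x
  proof -
    have "hom u z (V D {}) \<Longrightarrow> (\<forall>j\<in>Obj ?J. edge C m (toarr m D) {} j \<cdot>\<^bsub>tagged C\<^esub> u = x j) \<longleftrightarrow> (\<forall>S\<in>?U. D {} S \<odot> u = x S)" for u
      unfolding oJ using e cmp_eq_Comp[OF _ fam_hom[OF apex]] by simp
    then show ?thesis unfolding v[OF empty_subsetI] by (intro arg_cong[of _ _ Ex1] ext conj_cong refl)
  qed
  have apex': "is_cone ?J (tagged C) (cube C m (toarr m D)) (vertex C m (toarr m D) {}) (edge C m (toarr m D) {})"
  proof -
    have "fam D ?U (V D {}) (edge C m (toarr m D) {})"
      using apex e unfolding fam_def by simp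
    then show ?thesis unfolding cone v[OF empty_subsetI] .
  qed
  have "limit_cube C m (toarr m D) \<longleftrightarrow> (\<forall>z x. fam D ?U z x \<longrightarrow> (\<exists>!u. hom u z (V D {}) \<and> (\<forall>S\<in>?U. D {} S \<odot> u = x S)))"
    unfolding limit_cube_def is_limit_def cone univ using apex'[unfolded cone] by simp
  also have "\<dots> \<longleftrightarrow> ulifts (Pow {..<m}) D One (bang D) {}"
    unfolding ulifts_iff ab
  proof (intro iffI allI impI)
    fix z x y assume a: "\<forall>z x. fam D ?U z x \<longrightarrow> (\<exists>!u. hom u z (V D {}) \<and> (\<forall>S\<in>?U. D {} S \<odot> u = x S))"
      and m: "match (Pow {..<m}) D One (bang D) {} z x y"
    have "fam D ?U z x" using match_fam[OF m] unfolding ab .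
    then have ex: "\<exists>!u. hom u z (V D {}) \<and> (\<forall>S\<in>?U. D {} S \<odot> u = x S)" using a by simp
    have y: "hom y z tt" using match_hom[OF m] unfolding V_One .
    have "bang D {} \<odot> u = y" if "hom u z (V D {})" for u
      using tt_unique[OF hom_cmp[OF that bang_hom[OF diag_Obj[OF D, of "{}"]]] y] by simp
    then show "\<exists>!x'. hom x' z (V D {}) \<and> bang D {} \<odot> x' = y \<and> (\<forall>T\<in>?U. D {} T \<odot> x' = x T)"
      using ex by (simp cong: conj_cong)
  next
    fix z x assume a: "\<forall>z x y. match (Pow {..<m}) D One (bang D) {} z x y \<longrightarrow>
        (\<exists>!x'. hom x' z (V D {}) \<and> bang D {} \<odot> x' = y \<and> (\<forall>T\<in>?U. D {} T \<odot> x' = x T))" and x: "fam D ?U z x"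
    obtain y where y: "hom y z tt" using tt fam_Obj[OF x] by blast
    have b: "bang D S \<odot> u = y" if "hom u z (V D S)" "S \<in> Pow {..<m}" for u S
      using tt_unique[OF hom_cmp[OF that(1) bang_hom[OF diag_Obj[OF D that(2)]]] y] .
    have "match (Pow {..<m}) D One (bang D) {} z x y"
    proof (rule matchI)
      show "fam D (above (Pow {..<m}) {}) z x" using x unfolding ab .
      show "hom y z (V One {})" using y unfolding V_One .
      fix T assume "T \<in> above (Pow {..<m}) {}"
      then have T: "T \<in> ?U" unfolding ab .
      show "bang D T \<odot> x T = One {} T \<odot> y" using b[OF fam_hom[OF x T]] T Id_cmp[OF y] by (simp add: One_def)
    qed
    then have "\<exists>!x'. hom x' z (V D {}) \<and> bang D {} \<odot> x' = y \<and> (\<forall>T\<in>?U. D {} T \<odot> x' = x T)" using a by simp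
    moreover have "bang D {} \<odot> u = y" if "hom u z (V D {})" for u using b[OF that] by simp
    ultimately show "\<exists>!u. hom u z (V D {}) \<and> (\<forall>S\<in>?U. D {} S \<odot> u = x S)" by (simp cong: conj_cong)
  qed
  finally show ?thesis .
qed

lemma restricts_along_iff:
  assumes D: "diag (Pow {..<m}) D" and X: "diag (Pow {..<n}) X" and \<phi>: "mono_idx (Pow {..<n}) (Pow {..<m}) \<phi>"
  shows "restricts_along C m (toarr m D) n (toarr n X) \<phi> \<longleftrightarrow> agree (Pow {..<n}) X (rx \<phi> D)"
proof -
  have p: "\<phi> S \<subseteq> {..<m}" if "S \<subseteq> {..<n}" for S using \<phi> that unfolding mono_idx_def by auto
  have p2: "\<phi> S \<subseteq> \<phi> T" if "S \<subseteq> T" "T \<subseteq> {..<n}" for S T using \<phi> that unfolding mono_idx_def by auto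
  have v: "vertex C n (toarr n X) S = V X S" "vertex C m (toarr m D) (\<phi> S) = V D (\<phi> S)" if "S \<subseteq> {..<n}" for S
    using vertex_toarr[OF X, of S] vertex_toarr[OF D, of "\<phi> S"] Int_absorb2[OF that] Int_absorb2[OF p[OF that]] by simp_all
  have e: "edge C n (toarr n X) S T = X S T" "edge C m (toarr m D) (\<phi> S) (\<phi> T) = D (\<phi> S) (\<phi> T)" if "S \<subseteq> T" "T \<subseteq> {..<n}" for S T
    using edge_toarr[OF X that(1)] edge_toarr[OF D p2[OF that]] Int_absorb2[OF that(2)] Int_absorb2[OF subset_trans[OF that]]
      Int_absorb2[OF p[OF that(2)]] Int_absorb2[OF p[OF subset_trans[OF that]]] by simp_all
  show ?thesis
  proof
    assume r: "restricts_along C m (toarr m D) n (toarr n X) \<phi>"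
    show "agree (Pow {..<n}) X (rx \<phi> D)"
      unfolding agree_def rx_def
    proof (intro ballI impI)
      fix S T assume a: "S \<in> Pow {..<n}" "T \<in> Pow {..<n}" "S \<subseteq> T"
      then have T: "T \<subseteq> {..<n}" by simp
      show "X S T = D (\<phi> S) (\<phi> T)" using r e[OF a(3) T] a(3) T unfolding restricts_along_def by simp
    qed
  next
    assume a: "agree (Pow {..<n}) X (rx \<phi> D)"
    have V: "V X S = V D (\<phi> S)" if "S \<subseteq> {..<n}" for S using agree_V[OF a, of S] that by simp
    have "X S T = D (\<phi> S) (\<phi> T)" if "S \<subseteq> T" "T \<subseteq> {..<n}" for S T
      using a that unfolding agree_def rx_def by simp
    then show "restricts_along C m (toarr m D) n (toarr n X) \<phi>"
      unfolding restricts_along_def using toarr_Obj[OF D] toarr_Obj[OF X] V v e by simp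
  qed
qed

text \<open>In the outermost direction the mapping cube of \<open>f\<close> is cut into \<open>T\<close> and \<open>A\<close>, so by \<open>lifting_bang\<close> the
  unique lifts of \<open>f\<close> at the initial vertex make the cube a limit cube.\<close>

lemma discrete_fibrationI:
  assumes f: "dfib {..<n} T A f" and A: "extc {..<n} A"
  shows "discrete_fibration C n (toarr (Suc n) (mapc n T A f)) (toarr n T) (toarr n A)"
proof -
  let ?D = "mapc n T A f" and ?P = "Pow {..<n}"
  note fe = dfib_emap[OF f]
  note Td = emap_dom[OF fe] and Ad = emap_cod[OF fe] and fn = emap_nat[OF fe]
  have T: "extc {..<n} T" using extc_dom[OF fe A] .
  have D: "diag (Pow {..<Suc n}) ?D" using diag_SucI[OF Td Ad fn] .
  have De: "extc {..<Suc n} ?D" unfolding lessThan_Suc extc_mapc[OF notin_lessThan Td Ad fn] using A fe by simp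
  note dn = mapc_dn[OF notin_lessThan, of n T A f] and up = mapc_up[OF notin_lessThan, of n A T f]
  have "ulifts ?P T A f {}" using dfib_u[OF f] .
  then have "ulifts ?P ?D (up n ?D) (dir n ?D) {}"
    using agree_lifting(2)[OF dn up mapc_dir[OF notin_lessThan Td fn, symmetric], where S = "{}"] by simp
  then have lim: "limit_cube C (Suc n) (toarr (Suc n) ?D)"
    unfolding limit_cube_iff_ulifts[OF D]
    using lifting_bang(2)[OF notin_lessThan D[unfolded Pow_Suc_iff] empty_subsetI] unfolding Pow_Suc_iff by simp
  have im: "(\<lambda>j. if j < n then j else Suc j) ` S = S" if "S \<subseteq> {..<n}" for S
  proof -
    have "(\<lambda>j. if j < n then j else Suc j) ` S = (\<lambda>j. j) ` S" using that by (intro image_cong) auto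
    then show ?thesis by simp
  qed
  have f0: "face n False S = S" and f1: "face n True S = insert n S" if "S \<subseteq> {..<n}" for S
    unfolding face_def im[OF that] by simp_all
  have m: "mono_idx ?P (Pow {..<Suc n}) (face n b)" for b
    unfolding mono_idx_def Pow_Suc_iff using f0 f1 by (cases b) auto
  have "agree ?P T (rx (face n False) ?D)" "agree ?P A (rx (face n True) ?D)"
    using dn up f0 f1 unfolding agree_def rx_def by simp_all
  then have "restricts_along C (Suc n) (toarr (Suc n) ?D) n (toarr n T) (face n False)"
    "restricts_along C (Suc n) (toarr (Suc n) ?D) n (toarr n A) (face n True)"
    using restricts_along_iff[OF D Td m] restricts_along_iff[OF D Ad m] by simp_all
  then show ?thesis
    unfolding discrete_fibration_def
    using lim cubicalD[OF cubical_all De] cubicalD[OF cubical_all T] cubicalD[OF cubical_all A]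
    by (intro conjI exI[of _ n]) simp_all
qed

text \<open>A discrete fibration may be regarded in any direction \<open>i\<close>. The conditions on the cube do not
  depend on the direction, and the faces are renumbered by the map \<open>\<pi>\<close> that skips \<open>i\<close>.\<close>

lemma discrete_fibrationD:
  assumes df: "discrete_fibration C n \<delta> (toarr n T) (toarr n A)" and T: "diag (Pow {..<n}) T" and A: "diag (Pow {..<n}) A"
  shows "\<exists>f. dfib {..<n} T A f"
proof -
  let ?P = "Pow {..<n}"
  obtain i where \<delta>: "\<delta> \<in> n_ext C (Suc n)" and lim: "limit_cube C (Suc n) \<delta>" and i: "i \<le> n"
    and r: "restricts_along C (Suc n) \<delta> n (toarr n T) (face i False)" "restricts_along C (Suc n) \<delta> n (toarr n A) (face i True)"
    using df unfolding discrete_fibration_def by (elim conjE exE)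
  from cubical_ex[OF cubical_all \<delta>] obtain D where D: "extc {..<Suc n} D" "\<delta> = toarr (Suc n) D" by (elim exE conjE)
  note Dd = extc_diag[OF D(1)]
  define \<pi> where "\<pi> = (\<lambda>j. if j < i then j else Suc j)"
  have inj: "inj_on \<pi> M" for M by (rule inj_onI) (auto simp: \<pi>_def split: if_splits)
  have iN: "i \<notin> \<pi> ` {..<n}" by (auto simp: \<pi>_def split: if_splits)
  have im: "insert i (\<pi> ` {..<n}) = {..<Suc n}"
  proof
    show "insert i (\<pi> ` {..<n}) \<subseteq> {..<Suc n}" using i by (auto simp: \<pi>_def)
    show "{..<Suc n} \<subseteq> insert i (\<pi> ` {..<n})"
    proof
      fix x assume x: "x \<in> {..<Suc n}"
      show "x \<in> insert i (\<pi> ` {..<n})"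
      proof (cases x i rule: linorder_cases)
        case less
        then have "x = \<pi> x" "x \<in> {..<n}" using i by (simp_all add: \<pi>_def)
        then show ?thesis by blast
      next
        case equal
        then show ?thesis by simp
      next
        case greater
        then have "x = \<pi> (x - 1)" "x - 1 \<in> {..<n}" using x by (auto simp: \<pi>_def)
        then show ?thesis by blast
      qed
    qed
  qed
  have fe: "face i b S = (if b then insert i (\<pi> ` S) else \<pi> ` S)" for b S
    unfolding face_def \<pi>_def by simp
  have m: "mono_idx ?P (Pow {..<Suc n}) (face i b)" for b
    unfolding mono_idx_def fe im[symmetric] by auto
  have DQ: "diag (Pow (insert i (\<pi> ` {..<n}))) D" using Dd unfolding im .
  have e: "emap (Pow (\<pi> ` {..<n})) D (up i D) (dir i D)"
    using D(1) unfolding im[symmetric] extc_insert[OF iN] by simp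
  have u: "ulifts (Pow (\<pi> ` {..<n})) D (up i D) (dir i D) {}"
    using lim unfolding D(2) limit_cube_iff_ulifts[OF Dd] unfolding im[symmetric] lifting_bang(2)[OF iN DQ empty_subsetI] .
  have "dfib (\<pi> ` {..<n}) D (up i D) (dir i D)" using e u unfolding dfib_def by simp
  note d = dfib_rx[OF inj this]
  have "agree ?P T (rx (image \<pi>) D)" "agree ?P A (rx (image \<pi>) (up i D))"
    using r restricts_along_iff[OF Dd T m, of False] restricts_along_iff[OF Dd A m, of True]
    unfolding D(2) agree_def rx_def fe by simp_all
  from dfib_agree[OF agree_sym[OF this(1)] agree_sym[OF this(2)] refl d] show ?thesis
    by (intro exI[of _ "\<lambda>S. dir i D (\<pi> ` S)"])
qed

end

context regular_tower
begin

lemma covering_iff_span: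
  assumes X: "extc {..<Suc m} X"
  shows "covering (\<Gamma> m) (toarr (Suc m) X) \<longleftrightarrow> cubes.base_span {..<Suc m} X"
  using base_cube_Suc[of m X] cubes.B_iff_base_span[OF X] X by simp

lemma n_ext_in_iff:
  assumes Y: "extc {..<n} Y"
  shows "toarr n Y \<in> n_ext_in C (Obj (galois.sub (\<Gamma> 0))) n \<longleftrightarrow> (\<forall>S. S \<subseteq> {..<n} \<longrightarrow> base_cube 0 (fc S Y))"
proof -
  have "vertex C n (toarr n Y) S \<in> Obj (galois.sub (\<Gamma> 0)) \<longleftrightarrow> base_cube 0 (fc S Y)" if S: "S \<subseteq> {..<n}" for S
  proof -
    have "mono_idx (Pow {}) (Pow {..<n}) (\<lambda>T. T \<union> S)" using S unfolding mono_idx_def by auto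
    from rx_diag[OF this extc_diag[OF Y]] have "extc {..<0} (fc S Y)" using extc_empty by simp
    then show ?thesis
      unfolding base_cube_def using vertex_toarr[OF extc_diag[OF Y], of S] Int_absorb2[OF S] by simp
  qed
  then show ?thesis unfolding n_ext_in_def using cubicalD[OF cubical_all Y] by simp
qed

lemma span_iff:
  assumes X: "extc {..<n} X"
  shows "(\<exists>\<beta> \<tau> \<delta> \<epsilon>. \<beta> \<in> n_ext_in C (Obj (galois.sub (\<Gamma> 0))) n \<and>
      discrete_fibration C n \<delta> \<tau> \<beta> \<and> discrete_fibration C n \<epsilon> \<tau> (toarr n X)) \<longleftrightarrow> cubes.base_span {..<n} X"
proof
  assume "\<exists>\<beta> \<tau> \<delta> \<epsilon>. \<beta> \<in> n_ext_in C (Obj (galois.sub (\<Gamma> 0))) n \<and>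
      discrete_fibration C n \<delta> \<tau> \<beta> \<and> discrete_fibration C n \<epsilon> \<tau> (toarr n X)"
  then obtain \<beta> \<tau> \<delta> \<epsilon> where \<beta>: "\<beta> \<in> n_ext_in C (Obj (galois.sub (\<Gamma> 0))) n" and \<delta>: "discrete_fibration C n \<delta> \<tau> \<beta>"
    and \<epsilon>: "discrete_fibration C n \<epsilon> \<tau> (toarr n X)" by (elim exE conjE)
  have "\<beta> \<in> n_ext C n" "\<tau> \<in> n_ext C n" using \<delta> unfolding discrete_fibration_def by simp_all
  from cubical_ex[OF cubical_all this(1)] cubical_ex[OF cubical_all this(2)]
  obtain Y T where Y: "extc {..<n} Y" "\<beta> = toarr n Y" and T: "extc {..<n} T" "\<tau> = toarr n T" by (elim exE conjE)
  from discrete_fibrationD[OF \<delta>[unfolded Y(2) T(2)] extc_diag[OF T(1)] extc_diag[OF Y(1)]]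
    discrete_fibrationD[OF \<epsilon>[unfolded T(2)] extc_diag[OF T(1)] extc_diag[OF X]]
  obtain g f where g: "dfib {..<n} T Y g" and f: "dfib {..<n} T X f" by (elim exE)
  have B: "\<forall>S. S \<subseteq> {..<n} \<longrightarrow> base_cube 0 (fc S Y)" using \<beta> unfolding Y(2) n_ext_in_iff[OF Y(1)] .
  show "cubes.base_span {..<n} X"
    unfolding cubes.base_span_def
    by (rule exI, rule exI, rule exI, rule exI, rule conjI, rule f, rule conjI, rule g, rule conjI, rule Y(1), rule B)
next
  assume "cubes.base_span {..<n} X"
  then obtain T f Y g where f: "dfib {..<n} T X f" and g: "dfib {..<n} T Y g" and Y: "extc {..<n} Y"
    and B: "\<forall>S. S \<subseteq> {..<n} \<longrightarrow> base_cube 0 (fc S Y)"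
    unfolding cubes.base_span_def by (elim exE conjE)
  show "\<exists>\<beta> \<tau> \<delta> \<epsilon>. \<beta> \<in> n_ext_in C (Obj (galois.sub (\<Gamma> 0))) n \<and>
      discrete_fibration C n \<delta> \<tau> \<beta> \<and> discrete_fibration C n \<epsilon> \<tau> (toarr n X)"
    by (rule exI, rule exI, rule exI, rule exI, rule conjI, rule n_ext_in_iff[OF Y, THEN iffD2, OF B], rule conjI,
      rule discrete_fibrationI[OF g Y], rule discrete_fibrationI[OF f X])
qed

lemma symmetric_covering_iff:
  assumes "\<alpha> \<in> n_ext C n"
  shows "symmetric_covering C B n \<alpha> \<longleftrightarrow>
    (\<exists>\<beta> \<tau> \<delta> \<epsilon>. \<beta> \<in> n_ext_in C B n \<and> discrete_fibration C n \<delta> \<tau> \<beta> \<and> discrete_fibration C n \<epsilon> \<tau> \<alpha>)"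
proof -
  have "\<tau> \<in> n_ext C n" if "discrete_fibration C n \<epsilon> \<tau> \<alpha>" for \<tau> \<epsilon>
    using that unfolding discrete_fibration_def by simp
  then show ?thesis unfolding symmetric_covering_def symmetrically_trivial_covering_def using assms by blast
qed

lemma base_span_permute:
  assumes \<pi>: "\<pi> permutes A"
  shows "cubes.base_span A (rx (image \<pi>) X) \<longleftrightarrow> cubes.base_span A X"
proof
  have im: "\<pi> ` A = A" and im': "inv \<pi> ` A = A" using permutes_image[OF \<pi>] permutes_image[OF permutes_inv[OF \<pi>]] .
  have inj: "inj_on \<pi> A" "inj_on (inv \<pi>) A" using permutes_inj_on[OF \<pi>] permutes_inj_on[OF permutes_inv[OF \<pi>]] .
  show "cubes.base_span A (rx (image \<pi>) X)" if "cubes.base_span A X"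
    using cubes.base_span_rx[OF inj(1), of X] that unfolding im by simp
  have "rx (image (inv \<pi>)) (rx (image \<pi>) X) = X"
    by (intro ext) (simp add: rx_def image_image permutes_inverses(1)[OF \<pi>])
  then show "cubes.base_span A X" if "cubes.base_span A (rx (image \<pi>) X)"
    using cubes.base_span_rx[OF inj(2), of "rx (image \<pi>) X"] that unfolding im' by simp
qed

lemma covering_permute:
  assumes \<alpha>: "\<alpha> \<in> n_ext C (Suc m)" and \<pi>: "\<pi> permutes {..<Suc m}"
    and r: "restricts_along C (Suc m) \<alpha> (Suc m) \<alpha>' (image \<pi>)"
  shows "covering (\<Gamma> m) \<alpha>' \<longleftrightarrow> covering (\<Gamma> m) \<alpha>"
proof -
  let ?A = "{..<Suc m}"
  from cubical_ex[OF cubical_all \<alpha>] obtain X where X: "extc ?A X" "\<alpha> = toarr (Suc m) X" by (elim exE conjE)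
  have "\<alpha>' \<in> Obj (Arr (Suc m))" using r unfolding restricts_along_def by simp
  from toarr_ex[OF this] obtain X' where X': "diag (Pow ?A) X'" "\<alpha>' = toarr (Suc m) X'" by (elim exE conjE)
  have m: "mono_idx (Pow ?A) (Pow ?A) (image \<pi>)"
    unfolding mono_idx_def using permutes_image[OF \<pi>] by blast
  have "agree (Pow ?A) X' (rx (image \<pi>) X)"
    using r unfolding X(2) X'(2) restricts_along_iff[OF extc_diag[OF X(1)] X'(1) m] .
  from toarr_cong[OF this] have e: "\<alpha>' = toarr (Suc m) (rx (image \<pi>) X)" unfolding X'(2) .
  have "extc ?A (rx (image \<pi>) X)"
    using extc_rx[OF permutes_inj_on[OF \<pi>], of ?A X] X(1) permutes_image[OF \<pi>] by simp
  from covering_iff_span[OF this] covering_iff_span[OF X(1)] base_span_permute[OF \<pi>, of X]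
  show ?thesis unfolding e X(2) by simp
qed

end

theorem theorem7p13:
  fixes C :: "('o, 'a) cat"
    and \<Gamma> :: "nat \<Rightarrow> (('o, 'a) iarr, ('o, 'a) iarr) galois"
    and n :: nat
  assumes "barr_exact C" and "tower C \<Gamma>" and "n \<ge> 2"
  shows "(\<forall>\<alpha>\<in>n_ext C n.
            (covering (\<Gamma> (n - 1)) \<alpha> \<longleftrightarrow> symmetric_covering C (Obj (sub (\<Gamma> 0))) n \<alpha>) \<and>
            (covering (\<Gamma> (n - 1)) \<alpha> \<longleftrightarrow>
               (\<exists>\<beta> \<tau> \<delta> \<epsilon>. \<beta> \<in> n_ext_in C (Obj (sub (\<Gamma> 0))) n \<and>
                  discrete_fibration C n \<delta> \<tau> \<beta> \<and> discrete_fibration C n \<epsilon> \<tau> \<alpha>))) \<and>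
         (\<forall>\<alpha> \<alpha>' \<pi>. \<alpha> \<in> n_ext C n \<and> \<pi> permutes {..<n} \<and> restricts_along C n \<alpha> n \<alpha>' (image \<pi>) \<longrightarrow>
            (covering (\<Gamma> (n - 1)) \<alpha>' \<longleftrightarrow> covering (\<Gamma> (n - 1)) \<alpha>))"
proof -
  have "regular_category C" using assms(1) by (simp add: barr_exact_def)
  then interpret regular_tower C \<Gamma> using assms(2) by (intro regular_tower.intro regular_cat.intro)
  define m where "m = n - 1"
  have n: "n = Suc m" "n - 1 = m" using assms(3) by (simp_all add: m_def)
  show ?thesis
  proof (intro conjI ballI allI impI)
    fix \<alpha> assume \<alpha>: "\<alpha> \<in> n_ext C n"
    from cubical_ex[OF cubical_all \<alpha>] obtain X where X: "extc {..<n} X" "\<alpha> = toarr n X" by (elim exE conjE)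
    have c: "covering (\<Gamma> (n - 1)) \<alpha> \<longleftrightarrow> (\<exists>\<beta> \<tau> \<delta> \<epsilon>. \<beta> \<in> n_ext_in C (Obj (sub (\<Gamma> 0))) n \<and>
                  discrete_fibration C n \<delta> \<tau> \<beta> \<and> discrete_fibration C n \<epsilon> \<tau> \<alpha>)"
      unfolding X(2) span_iff[OF X(1)] using covering_iff_span[of m X] X(1) unfolding n by simp
    then show "covering (\<Gamma> (n - 1)) \<alpha> \<longleftrightarrow> (\<exists>\<beta> \<tau> \<delta> \<epsilon>. \<beta> \<in> n_ext_in C (Obj (sub (\<Gamma> 0))) n \<and>
                  discrete_fibration C n \<delta> \<tau> \<beta> \<and> discrete_fibration C n \<epsilon> \<tau> \<alpha>)" .
    show "covering (\<Gamma> (n - 1)) \<alpha> \<longleftrightarrow> symmetric_covering C (Obj (sub (\<Gamma> 0))) n \<alpha>"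
      unfolding c symmetric_covering_iff[OF \<alpha>] ..
  next
    fix \<alpha> \<alpha>' \<pi> assume a: "\<alpha> \<in> n_ext C n \<and> \<pi> permutes {..<n} \<and> restricts_along C n \<alpha> n \<alpha>' (image \<pi>)"
    then show "covering (\<Gamma> (n - 1)) \<alpha>' \<longleftrightarrow> covering (\<Gamma> (n - 1)) \<alpha>"
      unfolding n using covering_permute[of \<alpha> m \<pi> \<alpha>'] by simp
  qed
qed

end
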